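(* Let $d=2$. The operators $H:\mathscr D(H)\to L^2$ and $H_\varepsilon:\mathscr H^2\to L^2$, $\varepsilon\in(0,1)$, are self-adjoint on $L^2$.
   Context: Function spaces. $\mathbb T^2=\mathbb R^2/\mathbb Z^2$; $L^2=L^2(\mathbb T^2)$; $\mathscr H^s$ is the $L^2$-based Sobolev space. $\Delta$ without index is the Laplacian. $\Delta_j$, $j\ge -1$, are Littlewood–Paley blocks: Fourier multipliers with symbols $\chi$ ($j=-1$) and $\rho(2^{-j}\cdot)$ ($j\ge0$), where $\chi,\rho\ge 0$ are smooth radial, $\chi$ supported in a ball, $\rho$ in an annulus, $\chi+\sum_{j\ge0}\rho(2^{-j}\cdot)=1$, $\chi\rho(2^{-j}\cdot)=0$ for $j\ge1$, $\rho(2^{-i}\cdot)\rho(2^{-j}\cdot)=0$ for $|i-j|>1$. $\mathscr C^a=B^a_{\infty,\infty}$ with norm $\sup_j2^{ja}\|\Delta_jf\|_{L^\infty}$. Paraproducts: $f\prec g=\sum_{j}\sum_{i\le j-2}\Delta_if\,\Delta_jg$, $f\succ g=g\prec f$; resonant product: $f\circ g=\sum_{|i-j|\le1}\Delta_if\,\Delta_jg$ (products of gradients are contracted). For $a\in(0,1)$, $b+c<0$, $a+b+c>0$, $C:\mathscr H^a\times\mathscr C^b\times\mathscr C^c\to\mathscr H^{a+b+c}$ is the bounded trilinear operator which on smooth functions is $C(f,g,h)=(f\prec g)\circ h-f(g\circ h)$. Noise. $\xi=\sum_{k\in\mathbb Z^2}\hat\xi(k)e^{2\pi ik\cdot x}$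 is (real) Gaussian white noise on $\mathbb T^2$, i.e. $\hat\xi(k)$ are centred complex Gaussians, independent up to $\hat\xi(-k)=\overline{\hat\xi(k)}$, with $\mathbb E[\hat\xi(k)\overline{\hat\xi(l)}]=\delta_{kl}$. $\xi_\varepsilon=\sum_{k\in\mathbb Z^2}m(\varepsilon k)\hat\xi(k)e^{2\pi ik\cdot x}$, with $m$ radial, smooth away from $0$, compactly supported, $\lim_{x\to0}m(x)=1$, and $c_\varepsilon=\sum_{k\in\mathbb Z^2}|m(\varepsilon k)|^2/(1+4\pi^2|k|^2)$. Almost surely $\Xi^\varepsilon=(\xi_\varepsilon,\ \xi_\varepsilon\circ(1-\Delta)^{-1}\xi_\varepsilon-c_\varepsilon)$ converges as $\varepsilon\to0$ in $\mathscr C^{\alpha}\times\mathscr C^{2\alpha+2}$, for every $\alpha<-1$, to a limit $\Xi=(\xi,\Xi_2)$ (the enhanced noise). Everything is pathwise: a realization for which this holds is fixed. The operator. Fix $-4/3<\alpha<-1$, $2/3<\gamma\le\alpha+2$. Put $X=(1-\Delta)^{-1}\xi$, $B_\Xi(u)=(1-\Delta)^{-1}(\Delta u\prec X+2\nabla u\prec\nabla X+\xi\prec u+u\prec\Xi_2)$, and $\mathscr D(A)=\{u\in\mathscr H^\gamma:\ R(u):=u-u\prec X-B_\Xi(u)\in\mathscr H^2\}$ (independent of $\gamma$). For $u\in\mathscr D(A)$, $Au:=\Delta u+u\prec\xi+\xi\prec u+u\circ\xi\in L^2$, with $u\circ\xi:=C(u,X,\xi)+u\,\Xi_2+B_\Xi(u)\circ\xi+R(u)\circ\xi$.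 Further $A_\varepsilon=\Delta+\xi_\varepsilon-c_\varepsilon$ on $\mathscr D(A_\varepsilon)=\mathscr H^2$. Finally $H=A-K_\Xi$, $\mathscr D(H)=\mathscr D(A)$, and $H_\varepsilon=A_\varepsilon-K_\Xi$, $\mathscr D(H_\varepsilon)=\mathscr H^2$, where $K_\Xi>0$ is a sufficiently large constant depending only on $\Xi$ and not on $\varepsilon$ (claims are meant for all $K_\Xi$ above some threshold depending only on $\Xi$). *)

theory Defs
  imports "HOL-Probability.Probability" "HOL-Library.Function_Algebras"
begin

section \<open>Periodic distributions\<close>

text \<open>
  A distribution on the torus \<open>\<real>\<^sup>2/\<int>\<^sup>2\<close> is represented by the family of its Fourier coefficients
  with respect to \<open>e\<^sub>k(x) = exp (2\<pi>i k\<cdot>x)\<close>. Sums, differences and the zero distribution are the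
  pointwise ones of \<^theory>\<open>HOL-Library.Function_Algebras\<close>. All spaces below (Sobolev, Besov)
  consist of families of at most polynomial growth, as their defining conditions imply; so they are
  spaces of distributions and no separate growth condition is imposed.
\<close>

type_synonym plane = "real \<times> real"
type_synonym pdist = "int \<times> int \<Rightarrow> complex"

definition freq :: "int \<times> int \<Rightarrow> plane" where
  "freq k = (real_of_int (fst k), real_of_int (snd k))"

definition echar :: "int \<times> int \<Rightarrow> plane \<Rightarrow> complex" where
  "echar k x = exp (2 * complex_of_real pi * \<i> * complex_of_real (freq k \<bullet> x))"

definition scal :: "complex \<Rightarrow> pdist \<Rightarrow> pdist" where
  "scal c f = (\<lambda>k. c * f k)"

text \<open>
  \<open>eval_series\<close> is only used for trigonometric polynomials (finitely many non-zero coefficients).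
\<close>

definition eval_series :: "pdist \<Rightarrow> plane \<Rightarrow> complex" where
  "eval_series f x = (\<Sum>\<^sub>\<infinity>k. f k * echar k x)"

definition Linf_norm :: "pdist \<Rightarrow> real" where
  "Linf_norm f = (SUP x. cmod (eval_series f x))"

text \<open>
  Fourier coefficients of the pointwise product of two functions; only used if one factor is a
  trigonometric polynomial or both factors are smooth, so that the sum converges absolutely.
\<close>

definition pw_mult :: "pdist \<Rightarrow> pdist \<Rightarrow> pdist" where
  "pw_mult f g = (\<lambda>k. \<Sum>\<^sub>\<infinity>l. f l * g (k - l))"

definition const_dist :: "complex \<Rightarrow> pdist" where
  "const_dist c = (\<lambda>k. if k = 0 then c else 0)"

definition partial1 :: "pdist \<Rightarrow> pdist" where
  "partial1 f = (\<lambda>k. 2 * complex_of_real pi * \<i> * of_int (fst k) * f k)"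

definition partial2 :: "pdist \<Rightarrow> pdist" where
  "partial2 f = (\<lambda>k. 2 * complex_of_real pi * \<i> * of_int (snd k) * f k)"

definition bessel :: "int \<times> int \<Rightarrow> real" where
  "bessel k = 1 + 4 * pi\<^sup>2 * (norm (freq k))\<^sup>2"

definition laplacian :: "pdist \<Rightarrow> pdist" where
  "laplacian f = (\<lambda>k. - complex_of_real (4 * pi\<^sup>2 * (norm (freq k))\<^sup>2) * f k)"

definition inv_one_minus_lap :: "pdist \<Rightarrow> pdist" where
  "inv_one_minus_lap f = (\<lambda>k. f k / complex_of_real (bessel k))"


section \<open>Smooth functions\<close>

text \<open>The iterated-derivative notion below is the usual one on open sets \<open>S\<close>.\<close>

fun times_differentiable_on ::
  "nat \<Rightarrow> ('a::real_normed_vector \<Rightarrow> 'b::real_normed_vector) \<Rightarrow> 'a set \<Rightarrow> bool" where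
  "times_differentiable_on 0 f S \<longleftrightarrow> continuous_on S f"
| "times_differentiable_on (Suc n) f S \<longleftrightarrow>
     (\<forall>x\<in>S. f differentiable (at x)) \<and>
     (\<forall>v. times_differentiable_on n (\<lambda>x. frechet_derivative f (at x) v) S)"

definition smooth_on :: "('a::real_normed_vector \<Rightarrow> 'b::real_normed_vector) \<Rightarrow> 'a set \<Rightarrow> bool" where
  "smooth_on f S \<longleftrightarrow> (\<forall>n. times_differentiable_on n f S)"

definition radial :: "(plane \<Rightarrow> real) \<Rightarrow> bool" where
  "radial f \<longleftrightarrow> (\<forall>x y. norm x = norm y \<longrightarrow> f x = f y)"


section \<open>The space \<open>L\<^sup>2\<close> of the torus\<close>

text \<open>Lebesgue measure on a fundamental domain.\<close>

definition torus :: "plane measure" where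
  "torus = restrict_space lborel ({0..1} \<times> {0..1})"

definition fourier_coeff :: "(plane \<Rightarrow> complex) \<Rightarrow> pdist" where
  "fourier_coeff \<phi> = (\<lambda>k. \<integral>x. \<phi> x * cnj (echar k x) \<partial>torus)"

definition L2_fun :: "(plane \<Rightarrow> complex) \<Rightarrow> bool" where
  "L2_fun \<phi> \<longleftrightarrow> \<phi> \<in> borel_measurable torus \<and> integrable torus (\<lambda>x. (cmod (\<phi> x))\<^sup>2)"

definition L2 :: "pdist set" where
  "L2 = {f. \<exists>\<phi>. L2_fun \<phi> \<and> f = fourier_coeff \<phi>}"

text \<open>
  The representative in \<open>L\<^sup>2\<close> is unique up to null sets, so the inner product does not depend on
  the choice. Scalars are complex; the inner product is linear in the first argument.
\<close>

definition L2_rep :: "pdist \<Rightarrow> plane \<Rightarrow> complex" where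
  "L2_rep f = (SOME \<phi>. L2_fun \<phi> \<and> f = fourier_coeff \<phi>)"

definition L2_inner :: "pdist \<Rightarrow> pdist \<Rightarrow> complex" where
  "L2_inner f g = (\<integral>x. L2_rep f x * cnj (L2_rep g x) \<partial>torus)"

definition L2_norm :: "pdist \<Rightarrow> real" where
  "L2_norm f = sqrt (Re (L2_inner f f))"

definition smooth_pdist :: "pdist set" where
  "smooth_pdist = {f. \<exists>\<phi> :: plane \<Rightarrow> complex.
     smooth_on \<phi> UNIV \<and> (\<forall>x k. \<phi> (x + freq k) = \<phi> x) \<and> f = fourier_coeff \<phi>}"


section \<open>Self-adjoint unbounded operators on \<open>L\<^sup>2\<close>\<close>

definition linear_operator_on_L2 :: "pdist set \<Rightarrow> (pdist \<Rightarrow> pdist) \<Rightarrow> bool" where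
  "linear_operator_on_L2 D T \<longleftrightarrow>
     D \<subseteq> L2 \<and> T ` D \<subseteq> L2 \<and> 0 \<in> D \<and>
     (\<forall>u\<in>D. \<forall>v\<in>D. u + v \<in> D \<and> T (u + v) = T u + T v) \<and>
     (\<forall>c. \<forall>u\<in>D. scal c u \<in> D \<and> T (scal c u) = scal c (T u))"

definition dense_in_L2 :: "pdist set \<Rightarrow> bool" where
  "dense_in_L2 D \<longleftrightarrow> (\<forall>f\<in>L2. \<forall>e>0. \<exists>u\<in>D. L2_norm (f - u) < e)"

definition adjoint_graph :: "pdist set \<Rightarrow> (pdist \<Rightarrow> pdist) \<Rightarrow> (pdist \<times> pdist) set" where
  "adjoint_graph D T =
     {(v, w). v \<in> L2 \<and> w \<in> L2 \<and> (\<forall>u\<in>D. L2_inner (T u) v = L2_inner u w)}"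

definition self_adjoint_on_L2 :: "pdist set \<Rightarrow> (pdist \<Rightarrow> pdist) \<Rightarrow> bool" where
  "self_adjoint_on_L2 D T \<longleftrightarrow>
     linear_operator_on_L2 D T \<and> dense_in_L2 D \<and> adjoint_graph D T = {(u, T u) | u. u \<in> D}"


section \<open>Littlewood--Paley theory\<close>

text \<open>A pair \<open>(chi, rho)\<close> of functions on the plane.\<close>

type_synonym lp_pair = "(plane \<Rightarrow> real) \<times> (plane \<Rightarrow> real)"

definition dyadic_partition :: "lp_pair \<Rightarrow> bool" where
  "dyadic_partition P \<longleftrightarrow>
     (let chi = fst P; rho = snd P; rho' = (\<lambda>(j::nat) x. rho ((1 / 2 ^ j) *\<^sub>R x)) in
       (\<forall>x. 0 \<le> chi x) \<and> (\<forall>x. 0 \<le> rho x) \<and>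
       smooth_on chi UNIV \<and> smooth_on rho UNIV \<and> radial chi \<and> radial rho \<and>
       (\<exists>r. \<forall>x. chi x \<noteq> 0 \<longrightarrow> norm x \<le> r) \<and>
       (\<exists>r R. 0 < r \<and> r < R \<and> (\<forall>x. rho x \<noteq> 0 \<longrightarrow> r \<le> norm x \<and> norm x \<le> R)) \<and>
       (\<forall>x. (\<lambda>j. rho' j x) sums (1 - chi x)) \<and>
       (\<forall>j\<ge>1. \<forall>x. chi x * rho' j x = 0) \<and>
       (\<forall>i j. \<bar>int i - int j\<bar> > 1 \<longrightarrow> (\<forall>x. rho' i x * rho' j x = 0)))"

definition block :: "lp_pair \<Rightarrow> int \<Rightarrow> pdist \<Rightarrow> pdist" where
  "block P j f = (\<lambda>k. complex_of_real
     (if j = -1 then fst P (freq k) else snd P ((2 powr (- real_of_int j)) *\<^sub>R freq k)) * f k)"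

definition sobolev :: "real \<Rightarrow> pdist set" where
  "sobolev s = {f. (\<lambda>k. bessel k powr s * (cmod (f k))\<^sup>2) summable_on UNIV}"

definition sobolev_norm :: "real \<Rightarrow> pdist \<Rightarrow> real" where
  "sobolev_norm s f = sqrt (\<Sum>\<^sub>\<infinity>k. bessel k powr s * (cmod (f k))\<^sup>2)"

definition besov :: "lp_pair \<Rightarrow> real \<Rightarrow> pdist set" where
  "besov P a = {f. bdd_above ((\<lambda>j. 2 powr (real_of_int j * a) * Linf_norm (block P j f)) ` {-1..})}"

definition besov_norm :: "lp_pair \<Rightarrow> real \<Rightarrow> pdist \<Rightarrow> real" where
  "besov_norm P a f = (SUP j\<in>{-1..}. 2 powr (real_of_int j * a) * Linf_norm (block P j f))"

text \<open>The series over blocks converge in the sense of distributions, i.e. coefficientwise.\<close>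

definition para :: "lp_pair \<Rightarrow> pdist \<Rightarrow> pdist \<Rightarrow> pdist" where
  "para P f g = (\<lambda>k. \<Sum>\<^sub>\<infinity>j\<in>{-1..}. \<Sum>i\<in>{-1..j - 2}. pw_mult (block P i f) (block P j g) k)"

definition reson :: "lp_pair \<Rightarrow> pdist \<Rightarrow> pdist \<Rightarrow> pdist" where
  "reson P f g = (\<lambda>k. \<Sum>\<^sub>\<infinity>(i, j)\<in>{(i, j). -1 \<le> i \<and> -1 \<le> j \<and> \<bar>i - j\<bar> \<le> 1}.
     pw_mult (block P i f) (block P j g) k)"

text \<open>
  Product of two distributions through its decomposition into two paraproducts and a resonant
  product.
\<close>

definition dist_mult :: "lp_pair \<Rightarrow> pdist \<Rightarrow> pdist \<Rightarrow> pdist" where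
  "dist_mult P f g = para P f g + reson P f g + para P g f"

text \<open>
  \<open>is_commutator_operator P C\<close>: for all admissible exponents, \<open>C\<close> is a bounded trilinear operator
  extending \<open>(f \<prec> g) \<circ> h - f (g \<circ> h)\<close> from smooth functions. One \<open>C\<close> serves all
  exponents. Although smooth functions are not dense in Hoelder--Besov spaces, these properties
  determine \<open>C f g h\<close> for all admissible arguments: approximate by Fourier truncation, which
  converges after lowering the exponents of the last two spaces slightly.
\<close>

definition is_commutator_operator :: "lp_pair \<Rightarrow> (pdist \<Rightarrow> pdist \<Rightarrow> pdist \<Rightarrow> pdist) \<Rightarrow> bool" where
  "is_commutator_operator P C \<longleftrightarrow>
     (\<forall>f\<in>smooth_pdist. \<forall>g\<in>smooth_pdist. \<forall>h\<in>smooth_pdist.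
        C f g h = reson P (para P f g) h - pw_mult f (reson P g h)) \<and>
     (\<forall>a b c. 0 < a \<and> a < 1 \<and> b + c < 0 \<and> 0 < a + b + c \<longrightarrow>
        (\<forall>f\<in>sobolev a. \<forall>g\<in>besov P b. \<forall>h\<in>besov P c. C f g h \<in> sobolev (a + b + c)) \<and>
        (\<forall>f1\<in>sobolev a. \<forall>f2\<in>sobolev a. \<forall>g\<in>besov P b. \<forall>h\<in>besov P c. \<forall>s t.
           C (scal s f1 + scal t f2) g h = scal s (C f1 g h) + scal t (C f2 g h)) \<and>
        (\<forall>f\<in>sobolev a. \<forall>g1\<in>besov P b. \<forall>g2\<in>besov P b. \<forall>h\<in>besov P c. \<forall>s t.
           C f (scal s g1 + scal t g2) h = scal s (C f g1 h) + scal t (C f g2 h)) \<and>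
        (\<forall>f\<in>sobolev a. \<forall>g\<in>besov P b. \<forall>h1\<in>besov P c. \<forall>h2\<in>besov P c. \<forall>s t.
           C f g (scal s h1 + scal t h2) = scal s (C f g h1) + scal t (C f g h2)) \<and>
        (\<exists>B. \<forall>f\<in>sobolev a. \<forall>g\<in>besov P b. \<forall>h\<in>besov P c.
           sobolev_norm (a + b + c) (C f g h)
             \<le> B * sobolev_norm a f * besov_norm P b g * besov_norm P c h))"


section \<open>White noise and enhanced noise\<close>

text \<open>Degenerate (almost surely vanishing) variables count as centred Gaussians.\<close>

definition centred_gaussian :: "'w measure \<Rightarrow> ('w \<Rightarrow> real) \<Rightarrow> bool" where
  "centred_gaussian M Y \<longleftrightarrow> Y \<in> borel_measurable M \<and>
     ((AE w in M. Y w = 0) \<or> (\<exists>\<sigma>>0. distributed M lborel Y (\<lambda>x. ennreal (normal_density 0 \<sigma> x))))"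

definition centred_complex_gaussian :: "'w measure \<Rightarrow> ('w \<Rightarrow> complex) \<Rightarrow> bool" where
  "centred_complex_gaussian M Z \<longleftrightarrow>
     (\<forall>a b. centred_gaussian M (\<lambda>w. a * Re (Z w) + b * Im (Z w)))"

text \<open>
  Independence up to the reality constraint: the coefficients with index in \<open>S\<close> are independent as
  soon as \<open>S\<close> contains no pair \<open>k, -k\<close> with \<open>k \<noteq> 0\<close>.
\<close>

definition white_noise :: "'w measure \<Rightarrow> ('w \<Rightarrow> pdist) \<Rightarrow> bool" where
  "white_noise M \<xi> \<longleftrightarrow> prob_space M \<and>
     (\<forall>k. centred_complex_gaussian M (\<lambda>w. \<xi> w k)) \<and>
     (\<forall>w\<in>space M. \<forall>k. \<xi> w (- k) = cnj (\<xi> w k)) \<and>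
     (\<forall>S. (\<forall>k\<in>S. - k \<in> S \<longrightarrow> k = 0) \<longrightarrow>
        prob_space.indep_vars M (\<lambda>_. borel) (\<lambda>k w. \<xi> w k) S) \<and>
     (\<forall>k l. (\<integral>w. \<xi> w k * cnj (\<xi> w l) \<partial>M) = (if k = l then 1 else 0))"

definition mollifier_symbol :: "(plane \<Rightarrow> real) \<Rightarrow> bool" where
  "mollifier_symbol m \<longleftrightarrow> radial m \<and> smooth_on m (- {0}) \<and>
     (\<exists>r. \<forall>x. m x \<noteq> 0 \<longrightarrow> norm x \<le> r) \<and> (m \<longlongrightarrow> 1) (at 0)"

definition xi_eps :: "(plane \<Rightarrow> real) \<Rightarrow> real \<Rightarrow> pdist \<Rightarrow> pdist" where
  "xi_eps m \<epsilon> \<xi> = (\<lambda>k. complex_of_real (m (\<epsilon> *\<^sub>R freq k)) * \<xi> k)"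

definition c_eps :: "(plane \<Rightarrow> real) \<Rightarrow> real \<Rightarrow> real" where
  "c_eps m \<epsilon> = (\<Sum>\<^sub>\<infinity>k. \<bar>m (\<epsilon> *\<^sub>R freq k)\<bar>\<^sup>2 / bessel k)"

definition Xi2_eps :: "lp_pair \<Rightarrow> (plane \<Rightarrow> real) \<Rightarrow> real \<Rightarrow> pdist \<Rightarrow> pdist" where
  "Xi2_eps P m \<epsilon> \<xi> =
     reson P (xi_eps m \<epsilon> \<xi>) (inv_one_minus_lap (xi_eps m \<epsilon> \<xi>))
       - const_dist (complex_of_real (c_eps m \<epsilon>))"

text \<open>Convergence of the mollified noise to the enhanced noise, for one realization of the noise.\<close>

definition enhanced_noise_limit :: "lp_pair \<Rightarrow> (plane \<Rightarrow> real) \<Rightarrow> pdist \<times> pdist \<Rightarrow> bool" where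
  "enhanced_noise_limit P m \<Xi> \<longleftrightarrow>
     (\<forall>a < -1. fst \<Xi> \<in> besov P a \<and> snd \<Xi> \<in> besov P (2 * a + 2) \<and>
        ((\<lambda>\<epsilon>. besov_norm P a (xi_eps m \<epsilon> (fst \<Xi>) - fst \<Xi>)) \<longlongrightarrow> 0) (at_right 0) \<and>
        ((\<lambda>\<epsilon>. besov_norm P (2 * a + 2) (Xi2_eps P m \<epsilon> (fst \<Xi>) - snd \<Xi>)) \<longlongrightarrow> 0) (at_right 0))"


section \<open>The Anderson Hamiltonian\<close>

text \<open>Throughout, \<open>\<Xi> = (\<xi>, \<Xi>\<^sub>2)\<close> is the enhanced noise.\<close>

definition X_of :: "pdist \<times> pdist \<Rightarrow> pdist" where
  "X_of \<Xi> = inv_one_minus_lap (fst \<Xi>)"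

definition B_op :: "lp_pair \<Rightarrow> pdist \<times> pdist \<Rightarrow> pdist \<Rightarrow> pdist" where
  "B_op P \<Xi> u = inv_one_minus_lap
     (para P (laplacian u) (X_of \<Xi>)
      + scal 2 (para P (partial1 u) (partial1 (X_of \<Xi>)) + para P (partial2 u) (partial2 (X_of \<Xi>)))
      + para P (fst \<Xi>) u
      + para P u (snd \<Xi>))"

definition R_op :: "lp_pair \<Rightarrow> pdist \<times> pdist \<Rightarrow> pdist \<Rightarrow> pdist" where
  "R_op P \<Xi> u = u - para P u (X_of \<Xi>) - B_op P \<Xi> u"

definition A_dom :: "lp_pair \<Rightarrow> pdist \<times> pdist \<Rightarrow> real \<Rightarrow> pdist set" where
  "A_dom P \<Xi> \<gamma> = {u \<in> sobolev \<gamma>. R_op P \<Xi> u \<in> sobolev 2}"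

text \<open>The resonant product of \<open>u\<close> in the domain with the noise; \<open>C\<close> is the commutator operator.\<close>

definition reson_xi ::
  "lp_pair \<Rightarrow> (pdist \<Rightarrow> pdist \<Rightarrow> pdist \<Rightarrow> pdist) \<Rightarrow> pdist \<times> pdist \<Rightarrow> pdist \<Rightarrow> pdist" where
  "reson_xi P C \<Xi> u =
     C u (X_of \<Xi>) (fst \<Xi>) + dist_mult P u (snd \<Xi>)
       + reson P (B_op P \<Xi> u) (fst \<Xi>) + reson P (R_op P \<Xi> u) (fst \<Xi>)"

definition A_op ::
  "lp_pair \<Rightarrow> (pdist \<Rightarrow> pdist \<Rightarrow> pdist \<Rightarrow> pdist) \<Rightarrow> pdist \<times> pdist \<Rightarrow> pdist \<Rightarrow> pdist" where
  "A_op P C \<Xi> u = laplacian u + para P u (fst \<Xi>) + para P (fst \<Xi>) u + reson_xi P C \<Xi> u"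

definition A_eps_op :: "(plane \<Rightarrow> real) \<Rightarrow> real \<Rightarrow> pdist \<times> pdist \<Rightarrow> pdist \<Rightarrow> pdist" where
  "A_eps_op m \<epsilon> \<Xi> u =
     laplacian u + pw_mult (xi_eps m \<epsilon> (fst \<Xi>)) u - scal (complex_of_real (c_eps m \<epsilon>)) u"

definition H_op ::
  "lp_pair \<Rightarrow> (pdist \<Rightarrow> pdist \<Rightarrow> pdist \<Rightarrow> pdist) \<Rightarrow> pdist \<times> pdist \<Rightarrow> real \<Rightarrow> pdist \<Rightarrow> pdist" where
  "H_op P C \<Xi> K u = A_op P C \<Xi> u - scal (complex_of_real K) u"

definition H_eps_op :: "(plane \<Rightarrow> real) \<Rightarrow> real \<Rightarrow> pdist \<times> pdist \<Rightarrow> real \<Rightarrow> pdist \<Rightarrow> pdist" where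
  "H_eps_op m \<epsilon> \<Xi> K u = A_eps_op m \<epsilon> \<Xi> u - scal (complex_of_real K) u"

end

theory Submission
  imports Defs
begin

text \<open>
  Distributions are identified with their Fourier coefficients, so \<open>L\<^sup>2\<close> is the weighted sequence
  space \<open>\<H>\<^sup>0\<close> (Riesz--Fischer and Parseval). A densely defined symmetric \<open>A\<close> is self-adjoint as soon as
  \<open>K - A\<close> is onto for one real \<open>K\<close>; then so is every \<open>A - K'\<close>, and any positive threshold works.

  Surjectivity: writing \<open>u = R + T u\<close> with \<open>T u = u \<prec> X + B u\<close>, the operator is
  \<open>A u = E u + R \<circ> \<xi> - (1 - \<Delta>) R\<close> with \<open>E\<close> bounded from \<open>\<H>\<^sup>\<gamma>\<close> to \<open>L\<^sup>2\<close>, so \<open>K u - A u = f\<close> becomes a fixed-point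
  equation for the pair \<open>(u, R)\<close> involving \<open>(K - \<Delta> + 1)\<^sup>-\<^sup>1\<close>. It is a contraction on \<open>\<H>\<^sup>\<gamma> \<times> \<H>\<^sup>1\<^sup>+\<^sup>3\<^sup>\<kappa>\<close>, with a
  weight \<open>K\<^sup>-\<^sup>1\<^sup>/\<^sup>4\<close> on the second component, once \<open>K\<close> is large, uniformly for bounded enhanced noises.
  The same equation gives density of the domain (let \<open>K \<rightarrow> \<infinity>\<close>) and continuous dependence on the noise.

  Symmetry: for the mollified noise, a trigonometric polynomial, the operator is \<open>\<Delta> + \<xi>\<^sub>\<epsilon> - c\<^sub>\<epsilon>\<close> on \<open>\<H>\<^sup>2\<close>,
  which is symmetric by inspection; symmetry of \<open>A\<close> follows by letting \<open>\<epsilon> \<rightarrow> 0\<close>.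

  The \<open>L\<^sup>2\<close>-type paraproduct estimates rest on Wiener's device: a smooth compactly supported symbol is
  an absolutely convergent superposition of characters, that is, its multiplier is a superposition of translations.
\<close>

section \<open>Sobolev spaces as weighted sequence spaces\<close>

text \<open>The dyadic partition only makes the symbols of distant blocks disjoint; their supports
  may touch. A term \<open>below j f\<close> times \<open>block P j g\<close> can therefore have
  output frequencies far below 2^j, and spectral support gives no gain in negative Sobolev norms. A
  gain of order up to one comes from an increment of the symbol instead; hence the condition
  \<open>-1 \<le> t\<close> in the paraproduct bounds. The domain depends on the noise, so there is
  no common core on which to test symmetry or compare operators. Two noises are compared through
  solutions u and u' with the same right-hand side, for which A u - A' u' = K (u - u'). All losses
  of regularity are multiples of \<kappa> = (1 - \<gamma>) / 8: \<xi> is measured at -1 - \<kappa>,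
  \<Xi>2 at -2 \<kappa>, X at 1 - \<kappa>, T u at 1 - 2 \<kappa>, B u and the unknown R at 1 + 3
  \<kappa>. R is obtained from t = T u as J g - K J t, with J the resolvent, and so costs K^(5
  \<kappa> / 2) in terms of u. The weight K^(-1/4) pays for this; the price K^(1/4) of R in the
  equation for u is covered by the smoothing of J.\<close>

definition sobolev_wt :: "real \<Rightarrow> pdist \<Rightarrow> int \<times> int \<Rightarrow> real" where
  "sobolev_wt s f k = bessel k powr (s / 2) * cmod (f k)"

lemma bessel_ge_1: "1 \<le> bessel k"
  by (simp add: bessel_def)

lemma bessel_pos [simp]: "0 < bessel k"
  using bessel_ge_1[of k] by linarith

lemma bessel_neq_0 [simp]: "bessel k \<noteq> 0"
  using bessel_pos[of k] by linarith

lemma sobolev_wt_nonneg [simp]: "0 \<le> sobolev_wt s f k"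
  by (simp add: sobolev_wt_def)

lemma sobolev_wt_square: "(sobolev_wt s f k)\<^sup>2 = bessel k powr s * (cmod (f k))\<^sup>2"
  by (simp add: sobolev_wt_def power_mult_distrib power2_eq_square flip: powr_add)

lemma sobolev_norm_nonneg [simp]: "0 \<le> sobolev_norm s f"
  unfolding sobolev_norm_def by (intro real_sqrt_ge_zero infsum_nonneg) simp

text \<open>Uniform bounds over finite frequency sets give summability and the norm bound at once,
  so that the triangle inequality and limit passages only have to be made in \<open>L2_set\<close>
  over finite sets.\<close>

lemma sobolev_I:
  assumes "\<And>K. finite K \<Longrightarrow> L2_set (sobolev_wt s f) K \<le> c"
  shows "f \<in> sobolev s" "sobolev_norm s f \<le> c"
proof -
  have c: "0 \<le> c" using assms[of "{}"] by simp
  have *: "(\<Sum>k\<in>K. bessel k powr s * (cmod (f k))\<^sup>2) \<le> c\<^sup>2" if "finite K" for K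
    using power_mono[OF assms[OF that] L2_set_nonneg, of 2]
    by (simp add: L2_set_def sobolev_wt_square sum_nonneg)
  show 1: "f \<in> sobolev s"
    unfolding sobolev_def
    by (auto intro!: nonneg_bdd_above_summable_on bdd_aboveI[of _ "c\<^sup>2"] *)
  have "(\<Sum>\<^sub>\<infinity>k. bessel k powr s * (cmod (f k))\<^sup>2) \<le> c\<^sup>2"
    by (rule infsum_le_finite_sums) (use 1 * in \<open>auto simp: sobolev_def\<close>)
  then show "sobolev_norm s f \<le> c"
    unfolding sobolev_norm_def using c by (simp add: real_le_lsqrt infsum_nonneg)
qed

text \<open>For infinite \<open>K\<close> the sum inside \<open>L2_set\<close> is 0 by default, so
  the bound is trivial there and \<open>K\<close> can be left arbitrary.\<close>

lemma sobolev_D: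
  assumes "f \<in> sobolev s"
  shows "L2_set (sobolev_wt s f) K \<le> sobolev_norm s f"
proof (cases "finite K")
  case True
  then show ?thesis
    unfolding L2_set_def sobolev_norm_def sobolev_wt_square
    by (intro real_sqrt_le_mono finite_sum_le_infsum) (use assms in \<open>auto simp: sobolev_def\<close>)
qed simp

lemma sobolev_wt_le:
  assumes "f \<in> sobolev s"
  shows "sobolev_wt s f k \<le> sobolev_norm s f"
  using member_le_L2_set[of "{k}" k "sobolev_wt s f"] sobolev_D[OF assms, of "{k}"] by simp

lemma sobolev_compare:
  assumes "f \<in> sobolev s" "0 \<le> c" "\<And>k. sobolev_wt t g k \<le> c * sobolev_wt s f k"
  shows "g \<in> sobolev t" "sobolev_norm t g \<le> c * sobolev_norm s f"
proof -
  have "L2_set (sobolev_wt t g) K \<le> c * sobolev_norm s f" if "finite K" for K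
  proof -
    have "L2_set (sobolev_wt t g) K \<le> L2_set (\<lambda>k. c * sobolev_wt s f k) K"
      by (intro L2_set_mono assms) auto
    also have "\<dots> = c * L2_set (sobolev_wt s f) K"
      using assms(2) by (simp add: L2_set_right_distrib)
    finally show ?thesis using sobolev_D[OF assms(1), of K] assms(2)
      by (meson mult_left_mono order_trans)
  qed
  from sobolev_I[OF this] show "g \<in> sobolev t" "sobolev_norm t g \<le> c * sobolev_norm s f" by auto
qed

lemma sobolev_compare1:
  assumes "f \<in> sobolev s" "\<And>k. sobolev_wt t g k \<le> sobolev_wt s f k"
  shows "g \<in> sobolev t" "sobolev_norm t g \<le> sobolev_norm s f"
  using sobolev_compare[OF assms(1), of 1] assms(2) by auto

lemma sobolev_mono:
  assumes "f \<in> sobolev s" "t \<le> s"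
  shows "f \<in> sobolev t" "sobolev_norm t f \<le> sobolev_norm s f"
proof -
  have "sobolev_wt t f k \<le> sobolev_wt s f k" for k
    using assms(2) bessel_ge_1[of k] by (auto simp: sobolev_wt_def intro!: mult_right_mono powr_mono)
  from sobolev_compare1[OF assms(1) this] show "f \<in> sobolev t" "sobolev_norm t f \<le> sobolev_norm s f" by auto
qed

text \<open>Only the weights are compared, frequency by frequency. Derivatives, Bessel potentials
  and the resolvent get their Sobolev mapping properties from this one estimate.\<close>

lemma sobolev_multiplier:
  assumes "f \<in> sobolev s" "0 \<le> c" "\<And>k. cmod (m k) \<le> c * bessel k powr ((s - t) / 2)"
  shows "(\<lambda>k. m k * f k) \<in> sobolev t" "sobolev_norm t (\<lambda>k. m k * f k) \<le> c * sobolev_norm s f"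
proof -
  have "sobolev_wt t (\<lambda>k. m k * f k) k \<le> c * sobolev_wt s f k" for k
  proof -
    have "sobolev_wt t (\<lambda>k. m k * f k) k = cmod (m k) * (bessel k powr (t/2) * cmod (f k))"
      by (simp add: sobolev_wt_def norm_mult)
    also have "\<dots> \<le> (c * bessel k powr ((s - t) / 2)) * (bessel k powr (t/2) * cmod (f k))"
      by (intro mult_right_mono assms) auto
    also have "\<dots> = c * (bessel k powr ((s - t) / 2 + t/2) * cmod (f k))"
      by (simp add: powr_add mult_ac)
    also have "\<dots> = c * sobolev_wt s f k"
      by (simp add: sobolev_wt_def flip: add_divide_distrib)
    finally show ?thesis .
  qed
  from sobolev_compare[OF assms(1,2) this]
  show "(\<lambda>k. m k * f k) \<in> sobolev t" "sobolev_norm t (\<lambda>k. m k * f k) \<le> c * sobolev_norm s f" by auto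
qed

lemma sobolev_wt_triangle: "sobolev_wt s (f + g) k \<le> sobolev_wt s f k + sobolev_wt s g k"
  by (simp add: sobolev_wt_def norm_triangle_ineq mult_left_mono flip: distrib_left)

lemma sobolev_zero [simp]: "0 \<in> sobolev s" "sobolev_norm s 0 = 0"
  by (auto simp: sobolev_def sobolev_norm_def)

lemma sobolev_add:
  assumes "f \<in> sobolev s" "g \<in> sobolev s"
  shows "f + g \<in> sobolev s" "sobolev_norm s (f + g) \<le> sobolev_norm s f + sobolev_norm s g"
proof -
  have "L2_set (sobolev_wt s (f + g)) K \<le> sobolev_norm s f + sobolev_norm s g" for K
  proof -
    have "L2_set (sobolev_wt s (f + g)) K \<le> L2_set (\<lambda>k. sobolev_wt s f k + sobolev_wt s g k) K"
      by (intro L2_set_mono sobolev_wt_triangle) auto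
    also have "\<dots> \<le> L2_set (sobolev_wt s f) K + L2_set (sobolev_wt s g) K"
      by (rule L2_set_triangle_ineq)
    finally show ?thesis using sobolev_D[OF assms(1), of K] sobolev_D[OF assms(2), of K] by linarith
  qed
  from sobolev_I[OF this]
  show "f + g \<in> sobolev s" "sobolev_norm s (f + g) \<le> sobolev_norm s f + sobolev_norm s g" by auto
qed

lemma sobolev_scal:
  assumes "f \<in> sobolev s"
  shows "scal c f \<in> sobolev s" "sobolev_norm s (scal c f) \<le> cmod c * sobolev_norm s f"
  using sobolev_multiplier[OF assms, of "cmod c" "\<lambda>_. c" s] by (auto simp: scal_def)

lemma sobolev_minus_iff: "- f \<in> sobolev s \<longleftrightarrow> f \<in> sobolev s"
  by (simp add: sobolev_def)

lemma sobolev_norm_minus [simp]: "sobolev_norm s (- f) = sobolev_norm s f"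
  by (simp add: sobolev_norm_def)

lemma sobolev_norm_diff_commute: "sobolev_norm s (f - g) = sobolev_norm s (g - f)"
  using sobolev_norm_minus[of s "f - g"] by simp

lemma sobolev_diff:
  assumes "f \<in> sobolev s" "g \<in> sobolev s"
  shows "f - g \<in> sobolev s" "sobolev_norm s (f - g) \<le> sobolev_norm s f + sobolev_norm s g"
  using sobolev_add[OF assms(1), of "- g"] assms(2) by (auto simp: sobolev_minus_iff)

lemma sobolev_norm_eq_0:
  assumes "f \<in> sobolev s" "sobolev_norm s f = 0"
  shows "f = 0"
proof
  fix k
  have "sobolev_wt s f k \<le> 0" using sobolev_wt_le[OF assms(1), of k] assms(2) by simp
  then have "bessel k powr (s/2) * cmod (f k) = 0"
    using sobolev_wt_nonneg[of s f k] unfolding sobolev_wt_def by linarith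
  then show "f k = 0 k" by simp
qed

lemma sobolev_coeff_le:
  assumes "f \<in> sobolev s"
  shows "cmod (f k) \<le> bessel k powr (- s / 2) * sobolev_norm s f"
proof -
  have "cmod (f k) = bessel k powr (- s / 2) * sobolev_wt s f k"
    by (simp add: sobolev_wt_def flip: powr_add mult.assoc)
  then show ?thesis using sobolev_wt_le[OF assms, of k] by (simp add: mult_left_mono)
qed

section \<open>Series, completeness and fixed points\<close>

lemma sum_pdist_apply: "(\<Sum>i\<in>I. G i) k = (\<Sum>i\<in>I. G i k)" for G :: "'i \<Rightarrow> pdist"
  by (induction I rule: infinite_finite_induct) auto

text \<open>Single coefficients are controlled by the norm, so the series converges absolutely at
  each frequency. The norm bound is lower semicontinuity: a finite \<open>K\<close> sees finitely
  many coefficients, and the finite partial sums obey the triangle inequality.\<close>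

lemma sobolev_infsum:
  assumes G: "\<And>i. i \<in> I \<Longrightarrow> G i \<in> sobolev s" and le: "\<And>i. i \<in> I \<Longrightarrow> sobolev_norm s (G i) \<le> a i"
    and a: "a summable_on I"
  shows "(\<lambda>i. cmod (G i k)) summable_on I"
    and "(\<lambda>k. \<Sum>\<^sub>\<infinity>i\<in>I. G i k) \<in> sobolev s"
    and "sobolev_norm s (\<lambda>k. \<Sum>\<^sub>\<infinity>i\<in>I. G i k) \<le> infsum a I"
proof -
  have abs: "(\<lambda>i. cmod (G i k)) summable_on I" for k
  proof (rule summable_on_comparison_test)
    show "(\<lambda>i. bessel k powr (- s / 2) * a i) summable_on I"
      using a by (rule summable_on_cmult_right)
    show "cmod (G i k) \<le> bessel k powr (- s / 2) * a i" if "i \<in> I" for i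
      using sobolev_coeff_le[OF G[OF that], of k] le[OF that]
      by (meson mult_left_mono order_trans powr_ge_zero)
  qed simp
  then show "(\<lambda>i. cmod (G i k)) summable_on I" .
  let ?F = "\<lambda>k. \<Sum>\<^sub>\<infinity>i\<in>I. G i k"
  have a_nn: "0 \<le> a i" if "i \<in> I" for i
    using le[OF that] sobolev_norm_nonneg[of s "G i"] by linarith
  have fin: "sum (\<lambda>i. G i) J \<in> sobolev s \<and> sobolev_norm s (sum (\<lambda>i. G i) J) \<le> sum a J"
    if "finite J" "J \<subseteq> I" for J
    using that
  proof (induction J rule: finite_induct)
    case (insert i J)
    then have i: "G i \<in> sobolev s" "sobolev_norm s (G i) \<le> a i"
      and J: "sum G J \<in> sobolev s" "sobolev_norm s (sum G J) \<le> sum a J"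
      using G[of i] le[of i] by auto
    have "sobolev_norm s (G i + sum G J) \<le> a i + sum a J"
      using sobolev_add(2)[OF i(1) J(1)] i(2) J(2) by linarith
    then show ?case using sobolev_add(1)[OF i(1) J(1)] unfolding sum.insert[OF insert.hyps] by blast
  qed auto
  have "L2_set (sobolev_wt s ?F) K \<le> infsum a I" if K: "finite K" for K
  proof (rule tendsto_upperbound)
    show "((\<lambda>J. L2_set (sobolev_wt s (sum G J)) K) \<longlongrightarrow> L2_set (sobolev_wt s ?F) K) (finite_subsets_at_top I)"
      unfolding L2_set_def sobolev_wt_def
    proof (intro tendsto_intros)
      fix k
      have "((\<lambda>i. G i k) has_sum ?F k) I"
        using abs[of k] by (simp add: abs_summable_summable)
      then show "((\<lambda>J. sum G J k) \<longlongrightarrow> ?F k) (finite_subsets_at_top I)"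
        by (simp add: has_sum_def sum_pdist_apply)
    qed
    show "\<forall>\<^sub>F J in finite_subsets_at_top I. L2_set (sobolev_wt s (sum G J)) K \<le> infsum a I"
    proof (rule eventually_finite_subsets_at_top_weakI)
      fix J assume J: "finite J" "J \<subseteq> I"
      have "L2_set (sobolev_wt s (sum G J)) K \<le> sum a J"
        using fin[OF J] sobolev_D[of "sum G J" s K] by linarith
      also have "\<dots> \<le> infsum a I"
        by (rule finite_sum_le_infsum) (use J a a_nn in auto)
      finally show "L2_set (sobolev_wt s (sum G J)) K \<le> infsum a I" .
    qed
  qed simp
  from sobolev_I[OF this] show "?F \<in> sobolev s" "sobolev_norm s ?F \<le> infsum a I" by auto
qed

text \<open>The limit is taken coefficientwise; the Cauchy estimate for \<open>x m - x n\<close>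
  survives n \<rightarrow> \<infinity> on every finite frequency set and hence in norm.\<close>

lemma sobolev_complete:
  assumes x: "\<And>n. x n \<in> sobolev s"
    and C: "\<And>e. e > 0 \<Longrightarrow> \<exists>N. \<forall>m\<ge>N. \<forall>n\<ge>N. sobolev_norm s (x m - x n) < e"
  shows "\<exists>f\<in>sobolev s. (\<lambda>n. sobolev_norm s (x n - f)) \<longlonglongrightarrow> 0"
proof -
  have "Cauchy (\<lambda>n. x n k)" for k
  proof (rule metric_CauchyI)
    fix e :: real assume e: "e > 0"
    define b where "b = bessel k powr (- s / 2)"
    have b: "b > 0" by (simp add: b_def)
    from C[of "e / b"] e b obtain N where N: "\<And>m n. m \<ge> N \<Longrightarrow> n \<ge> N \<Longrightarrow> sobolev_norm s (x m - x n) < e / b"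
      by (meson divide_pos_pos)
    have "dist (x m k) (x n k) < e" if "m \<ge> N" "n \<ge> N" for m n
    proof -
      have "dist (x m k) (x n k) \<le> b * sobolev_norm s (x m - x n)"
        using sobolev_coeff_le[OF sobolev_diff(1)[OF x[of m] x[of n]], of k] by (simp add: dist_norm b_def)
      also have "\<dots> < b * (e / b)" using N[OF that] b by (intro mult_strict_left_mono)
      finally show ?thesis using b by simp
    qed
    then show "\<exists>M. \<forall>m\<ge>M. \<forall>n\<ge>M. dist (x m k) (x n k) < e" by blast
  qed
  then have "\<exists>l. (\<lambda>n. x n k) \<longlonglongrightarrow> l" for k
    using Cauchy_convergent[of "\<lambda>n. x n k"] by (simp add: convergent_def)
  then obtain f where f: "\<And>k. (\<lambda>n. x n k) \<longlonglongrightarrow> f k"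
    using choice[of "\<lambda>k l. (\<lambda>n. x n k) \<longlonglongrightarrow> l"] by blast
  have key: "x m - f \<in> sobolev s \<and> sobolev_norm s (x m - f) \<le> e"
    if N: "\<forall>m\<ge>N. \<forall>n\<ge>N. sobolev_norm s (x m - x n) < e" and m: "m \<ge> N" for m N e
  proof -
    have "L2_set (sobolev_wt s (x m - f)) K \<le> e" if K: "finite K" for K
    proof (rule tendsto_upperbound)
      show "(\<lambda>n. L2_set (sobolev_wt s (x m - x n)) K) \<longlonglongrightarrow> L2_set (sobolev_wt s (x m - f)) K"
        unfolding L2_set_def sobolev_wt_def by (simp, intro tendsto_intros f)
      show "\<forall>\<^sub>F n in sequentially. L2_set (sobolev_wt s (x m - x n)) K \<le> e"
        using eventually_ge_at_top[of N]
      proof eventually_elim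
        case (elim n)
        then show ?case using N m sobolev_D[OF sobolev_diff(1)[OF x[of m] x[of n]], of K] by fastforce
      qed
    qed simp
    from sobolev_I[OF this] show ?thesis by auto
  qed
  obtain N where N: "\<forall>m\<ge>N. \<forall>n\<ge>N. sobolev_norm s (x m - x n) < 1" using C[of 1] by auto
  have "x N - (x N - f) \<in> sobolev s"
    using key[OF N, of N] x[of N] by (blast intro: sobolev_diff(1))
  then have "f \<in> sobolev s" by simp
  moreover have "(\<lambda>n. sobolev_norm s (x n - f)) \<longlonglongrightarrow> 0"
  proof (rule metric_LIMSEQ_I)
    fix r :: real assume "r > 0"
    then obtain N where N: "\<forall>m\<ge>N. \<forall>n\<ge>N. sobolev_norm s (x m - x n) < r / 2" using C[of "r/2"] by auto
    then have "\<forall>n\<ge>N. dist (sobolev_norm s (x n - f)) 0 < r"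
      using key[OF N] \<open>r > 0\<close> by (fastforce simp: dist_norm)
    then show "\<exists>N. \<forall>n\<ge>N. dist (sobolev_norm s (x n - f)) 0 < r" by blast
  qed
  ultimately show ?thesis by blast
qed

text \<open>The spaces are subsets of a function type that carries no norm of its own, so Banach's
  theorem is used for the set-based \<open>Metric_space\<close> with the weighted metric
  \<open>d\<close>.\<close>

lemma sobolev_pair_fixpoint:
  fixes \<Phi> :: "pdist \<times> pdist \<Rightarrow> pdist \<times> pdist" and a b w q :: real
  defines "d \<equiv> \<lambda>x y. sobolev_norm a (fst x - fst y) + w * sobolev_norm b (snd x - snd y)"
  assumes w: "w > 0" and q: "q < 1"
    and maps: "\<And>x. x \<in> sobolev a \<times> sobolev b \<Longrightarrow> \<Phi> x \<in> sobolev a \<times> sobolev b"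
    and contr: "\<And>x y. x \<in> sobolev a \<times> sobolev b \<Longrightarrow> y \<in> sobolev a \<times> sobolev b \<Longrightarrow> d (\<Phi> x) (\<Phi> y) \<le> q * d x y"
  shows "\<exists>x\<in>sobolev a \<times> sobolev b. \<Phi> x = x"
proof -
  let ?S = "sobolev a \<times> sobolev b"
  have d_nn: "0 \<le> d x y" for x y using w by (simp add: d_def)
  have d_com: "d x y = d y x" for x y by (simp add: d_def sobolev_norm_diff_commute)
  have d0: "x = y" if "x \<in> ?S" "y \<in> ?S" "d x y = 0" for x y
  proof -
    have "sobolev_norm a (fst x - fst y) \<ge> 0" "w * sobolev_norm b (snd x - snd y) \<ge> 0" using w by auto
    with that(3) have "sobolev_norm a (fst x - fst y) = 0" "w * sobolev_norm b (snd x - snd y) = 0"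
      unfolding d_def by linarith+
    then have "sobolev_norm a (fst x - fst y) = 0" "sobolev_norm b (snd x - snd y) = 0"
      using w by simp_all
    moreover have "fst x - fst y \<in> sobolev a" "snd x - snd y \<in> sobolev b"
      using that by (auto intro!: sobolev_diff(1))
    ultimately have "fst x - fst y = 0" "snd x - snd y = 0"
      by (blast intro: sobolev_norm_eq_0)+
    then show ?thesis by (simp add: prod_eq_iff)
  qed
  have tri: "d x z \<le> d x y + d y z" if "x \<in> ?S" "y \<in> ?S" "z \<in> ?S" for x y z
  proof -
    have "sobolev_norm a ((fst x - fst y) + (fst y - fst z)) \<le> sobolev_norm a (fst x - fst y) + sobolev_norm a (fst y - fst z)"
      "sobolev_norm b ((snd x - snd y) + (snd y - snd z)) \<le> sobolev_norm b (snd x - snd y) + sobolev_norm b (snd y - snd z)"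
      using that by (intro sobolev_add(2) sobolev_diff(1); auto)+
    then have "sobolev_norm a (fst x - fst z) \<le> sobolev_norm a (fst x - fst y) + sobolev_norm a (fst y - fst z)"
      "w * sobolev_norm b (snd x - snd z) \<le> w * (sobolev_norm b (snd x - snd y) + sobolev_norm b (snd y - snd z))"
      using w by simp_all
    then show ?thesis by (simp add: d_def distrib_left)
  qed
  interpret Metric_space ?S d
  proof
    show "d x y = 0 \<longleftrightarrow> x = y" if "x \<in> ?S" "y \<in> ?S" for x y using d0[OF that] by (auto simp: d_def)
  qed (fact d_nn d_com tri)+
  have mcomplete unfolding mcomplete_def
  proof (intro allI impI)
    fix z assume "MCauchy z"
    note z = this[unfolded MCauchy_def]
    have C: "\<exists>N. \<forall>m\<ge>N. \<forall>n\<ge>N. d (z m) (z n) < e" if "e > 0" for e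
      using conjunct2[OF z, rule_format, OF that] by (elim exE, intro exI) simp
    have zS: "z n \<in> ?S" for n using conjunct1[OF z] by (rule subsetD) simp
    then have zS': "fst (z n) \<in> sobolev a" "snd (z n) \<in> sobolev b" for n by (auto simp: mem_Times_iff)
    have le: "sobolev_norm a (fst x - fst y) \<le> d x y" "w * sobolev_norm b (snd x - snd y) \<le> d x y" for x y
      using w by (simp_all add: d_def)
    have "\<exists>f\<in>sobolev a. (\<lambda>n. sobolev_norm a (fst (z n) - f)) \<longlonglongrightarrow> 0"
      by (rule sobolev_complete[OF zS'(1)]) (meson C le(1) order_le_less_trans)
    then obtain f where f: "f \<in> sobolev a" "(\<lambda>n. sobolev_norm a (fst (z n) - f)) \<longlonglongrightarrow> 0" by blast
    have "\<exists>f\<in>sobolev b. (\<lambda>n. sobolev_norm b (snd (z n) - f)) \<longlonglongrightarrow> 0"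
    proof (rule sobolev_complete[OF zS'(2)])
      fix e :: real assume "e > 0"
      then obtain N where "\<forall>m\<ge>N. \<forall>n\<ge>N. d (z m) (z n) < w * e" using C[of "w * e"] w by auto
      then have "\<forall>m\<ge>N. \<forall>n\<ge>N. w * sobolev_norm b (snd (z m) - snd (z n)) < w * e" by (meson le(2) order_le_less_trans)
      with w show "\<exists>N. \<forall>m\<ge>N. \<forall>n\<ge>N. sobolev_norm b (snd (z m) - snd (z n)) < e" by auto
    qed
    then obtain g where g: "g \<in> sobolev b" "(\<lambda>n. sobolev_norm b (snd (z n) - g)) \<longlonglongrightarrow> 0" by blast
    have "(\<lambda>n. d (z n) (f, g)) \<longlonglongrightarrow> 0 + w * 0"
      unfolding d_def fst_conv snd_conv by (intro tendsto_intros f g)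
    then have "limitin mtopology z (f, g) sequentially"
      using f(1) g(1) zS by (auto simp: limitin_metric order_tendstoD(2))
    then show "\<exists>x. limitin mtopology z x sequentially" by blast
  qed
  moreover have "0 \<in> ?S" by (simp add: zero_prod_def)
  ultimately show ?thesis using Banach_fixedpoint_thm[of \<Phi> q] maps contr q by (metis Pi_I empty_iff)
qed

section \<open>Characters and trigonometric polynomials\<close>

text \<open>Blocks of distributions are of this kind. For such families evaluation and products are
  finite sums and the supremum in \<open>Linf_norm\<close> is over a bounded function; product
  estimates are proved at this level before summing over blocks.\<close>

definition trig_poly :: "pdist \<Rightarrow> bool" where
  "trig_poly f \<longleftrightarrow> finite {k. f k \<noteq> 0}"

lemma freq_add: "freq (k + l) = freq k + freq l"
  by (simp add: freq_def)

lemma freq_minus: "freq (- k) = - freq k"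
  by (simp add: freq_def)

lemma freq_diff: "freq (k - l) = freq k - freq l"
  by (simp add: freq_def)

lemma freq_0 [simp]: "freq 0 = 0"
  by (simp add: freq_def zero_prod_def)

lemma echar_0 [simp]: "echar 0 x = 1"
  by (simp add: echar_def)

lemma echar_add: "echar (k + l) x = echar k x * echar l x"
  by (simp add: echar_def freq_add inner_add_left algebra_simps flip: exp_add)

lemma echar_add_right: "echar k (x + y) = echar k x * echar k y"
  by (simp add: echar_def inner_add_right algebra_simps flip: exp_add)

lemma echar_eq_cis: "echar k x = cis (2 * pi * (freq k \<bullet> x))"
  by (simp add: echar_def cis_conv_exp mult_ac)

lemma cmod_echar [simp]: "cmod (echar k x) = 1"
  by (simp add: echar_eq_cis)

lemma cnj_echar: "cnj (echar k x) = echar (- k) x"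
  by (simp add: echar_eq_cis freq_minus cis_cnj)

lemma echar_diff: "echar (k - l) x = echar k x * cnj (echar l x)"
  using echar_add[of k "- l" x] by (simp add: cnj_echar)

lemma continuous_on_echar [continuous_intros]:
  "continuous_on S f \<Longrightarrow> continuous_on S (\<lambda>x. echar k (f x))"
  unfolding echar_def by (intro continuous_intros)

lemma measurable_echar [measurable]: "echar k \<in> borel_measurable borel"
  by (intro borel_measurable_continuous_onI continuous_intros)

lemma eval_series_finite:
  assumes "finite K" "{k. f k \<noteq> 0} \<subseteq> K"
  shows "eval_series f x = (\<Sum>k\<in>K. f k * echar k x)"
proof -
  have "eval_series f x = (\<Sum>\<^sub>\<infinity>k\<in>K. f k * echar k x)"
    unfolding eval_series_def by (rule infsum_cong_neutral) (use assms in auto)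
  then show ?thesis using assms by simp
qed

lemma eval_series_trig:
  "trig_poly f \<Longrightarrow> eval_series f x = (\<Sum>k\<in>{k. f k \<noteq> 0}. f k * echar k x)"
  by (rule eval_series_finite) (auto simp: trig_poly_def)

lemma trig_poly_mult: "trig_poly f \<Longrightarrow> trig_poly (\<lambda>k. m k * f k)"
  unfolding trig_poly_def by (erule finite_subset[rotated]) auto

lemma trig_poly_mult': "trig_poly f \<Longrightarrow> trig_poly (\<lambda>k. f k * m k)"
  unfolding trig_poly_def by (erule finite_subset[rotated]) auto

lemma trig_poly_0 [simp]: "trig_poly 0"
  by (simp add: trig_poly_def)

lemma trig_poly_add: "trig_poly f \<Longrightarrow> trig_poly g \<Longrightarrow> trig_poly (f + g)"
  unfolding trig_poly_def by (rule finite_subset[of _ "{k. f k \<noteq> 0} \<union> {k. g k \<noteq> 0}"]) auto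

lemma trig_poly_scal: "trig_poly f \<Longrightarrow> trig_poly (scal c f)"
  unfolding scal_def by (rule trig_poly_mult)

lemma trig_poly_uminus: "trig_poly f \<Longrightarrow> trig_poly (- f)"
  by (simp add: trig_poly_def)

lemma trig_poly_diff: "trig_poly f \<Longrightarrow> trig_poly g \<Longrightarrow> trig_poly (f - g)"
  using trig_poly_add[of f "- g"] by (simp add: trig_poly_uminus)

lemma trig_poly_sum: "(\<And>i. i \<in> I \<Longrightarrow> trig_poly (f i)) \<Longrightarrow> trig_poly (\<Sum>i\<in>I. f i)"
  by (induction I rule: infinite_finite_induct) (auto intro: trig_poly_add)

lemma trig_poly_const_dist: "trig_poly (const_dist c)"
  unfolding trig_poly_def const_dist_def by (rule finite_subset[of _ "{0}"]) auto

lemma eval_series_add: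
  assumes "trig_poly f" "trig_poly g"
  shows "eval_series (f + g) x = eval_series f x + eval_series g x"
proof -
  let ?K = "{k. f k \<noteq> 0} \<union> {k. g k \<noteq> 0}"
  have "finite ?K" using assms by (simp add: trig_poly_def)
  then show ?thesis
    by (subst (1 2 3) eval_series_finite[of ?K]) (auto simp: sum.distrib ring_distribs)
qed

lemma eval_series_scal: "trig_poly f \<Longrightarrow> eval_series (scal c f) x = c * eval_series f x"
  by (subst (1 2) eval_series_finite[of "{k. f k \<noteq> 0}"])
     (auto simp: trig_poly_def scal_def sum_distrib_left mult_ac)

lemma eval_series_translate:
  "trig_poly f \<Longrightarrow> eval_series (\<lambda>k. echar k y * f k) x = eval_series f (x + y)"
  by (subst (1 2) eval_series_finite[of "{k. f k \<noteq> 0}"])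
     (auto simp: trig_poly_def echar_add_right mult_ac)

lemma cmod_eval_le_sum: "trig_poly f \<Longrightarrow> cmod (eval_series f x) \<le> (\<Sum>k\<in>{k. f k \<noteq> 0}. cmod (f k))"
  unfolding eval_series_trig by (rule sum_norm_le) (simp add: norm_mult)

lemma cmod_eval_le_Linf:
  assumes "trig_poly f"
  shows "cmod (eval_series f x) \<le> Linf_norm f"
  unfolding Linf_norm_def
  by (rule cSUP_upper) (auto intro!: bdd_aboveI2[OF cmod_eval_le_sum[OF assms]])

lemma Linf_le: "(\<And>x. cmod (eval_series f x) \<le> c) \<Longrightarrow> Linf_norm f \<le> c"
  unfolding Linf_norm_def by (rule cSUP_least) auto

lemma Linf_nonneg: "trig_poly f \<Longrightarrow> 0 \<le> Linf_norm f"
  using cmod_eval_le_Linf[of f 0] norm_ge_zero[of "eval_series f 0"] by linarith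

lemma Linf_le_sum: "trig_poly f \<Longrightarrow> Linf_norm f \<le> (\<Sum>k\<in>{k. f k \<noteq> 0}. cmod (f k))"
  by (intro Linf_le cmod_eval_le_sum)

lemma Linf_0 [simp]: "Linf_norm 0 = 0"
  by (simp add: Linf_norm_def eval_series_def)

lemma Linf_add: "trig_poly f \<Longrightarrow> trig_poly g \<Longrightarrow> Linf_norm (f + g) \<le> Linf_norm f + Linf_norm g"
  by (rule Linf_le)
     (simp add: eval_series_add order_trans[OF norm_triangle_ineq add_mono] cmod_eval_le_Linf)

lemma Linf_sum: "(\<And>i. i \<in> I \<Longrightarrow> trig_poly (f i)) \<Longrightarrow> Linf_norm (\<Sum>i\<in>I. f i) \<le> (\<Sum>i\<in>I. Linf_norm (f i))"
proof (induction I rule: infinite_finite_induct)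
  case (insert i I)
  then have "trig_poly (f i)" "trig_poly (sum f I)" "Linf_norm (sum f I) \<le> (\<Sum>i\<in>I. Linf_norm (f i))"
    by (auto intro!: trig_poly_sum)
  with Linf_add[of "f i" "sum f I"]
  have "Linf_norm (f i + sum f I) \<le> Linf_norm (f i) + (\<Sum>i\<in>I. Linf_norm (f i))" by linarith
  then show ?case unfolding sum.insert[OF insert.hyps] .
qed simp_all

lemma Linf_scal_le: "trig_poly f \<Longrightarrow> Linf_norm (scal c f) \<le> cmod c * Linf_norm f"
  by (rule Linf_le) (simp add: eval_series_scal norm_mult mult_left_mono cmod_eval_le_Linf)

lemma Linf_uminus [simp]: "Linf_norm (- f) = Linf_norm f"
  by (simp add: Linf_norm_def eval_series_def infsum_uminus)

lemma Linf_diff: "trig_poly f \<Longrightarrow> trig_poly g \<Longrightarrow> Linf_norm (f - g) \<le> Linf_norm f + Linf_norm g"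
  using Linf_add[of f "- g"] by (simp add: trig_poly_uminus)

lemma Linf_translate: "trig_poly f \<Longrightarrow> Linf_norm (\<lambda>k. echar k y * f k) \<le> Linf_norm f"
  by (rule Linf_le) (simp add: eval_series_translate cmod_eval_le_Linf)

section \<open>Products with a trigonometric polynomial\<close>

lemma pw_mult_finite:
  assumes "finite K" "{k. f k \<noteq> 0} \<subseteq> K"
  shows "pw_mult f g k = (\<Sum>l\<in>K. f l * g (k - l))"
proof -
  have "pw_mult f g k = (\<Sum>\<^sub>\<infinity>l\<in>K. f l * g (k - l))"
    unfolding pw_mult_def by (rule infsum_cong_neutral) (use assms in auto)
  then show ?thesis using assms by simp
qed

lemma pw_mult_trig: "trig_poly f \<Longrightarrow> pw_mult f g k = (\<Sum>l\<in>{k. f k \<noteq> 0}. f l * g (k - l))"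
  by (rule pw_mult_finite) (auto simp: trig_poly_def)

lemma pw_mult_commute: "pw_mult f g = pw_mult g f"
proof
  fix k :: "int \<times> int"
  have "bij_betw (\<lambda>l. k - l) UNIV UNIV"
    by (rule bij_betwI[where g = "\<lambda>l. k - l"]) auto
  from infsum_reindex_bij_betw[OF this, of "\<lambda>l. g l * f (k - l)"]
  show "pw_mult f g k = pw_mult g f k"
    by (simp add: pw_mult_def mult.commute)
qed

lemma pw_mult_add_right: "trig_poly f \<Longrightarrow> pw_mult f (g + h) = pw_mult f g + pw_mult f h"
  by (rule ext) (simp add: pw_mult_trig sum.distrib ring_distribs)

lemma pw_mult_scal_right: "trig_poly f \<Longrightarrow> pw_mult f (scal c g) = scal c (pw_mult f g)"
  by (rule ext) (simp add: pw_mult_trig scal_def sum_distrib_left mult_ac)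

lemma pw_mult_add_left: "trig_poly h \<Longrightarrow> pw_mult (f + g) h = pw_mult f h + pw_mult g h"
  by (simp add: pw_mult_commute[of _ h] pw_mult_add_right)

lemma pw_mult_scal_left: "trig_poly g \<Longrightarrow> pw_mult (scal c f) g = scal c (pw_mult f g)"
  by (simp add: pw_mult_commute[of _ g] pw_mult_scal_right)

lemma pw_mult_0 [simp]: "pw_mult 0 f = 0" "pw_mult f 0 = 0"
  by (auto simp: pw_mult_def fun_eq_iff)

lemma pw_mult_sum_right:
  "trig_poly f \<Longrightarrow> pw_mult f (\<Sum>i\<in>I. g i) = (\<Sum>i\<in>I. pw_mult f (g i))"
  by (induction I rule: infinite_finite_induct) (auto simp: pw_mult_add_right)

lemma pw_mult_sum_left:
  "trig_poly h \<Longrightarrow> pw_mult (\<Sum>i\<in>I. g i) h = (\<Sum>i\<in>I. pw_mult (g i) h)"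
  by (simp add: pw_mult_commute[of _ h] pw_mult_sum_right)

lemma trig_poly_pw_mult:
  assumes "trig_poly f" "trig_poly g"
  shows "trig_poly (pw_mult f g)"
proof -
  let ?K = "(\<lambda>(l, n). l + n) ` ({k. f k \<noteq> 0} \<times> {k. g k \<noteq> 0})"
  have "finite ?K" using assms by (simp add: trig_poly_def)
  moreover have "{k. pw_mult f g k \<noteq> 0} \<subseteq> ?K"
  proof
    fix k assume "k \<in> {k. pw_mult f g k \<noteq> 0}"
    then have "(\<Sum>l\<in>{k. f k \<noteq> 0}. f l * g (k - l)) \<noteq> 0"
      by (simp only: pw_mult_trig[OF assms(1)] mem_Collect_eq not_False_eq_True)
    then obtain l where "f l * g (k - l) \<noteq> 0"
      by (rule sum.not_neutral_contains_not_neutral)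
    then have "k = (\<lambda>(l, n). l + n) (l, k - l)" "(l, k - l) \<in> {k. f k \<noteq> 0} \<times> {k. g k \<noteq> 0}" by auto
    then show "k \<in> ?K" by (rule image_eqI)
  qed
  ultimately show ?thesis unfolding trig_poly_def by (rule finite_subset[rotated])
qed

lemma eval_pw_mult:
  assumes f: "trig_poly f" and g: "trig_poly g"
  shows "eval_series (pw_mult f g) x = eval_series f x * eval_series g x"
proof -
  let ?A = "{k. f k \<noteq> 0}" and ?B = "{k. g k \<noteq> 0}"
  let ?K = "(\<lambda>(l, n). l + n) ` (?A \<times> ?B)"
  have fin: "finite ?A" "finite ?B" using f g by (auto simp: trig_poly_def)
  then have K: "finite ?K" by simp
  have "{k. pw_mult f g k \<noteq> 0} \<subseteq> ?K"
  proof
    fix k assume "k \<in> {k. pw_mult f g k \<noteq> 0}"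
    then have "(\<Sum>l\<in>?A. f l * g (k - l)) \<noteq> 0"
      by (simp only: pw_mult_trig[OF f] mem_Collect_eq not_False_eq_True)
    then obtain l where "f l * g (k - l) \<noteq> 0"
      by (rule sum.not_neutral_contains_not_neutral)
    then have "k = (\<lambda>(l, n). l + n) (l, k - l)" "(l, k - l) \<in> ?A \<times> ?B" by auto
    then show "k \<in> ?K" by (rule image_eqI)
  qed
  then have "eval_series (pw_mult f g) x = (\<Sum>k\<in>?K. \<Sum>l\<in>?A. f l * g (k - l) * echar k x)"
    using K by (simp add: eval_series_finite pw_mult_trig[OF f] sum_distrib_right)
  also have "\<dots> = (\<Sum>l\<in>?A. \<Sum>k\<in>?K. f l * g (k - l) * echar k x)"
    by (rule sum.swap)
  also have "\<dots> = (\<Sum>l\<in>?A. f l * echar l x * eval_series g x)"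
  proof (rule sum.cong[OF refl])
    fix l assume l: "l \<in> ?A"
    \<comment> \<open>Only frequencies \<open>k\<close> in the support of \<open>g\<close>
      translated by \<open>l\<close> contribute to the inner sum.\<close>
    have "(\<Sum>k\<in>?K. f l * g (k - l) * echar k x) = (\<Sum>k\<in>(+) l ` ?B. f l * g (k - l) * echar k x)"
    proof (rule sum.mono_neutral_right[OF K])
      show "(+) l ` ?B \<subseteq> ?K" using l by force
      show "\<forall>k\<in>?K - (+) l ` ?B. f l * g (k - l) * echar k x = 0"
        by (auto intro!: image_eqI[of _ "(+) l" "_ - l"])
    qed
    also have "\<dots> = (\<Sum>k\<in>?B. f l * g k * echar (l + k) x)"
      by (subst sum.reindex) (auto simp: inj_on_def)
    also have "\<dots> = f l * echar l x * eval_series g x"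
      by (simp add: eval_series_trig[OF g] echar_add sum_distrib_left mult_ac)
    finally show "(\<Sum>k\<in>?K. f l * g (k - l) * echar k x) = f l * echar l x * eval_series g x" .
  qed
  also have "\<dots> = eval_series f x * eval_series g x"
    by (simp add: eval_series_trig[OF f] sum_distrib_right)
  finally show ?thesis .
qed

section \<open>Orthogonality of the characters\<close>

lemma space_torus: "space torus = {0..1} \<times> {0..1}"
  by (simp add: torus_def space_restrict_space)

lemma torus_set [measurable]: "{0..1::real} \<times> {0..1::real} \<in> sets borel"
  by (intro borel_closed closed_Times) auto

lemma measurable_torus: "f \<in> borel_measurable borel \<Longrightarrow> f \<in> borel_measurable torus"
  unfolding torus_def by (intro measurable_restrict_space1) simp

lemma integral_torus:
  fixes f :: "plane \<Rightarrow> 'b::{banach, second_countable_topology}"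
  shows "(\<integral>x. f x \<partial>torus) = (\<integral>x. indicator ({0..1} \<times> {0..1}) x *\<^sub>R f x \<partial>lborel)"
  unfolding torus_def by (subst integral_restrict_space) auto

lemma emeasure_torus: "emeasure torus (space torus) = 1"
proof -
  have "emeasure torus (space torus) = emeasure lborel ({0..1::real} \<times> {0..1::real})"
    unfolding space_torus torus_def by (subst emeasure_restrict_space) auto
  also have "{0..1::real} \<times> {0..1::real} = cbox (0, 0) (1, 1)" by (auto simp: cbox_Pair_eq)
  also have "emeasure lborel \<dots> = 1" by (subst emeasure_lborel_cbox_eq) (auto simp: Basis_prod_def prod.union_disjoint)
  finally show ?thesis .
qed

lemma prob_space_torus: "prob_space torus"
  by (rule prob_spaceI) (rule emeasure_torus)

lemma integrable_torus_bounded: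
  fixes f :: "plane \<Rightarrow> complex"
  assumes "f \<in> borel_measurable torus" "\<And>x. x \<in> space torus \<Longrightarrow> cmod (f x) \<le> B"
  shows "integrable torus f"
proof -
  interpret prob_space torus by (rule prob_space_torus)
  show ?thesis by (rule integrable_const_bound[of _ B]) (use assms in auto)
qed

lemma integrable_echar_torus: "integrable torus (echar k)"
  by (rule integrable_torus_bounded[of _ 1]) (auto intro: measurable_torus)

lemma integral_cis_unit:
  "(\<integral>x. indicator {0..1} x *\<^sub>R cis (2 * pi * (real_of_int n * x)) \<partial>lborel) = (if n = 0 then 1 else 0)"
proof (cases "n = 0")
  case False
  define F where "F x = cis (2 * pi * (real_of_int n * x)) / (2 * pi * \<i> * of_int n)" for x
  have "(\<integral>x. indicator {0..1} x *\<^sub>R cis (2 * pi * (real_of_int n * x)) \<partial>lborel) = F 1 - F 0"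
  proof (rule integral_FTC_Icc)
    fix x :: real
    show "(F has_vector_derivative cis (2 * pi * (real_of_int n * x))) (at x within {0..1})"
      unfolding F_def cis_conv_exp using False
      by (auto intro!: derivative_eq_intros has_vector_derivative_real_field simp: field_simps)
  qed (auto intro!: continuous_intros simp: cis_conv_exp)
  also have "F 1 = F 0" using cis_multiple_2pi[of "of_int n"] by (simp add: F_def)
  finally show ?thesis using False by simp
qed simp

lemma integral_echar_torus: "(\<integral>x. echar k x \<partial>torus) = (if k = 0 then 1 else 0)"
proof -
  let ?e = "\<lambda>n x. indicator {0..1} x *\<^sub>R cis (2 * pi * (real_of_int n * x)) :: complex"
  have int: "integrable (lborel \<Otimes>\<^sub>M lborel) (\<lambda>x::plane. indicator ({0..1} \<times> {0..1}) x *\<^sub>R echar k x)"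
    using integrable_echar_torus[of k] unfolding torus_def lborel_prod
    by (subst (asm) integrable_restrict_space) auto
  have "(\<integral>x. echar k x \<partial>torus) = (\<integral>x. indicator ({0..1} \<times> {0..1}) x *\<^sub>R echar k x \<partial>(lborel \<Otimes>\<^sub>M lborel))"
    by (simp add: integral_torus lborel_prod)
  also have "\<dots> = (\<integral>x. \<integral>y. indicator ({0..1} \<times> {0..1}) (x, y) *\<^sub>R echar k (x, y) \<partial>lborel \<partial>lborel)"
    by (rule lborel_pair.integral_fst'[OF int, symmetric])
  also have "\<dots> = (\<integral>x. \<integral>y. ?e (fst k) x * ?e (snd k) y \<partial>lborel \<partial>lborel)"
  proof -
    have "indicator ({0..1} \<times> {0..1}) (x, y) *\<^sub>R echar k (x, y) = ?e (fst k) x * ?e (snd k) y" for x y :: real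
      by (auto simp: indicator_def echar_eq_cis freq_def cis_mult algebra_simps)
    then show ?thesis by (simp only:)
  qed
  also have "\<dots> = (\<integral>x. ?e (fst k) x \<partial>lborel) * (\<integral>y. ?e (snd k) y \<partial>lborel)"
    by (simp only: integral_mult_right_zero integral_mult_left_zero)
  also have "\<dots> = (if k = 0 then 1 else 0)"
    unfolding integral_cis_unit by (auto simp: prod_eq_iff)
  finally show ?thesis .
qed

section \<open>Parseval for trigonometric polynomials\<close>

lemma fourier_coeff_trig:
  assumes "trig_poly f"
  shows "fourier_coeff (eval_series f) = f"
proof
  fix k
  let ?A = "{k. f k \<noteq> 0}"
  have fin: "finite ?A" using assms by (simp add: trig_poly_def)
  have "fourier_coeff (eval_series f) k = (\<integral>x. (\<Sum>l\<in>?A. f l * echar (l - k) x) \<partial>torus)"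
    unfolding fourier_coeff_def
    by (intro Bochner_Integration.integral_cong refl)
       (simp add: eval_series_trig[OF assms] sum_distrib_right echar_diff mult.assoc)
  also have "\<dots> = (\<Sum>l\<in>?A. f l * (if l = k then 1 else 0))"
    by (subst Bochner_Integration.integral_sum) (auto simp: integral_echar_torus intro: integrable_echar_torus)
  also have "\<dots> = f k" using fin by (simp add: if_distrib[of "times (f _)"] cong: if_cong)
  finally show "fourier_coeff (eval_series f) k = f k" .
qed

lemma continuous_on_eval_trig: "trig_poly f \<Longrightarrow> continuous_on S (eval_series f)"
  by (subst ext[OF eval_series_trig]) (auto intro!: continuous_intros)

lemma measurable_eval_trig: "trig_poly f \<Longrightarrow> eval_series f \<in> borel_measurable borel"
  by (intro borel_measurable_continuous_onI continuous_on_eval_trig)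

lemma parseval_trig:
  assumes "trig_poly f"
  shows "(\<integral>x. (cmod (eval_series f x))\<^sup>2 \<partial>torus) = (\<Sum>k\<in>{k. f k \<noteq> 0}. (cmod (f k))\<^sup>2)"
proof -
  let ?A = "{k. f k \<noteq> 0}"
  have m: "eval_series f \<in> borel_measurable torus"
    by (intro measurable_torus measurable_eval_trig assms)
  have int: "integrable torus (\<lambda>x. eval_series f x * cnj (echar k x))" for k
    using m by (intro integrable_torus_bounded[of _ "Linf_norm f"] borel_measurable_times)
       (auto simp: norm_mult cmod_eval_le_Linf assms cnj_echar intro: measurable_torus)
  have "complex_of_real (\<integral>x. (cmod (eval_series f x))\<^sup>2 \<partial>torus) = (\<integral>x. eval_series f x * cnj (eval_series f x) \<partial>torus)"
    by (subst integral_complex_of_real[symmetric]) (simp only: complex_norm_square)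
  also have "\<dots> = (\<integral>x. (\<Sum>k\<in>?A. cnj (f k) * (eval_series f x * cnj (echar k x))) \<partial>torus)"
    by (intro Bochner_Integration.integral_cong refl)
       (subst (2) eval_series_trig[OF assms], simp add: sum_distrib_left mult_ac)
  also have "\<dots> = (\<Sum>k\<in>?A. cnj (f k) * fourier_coeff (eval_series f) k)"
    using int by (subst Bochner_Integration.integral_sum) (auto simp: fourier_coeff_def)
  also have "\<dots> = complex_of_real (\<Sum>k\<in>?A. (cmod (f k))\<^sup>2)"
    unfolding of_real_sum fourier_coeff_trig[OF assms]
    by (intro sum.cong refl) (simp only: complex_norm_square mult.commute)
  finally show ?thesis by (simp only: of_real_eq_iff)
qed

lemma trig_sobolev:
  assumes "trig_poly f"
  shows "f \<in> sobolev s" "(sobolev_norm 0 f)\<^sup>2 = (\<integral>x. (cmod (eval_series f x))\<^sup>2 \<partial>torus)"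
proof -
  let ?A = "{k. f k \<noteq> 0}"
  have fin: "finite ?A" using assms by (simp add: trig_poly_def)
  have "(\<lambda>k. bessel k powr s * (cmod (f k))\<^sup>2) summable_on ?A" using fin by simp
  then show "f \<in> sobolev s"
    unfolding sobolev_def mem_Collect_eq by (rule summable_on_cong_neutral[THEN iffD1, rotated -1]) auto
  have "(\<Sum>\<^sub>\<infinity>k. bessel k powr 0 * (cmod (f k))\<^sup>2) = (\<Sum>\<^sub>\<infinity>k\<in>?A. (cmod (f k))\<^sup>2)"
    by (rule infsum_cong_neutral) auto
  then show "(sobolev_norm 0 f)\<^sup>2 = (\<integral>x. (cmod (eval_series f x))\<^sup>2 \<partial>torus)"
    using fin by (simp add: sobolev_norm_def parseval_trig[OF assms] sum_nonneg)
qed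

text \<open>Parseval turns the convolution of coefficients into a pointwise product on the torus,
  where the bounded factor comes out of the L2 norm. The product estimates for blocks all reduce to
  this.\<close>

lemma sobolev_norm_pw_mult_le:
  assumes f: "trig_poly f" and g: "trig_poly g"
  shows "sobolev_norm 0 (pw_mult f g) \<le> Linf_norm f * sobolev_norm 0 g"
proof -
  have sq: "integrable torus (\<lambda>x. (cmod (eval_series h x))\<^sup>2)" if "trig_poly h" for h
  proof -
    interpret prob_space torus by (rule prob_space_torus)
    have "eval_series h \<in> borel_measurable torus"
      by (intro measurable_torus measurable_eval_trig that)
    then show ?thesis
      by (intro integrable_const_bound[of _ "(Linf_norm h)\<^sup>2"])
         (auto intro!: power_mono cmod_eval_le_Linf that)
  qed
  have "(sobolev_norm 0 (pw_mult f g))\<^sup>2 = (\<integral>x. (cmod (eval_series (pw_mult f g) x))\<^sup>2 \<partial>torus)"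
    by (intro trig_sobolev trig_poly_pw_mult f g)
  also have "\<dots> \<le> (\<integral>x. (Linf_norm f)\<^sup>2 * (cmod (eval_series g x))\<^sup>2 \<partial>torus)"
    by (rule integral_mono[OF sq[OF trig_poly_pw_mult[OF f g]] integrable_mult_right[OF sq[OF g]]])
       (auto simp: eval_pw_mult f g norm_mult power_mult_distrib intro!: mult_right_mono power_mono cmod_eval_le_Linf)
  also have "\<dots> = (Linf_norm f * sobolev_norm 0 g)\<^sup>2"
    by (simp add: trig_sobolev(2)[OF g] power_mult_distrib)
  finally show ?thesis
    by (rule power2_le_imp_le) (simp add: Linf_nonneg f)
qed

lemma cmod_coeff_le_Linf:
  assumes "trig_poly f"
  shows "cmod (f k) \<le> Linf_norm f"
proof -
  interpret prob_space torus by (rule prob_space_torus)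
  have "f k = (\<integral>x. eval_series f x * cnj (echar k x) \<partial>torus)"
    by (subst (1) fourier_coeff_trig[OF assms, symmetric]) (simp only: fourier_coeff_def)
  also have "cmod \<dots> \<le> (\<integral>x. cmod (eval_series f x * cnj (echar k x)) \<partial>torus)"
    by (rule integral_norm_bound)
  also have "\<dots> \<le> Linf_norm f"
  proof (rule integral_le_const)
    have "eval_series f \<in> borel_measurable torus"
      by (intro measurable_torus measurable_eval_trig assms)
    then have "integrable torus (\<lambda>x. eval_series f x * cnj (echar k x))"
      by (intro integrable_torus_bounded[of _ "Linf_norm f"] borel_measurable_times)
         (auto simp: norm_mult cmod_eval_le_Linf assms cnj_echar intro: measurable_torus)
    then show "integrable torus (\<lambda>x. cmod (eval_series f x * cnj (echar k x)))"
      by (rule integrable_norm)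
  qed (simp add: norm_mult cmod_eval_le_Linf assms)
  finally show ?thesis .
qed

lemma has_derivative_echar:
  "(echar k has_derivative (\<lambda>v. 2 * of_real pi * \<i> * of_real (freq k \<bullet> v) * echar k x)) (at x)"
proof -
  have "((\<lambda>x. freq k \<bullet> x) has_derivative (\<lambda>v. freq k \<bullet> v)) (at x)"
    by (intro derivative_intros)
  then have "((\<lambda>x. complex_of_real (freq k \<bullet> x)) has_derivative (\<lambda>v. of_real (freq k \<bullet> v))) (at x)"
    by (rule has_derivative_of_real)
  then have *: "((\<lambda>x. 2 * of_real pi * \<i> * complex_of_real (freq k \<bullet> x)) has_derivative
      (\<lambda>v. 2 * of_real pi * \<i> * of_real (freq k \<bullet> v))) (at x)"
    by (rule has_derivative_mult_right)
  have "(exp has_derivative times (exp (2 * of_real pi * \<i> * complex_of_real (freq k \<bullet> x))))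
      (at (2 * of_real pi * \<i> * complex_of_real (freq k \<bullet> x)))"
    using DERIV_exp unfolding has_field_derivative_def .
  from has_derivative_compose[OF * this] show ?thesis
    unfolding echar_def by (simp add: mult.commute)
qed

text \<open>The formula for the commutator operator is available on \<open>smooth_pdist\<close>
  only, so trigonometric polynomials have to be exhibited as smooth periodic functions.\<close>

lemma smooth_pdist_trig:
  assumes "trig_poly f"
  shows "f \<in> smooth_pdist"
proof -
  let ?A = "{k. f k \<noteq> 0}"
  \<comment> \<open>General coefficients \<open>c\<close> make the induction work: a directional
    derivative multiplies each coefficient by a number depending on \<open>k\<close> and
    \<open>v\<close> and keeps the frequencies.\<close>
  have td: "times_differentiable_on n (\<lambda>x. \<Sum>k\<in>?A. c k * echar k x) UNIV" for n c
  proof (induction n arbitrary: c)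
    case 0
    then show ?case by (auto intro!: continuous_intros)
  next
    case (Suc n)
    have D: "((\<lambda>x. \<Sum>k\<in>?A. c k * echar k x) has_derivative
        (\<lambda>v. \<Sum>k\<in>?A. (2 * pi * \<i> * of_real (freq k \<bullet> v) * c k) * echar k x)) (at x)" for x
    proof (rule has_derivative_sum)
      fix k
      from has_derivative_mult_right[OF has_derivative_echar, of "c k"]
      show "((\<lambda>x. c k * echar k x) has_derivative
          (\<lambda>v. (2 * pi * \<i> * of_real (freq k \<bullet> v) * c k) * echar k x)) (at x)"
        by (simp add: mult_ac)
    qed
    have "(\<lambda>x. frechet_derivative (\<lambda>x. \<Sum>k\<in>?A. c k * echar k x) (at x) v) =
        (\<lambda>x. \<Sum>k\<in>?A. (2 * pi * \<i> * of_real (freq k \<bullet> v) * c k) * echar k x)" for v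
      by (rule ext) (simp only: frechet_derivative_at[OF D, symmetric])
    then show ?case using Suc D unfolding times_differentiable_on.simps differentiable_def
      by (simp only:) blast
  qed
  have "smooth_on (eval_series f) UNIV"
    unfolding smooth_on_def ext[OF eval_series_trig[OF assms]] using td by blast
  moreover have "echar k (x + freq l) = echar k x" for k l x
  proof -
    have "freq k \<bullet> freq l = of_int (fst k * fst l + snd k * snd l)" by (simp add: freq_def)
    then show ?thesis using cis_multiple_2pi[of "freq k \<bullet> freq l"]
      by (simp add: echar_add_right) (simp add: echar_eq_cis)
  qed
  then have "eval_series f (x + freq l) = eval_series f x" for x l
    by (simp add: eval_series_trig[OF assms])
  ultimately show ?thesis
    unfolding smooth_pdist_def using fourier_coeff_trig[OF assms] by (intro CollectI exI[of _ "eval_series f"]) auto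
qed

section \<open>Uniqueness of Fourier coefficients\<close>

text \<open>The torus realised as a product of two circles in \<complex> \<times> \<complex>. A
  function composed with it is periodic by construction, and Stone-Weierstrass applies on the
  compact product of circles.\<close>

definition torus_emb :: "plane \<Rightarrow> complex \<times> complex" where
  "torus_emb x = (cis (2 * pi * fst x), cis (2 * pi * snd x))"

lemma continuous_on_torus_emb: "continuous_on S torus_emb"
  unfolding torus_emb_def cis_conv_exp by (intro continuous_intros)

lemma trig_poly_single: "trig_poly (\<lambda>k. if k = l then c else 0)"
  unfolding trig_poly_def by (rule finite_subset[of _ "{l}"]) auto

lemma eval_series_single: "eval_series (\<lambda>k. if k = l then c else 0) x = c * echar l x"
  by (subst eval_series_finite[of "{l}"]) auto

lemma real_polynomial_torus_emb:
  assumes "real_polynomial_function p"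
  shows "\<exists>f. trig_poly f \<and> (\<forall>x. complex_of_real (p (torus_emb x)) = eval_series f x)"
  using assms
proof (induction p rule: real_polynomial_function.induct)
  case (linear p)
  then interpret bounded_linear p .
  let ?s = "\<lambda>(l :: int \<times> int) c k. if k = l then c else (0::complex)"
  \<comment> \<open>Euler's formulas: with \<open>c = p (1,0)\<close> and
    \<open>s = p (\<i>,0)\<close>, the function c cos + s sin has the coefficients (c - i s)/2 and
    (c + i s)/2 at the frequencies 1 and -1. The second circle is treated likewise.\<close>
  define f where "f = ?s (1,0) ((p (1,0) - \<i> * p (\<i>,0)) / 2) + ?s (-1,0) ((p (1,0) + \<i> * p (\<i>,0)) / 2)
     + ?s (0,1) ((p (0,1) - \<i> * p (0,\<i>)) / 2) + ?s (0,-1) ((p (0,1) + \<i> * p (0,\<i>)) / 2)"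
  have f: "trig_poly f" unfolding f_def by (intro trig_poly_add trig_poly_single)
  have "complex_of_real (p (torus_emb x)) = eval_series f x" for x
  proof -
    have "torus_emb x = cos (2 * pi * fst x) *\<^sub>R (1,0) + sin (2 * pi * fst x) *\<^sub>R (\<i>,0)
        + cos (2 * pi * snd x) *\<^sub>R (0,1) + sin (2 * pi * snd x) *\<^sub>R (0,\<i>)"
      by (simp add: torus_emb_def complex_eq_iff)
    then have "p (torus_emb x) = cos (2 * pi * fst x) * p (1,0) + sin (2 * pi * fst x) * p (\<i>,0)
        + cos (2 * pi * snd x) * p (0,1) + sin (2 * pi * snd x) * p (0,\<i>)"
      by (simp only: add scaleR real_scaleR_def)
    then show ?thesis
      unfolding f_def
      by (cases x, simp add: eval_series_add trig_poly_add trig_poly_single eval_series_single)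
         (simp add: echar_eq_cis freq_def inner_prod_def complex_eq_iff field_simps)
  qed
  with f show ?case by blast
next
  case (const c)
  show ?case
    by (intro exI[of _ "\<lambda>k. if k = 0 then complex_of_real c else 0"])
       (simp only: trig_poly_single eval_series_single echar_0, simp)
next
  case (add p q)
  then obtain f g where "trig_poly f" "trig_poly g" "\<forall>x. complex_of_real (p (torus_emb x)) = eval_series f x"
    "\<forall>x. complex_of_real (q (torus_emb x)) = eval_series g x" by blast
  then show ?case by (intro exI[of _ "f + g"]) (simp only: trig_poly_add eval_series_add of_real_add, simp)
next
  case (mult p q)
  then obtain f g where "trig_poly f" "trig_poly g" "\<forall>x. complex_of_real (p (torus_emb x)) = eval_series f x"
    "\<forall>x. complex_of_real (q (torus_emb x)) = eval_series g x" by blast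
  then show ?case by (intro exI[of _ "pw_mult f g"]) (simp only: trig_poly_pw_mult eval_pw_mult of_real_mult, simp)
qed

lemma integrable_mult_bounded_torus:
  fixes \<phi> g :: "plane \<Rightarrow> complex"
  assumes "integrable torus \<phi>" "g \<in> borel_measurable torus" "\<And>x. cmod (g x) \<le> B"
  shows "integrable torus (\<lambda>x. \<phi> x * g x)"
proof (rule Bochner_Integration.integrable_bound)
  show "integrable torus (\<lambda>x. B * \<phi> x)" using assms(1) by simp
  have "0 \<le> B" using assms(3)[of 0] norm_ge_zero order_trans by blast
  then show "AE x in torus. cmod (\<phi> x * g x) \<le> cmod (B * \<phi> x)"
    using assms(3)
    by (intro AE_I2) (simp add: norm_mult mult.commute[of B] mult_left_mono del: split_paired_All)
qed (use assms in auto)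

lemma integral_trig_zero:
  assumes int: "integrable torus \<phi>" and 0: "\<And>k. fourier_coeff \<phi> k = 0" and f: "trig_poly f"
  shows "(\<integral>x. \<phi> x * eval_series f x \<partial>torus) = 0"
proof -
  have i: "integrable torus (\<lambda>x. \<phi> x * echar k x)" for k
    by (rule integrable_mult_bounded_torus[OF int, of _ 1]) (auto intro: measurable_torus)
  have e: "(\<integral>x. \<phi> x * echar k x \<partial>torus) = 0" for k
    using 0[of "- k"] by (simp add: fourier_coeff_def cnj_echar)
  have "(\<integral>x. \<phi> x * eval_series f x \<partial>torus) = (\<integral>x. (\<Sum>k\<in>{k. f k \<noteq> 0}. f k * (\<phi> x * echar k x)) \<partial>torus)"
    by (intro Bochner_Integration.integral_cong refl) (simp add: eval_series_trig[OF f] sum_distrib_left mult_ac)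
  also have "\<dots> = 0" using i e by (subst Bochner_Integration.integral_sum) auto
  finally show ?thesis .
qed

lemma integral_continuous_zero:
  fixes g :: "complex \<times> complex \<Rightarrow> real"
  assumes int: "integrable torus \<phi>" and 0: "\<And>k. fourier_coeff \<phi> k = 0"
    and g: "continuous_on UNIV g" "\<And>z. \<bar>g z\<bar> \<le> 1"
  shows "(\<integral>x. \<phi> x * of_real (g (torus_emb x)) \<partial>torus) = 0"
proof (rule ccontr)
  let ?I = "\<integral>x. \<phi> x * of_real (g (torus_emb x)) \<partial>torus"
  let ?n = "\<integral>x. cmod (\<phi> x) \<partial>torus"
  assume ne: "?I \<noteq> 0"
  \<comment> \<open>This tolerance makes the approximation error \<open>e * ?n\<close> strictly
    smaller than \<open>cmod ?I\<close>, while the trigonometric polynomial contributes 0.\<close>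
  define e where "e = cmod ?I / (?n + 1)"
  have n: "?n \<ge> 0" by simp
  then have e: "e > 0" using ne unfolding e_def
    by (intro divide_pos_pos) (simp, use n in linarith)
  let ?S = "sphere (0::complex) 1 \<times> sphere (0::complex) 1"
  obtain p where p: "real_polynomial_function p" "\<And>x. x \<in> ?S \<Longrightarrow> \<bar>g x - p x\<bar> < e"
  proof (rule Stone_Weierstrass_real_polynomial_function[of ?S g e])
    show "compact ?S" by (intro compact_Times compact_sphere)
    show "continuous_on ?S g" using g(1) continuous_on_subset by blast
  qed (use e in auto)
  obtain f where f: "trig_poly f" "\<And>x. complex_of_real (p (torus_emb x)) = eval_series f x"
    using real_polynomial_torus_emb[OF p(1)] by blast
  have meas: "(\<lambda>x. complex_of_real (g (torus_emb x))) \<in> borel_measurable torus"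
    by (intro measurable_torus borel_measurable_continuous_onI continuous_intros
          continuous_on_compose2[OF g(1) continuous_on_torus_emb]) auto
  have i1: "integrable torus (\<lambda>x. \<phi> x * of_real (g (torus_emb x)))"
    by (rule integrable_mult_bounded_torus[OF int meas, of 1]) (use g(2) in simp)
  have i2: "integrable torus (\<lambda>x. \<phi> x * eval_series f x)"
    by (rule integrable_mult_bounded_torus[OF int _ cmod_eval_le_Linf[OF f(1)]])
       (intro measurable_torus measurable_eval_trig f)
  have "?I = (\<integral>x. \<phi> x * of_real (g (torus_emb x)) - \<phi> x * eval_series f x \<partial>torus)"
    using i1 i2 integral_trig_zero[OF int 0 f(1)] by simp
  also have "cmod \<dots> \<le> (\<integral>x. e * cmod (\<phi> x) \<partial>torus)"
  proof (rule order_trans[OF integral_norm_bound integral_mono])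
    fix x
    have "torus_emb x \<in> ?S" by (simp add: torus_emb_def)
    then have le: "\<bar>g (torus_emb x) - p (torus_emb x)\<bar> \<le> e" using p(2)[of "torus_emb x"] by linarith
    have "\<phi> x * of_real (g (torus_emb x)) - \<phi> x * eval_series f x
        = \<phi> x * of_real (g (torus_emb x) - p (torus_emb x))"
      by (simp only: f(2)[symmetric] of_real_diff right_diff_distrib)
    then have "cmod (\<phi> x * of_real (g (torus_emb x)) - \<phi> x * eval_series f x)
        = \<bar>g (torus_emb x) - p (torus_emb x)\<bar> * cmod (\<phi> x)"
      by (simp only: norm_mult norm_of_real mult.commute)
    also have "\<dots> \<le> e * cmod (\<phi> x)" by (intro mult_right_mono le) simp
    finally show "cmod (\<phi> x * of_real (g (torus_emb x)) - \<phi> x * eval_series f x) \<le> e * cmod (\<phi> x)" .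
  qed (use i1 i2 int in auto)
  also have "\<dots> = e * ?n" by simp
  finally have "cmod ?I * (?n + 1) \<le> cmod ?I * ?n" using n by (simp add: e_def field_simps)
  then show False using ne by (simp add: distrib_left)
qed

text \<open>Opposite sides of the closed square have the same image, so injectivity is claimed only
  against an interior point: there the coordinate differences are integers strictly between -1 and
  1.\<close>

lemma torus_emb_inj:
  assumes "torus_emb x = torus_emb a" "x \<in> {0..1} \<times> {0..1}" "a \<in> {0<..<1} \<times> {0<..<1}"
  shows "x = a"
proof -
  have *: "s = t" if "cis (2 * pi * s) = cis (2 * pi * t)" "0 \<le> s" "s \<le> 1" "0 < t" "t < 1" for s t :: real
  proof -
    have "cis (2 * pi * s) / cis (2 * pi * t) = 1" using that by simp
    then have "cis (2 * pi * (s - t)) = 1" by (simp add: cis_divide right_diff_distrib)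
    then have "cos (2 * pi * (s - t)) = 1" by (simp add: complex_eq_iff)
    then obtain n :: int where "2 * pi * (s - t) = of_int n * 2 * pi"
      using cos_one_2pi_int by auto
    then have "(2 * pi) * (s - t) = (2 * pi) * of_int n" by (simp add: mult_ac)
    then have n: "s - t = of_int n" by (subst (asm) mult_left_cancel) auto
    then have "-1 < real_of_int n" "real_of_int n < 1" using that by linarith+
    then have "n = 0" by linarith
    then show ?thesis using n by simp
  qed
  show ?thesis using assms *[of "fst x" "fst a"] *[of "snd x" "snd a"]
    by (auto simp: torus_emb_def prod_eq_iff mem_Times_iff)
qed

text \<open>The indicator of \<open>A\<close> is the pointwise limit of continuous functions of the
  distance to the image of \<open>A\<close>. As \<open>A\<close> avoids the boundary, the image of a
  point of the closed square outside \<open>A\<close> has positive distance.\<close>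

lemma integral_indicator_compact_zero:
  assumes int: "integrable torus \<phi>" and 0: "\<And>k. fourier_coeff \<phi> k = 0"
    and A: "compact A" "A \<subseteq> {0<..<1} \<times> {0<..<1}"
  shows "(\<integral>x. \<phi> x * indicator A x \<partial>torus) = 0"
proof (cases "A = {}")
  case False
  let ?C = "torus_emb ` A"
  have C: "closed ?C" "?C \<noteq> {}"
    using False compact_continuous_image[OF continuous_on_torus_emb A(1)] by (auto intro: compact_imp_closed)
  define g where "g n z = max 0 (1 - real n * infdist z ?C)" for n z
  have g1: "\<bar>g n z\<bar> \<le> 1" for n z by (auto simp: g_def infdist_nonneg)
  have gc: "continuous_on UNIV (g n)" for n
    unfolding g_def by (intro continuous_intros)
  have meas: "(\<lambda>x. complex_of_real (g n (torus_emb x))) \<in> borel_measurable torus" for n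
    by (intro measurable_torus borel_measurable_continuous_onI continuous_intros
          continuous_on_compose2[OF gc continuous_on_torus_emb]) auto
  have [measurable]: "A \<in> sets borel" using A(1) by (intro borel_closed compact_imp_closed)
  have phim: "\<phi> \<in> borel_measurable torus" using int by simp
  have indm: "(\<lambda>x. indicator A x :: complex) \<in> borel_measurable torus"
    by (intro measurable_torus) simp
  have "(\<lambda>n. \<integral>x. \<phi> x * of_real (g n (torus_emb x)) \<partial>torus) \<longlonglongrightarrow> (\<integral>x. \<phi> x * indicator A x \<partial>torus)"
  proof (rule integral_dominated_convergence[where w = "\<lambda>x. cmod (\<phi> x)"])
    show "AE x in torus. (\<lambda>n. \<phi> x * of_real (g n (torus_emb x))) \<longlonglongrightarrow> \<phi> x * indicator A x"
    proof (rule AE_I2)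
      fix x assume x: "x \<in> space torus"
      have "(\<lambda>n. complex_of_real (g n (torus_emb x))) \<longlonglongrightarrow> indicator A x"
      proof (cases "x \<in> A")
        case True
        then show ?thesis by (simp add: g_def infdist_zero)
      next
        case False
        have "torus_emb x \<notin> ?C"
          using torus_emb_inj[of x] x False A(2) by (auto simp: space_torus)
        then have pos: "infdist (torus_emb x) ?C > 0"
          using C by (metis in_closed_iff_infdist_zero infdist_nonneg less_eq_real_def)
        obtain N :: nat where N: "1 < real N * infdist (torus_emb x) ?C"
          using reals_Archimedean3[OF pos] by blast
        have "\<forall>\<^sub>F n in sequentially. complex_of_real (g n (torus_emb x)) = 0"
          using eventually_ge_at_top[of N]
        proof eventually_elim
          case (elim n)
          then have "1 < real n * infdist (torus_emb x) ?C"
            using N pos by (meson less_le_trans mult_right_mono of_nat_le_iff less_imp_le)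
          then show ?case by (simp add: g_def)
        qed
        then show ?thesis using False by (simp add: tendsto_eventually)
      qed
      then show "(\<lambda>n. \<phi> x * of_real (g n (torus_emb x))) \<longlonglongrightarrow> \<phi> x * indicator A x"
        by (intro tendsto_intros)
    qed
    show "AE x in torus. cmod (\<phi> x * of_real (g n (torus_emb x))) \<le> cmod (\<phi> x)" for n
      using g1[of n] by (auto simp: norm_mult mult_left_le)
  qed (use phim indm meas int in auto)
  moreover have "(\<integral>x. \<phi> x * of_real (g n (torus_emb x)) \<partial>torus) = 0" for n
    by (rule integral_continuous_zero[OF int 0 gc g1])
  ultimately show ?thesis by (simp add: LIMSEQ_const_iff)
qed simp

lemma AE_torus_interior: "AE x in torus. x \<in> {0<..<1} \<times> {0<..<1}"
proof -
  have "AE x in lborel. x \<notin> {0..1::real} \<times> {0..1::real} - {0<..<1} \<times> {0<..<1}"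
  proof (rule AE_not_in)
    have "{0..1::real} \<times> {0..1::real} - {0<..<1} \<times> {0<..<1} = cbox (0,0) (1,1) - box (0,0) (1,1)"
      proof -
      have "box (0::real,0::real) (1,1) = {0<..<1} \<times> {0<..<1}"
        by (auto simp: Basis_prod_def ball_Un box_def)
      then show ?thesis by (simp add: cbox_Pair_eq)
    qed
    moreover have "emeasure lborel (cbox (0,0) (1,1) - box (0::real,0::real) (1,1)) = 0"
    proof (subst emeasure_Diff)
      have "emeasure lborel (cbox (0,0) (1::real,1::real)) = 1" "emeasure lborel (box (0,0) (1::real,1::real)) = 1"
        by (subst emeasure_lborel_cbox_eq emeasure_lborel_box_eq, auto simp: Basis_prod_def prod.union_disjoint)+
      then show "emeasure lborel (cbox (0,0) (1::real,1::real)) - emeasure lborel (box (0,0) (1::real,1::real)) = 0"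
        "emeasure lborel (box (0,0) (1::real,1::real)) \<noteq> \<infinity>" by auto
    qed (simp_all only: box_subset_cbox sets_lborel borel_open open_box borel_closed closed_cbox)
    ultimately show "{0..1::real} \<times> {0..1::real} - {0<..<1} \<times> {0<..<1} \<in> null_sets lborel"
      by (simp add: null_sets_def)
  qed
  then show ?thesis
    unfolding torus_def
    by (subst AE_restrict_space_iff) (simp, erule AE_mp, intro AE_I2, blast)
qed

text \<open>Compact subsets of the open square exhaust a closed set up to the null boundary; closed
  sets form an intersection-stable generator, so the Dynkin argument reaches all Borel sets.\<close>

lemma integral_indicator_borel_zero:
  assumes int: "integrable torus \<phi>" and 0: "\<And>k. fourier_coeff \<phi> k = 0"
    and B: "B \<in> sets borel"
  shows "(\<integral>x. \<phi> x * indicator B x \<partial>torus) = 0"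
proof -
  have phim: "\<phi> \<in> borel_measurable torus" using int by simp
  have indm: "(\<lambda>x. indicator B x :: complex) \<in> borel_measurable torus" if "B \<in> sets borel" for B
    by (intro measurable_torus) (use that in simp)
  have ii: "integrable torus (\<lambda>x. \<phi> x * indicator B x)" if "B \<in> sets borel" for B
    by (rule integrable_mult_bounded_torus[OF int indm[OF that], of 1]) (simp add: indicator_def)
  have sb: "sets (borel :: plane measure) = sigma_sets UNIV (Collect closed)"
    unfolding borel_eq_closed by simp
  have tot: "(\<integral>x. \<phi> x \<partial>torus) = 0" using 0[of 0] by (simp add: fourier_coeff_def)
  have clos: "(\<integral>x. \<phi> x * indicator C x \<partial>torus) = 0" if "closed C" for C
  proof -
    \<comment> \<open>The margin 1/(n + 1) keeps \<open>D n\<close> away from the boundary and is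
      eventually smaller than the distance of any given interior point from it.\<close>
    define D where "D n = C \<inter> ({1 / Suc n..1 - 1 / Suc n} \<times> {1 / Suc n..1 - 1 / Suc n})" for n
    have D: "compact (D n)" "D n \<subseteq> {0<..<1} \<times> {0<..<1}" for n
    proof -
      show "compact (D n)" unfolding D_def using that
        by (intro closed_Int_compact compact_Times compact_Icc)
      have "0 < 1 / real (Suc n)" by simp
      then have "0 < t \<and> t < 1" if "1 / real (Suc n) \<le> t" "t \<le> 1 - 1 / real (Suc n)" for t
        using that by linarith
      then show "D n \<subseteq> {0<..<1} \<times> {0<..<1}" unfolding D_def
        by (auto simp del: of_nat_Suc)
    qed
    have "(\<lambda>n. \<integral>x. \<phi> x * indicator (D n) x \<partial>torus) \<longlonglongrightarrow> (\<integral>x. \<phi> x * indicator C x \<partial>torus)"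
    proof (rule integral_dominated_convergence[where w = "\<lambda>x. cmod (\<phi> x)"])
      show "AE x in torus. (\<lambda>n. \<phi> x * indicator (D n) x) \<longlonglongrightarrow> \<phi> x * indicator C x"
        using AE_torus_interior
      proof eventually_elim
        case (elim x)
        define r where "r = min (min (fst x) (1 - fst x)) (min (snd x) (1 - snd x))"
        have "r > 0" using elim by (auto simp: r_def)
        then obtain N :: nat where N: "1 / real (Suc N) < r" using nat_approx_posE by blast
        have "\<forall>\<^sub>F n in sequentially. \<phi> x * indicator (D n) x = \<phi> x * indicator C x"
          using eventually_ge_at_top[of N]
        proof eventually_elim
          case (elim n)
          then have "1 / real (Suc n) \<le> 1 / real (Suc N)" by (intro divide_left_mono) auto
          with N have "1 / real (Suc n) < r" by linarith
          then have "x \<in> {1 / Suc n..1 - 1 / Suc n} \<times> {1 / Suc n..1 - 1 / Suc n}"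
            by (auto simp: r_def mem_Times_iff simp del: of_nat_Suc)
          then show ?case by (simp add: D_def indicator_def)
        qed
        then show ?case by (rule tendsto_eventually)
      qed
      have "D n \<in> sets borel" for n using D(1) by (intro borel_closed compact_imp_closed)
      then show "(\<lambda>x. \<phi> x * indicator (D n) x) \<in> borel_measurable torus" for n
        using phim indm by auto
      show "(\<lambda>x. \<phi> x * indicator C x) \<in> borel_measurable torus"
        using phim indm[of C] that by auto
    qed (use int in \<open>auto simp: indicator_def\<close>)
    moreover have "(\<integral>x. \<phi> x * indicator (D n) x \<partial>torus) = 0" for n
      by (rule integral_indicator_compact_zero[OF int 0 D])
    ultimately show ?thesis by (simp add: LIMSEQ_const_iff)
  qed
  have "Int_stable (Collect closed :: plane set set)" by (auto simp: Int_stable_def)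
  then show ?thesis
  proof (rule sigma_sets_induct_disjoint[where \<Omega> = UNIV and G = "Collect closed" and A = B
        and P = "\<lambda>B. (\<integral>x. \<phi> x * indicator B x \<partial>torus) = 0"])
    show "B \<in> sigma_sets UNIV (Collect closed)" using B sb by simp
    show "(\<integral>x. \<phi> x * indicator (UNIV - A) x \<partial>torus) = 0"
      if "A \<in> sigma_sets UNIV (Collect closed)" "(\<integral>x. \<phi> x * indicator A x \<partial>torus) = 0" for A
    proof -
      have "\<phi> x * indicator (UNIV - A) x = \<phi> x - \<phi> x * indicator A x" for x by (simp add: indicator_def)
      then show ?thesis using that int ii[of A] tot sb by simp
    qed
    show "(\<integral>x. \<phi> x * indicator (\<Union>i. A i) x \<partial>torus) = 0"
      if dj: "disjoint_family A" and A: "range A \<subseteq> sigma_sets UNIV (Collect closed)"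
        and z: "\<And>i. (\<integral>x. \<phi> x * indicator (A i) x \<partial>torus) = 0" for A :: "nat \<Rightarrow> plane set"
    proof -
      have Ab: "A i \<in> sets borel" for i using A sb by auto
      have T: "A i \<inter> space torus \<in> sets torus" for i
        unfolding torus_def using Ab[of i] by (auto simp: sets_restrict_space space_restrict_space)
      have set: "(\<integral>x. \<phi> x * indicator S x \<partial>torus) = (LINT x:S \<inter> space torus|torus. \<phi> x)" for S
        unfolding set_lebesgue_integral_def by (rule Bochner_Integration.integral_cong) (auto simp: indicator_def)
      have "(LINT x:(\<Union>i. A i \<inter> space torus)|torus. \<phi> x) = (\<Sum>i. LINT x:A i \<inter> space torus|torus. \<phi> x)"
      proof (intro lebesgue_integral_countable_add)
        show "set_integrable torus (\<Union>i. A i \<inter> space torus) \<phi>"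
          unfolding set_integrable_def using T by (intro integrable_mult_indicator int sets.countable_UN) auto
      qed (use dj T in \<open>auto simp: disjoint_family_on_def\<close>)
      then show ?thesis unfolding set z[unfolded set] by simp
    qed
  qed (use clos in auto)
qed

text \<open>The test set is the one where \<open>h\<close> is positive: a nonnegative integrand with
  zero integral vanishes almost everywhere.\<close>

lemma AE_zero_of_real_integrals:
  fixes h :: "plane \<Rightarrow> real"
  assumes int: "integrable torus h" and z: "\<And>B. B \<in> sets borel \<Longrightarrow> (\<integral>x. h x * indicator B x \<partial>torus) = 0"
  shows "AE x in torus. h x \<le> 0"
proof -
  define B where "B = {x \<in> space torus. h x > 0}"
  have "B \<in> sets torus" unfolding B_def using int by measurable
  then have Bb: "B \<in> sets borel" unfolding torus_def by (subst (asm) sets_restrict_space_iff) auto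
  have hm: "h \<in> borel_measurable torus" using int by simp
  have "(\<lambda>x. indicator B x :: real) \<in> borel_measurable torus"
    by (intro measurable_torus) (use Bb in simp)
  then have i: "integrable torus (\<lambda>x. h x * indicator B x)"
    by (intro Bochner_Integration.integrable_bound[OF int]) (use hm in \<open>auto simp: indicator_def\<close>)
  have "AE x in torus. h x * indicator B x = 0"
    using z[OF Bb] by (subst (asm) integral_nonneg_eq_0_iff_AE[OF i]) (auto simp: B_def indicator_def)
  then show ?thesis
    by (rule AE_mp) (auto simp: B_def indicator_def split: if_splits intro!: AE_I2)
qed

lemma fourier_coeff_unique:
  assumes int: "integrable torus \<phi>" and 0: "\<And>k. fourier_coeff \<phi> k = 0"
  shows "AE x in torus. \<phi> x = 0"
proof -
  note z = integral_indicator_borel_zero[OF int 0]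
  have i: "integrable torus (\<lambda>x. \<phi> x * indicator B x)" if "B \<in> sets borel" for B
    by (rule integrable_mult_bounded_torus[OF int, of _ 1])
       (use that in \<open>auto simp: indicator_def intro!: measurable_torus\<close>)
  have Re: "(\<integral>x. Re (\<phi> x) * indicator B x \<partial>torus) = 0" if "B \<in> sets borel" for B
  proof -
    have "Re (\<phi> x) * indicator B x = Re (\<phi> x * indicator B x)" for x by (simp add: indicator_def)
    then show ?thesis using integral_Re[OF i[OF that]] z[OF that] by (simp only: zero_complex.sel)
  qed
  have Im: "(\<integral>x. Im (\<phi> x) * indicator B x \<partial>torus) = 0" if "B \<in> sets borel" for B
  proof -
    have "Im (\<phi> x) * indicator B x = Im (\<phi> x * indicator B x)" for x by (simp add: indicator_def)
    then show ?thesis using integral_Im[OF i[OF that]] z[OF that] by (simp only: zero_complex.sel)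
  qed
  have "AE x in torus. Re (\<phi> x) \<le> 0" "AE x in torus. - Re (\<phi> x) \<le> 0"
    "AE x in torus. Im (\<phi> x) \<le> 0" "AE x in torus. - Im (\<phi> x) \<le> 0"
    by (intro AE_zero_of_real_integrals; use int Re Im in simp)+
  then show ?thesis
    by eventually_elim (simp add: complex_eq_iff)
qed

section \<open>Riesz--Fischer and Parseval\<close>

lemma L2_fun_integrable:
  assumes "L2_fun \<phi>"
  shows "integrable torus \<phi>"
proof -
  interpret prob_space torus by (rule prob_space_torus)
  have sq: "integrable torus (\<lambda>x. (cmod (\<phi> x))\<^sup>2)" and m: "\<phi> \<in> borel_measurable torus"
    using assms by (auto simp: L2_fun_def)
  have "integrable torus (\<lambda>x. 1 + (cmod (\<phi> x))\<^sup>2)" using sq by simp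
  then show ?thesis
  proof (rule Bochner_Integration.integrable_bound[OF _ m], intro AE_I2)
    fix x
    have "2 * cmod (\<phi> x) \<le> 1 + (cmod (\<phi> x))\<^sup>2"
      using zero_le_power2[of "cmod (\<phi> x) - 1"] by (simp add: power2_diff)
    then show "cmod (\<phi> x) \<le> norm (1 + (cmod (\<phi> x))\<^sup>2)" by (simp add: abs_of_nonneg) (smt (verit) norm_ge_zero)
  qed
qed

lemma L2_fun_trig: "trig_poly f \<Longrightarrow> L2_fun (eval_series f)"
proof -
  assume f: "trig_poly f"
  interpret prob_space torus by (rule prob_space_torus)
  have m: "eval_series f \<in> borel_measurable torus"
    by (intro measurable_torus measurable_eval_trig f)
  then have "integrable torus (\<lambda>x. (cmod (eval_series f x))\<^sup>2)"
    by (intro integrable_const_bound[of _ "(Linf_norm f)\<^sup>2"])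
       (auto intro!: power_mono cmod_eval_le_Linf f)
  with m show ?thesis by (simp add: L2_fun_def)
qed

lemma L2_fun_add: "L2_fun \<phi> \<Longrightarrow> L2_fun \<psi> \<Longrightarrow> L2_fun (\<lambda>x. \<phi> x + \<psi> x)"
  and L2_fun_cmult: "L2_fun \<phi> \<Longrightarrow> L2_fun (\<lambda>x. c * \<phi> x)"
proof -
  show "L2_fun (\<lambda>x. c * \<phi> x)" if "L2_fun \<phi>" for \<phi>
    using that by (auto simp: L2_fun_def norm_mult power_mult_distrib)
  assume a: "L2_fun \<phi>" "L2_fun \<psi>"
  have "integrable torus (\<lambda>x. (cmod (\<phi> x + \<psi> x))\<^sup>2)"
  proof (rule Bochner_Integration.integrable_bound)
    show "integrable torus (\<lambda>x. 2 * (cmod (\<phi> x))\<^sup>2 + 2 * (cmod (\<psi> x))\<^sup>2)"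
      using a by (auto simp: L2_fun_def)
    show "(\<lambda>x. (cmod (\<phi> x + \<psi> x))\<^sup>2) \<in> borel_measurable torus"
      using a by (auto simp: L2_fun_def)
    show "AE x in torus. norm ((cmod (\<phi> x + \<psi> x))\<^sup>2) \<le> norm (2 * (cmod (\<phi> x))\<^sup>2 + 2 * (cmod (\<psi> x))\<^sup>2)"
    proof (intro AE_I2)
      fix x
      have "(cmod (\<phi> x + \<psi> x))\<^sup>2 \<le> (cmod (\<phi> x) + cmod (\<psi> x))\<^sup>2"
        by (intro power_mono norm_triangle_ineq) auto
      also have "\<dots> \<le> 2 * (cmod (\<phi> x))\<^sup>2 + 2 * (cmod (\<psi> x))\<^sup>2"
        using zero_le_power2[of "cmod (\<phi> x) - cmod (\<psi> x)"] by (simp add: power2_diff power2_sum)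
      finally show "norm ((cmod (\<phi> x + \<psi> x))\<^sup>2) \<le> norm (2 * (cmod (\<phi> x))\<^sup>2 + 2 * (cmod (\<psi> x))\<^sup>2)"
        by simp
    qed
  qed
  then show "L2_fun (\<lambda>x. \<phi> x + \<psi> x)" using a by (auto simp: L2_fun_def)
qed

lemma L2_fun_diff: "L2_fun \<phi> \<Longrightarrow> L2_fun \<psi> \<Longrightarrow> L2_fun (\<lambda>x. \<phi> x - \<psi> x)"
  using L2_fun_add[of \<phi> "\<lambda>x. (-1) * \<psi> x"] L2_fun_cmult[of \<psi> "-1"] by simp

definition restrict_freq :: "(int \<times> int) set \<Rightarrow> pdist \<Rightarrow> pdist" where
  "restrict_freq K f = (\<lambda>k. if k \<in> K then f k else 0)"

lemma trig_poly_restrict: "finite K \<Longrightarrow> trig_poly (restrict_freq K f)"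
  unfolding trig_poly_def restrict_freq_def by (rule finite_subset[of _ K]) auto

lemma eval_restrict: "finite K \<Longrightarrow> eval_series (restrict_freq K f) x = (\<Sum>k\<in>K. f k * echar k x)"
  by (subst eval_series_finite[of K]) (auto simp: restrict_freq_def)

lemma fourier_coeff_int: "integrable torus \<phi> \<Longrightarrow> integrable torus (\<lambda>x. \<phi> x * cnj (echar k x))"
  by (rule integrable_mult_bounded_torus[of _ _ 1]) (auto simp: cnj_echar intro: measurable_torus)

text \<open>The truncated Fourier series is the orthogonal projection of \<phi>. Bessel's inequality
  and the norm identity in the Riesz-Fischer argument both come from this.\<close>

lemma pythagoras:
  assumes "L2_fun \<phi>" "finite K"
  shows "(\<integral>x. (cmod (\<phi> x - eval_series (restrict_freq K (fourier_coeff \<phi>)) x))\<^sup>2 \<partial>torus)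
      = (\<integral>x. (cmod (\<phi> x))\<^sup>2 \<partial>torus) - (\<Sum>k\<in>K. (cmod (fourier_coeff \<phi> k))\<^sup>2)"
proof -
  let ?f = "fourier_coeff \<phi>" let ?s = "eval_series (restrict_freq K ?f)"
  have int: "integrable torus \<phi>" by (rule L2_fun_integrable[OF assms(1)])
  have sq: "integrable torus (\<lambda>x. (cmod (\<phi> x))\<^sup>2)" using assms by (auto simp: L2_fun_def)
  have t: "trig_poly (restrict_freq K ?f)" using assms by (intro trig_poly_restrict)
  have ssq: "integrable torus (\<lambda>x. (cmod (?s x))\<^sup>2)"
    using L2_fun_trig[OF t] by (simp add: L2_fun_def)
  have sint: "(\<integral>x. (cmod (?s x))\<^sup>2 \<partial>torus) = (\<Sum>k\<in>K. (cmod (?f k))\<^sup>2)"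
    unfolding parseval_trig[OF t]
    by (rule sum.mono_neutral_cong_left) (use assms in \<open>auto simp: restrict_freq_def\<close>)
  have ce: "\<phi> x * cnj (?s x) = (\<Sum>k\<in>K. cnj (?f k) * (\<phi> x * cnj (echar k x)))" for x
    by (simp add: eval_restrict[OF assms(2)] sum_distrib_left mult_ac)
  have ci: "integrable torus (\<lambda>x. \<phi> x * cnj (?s x))"
    unfolding ce by (intro Bochner_Integration.integrable_sum integrable_mult_right fourier_coeff_int int)
  have "(\<integral>x. \<phi> x * cnj (?s x) \<partial>torus) = (\<Sum>k\<in>K. cnj (?f k) * ?f k)"
    unfolding ce using fourier_coeff_int[OF int]
    by (subst Bochner_Integration.integral_sum) (auto simp: fourier_coeff_def)
  also have "\<dots> = of_real (\<Sum>k\<in>K. (cmod (?f k))\<^sup>2)"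
    unfolding of_real_sum by (intro sum.cong refl) (simp only: complex_norm_square mult.commute)
  finally have cint: "(\<integral>x. \<phi> x * cnj (?s x) \<partial>torus) = of_real (\<Sum>k\<in>K. (cmod (?f k))\<^sup>2)" .
  define r where "r x = Re (\<phi> x * cnj (?s x))" for x
  have ri: "integrable torus r" and rint: "(\<integral>x. r x \<partial>torus) = (\<Sum>k\<in>K. (cmod (?f k))\<^sup>2)"
    using integrable_Re[OF ci] integral_Re[OF ci] cint by (simp_all only: r_def[abs_def] Re_complex_of_real)
  have ex: "(cmod (\<phi> x - ?s x))\<^sup>2 = (cmod (\<phi> x))\<^sup>2 - 2 * r x + (cmod (?s x))\<^sup>2" for x
    unfolding cmod_power2 r_def by (simp add: power2_eq_square algebra_simps)
  have "(\<integral>x. (cmod (\<phi> x - ?s x))\<^sup>2 \<partial>torus) =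
      (\<integral>x. (cmod (\<phi> x))\<^sup>2 \<partial>torus) - 2 * (\<integral>x. r x \<partial>torus) + (\<integral>x. (cmod (?s x))\<^sup>2 \<partial>torus)"
    unfolding ex using sq ssq ri by simp
  also note rint
  finally show ?thesis unfolding sint by simp
qed

lemma sobolev_0_summable: "f \<in> sobolev 0 \<longleftrightarrow> (\<lambda>k. (cmod (f k))\<^sup>2) summable_on UNIV"
  by (simp add: sobolev_def)

lemma sobolev_norm_0_square: "(sobolev_norm 0 f)\<^sup>2 = (\<Sum>\<^sub>\<infinity>k. (cmod (f k))\<^sup>2)"
  by (simp add: sobolev_norm_def infsum_nonneg)

lemma bessel_inequality:
  assumes "L2_fun \<phi>"
  shows "fourier_coeff \<phi> \<in> sobolev 0"
proof -
  have "(\<Sum>k\<in>K. (cmod (fourier_coeff \<phi> k))\<^sup>2) \<le> (\<integral>x. (cmod (\<phi> x))\<^sup>2 \<partial>torus)" if "finite K" for K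
    using pythagoras[OF assms that] Bochner_Integration.integral_nonneg[of torus "\<lambda>x. (cmod (\<phi> x - eval_series (restrict_freq K (fourier_coeff \<phi>)) x))\<^sup>2"]
    by simp
  then show ?thesis unfolding sobolev_0_summable
    by (intro nonneg_bdd_above_summable_on) (auto intro!: bdd_aboveI)
qed

text \<open>Cauchy-Schwarz against the constant 1 on a probability space, obtained by integrating t
  \<le> t^2/(2c) + c/2.\<close>

lemma integral_cmod_le:
  assumes "L2_fun \<phi>" "(\<integral>x. (cmod (\<phi> x))\<^sup>2 \<partial>torus) \<le> c\<^sup>2" "c > 0"
  shows "(\<integral>x. cmod (\<phi> x) \<partial>torus) \<le> c"
proof -
  interpret prob_space torus by (rule prob_space_torus)
  have sq: "integrable torus (\<lambda>x. (cmod (\<phi> x))\<^sup>2)" using assms by (auto simp: L2_fun_def)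
  have le: "cmod (\<phi> x) \<le> (cmod (\<phi> x))\<^sup>2 / (2 * c) + c / 2" for x
  proof -
    have "2 * c * cmod (\<phi> x) \<le> (cmod (\<phi> x))\<^sup>2 + c\<^sup>2"
      using zero_le_power2[of "cmod (\<phi> x) - c"] by (simp add: power2_diff mult_ac)
    then show ?thesis using assms(3) by (simp add: field_simps power2_eq_square)
  qed
  have "(\<integral>x. cmod (\<phi> x) \<partial>torus) \<le> (\<integral>x. (cmod (\<phi> x))\<^sup>2 / (2 * c) + c / 2 \<partial>torus)"
    by (rule integral_mono) (use le sq L2_fun_integrable[OF assms(1)] in auto)
  also have "\<dots> = (\<integral>x. (cmod (\<phi> x))\<^sup>2 \<partial>torus) / (2 * c) + c / 2"
    using sq by (simp add: prob_space)
  also have "\<dots> \<le> c\<^sup>2 / (2 * c) + c / 2" using assms by (intro add_right_mono divide_right_mono) auto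
  also have "\<dots> = c" using assms(3) by (simp add: power2_eq_square field_simps)
  finally show ?thesis .
qed

lemma sobolev_0_tail:
  assumes "f \<in> sobolev 0" "e > 0"
  shows "\<exists>K. finite K \<and> (\<forall>L. finite L \<and> K \<subseteq> L \<longrightarrow> (sobolev_norm 0 (f - restrict_freq L f))\<^sup>2 \<le> e)"
proof -
  have s: "(\<lambda>k. (cmod (f k))\<^sup>2) summable_on UNIV" using assms(1) by (simp add: sobolev_0_summable)
  let ?S = "\<Sum>\<^sub>\<infinity>k. (cmod (f k))\<^sup>2"
  have "((\<lambda>K. \<Sum>k\<in>K. (cmod (f k))\<^sup>2) \<longlongrightarrow> ?S) (finite_subsets_at_top UNIV)"
    using has_sum_infsum[OF s] by (simp add: has_sum_def)
  then have "\<forall>\<^sub>F K in finite_subsets_at_top UNIV. ?S - e < (\<Sum>k\<in>K. (cmod (f k))\<^sup>2)"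
    using assms(2) by (intro order_tendstoD(1)) auto
  then obtain K where K: "finite K" "\<And>L. finite L \<Longrightarrow> K \<subseteq> L \<Longrightarrow> ?S - e < (\<Sum>k\<in>L. (cmod (f k))\<^sup>2)"
    by (auto simp: eventually_finite_subsets_at_top)
  have "(sobolev_norm 0 (f - restrict_freq L f))\<^sup>2 \<le> e" if "finite L" "K \<subseteq> L" for L
  proof -
    have "(sobolev_norm 0 (f - restrict_freq L f))\<^sup>2 = (\<Sum>\<^sub>\<infinity>k\<in>-L. (cmod (f k))\<^sup>2)"
      unfolding sobolev_norm_0_square
      by (rule infsum_cong_neutral) (auto simp: restrict_freq_def)
    also have "?S = (\<Sum>\<^sub>\<infinity>k\<in>-L. (cmod (f k))\<^sup>2) + (\<Sum>k\<in>L. (cmod (f k))\<^sup>2)"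
      using infsum_Un_disjoint[of "\<lambda>k. (cmod (f k))\<^sup>2" "-L" L] s that(1)
      by (simp add: summable_on_subset_banach)
    ultimately show ?thesis using K(2)[OF that] by linarith
  qed
  with K(1) show ?thesis by blast
qed

lemma restrict_freq_sobolev: "f \<in> sobolev s \<Longrightarrow> restrict_freq K f \<in> sobolev s"
  by (erule sobolev_compare1(1)) (simp add: restrict_freq_def sobolev_wt_def)

text \<open>The geometric rate makes the increments summable in L1, hence the sequence converges
  almost everywhere; Fatou's lemma then carries the rate over to the limit.\<close>

lemma L2_fun_limit:
  fixes S :: "nat \<Rightarrow> plane \<Rightarrow> complex"
  assumes S: "\<And>j. L2_fun (S j)"
    and C: "\<And>i j. i \<le> j \<Longrightarrow> (\<integral>x. (cmod (S j x - S i x))\<^sup>2 \<partial>torus) \<le> ((1/2) ^ i)\<^sup>2"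
  obtains \<phi> where "L2_fun \<phi>" "\<And>j. (\<integral>x. (cmod (\<phi> x - S j x))\<^sup>2 \<partial>torus) \<le> ((1/2) ^ j)\<^sup>2"
proof -
  have Sm: "S j \<in> borel_measurable torus" for j using S by (simp add: L2_fun_def)
  define d where "d j x = S (Suc j) x - S j x" for j x
  have dL: "L2_fun (d j)" for j unfolding d_def by (intro L2_fun_diff S)
  have dm[measurable]: "d j \<in> borel_measurable torus" for j using dL by (simp add: L2_fun_def)
  have di: "(\<integral>x. cmod (d j x) \<partial>torus) \<le> (1/2) ^ j" for j
    by (rule integral_cmod_le[OF dL]) (use C[of j "Suc j"] in \<open>auto simp: d_def\<close>)
  have "(\<integral>\<^sup>+x. (\<Sum>j. ennreal (cmod (d j x))) \<partial>torus) = (\<Sum>j. \<integral>\<^sup>+x. ennreal (cmod (d j x)) \<partial>torus)"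
    by (rule nn_integral_suminf) simp
  also have "\<dots> \<le> (\<Sum>j. ennreal ((1/2) ^ j))"
  proof (rule suminf_le)
    fix j
    have "(\<integral>\<^sup>+x. ennreal (cmod (d j x)) \<partial>torus) = ennreal (\<integral>x. cmod (d j x) \<partial>torus)"
      by (rule nn_integral_eq_integral) (use L2_fun_integrable[OF dL] in auto)
    then show "(\<integral>\<^sup>+x. ennreal (cmod (d j x)) \<partial>torus) \<le> ennreal ((1/2) ^ j)"
      using di[of j] by (simp add: ennreal_leI)
  qed auto
  also have "\<dots> = ennreal (\<Sum>j. (1/2) ^ j)"
    by (rule suminf_ennreal2) (auto intro: summable_geometric)
  also have "\<dots> < \<infinity>" by simp
  finally have fin: "(\<integral>\<^sup>+x. (\<Sum>j. ennreal (cmod (d j x))) \<partial>torus) \<noteq> \<infinity>" by simp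
  have "AE x in torus. (\<Sum>j. ennreal (cmod (d j x))) \<noteq> \<infinity>"
    by (rule nn_integral_PInf_AE[OF _ fin]) simp
  then have conv: "AE x in torus. convergent (\<lambda>j. S j x)"
  proof eventually_elim
    case (elim x)
    then have "summable (\<lambda>j. cmod (d j x))"
      by (intro summable_suminf_not_top) auto
    then have "summable (\<lambda>j. d j x)" by (rule summable_norm_cancel)
    then have "convergent (\<lambda>n. \<Sum>j<n. d j x)" by (simp add: summable_iff_convergent)
    then have "convergent (\<lambda>n. S n x - S 0 x)"
      unfolding d_def by (simp add: sum_lessThan_telescope[of "\<lambda>j. S j x"])
    then show "convergent (\<lambda>j. S j x)" by (simp add: convergent_diff_const_right_iff)
  qed
  define \<phi> where "\<phi> x = lim (\<lambda>j. S j x)" for x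
  have phim[measurable]: "\<phi> \<in> borel_measurable torus"
    unfolding \<phi>_def by (rule borel_measurable_lim_metric) (rule Sm)
  have lim: "AE x in torus. (\<lambda>j. S j x) \<longlonglongrightarrow> \<phi> x"
    using conv by eventually_elim (simp add: \<phi>_def convergent_LIMSEQ_iff)
  have fatou: "(\<integral>\<^sup>+x. ennreal ((cmod (\<phi> x - S j x))\<^sup>2) \<partial>torus) \<le> ennreal (((1/2) ^ j)\<^sup>2)" for j
  proof -
    have "(\<integral>\<^sup>+x. ennreal ((cmod (\<phi> x - S j x))\<^sup>2) \<partial>torus)
        = (\<integral>\<^sup>+x. liminf (\<lambda>i. ennreal ((cmod (S i x - S j x))\<^sup>2)) \<partial>torus)"
    proof (rule nn_integral_cong_AE)
      show "AE x in torus. ennreal ((cmod (\<phi> x - S j x))\<^sup>2) = liminf (\<lambda>i. ennreal ((cmod (S i x - S j x))\<^sup>2))"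
        using lim
      proof eventually_elim
        case (elim x)
        have "(\<lambda>i. ennreal ((cmod (S i x - S j x))\<^sup>2)) \<longlonglongrightarrow> ennreal ((cmod (\<phi> x - S j x))\<^sup>2)"
          by (intro tendsto_intros tendsto_ennrealI elim)
        then show ?case by (rule lim_imp_Liminf[OF sequentially_bot, symmetric])
      qed
    qed
    also have "\<dots> \<le> liminf (\<lambda>i. \<integral>\<^sup>+x. ennreal ((cmod (S i x - S j x))\<^sup>2) \<partial>torus)"
      by (rule nn_integral_liminf) (use Sm in simp)
    also have "\<dots> \<le> ennreal (((1/2) ^ j)\<^sup>2)"
    proof (rule order_trans[OF Liminf_mono[where g = "\<lambda>_. ennreal (((1/2) ^ j)\<^sup>2)"]])
      show "\<forall>\<^sub>F i in sequentially. (\<integral>\<^sup>+x. ennreal ((cmod (S i x - S j x))\<^sup>2) \<partial>torus) \<le> ennreal (((1/2) ^ j)\<^sup>2)"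
        using eventually_ge_at_top[of j]
      proof eventually_elim
        case (elim i)
        have "(\<integral>\<^sup>+x. ennreal ((cmod (S i x - S j x))\<^sup>2) \<partial>torus) = ennreal (\<integral>x. (cmod (S i x - S j x))\<^sup>2 \<partial>torus)"
          by (rule nn_integral_eq_integral) (use L2_fun_diff[OF S S, of i j] in \<open>auto simp: L2_fun_def\<close>)
        then show ?case using C[OF elim] by (simp add: ennreal_leI)
      qed
    qed (simp add: Liminf_const)
    finally show ?thesis .
  qed
  have L: "L2_fun (\<lambda>x. \<phi> x - S j x)" for j
  proof -
    have "integrable torus (\<lambda>x. (cmod (\<phi> x - S j x))\<^sup>2)"
      using fatou[of j] Sm by (intro integrableI_bounded) (auto simp: order_le_less_trans)
    then show ?thesis using Sm by (simp add: L2_fun_def)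
  qed
  have "L2_fun \<phi>" using L2_fun_add[OF L[of 0] S[of 0]] by simp
  moreover have "(\<integral>x. (cmod (\<phi> x - S j x))\<^sup>2 \<partial>torus) \<le> ((1/2) ^ j)\<^sup>2" for j
  proof -
    have "ennreal (\<integral>x. (cmod (\<phi> x - S j x))\<^sup>2 \<partial>torus) \<le> ennreal (((1/2) ^ j)\<^sup>2)"
      using fatou[of j] L[of j] by (subst nn_integral_eq_integral[symmetric]) (auto simp: L2_fun_def)
    then show ?thesis by (subst (asm) ennreal_le_iff) auto
  qed
  ultimately show ?thesis by (rule that)
qed

lemma fourier_coeff_diff:
  assumes "integrable torus \<phi>" "integrable torus \<psi>"
  shows "fourier_coeff (\<lambda>x. \<phi> x - \<psi> x) = fourier_coeff \<phi> - fourier_coeff \<psi>"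
proof
  fix k
  show "fourier_coeff (\<lambda>x. \<phi> x - \<psi> x) k = (fourier_coeff \<phi> - fourier_coeff \<psi>) k"
    using fourier_coeff_int[OF assms(1), of k] fourier_coeff_int[OF assms(2), of k]
    by (simp add: fourier_coeff_def left_diff_distrib)
qed

lemma cmod_fourier_coeff_le:
  assumes "integrable torus \<phi>"
  shows "cmod (fourier_coeff \<phi> k) \<le> (\<integral>x. cmod (\<phi> x) \<partial>torus)"
proof -
  have "cmod (fourier_coeff \<phi> k) \<le> (\<integral>x. cmod (\<phi> x * cnj (echar k x)) \<partial>torus)"
    unfolding fourier_coeff_def by (rule integral_norm_bound)
  then show ?thesis by (simp add: norm_mult)
qed

lemma riesz_fischer:
  assumes f: "f \<in> sobolev 0"
  obtains \<phi> where "L2_fun \<phi>" "fourier_coeff \<phi> = f" "(\<integral>x. (cmod (\<phi> x))\<^sup>2 \<partial>torus) = (sobolev_norm 0 f)\<^sup>2"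
proof -
  have "\<exists>K. finite K \<and> (\<forall>L. finite L \<and> K \<subseteq> L \<longrightarrow> (sobolev_norm 0 (f - restrict_freq L f))\<^sup>2 \<le> ((1/2) ^ j)\<^sup>2)" for j
    by (rule sobolev_0_tail[OF f]) simp
  then obtain K0 where K0: "\<And>j. finite (K0 j)"
    "\<And>j L. finite L \<Longrightarrow> K0 j \<subseteq> L \<Longrightarrow> (sobolev_norm 0 (f - restrict_freq L f))\<^sup>2 \<le> ((1/2) ^ j)\<^sup>2" for j :: nat
    by metis
  \<comment> \<open>Unions make the frequency sets increasing, so that \<open>S j - S i\<close> only
    involves frequencies outside \<open>K i\<close> when \<open>i \<le> j\<close>.\<close>
  define K where "K j = (\<Union>i\<le>j. K0 i)" for j
  have K: "finite (K j)" for j using K0 by (simp add: K_def)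
  have Kmono: "i \<le> j \<Longrightarrow> K i \<subseteq> K j" for i j by (force simp: K_def)
  have tail: "sobolev_norm 0 (f - restrict_freq (K j) f) \<le> (1/2) ^ j" for j
    using K0(2)[OF K, of j j] by (intro power2_le_imp_le[of "sobolev_norm 0 (f - restrict_freq (K j) f)"]) (auto simp: K_def)
  define S where "S j = eval_series (restrict_freq (K j) f)" for j
  have t: "trig_poly (restrict_freq (K j) f)" for j by (intro trig_poly_restrict K)
  have SL: "L2_fun (S j)" for j unfolding S_def by (intro L2_fun_trig t)
  have C: "(\<integral>x. (cmod (S j x - S i x))\<^sup>2 \<partial>torus) \<le> ((1/2) ^ i)\<^sup>2" if "i \<le> j" for i j
  proof -
    let ?d = "restrict_freq (K j) f - restrict_freq (K i) f"
    have d: "trig_poly ?d" by (intro trig_poly_diff t)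
    have "eval_series ?d x = S j x - S i x" for x
      using eval_series_add[OF d t[of i], of x] by (simp add: S_def)
    then have "(\<integral>x. (cmod (S j x - S i x))\<^sup>2 \<partial>torus) = (sobolev_norm 0 ?d)\<^sup>2"
      using trig_sobolev(2)[OF d] by simp
    also have "\<dots> \<le> (sobolev_norm 0 (f - restrict_freq (K i) f))\<^sup>2"
    proof (intro power_mono sobolev_norm_nonneg sobolev_compare1(2))
      show "f - restrict_freq (K i) f \<in> sobolev 0"
        by (intro sobolev_diff f restrict_freq_sobolev)
      show "sobolev_wt 0 ?d k \<le> sobolev_wt 0 (f - restrict_freq (K i) f) k" for k
        using Kmono[OF that] by (auto simp: sobolev_wt_def restrict_freq_def)
    qed
    also have "\<dots> \<le> ((1/2) ^ i)\<^sup>2" by (intro power_mono tail sobolev_norm_nonneg)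
    finally show ?thesis .
  qed
  obtain \<phi> where \<phi>: "L2_fun \<phi>" "\<And>j. (\<integral>x. (cmod (\<phi> x - S j x))\<^sup>2 \<partial>torus) \<le> ((1/2) ^ j)\<^sup>2"
    using L2_fun_limit[OF SL C] by blast
  have coS: "fourier_coeff (S j) = restrict_freq (K j) f" for j
    unfolding S_def by (rule fourier_coeff_trig[OF t])
  have co: "fourier_coeff \<phi> k = f k" for k
  proof -
    have le: "cmod (fourier_coeff \<phi> k - f k) \<le> 2 * (1/2) ^ j" for j
    proof -
      have "cmod (fourier_coeff (\<lambda>x. \<phi> x - S j x) k) \<le> (1/2) ^ j"
        using cmod_fourier_coeff_le[OF L2_fun_integrable[OF L2_fun_diff[OF \<phi>(1) SL]]]
          integral_cmod_le[OF L2_fun_diff[OF \<phi>(1) SL] \<phi>(2)] by (meson order_trans zero_less_power half_gt_zero zero_less_one)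
      moreover have "cmod ((f - restrict_freq (K j) f) k) \<le> (1/2) ^ j"
        using sobolev_coeff_le[OF sobolev_diff(1)[OF f restrict_freq_sobolev[OF f, of "K j"]], of k] tail[of j]
        by (simp add: powr_def)
      ultimately have "cmod ((fourier_coeff \<phi> - restrict_freq (K j) f) k) + cmod ((f - restrict_freq (K j) f) k) \<le> 2 * (1/2) ^ j"
        unfolding fourier_coeff_diff[OF L2_fun_integrable[OF \<phi>(1)] L2_fun_integrable[OF SL]] coS by linarith
      moreover have "fourier_coeff \<phi> k - f k = (fourier_coeff \<phi> - restrict_freq (K j) f) k - (f - restrict_freq (K j) f) k" by simp
      ultimately show ?thesis using norm_triangle_ineq4 order_trans by metis
    qed
    have "(\<lambda>j. 2 * (1/2::real) ^ j) \<longlonglongrightarrow> 2 * 0"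
      by (intro tendsto_intros LIMSEQ_realpow_zero) auto
    then have "cmod (fourier_coeff \<phi> k - f k) \<le> 2 * 0"
      by (rule tendsto_lowerbound) (use le in auto)
    then show ?thesis by simp
  qed
  then have co': "fourier_coeff \<phi> = f" by (simp add: fun_eq_iff)
  have eq: "(\<integral>x. (cmod (\<phi> x - S j x))\<^sup>2 \<partial>torus) = (\<integral>x. (cmod (\<phi> x))\<^sup>2 \<partial>torus) - (\<Sum>k\<in>K j. (cmod (f k))\<^sup>2)" for j
    using pythagoras[OF \<phi>(1) K[of j]] by (simp add: co' S_def)
  \<comment> \<open>Both the integral and the squared norm differ from the finite sum over
    \<open>K j\<close> by at most the same vanishing error.\<close>
  have le: "\<bar>(\<integral>x. (cmod (\<phi> x))\<^sup>2 \<partial>torus) - (sobolev_norm 0 f)\<^sup>2\<bar> \<le> ((1/2) ^ j)\<^sup>2" for j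
  proof -
    let ?I = "\<integral>x. (cmod (\<phi> x))\<^sup>2 \<partial>torus" let ?s = "\<Sum>k\<in>K j. (cmod (f k))\<^sup>2"
    have s: "(\<lambda>k. (cmod (f k))\<^sup>2) summable_on UNIV" using f by (simp add: sobolev_0_summable)
    have t: "(sobolev_norm 0 (f - restrict_freq (K j) f))\<^sup>2 = (\<Sum>\<^sub>\<infinity>k\<in>-K j. (cmod (f k))\<^sup>2)"
      unfolding sobolev_norm_0_square
      by (rule infsum_cong_neutral) (auto simp: restrict_freq_def)
    have "(sobolev_norm 0 f)\<^sup>2 = (\<Sum>\<^sub>\<infinity>k\<in>-K j. (cmod (f k))\<^sup>2) + ?s"
      unfolding sobolev_norm_0_square
      using infsum_Un_disjoint[of "\<lambda>k. (cmod (f k))\<^sup>2" "-K j" "K j"] s K[of j]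
      by (simp add: summable_on_subset_banach)
    moreover have "(sobolev_norm 0 (f - restrict_freq (K j) f))\<^sup>2 \<le> ((1/2) ^ j)\<^sup>2"
      by (intro power_mono tail sobolev_norm_nonneg)
    moreover have "0 \<le> ?I - ?s" using eq[of j] Bochner_Integration.integral_nonneg[of torus "\<lambda>x. (cmod (\<phi> x - S j x))\<^sup>2"] by simp
    moreover have "?I - ?s \<le> ((1/2) ^ j)\<^sup>2" using eq[of j] \<phi>(2)[of j] by simp
    moreover have "0 \<le> (\<Sum>\<^sub>\<infinity>k\<in>-K j. (cmod (f k))\<^sup>2)" by (intro infsum_nonneg) simp
    ultimately show ?thesis unfolding t by linarith
  qed
  have "(\<lambda>j. ((1/2::real) ^ j)\<^sup>2) \<longlonglongrightarrow> 0\<^sup>2"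
    by (intro tendsto_intros LIMSEQ_realpow_zero) auto
  then have "\<bar>(\<integral>x. (cmod (\<phi> x))\<^sup>2 \<partial>torus) - (sobolev_norm 0 f)\<^sup>2\<bar> \<le> 0\<^sup>2"
    by (rule tendsto_lowerbound) (use le in auto)
  then have "(\<integral>x. (cmod (\<phi> x))\<^sup>2 \<partial>torus) = (sobolev_norm 0 f)\<^sup>2" by simp
  with \<phi>(1) co' show ?thesis by (rule that)
qed

lemma L2_eq_sobolev: "L2 = sobolev 0"
proof (intro subset_antisym subsetI)
  fix f assume "f \<in> L2"
  then show "f \<in> sobolev 0" unfolding L2_def using bessel_inequality by blast
next
  fix f :: pdist assume "f \<in> sobolev 0"
  then show "f \<in> L2" unfolding L2_def by (metis (mono_tags, lifting) mem_Collect_eq riesz_fischer)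
qed

text \<open>Riesz-Fischer supplies some function with these coefficients and the right norm;
  uniqueness of coefficients identifies it with \<phi> almost everywhere.\<close>

lemma parseval:
  assumes "L2_fun \<phi>"
  shows "(\<integral>x. (cmod (\<phi> x))\<^sup>2 \<partial>torus) = (sobolev_norm 0 (fourier_coeff \<phi>))\<^sup>2"
proof -
  obtain \<psi> where \<psi>: "L2_fun \<psi>" "fourier_coeff \<psi> = fourier_coeff \<phi>"
    "(\<integral>x. (cmod (\<psi> x))\<^sup>2 \<partial>torus) = (sobolev_norm 0 (fourier_coeff \<phi>))\<^sup>2"
    using riesz_fischer[OF bessel_inequality[OF assms]] by blast
  have "AE x in torus. \<phi> x - \<psi> x = 0"
    using fourier_coeff_diff[of \<phi> \<psi>] L2_fun_integrable[OF assms] L2_fun_integrable[OF \<psi>(1)] \<psi>(2)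
    by (intro fourier_coeff_unique) auto
  then have "(\<integral>x. (cmod (\<phi> x))\<^sup>2 \<partial>torus) = (\<integral>x. (cmod (\<psi> x))\<^sup>2 \<partial>torus)"
    by (intro integral_cong_AE) (use assms \<psi>(1) in \<open>auto simp: L2_fun_def elim: AE_mp\<close>)
  then show ?thesis using \<psi>(3) by simp
qed

section \<open>The inner product in terms of coefficients\<close>

definition l2_inner :: "pdist \<Rightarrow> pdist \<Rightarrow> complex" where
  "l2_inner f g = (\<Sum>\<^sub>\<infinity>k. f k * cnj (g k))"

lemma l2_inner_summable:
  assumes "f \<in> sobolev 0" "g \<in> sobolev 0"
  shows "(\<lambda>k. f k * cnj (g k)) summable_on UNIV"
proof (rule abs_summable_summable, rule summable_on_comparison_test)
  show "(\<lambda>k. (cmod (f k))\<^sup>2 + (cmod (g k))\<^sup>2) summable_on UNIV"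
    using assms by (intro summable_on_add) (simp_all add: sobolev_0_summable)
  fix k
  have "2 * (cmod (f k) * cmod (g k)) \<le> (cmod (f k))\<^sup>2 + (cmod (g k))\<^sup>2"
    using zero_le_power2[of "cmod (f k) - cmod (g k)"] by (simp add: power2_diff)
  moreover have "0 \<le> cmod (f k) * cmod (g k)" by simp
  ultimately show "cmod (f k * cnj (g k)) \<le> (cmod (f k))\<^sup>2 + (cmod (g k))\<^sup>2"
    unfolding norm_mult complex_mod_cnj by linarith
qed simp

text \<open>The factors 1 and -1 are kept so that each term has the shape \<open>a + c * b\<close>
  to which Parseval is applied for general \<open>c\<close>.\<close>

lemma polarization:
  fixes a b :: complex
  shows "4 * (a * cnj b) = of_real ((cmod (a + 1 * b))\<^sup>2) + (-1) * of_real ((cmod (a + (-1) * b))\<^sup>2)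
    + \<i> * of_real ((cmod (a + \<i> * b))\<^sup>2) + (-\<i>) * of_real ((cmod (a + (-\<i>) * b))\<^sup>2)"
  unfolding cmod_power2 by (simp add: complex_eq_iff power2_eq_square algebra_simps)

text \<open>By polarization both sides are the same combination of four squared norms, and these
  agree by Parseval. From here on the choice of representatives in \<open>L2_rep\<close> no longer
  matters.\<close>

lemma L2_inner_eq:
  assumes "f \<in> L2" "g \<in> L2"
  shows "L2_inner f g = l2_inner f g"
proof -
  have rep: "L2_fun (L2_rep f) \<and> f = fourier_coeff (L2_rep f)" if "f \<in> L2" for f
  proof -
    have "\<exists>\<phi>. L2_fun \<phi> \<and> f = fourier_coeff \<phi>" using that unfolding L2_def by blast
    then show ?thesis unfolding L2_rep_def by (rule someI_ex)
  qed
  define \<phi> \<psi> where "\<phi> = L2_rep f" and "\<psi> = L2_rep g"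
  have \<phi>: "L2_fun \<phi>" "fourier_coeff \<phi> = f" and \<psi>: "L2_fun \<psi>" "fourier_coeff \<psi> = g"
    using rep[OF assms(1)] rep[OF assms(2)] by (auto simp: \<phi>_def \<psi>_def)
  have fs: "f \<in> sobolev 0" and gs: "g \<in> sobolev 0" using assms by (auto simp: L2_eq_sobolev)
  have sq: "(\<integral>x. (cmod (\<phi> x + c * \<psi> x))\<^sup>2 \<partial>torus) = (\<Sum>\<^sub>\<infinity>k. (cmod (f k + c * g k))\<^sup>2)"
    and int: "integrable torus (\<lambda>x. (cmod (\<phi> x + c * \<psi> x))\<^sup>2)"
    and sm: "(\<lambda>k. (cmod (f k + c * g k))\<^sup>2) summable_on UNIV" for c
  proof -
    have L: "L2_fun (\<lambda>x. \<phi> x + c * \<psi> x)" by (intro L2_fun_add L2_fun_cmult \<phi> \<psi>)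
    then show "integrable torus (\<lambda>x. (cmod (\<phi> x + c * \<psi> x))\<^sup>2)" by (simp add: L2_fun_def)
    have co: "fourier_coeff (\<lambda>x. \<phi> x + c * \<psi> x) = (\<lambda>k. f k + c * g k)"
    proof
      fix k
      show "fourier_coeff (\<lambda>x. \<phi> x + c * \<psi> x) k = f k + c * g k"
        using fourier_coeff_int[OF L2_fun_integrable[OF \<phi>(1)], of k]
          fourier_coeff_int[OF L2_fun_integrable[OF \<psi>(1)], of k]
        unfolding \<phi>(2)[symmetric] \<psi>(2)[symmetric]
        by (simp add: fourier_coeff_def distrib_right mult.assoc)
    qed
    show "(\<integral>x. (cmod (\<phi> x + c * \<psi> x))\<^sup>2 \<partial>torus) = (\<Sum>\<^sub>\<infinity>k. (cmod (f k + c * g k))\<^sup>2)"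
      unfolding parseval[OF L] co sobolev_norm_0_square ..
    show "(\<lambda>k. (cmod (f k + c * g k))\<^sup>2) summable_on UNIV"
      using bessel_inequality[OF L] unfolding co sobolev_0_summable .
  qed
  define I where "I c = complex_of_real (\<integral>x. (cmod (\<phi> x + c * \<psi> x))\<^sup>2 \<partial>torus)" for c
  have hs: "((\<lambda>k. complex_of_real ((cmod (f k + c * g k))\<^sup>2)) has_sum I c) UNIV" for c
    unfolding I_def sq by (intro has_sum_of_real has_sum_infsum sm)
  have hi: "has_bochner_integral torus (\<lambda>x. complex_of_real ((cmod (\<phi> x + c * \<psi> x))\<^sup>2)) (I c)" for c
    unfolding I_def using int[of c] by (intro has_bochner_integral_of_real has_bochner_integral_integrable)
  let ?J = "I 1 + (-1) * I (-1) + \<i> * I \<i> + (-\<i>) * I (-\<i>)"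
  have "has_bochner_integral torus (\<lambda>x. 4 * (\<phi> x * cnj (\<psi> x))) ?J"
    unfolding polarization
    by (intro has_bochner_integral_add has_bochner_integral_mult_right hi)
  then have "(\<integral>x. 4 * (\<phi> x * cnj (\<psi> x)) \<partial>torus) = ?J" by (rule has_bochner_integral_integral_eq)
  moreover have "((\<lambda>k. 4 * (f k * cnj (g k))) has_sum ?J) UNIV"
    unfolding polarization by (intro has_sum_add has_sum_cmult_right hs)
  then have "(\<Sum>\<^sub>\<infinity>k. 4 * (f k * cnj (g k))) = ?J" by (rule infsumI)
  then have "4 * l2_inner f g = ?J"
    unfolding l2_inner_def by (simp add: infsum_cmult_right')
  ultimately have "4 * L2_inner f g = 4 * l2_inner f g" by (simp add: L2_inner_def \<phi>_def \<psi>_def)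
  then show ?thesis by simp
qed

lemma l2_inner_self: "f \<in> sobolev 0 \<Longrightarrow> l2_inner f f = of_real ((sobolev_norm 0 f)\<^sup>2)"
  unfolding l2_inner_def sobolev_norm_0_square complex_norm_square[symmetric]
  by (rule infsumI, rule has_sum_of_real, rule has_sum_infsum) (simp add: sobolev_0_summable)

lemma L2_norm_eq: "f \<in> L2 \<Longrightarrow> L2_norm f = sobolev_norm 0 f"
  by (simp add: L2_norm_def L2_inner_eq) (simp add: L2_eq_sobolev l2_inner_self)

lemma l2_inner_add_left:
  assumes "f \<in> sobolev 0" "g \<in> sobolev 0" "h \<in> sobolev 0"
  shows "l2_inner (f + g) h = l2_inner f h + l2_inner g h"
  unfolding l2_inner_def plus_fun_apply distrib_right
  by (intro infsum_add l2_inner_summable assms)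

lemma l2_inner_scal_left: "l2_inner (scal c f) g = c * l2_inner f g"
  by (simp add: l2_inner_def scal_def mult.assoc infsum_cmult_right')

lemma l2_inner_cnj: "cnj (l2_inner f g) = l2_inner g f"
  by (simp add: l2_inner_def mult.commute flip: infsum_cnj)

lemma scal_minus_one: "scal (- 1) f = - f"
  by (simp add: scal_def fun_eq_iff)

lemma l2_inner_diff_left:
  assumes "f \<in> sobolev 0" "g \<in> sobolev 0" "h \<in> sobolev 0"
  shows "l2_inner (f - g) h = l2_inner f h - l2_inner g h"
  using l2_inner_add_left[of f "- g" h] l2_inner_scal_left[of "-1" g h] assms
  by (simp add: sobolev_minus_iff scal_minus_one)

lemma l2_inner_diff_right:
  assumes "f \<in> sobolev 0" "g \<in> sobolev 0" "h \<in> sobolev 0"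
  shows "l2_inner h (f - g) = l2_inner h f - l2_inner h g"
  using arg_cong[OF l2_inner_diff_left[OF assms], of cnj] by (simp add: l2_inner_cnj)

lemma l2_inner_scal_right: "l2_inner f (scal c g) = cnj c * l2_inner f g"
  using arg_cong[OF l2_inner_scal_left[of c g f], of cnj] by (simp add: l2_inner_cnj)

lemma l2_inner_cauchy_schwarz:
  assumes "f \<in> sobolev 0" "g \<in> sobolev 0"
  shows "cmod (l2_inner f g) \<le> sobolev_norm 0 f * sobolev_norm 0 g"
proof -
  have lim: "((\<lambda>K. cmod (\<Sum>k\<in>K. f k * cnj (g k))) \<longlongrightarrow> cmod (l2_inner f g)) (finite_subsets_at_top UNIV)"
    using has_sum_infsum[OF l2_inner_summable[OF assms]]
    by (intro tendsto_norm) (simp add: has_sum_def l2_inner_def)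
  show ?thesis
  proof (rule tendsto_upperbound[OF lim], rule eventually_finite_subsets_at_top_weakI)
    fix K :: "(int \<times> int) set"
    have "cmod (\<Sum>k\<in>K. f k * cnj (g k)) \<le> (\<Sum>k\<in>K. \<bar>sobolev_wt 0 f k\<bar> * \<bar>sobolev_wt 0 g k\<bar>)"
      by (rule order_trans[OF norm_sum]) (simp add: norm_mult sobolev_wt_def)
    also have "\<dots> \<le> L2_set (sobolev_wt 0 f) K * L2_set (sobolev_wt 0 g) K"
      by (rule L2_set_mult_ineq)
    also have "\<dots> \<le> sobolev_norm 0 f * sobolev_norm 0 g"
      by (intro mult_mono sobolev_D assms) auto
    finally show "cmod (\<Sum>k\<in>K. f k * cnj (g k)) \<le> sobolev_norm 0 f * sobolev_norm 0 g" .
  qed simp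
qed

lemma l2_nondegenerate:
  assumes "f \<in> sobolev 0" "l2_inner f f = 0"
  shows "f = 0"
  using assms l2_inner_self[OF assms(1)] by (intro sobolev_norm_eq_0[of f 0]) auto

section \<open>A criterion for self-adjointness\<close>

text \<open>A pair (v, w) in the adjoint graph is compared with the solution v' in the domain of the
  equation that v satisfies formally. Symmetry makes v - v' orthogonal to the range of
  \<open>K - T\<close>, which is everything, so v = v'. Because \<open>K\<close> is real, one value
  suffices where the general criterion takes two conjugate points.\<close>

lemma self_adjoint_on_L2_I:
  fixes T :: "pdist \<Rightarrow> pdist" and K K' :: real
  assumes D: "D \<subseteq> sobolev 0" and T: "\<And>u. u \<in> D \<Longrightarrow> T u \<in> sobolev 0" and z: "0 \<in> D"
    and add: "\<And>u v. u \<in> D \<Longrightarrow> v \<in> D \<Longrightarrow> u + v \<in> D \<and> T (u + v) = T u + T v"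
    and sc: "\<And>c u. u \<in> D \<Longrightarrow> scal c u \<in> D \<and> T (scal c u) = scal c (T u)"
    and sym: "\<And>u v. u \<in> D \<Longrightarrow> v \<in> D \<Longrightarrow> l2_inner (T u) v = l2_inner u (T v)"
    and surj: "\<And>f. f \<in> sobolev 0 \<Longrightarrow> \<exists>u\<in>D. scal (of_real K) u - T u = f"
    and dense: "\<And>f e. f \<in> sobolev 0 \<Longrightarrow> e > 0 \<Longrightarrow> \<exists>u\<in>D. sobolev_norm 0 (f - u) < e"
  shows "self_adjoint_on_L2 D (\<lambda>u. T u - scal (of_real K') u)"
proof -
  let ?T = "\<lambda>u. T u - scal (of_real K') u"
  have Ds: "u \<in> D \<Longrightarrow> u \<in> sobolev 0" for u using D by blast
  have T'L: "u \<in> D \<Longrightarrow> ?T u \<in> sobolev 0" for u by (intro sobolev_diff sobolev_scal T Ds)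
  have lin: "linear_operator_on_L2 D ?T"
    unfolding linear_operator_on_L2_def L2_eq_sobolev
    using D T'L z add sc by (auto simp: scal_def fun_eq_iff algebra_simps)
  have den: "dense_in_L2 D"
    unfolding dense_in_L2_def L2_eq_sobolev
  proof (intro ballI allI impI)
    fix f e assume "f \<in> sobolev 0" "(0::real) < e"
    with dense obtain u where u: "u \<in> D" "sobolev_norm 0 (f - u) < e" by blast
    have "f - u \<in> L2" unfolding L2_eq_sobolev by (intro sobolev_diff \<open>f \<in> sobolev 0\<close> Ds u)
    from L2_norm_eq[OF this] u show "\<exists>u\<in>D. L2_norm (f - u) < e"
      by (intro bexI[of _ u]) simp_all
  qed
  have T'sym: "l2_inner (?T u) v = l2_inner u (?T v)" if "u \<in> D" "v \<in> D" for u v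
    using that sym[OF that]
    by (simp add: l2_inner_diff_left l2_inner_diff_right l2_inner_scal_left l2_inner_scal_right T Ds sobolev_scal)
  have "adjoint_graph D ?T = {(u, ?T u) | u. u \<in> D}"
  proof (intro subset_antisym subsetI)
    fix p assume "p \<in> adjoint_graph D ?T"
    then obtain v w where p: "p = (v, w)" and v: "v \<in> sobolev 0" and w: "w \<in> sobolev 0"
      and eq: "\<And>u. u \<in> D \<Longrightarrow> L2_inner (?T u) v = L2_inner u w"
      by (auto simp: adjoint_graph_def L2_eq_sobolev)
    have eq': "l2_inner (T u) v = l2_inner u w + of_real K' * l2_inner u v" if "u \<in> D" for u
    proof -
      have "l2_inner (?T u) v = l2_inner u w"
        using eq[OF that] T'L[OF that] Ds[OF that] v w by (simp add: L2_inner_eq L2_eq_sobolev)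
      moreover have "l2_inner (?T u) v = l2_inner (T u) v - of_real K' * l2_inner u v"
        by (subst l2_inner_diff_left) (use that v T Ds sobolev_scal in \<open>auto simp: l2_inner_scal_left\<close>)
      ultimately show ?thesis by (simp add: algebra_simps)
    qed
    \<comment> \<open>The adjoint of \<open>T\<close> should send \<open>v\<close> to w + K' v;
      \<open>f\<close> is the value of \<open>K\<close> minus this adjoint at
      \<open>v\<close>.\<close>
    define f where "f = scal (of_real (K - K')) v - w"
    have f: "f \<in> sobolev 0" unfolding f_def by (intro sobolev_diff sobolev_scal v w)
    obtain v' where v': "v' \<in> D" "scal (of_real K) v' - T v' = f" using surj[OF f] by blast
    have v's: "v' \<in> sobolev 0" by (intro Ds v')
    have *: "l2_inner (scal (of_real K) u - T u) (v - v') = 0" if u: "u \<in> D" for u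
    proof -
      have us: "u \<in> sobolev 0" "T u \<in> sobolev 0" "scal (of_real K) u \<in> sobolev 0"
        using u by (auto intro: Ds T sobolev_scal)
      have "l2_inner (scal (of_real K) u - T u) v = l2_inner u f"
        unfolding f_def using us v w sobolev_scal(1)[OF v]
        by (simp add: l2_inner_diff_left l2_inner_diff_right l2_inner_scal_left l2_inner_scal_right eq'[OF u] algebra_simps)
      also have "\<dots> = l2_inner (scal (of_real K) u - T u) v'"
        unfolding v'(2)[symmetric] using us v's T[OF v'(1)] sobolev_scal(1)[OF v's]
        by (simp add: l2_inner_diff_left l2_inner_diff_right l2_inner_scal_left l2_inner_scal_right sym[OF u v'(1)])
      finally show ?thesis
        using sobolev_diff(1)[OF us(3,2)] v v's by (simp add: l2_inner_diff_right)
    qed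
    \<comment> \<open>The orthogonality is tested with the \<open>u\<close> for which the left
      factor is \<open>v - v'\<close> itself.\<close>
    obtain u where "u \<in> D" "scal (of_real K) u - T u = v - v'"
      using surj[OF sobolev_diff(1)[OF v v's]] by blast
    with *[of u] have "v - v' = 0"
      using sobolev_diff(1)[OF v v's] by (intro l2_nondegenerate) auto
    then have vv: "v = v'" by simp
    have "w = ?T v"
      using v'(2) unfolding vv f_def by (auto simp: fun_eq_iff scal_def algebra_simps)
    then show "p \<in> {(u, ?T u) | u. u \<in> D}" using p vv v'(1) by auto
  next
    fix p assume "p \<in> {(u, ?T u) | u. u \<in> D}"
    then obtain v where p: "p = (v, ?T v)" "v \<in> D" by blast
    have "L2_inner (?T u) v = L2_inner u (?T v)" if "u \<in> D" for u
      using T'sym[OF that p(2)] Ds T'L that p(2) by (simp add: L2_inner_eq L2_eq_sobolev)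
    then show "p \<in> adjoint_graph D ?T"
      unfolding p adjoint_graph_def L2_eq_sobolev using Ds T'L p(2) by auto
  qed
  with lin den show ?thesis by (simp add: self_adjoint_on_L2_def)
qed

section \<open>Smooth functions\<close>

lemma frechet_derivative_cong_open:
  assumes "open S" "x \<in> S" "\<And>y. y \<in> S \<Longrightarrow> f y = g y" "f differentiable (at x)"
  shows "g differentiable (at x)" "frechet_derivative g (at x) = frechet_derivative f (at x)"
proof -
  have "(f has_derivative frechet_derivative f (at x)) (at x)"
    using assms(4) by (simp add: frechet_derivative_works)
  then have g: "(g has_derivative frechet_derivative f (at x)) (at x)"
    by (rule has_derivative_transform_within_open[OF _ assms(1,2,3)])
  then show "g differentiable (at x)" by (auto simp: differentiable_def)
  show "frechet_derivative g (at x) = frechet_derivative f (at x)"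
    by (rule frechet_derivative_at[OF g, symmetric])
qed

text \<open>Derivatives in \<open>times_differentiable_on\<close> are taken in the whole space, but
  on an open set they depend only on the values there. The rules for sums, products and inverses
  rely on this, since their derivative formulas are known only on \<open>S\<close>.\<close>

lemma times_differentiable_cong:
  assumes "open S" "\<And>x. x \<in> S \<Longrightarrow> f x = g x" "times_differentiable_on n f S"
  shows "times_differentiable_on n g S"
  using assms(2,3)
proof (induction n arbitrary: f g)
  case 0
  then show ?case by (simp cong: continuous_on_cong)
next
  case (Suc n)
  have d: "f differentiable (at x)" if "x \<in> S" for x using Suc.prems that by simp
  show ?case
    unfolding times_differentiable_on.simps
  proof (intro conjI ballI allI)
    fix x assume x: "x \<in> S"
    show "g differentiable (at x)"
      by (rule frechet_derivative_cong_open(1)[OF assms(1) x Suc.prems(1) d[OF x]])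
  next
    fix v
    show "times_differentiable_on n (\<lambda>x. frechet_derivative g (at x) v) S"
    proof (rule Suc.IH)
      show "times_differentiable_on n (\<lambda>x. frechet_derivative f (at x) v) S" using Suc.prems(2) by simp
      show "frechet_derivative f (at x) v = frechet_derivative g (at x) v" if "x \<in> S" for x
        using frechet_derivative_cong_open(2)[OF assms(1) that Suc.prems(1) d[OF that]] by simp
    qed
  qed
qed

lemma times_differentiable_Suc_imp:
  "times_differentiable_on (Suc n) f S \<Longrightarrow> times_differentiable_on n f S"
proof (induction n arbitrary: f)
  case 0
  then show ?case
    by (auto intro!: continuous_at_imp_continuous_on differentiable_imp_continuous_within)
next
  case (Suc n)
  then show ?case unfolding times_differentiable_on.simps(2)[of "Suc n"] times_differentiable_on.simps(2)[of n f S]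
    by blast
qed

lemma times_differentiable_const: "times_differentiable_on n (\<lambda>x. c) S"
proof (induction n arbitrary: c)
  case (Suc n)
  have "frechet_derivative (\<lambda>x. c) (at x) = (\<lambda>_. 0)" for x by (simp add: frechet_derivative_const)
  then show ?case using Suc by simp
qed simp

lemma times_differentiable_add:
  assumes "open S"
  shows "times_differentiable_on n f S \<Longrightarrow> times_differentiable_on n g S \<Longrightarrow>
    times_differentiable_on n (\<lambda>x. f x + g x) S"
proof (induction n arbitrary: f g)
  case 0
  then show ?case by (auto intro: continuous_intros)
next
  case (Suc n)
  show ?case unfolding times_differentiable_on.simps
  proof (intro conjI ballI allI)
    fix x assume "x \<in> S" with Suc show "(\<lambda>x. f x + g x) differentiable (at x)" by auto
  next
    fix v
    show "times_differentiable_on n (\<lambda>x. frechet_derivative (\<lambda>x. f x + g x) (at x) v) S"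
    proof (rule times_differentiable_cong[OF assms])
      show "times_differentiable_on n (\<lambda>x. frechet_derivative f (at x) v + frechet_derivative g (at x) v) S"
        using Suc by simp
      fix x assume "x \<in> S"
      then have "(f has_derivative frechet_derivative f (at x)) (at x)" "(g has_derivative frechet_derivative g (at x)) (at x)"
        using Suc.prems by (auto simp: frechet_derivative_works)
      from frechet_derivative_at[OF has_derivative_add[OF this]]
      show "frechet_derivative f (at x) v + frechet_derivative g (at x) v = frechet_derivative (\<lambda>x. f x + g x) (at x) v"
        by (simp add: fun_eq_iff)
    qed
  qed
qed

lemma times_differentiable_mult:
  fixes f g :: "'a::real_normed_vector \<Rightarrow> real"
  assumes "open S"
  shows "times_differentiable_on n f S \<Longrightarrow> times_differentiable_on n g S \<Longrightarrow>
    times_differentiable_on n (\<lambda>x. f x * g x) S"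
proof (induction n arbitrary: f g)
  case 0
  then show ?case by (auto intro: continuous_intros)
next
  case (Suc n)
  show ?case unfolding times_differentiable_on.simps
  proof (intro conjI ballI allI)
    fix x assume "x \<in> S" with Suc show "(\<lambda>x. f x * g x) differentiable (at x)" by auto
  next
    fix v
    have n: "times_differentiable_on n f S" "times_differentiable_on n g S"
      using Suc.prems by (blast intro: times_differentiable_Suc_imp)+
    show "times_differentiable_on n (\<lambda>x. frechet_derivative (\<lambda>x. f x * g x) (at x) v) S"
    proof (rule times_differentiable_cong[OF assms])
      show "times_differentiable_on n (\<lambda>x. f x * frechet_derivative g (at x) v + frechet_derivative f (at x) v * g x) S"
        using Suc n by (intro times_differentiable_add[OF assms] Suc.IH) simp_all
      fix x assume "x \<in> S"
      then have "(f has_derivative frechet_derivative f (at x)) (at x)" "(g has_derivative frechet_derivative g (at x)) (at x)"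
        using Suc.prems by (auto simp: frechet_derivative_works)
      from frechet_derivative_at[OF has_derivative_mult[OF this]]
      show "f x * frechet_derivative g (at x) v + frechet_derivative f (at x) v * g x = frechet_derivative (\<lambda>x. f x * g x) (at x) v"
        by (simp add: fun_eq_iff)
    qed
  qed
qed

lemma times_differentiable_inverse:
  fixes f :: "'a::real_normed_vector \<Rightarrow> real"
  assumes "open S" and nz: "\<And>x. x \<in> S \<Longrightarrow> f x \<noteq> 0"
  shows "times_differentiable_on n f S \<Longrightarrow> times_differentiable_on n (\<lambda>x. inverse (f x)) S"
proof (induction n)
  case 0
  then show ?case using nz by (auto intro: continuous_intros)
next
  case (Suc n)
  have n: "times_differentiable_on n f S"
    using Suc.prems by (rule times_differentiable_Suc_imp)
  have D: "((\<lambda>x. inverse (f x)) has_derivative (\<lambda>v. - (inverse (f x) * frechet_derivative f (at x) v * inverse (f x)))) (at x)"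
    if "x \<in> S" for x
    by (rule Deriv.has_derivative_inverse) (use that nz Suc.prems in \<open>auto simp: frechet_derivative_works\<close>)
  show ?case unfolding times_differentiable_on.simps
  proof (intro conjI ballI allI)
    fix x assume "x \<in> S" with D show "(\<lambda>x. inverse (f x)) differentiable (at x)" unfolding differentiable_def by blast
  next
    fix v
    show "times_differentiable_on n (\<lambda>x. frechet_derivative (\<lambda>x. inverse (f x)) (at x) v) S"
    proof (rule times_differentiable_cong[OF assms(1)])
      show "times_differentiable_on n (\<lambda>x. (-1) * (inverse (f x) * frechet_derivative f (at x) v * inverse (f x))) S"
        using Suc n by (intro times_differentiable_mult[OF assms(1)] times_differentiable_const) simp_all
      fix x assume "x \<in> S"
      from frechet_derivative_at[OF D[OF this]]
      show "(-1) * (inverse (f x) * frechet_derivative f (at x) v * inverse (f x)) = frechet_derivative (\<lambda>x. inverse (f x)) (at x) v"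
        by (simp add: fun_eq_iff)
    qed
  qed
qed

lemma times_differentiable_bounded_linear:
  assumes "bounded_linear f"
  shows "times_differentiable_on n f S"
proof (cases n)
  case 0
  then show ?thesis by (simp add: linear_continuous_on assms)
next
  case (Suc m)
  have "(f has_derivative f) (at x)" for x by (rule bounded_linear_imp_has_derivative[OF assms])
  then have "f differentiable (at x)" "frechet_derivative f (at x) = f" for x
    by (auto simp: differentiable_def intro: frechet_derivative_at[symmetric])
  then show ?thesis using Suc by (simp add: times_differentiable_const)
qed

lemma times_differentiable_Un:
  assumes "open S" "open T"
  shows "times_differentiable_on n f S \<Longrightarrow> times_differentiable_on n f T \<Longrightarrow> times_differentiable_on n f (S \<union> T)"
proof (induction n arbitrary: f)
  case 0
  then show ?case using assms by (auto intro: continuous_on_open_Un)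
qed auto

lemma times_differentiable_affine:
  assumes "times_differentiable_on n f UNIV"
  shows "times_differentiable_on n (\<lambda>x. f (b + c *\<^sub>R x)) UNIV"
  using assms
proof (induction n arbitrary: f)
  case 0
  then show ?case by (auto intro!: continuous_intros intro: continuous_on_compose2)
next
  case (Suc n)
  have D: "((\<lambda>x. f (b + c *\<^sub>R x)) has_derivative (\<lambda>v. frechet_derivative f (at (b + c *\<^sub>R x)) (c *\<^sub>R v))) (at x)" for x
  proof (rule has_derivative_compose[where f = "\<lambda>x. b + c *\<^sub>R x"])
    show "((\<lambda>x. b + c *\<^sub>R x) has_derivative (\<lambda>v. c *\<^sub>R v)) (at x)" by (auto intro!: derivative_eq_intros)
    show "(f has_derivative frechet_derivative f (at (b + c *\<^sub>R x))) (at (b + c *\<^sub>R x))"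
      using Suc.prems by (simp add: frechet_derivative_works)
  qed
  have "frechet_derivative (\<lambda>x. f (b + c *\<^sub>R x)) (at x) = (\<lambda>v. frechet_derivative f (at (b + c *\<^sub>R x)) (c *\<^sub>R v))" for x
    by (rule frechet_derivative_at[OF D, symmetric])
  moreover have "times_differentiable_on n (\<lambda>x. frechet_derivative f (at (b + c *\<^sub>R x)) (c *\<^sub>R v)) UNIV" for v
    by (rule Suc.IH[of "\<lambda>x. frechet_derivative f (at x) (c *\<^sub>R v)"]) (use Suc.prems in simp)
  ultimately show ?case using D by (auto simp: differentiable_def)
qed

lemma times_differentiable_subset:
  "S \<subseteq> T \<Longrightarrow> times_differentiable_on n f T \<Longrightarrow> times_differentiable_on n f S"
proof (induction n arbitrary: f)
  case 0
  then show ?case by (auto intro: continuous_on_subset)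
next
  case (Suc n)
  then show ?case unfolding times_differentiable_on.simps by blast
qed

lemma smooth_on_affine: "smooth_on f UNIV \<Longrightarrow> smooth_on (\<lambda>x. f (b + c *\<^sub>R x)) UNIV"
  by (simp add: smooth_on_def times_differentiable_affine)

lemma smooth_on_add: "open S \<Longrightarrow> smooth_on f S \<Longrightarrow> smooth_on g S \<Longrightarrow> smooth_on (\<lambda>x. f x + g x) S"
  by (simp add: smooth_on_def times_differentiable_add)

text \<open>The quotient vanishes near the origin and is a product of smooth functions away from it;
  the two open sets cover the plane. It serves to invert the Laplacian on an annulus.\<close>

lemma smooth_on_divide_norm_square:
  fixes f :: "plane \<Rightarrow> real"
  assumes f: "smooth_on f UNIV" and r: "0 < r" "\<And>x. norm x < r \<Longrightarrow> f x = 0"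
  shows "smooth_on (\<lambda>x. f x / (norm x)\<^sup>2) UNIV"
  unfolding smooth_on_def
proof
  fix n
  have "times_differentiable_on n (\<lambda>x. f x / (norm x)\<^sup>2) (ball 0 r \<union> (- {0}))"
  proof (rule times_differentiable_Un)
    show "times_differentiable_on n (\<lambda>x. f x / (norm x)\<^sup>2) (ball 0 r)"
      by (rule times_differentiable_cong[OF _ _ times_differentiable_const[of _ 0]]) (use r in auto)
    have U: "open (- {0::plane})" by auto
    have fS: "times_differentiable_on n f S" for S
      using f times_differentiable_subset[of S UNIV n f] by (simp add: smooth_on_def)
    have q: "times_differentiable_on n (\<lambda>x::plane. fst x * fst x + snd x * snd x) (- {0})"
      by (intro times_differentiable_add times_differentiable_mult U
          times_differentiable_bounded_linear bounded_linear_fst bounded_linear_snd)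
    have eq: "fst x * fst x + snd x * snd x = (norm x)\<^sup>2" for x :: plane
      by (simp add: norm_prod_def power2_eq_square)
    have "times_differentiable_on n (\<lambda>x. f x * inverse (fst x * fst x + snd x * snd x)) (- {0})"
      by (intro times_differentiable_mult times_differentiable_inverse U q fS) (simp add: eq)
    then show "times_differentiable_on n (\<lambda>x. f x / (norm x)\<^sup>2) (- {0})"
      unfolding eq by (simp add: divide_inverse)
  qed auto
  also have "ball 0 r \<union> (- {0}) = (UNIV :: plane set)" using r(1) by auto
  finally show "times_differentiable_on n (\<lambda>x. f x / (norm x)\<^sup>2) UNIV" .
qed

declare split_paired_All [simp del] split_paired_Ex [simp del]

section \<open>Absolutely convergent Fourier expansions of smooth symbols\<close>

text \<open>Integrating over the plane instead of the square removes boundary terms from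
  derivatives; for functions supported inside the square it agrees with
  \<open>fourier_coeff\<close>.\<close>

definition plane_coeff :: "(plane \<Rightarrow> real) \<Rightarrow> pdist" where
  "plane_coeff g k = (\<integral>x. complex_of_real (g x) * cnj (echar k x) \<partial>lborel)"

text \<open>The ball of radius 1/4 about the centre stays inside the fundamental square with margin
  1/4, so integrals over the plane and over the square agree.\<close>

definition bump :: "(plane \<Rightarrow> real) \<Rightarrow> bool" where
  "bump g \<longleftrightarrow> smooth_on g UNIV \<and> (\<forall>x. g x \<noteq> 0 \<longrightarrow> x \<in> cball (1/2, 1/2) (1/4))"

lemma bump_differentiable: "bump g \<Longrightarrow> g differentiable (at x)"
  unfolding bump_def smooth_on_def by (metis UNIV_I times_differentiable_on.simps(2))

lemma bump_continuous: "bump g \<Longrightarrow> continuous_on UNIV g"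
  unfolding bump_def smooth_on_def by (metis times_differentiable_on.simps(1))

lemma bump_bounded: assumes "bump g" obtains B where "B \<ge> 0" "\<And>x. \<bar>g x\<bar> \<le> B"
proof -
  have "compact (g ` cball (1/2, 1/2) (1/4))"
    using bump_continuous[OF assms] by (intro compact_continuous_image) (auto intro: continuous_on_subset)
  then obtain B where "\<forall>y\<in>g ` cball (1/2, 1/2) (1/4). norm y \<le> B"
    using compact_imp_bounded bounded_iff by metis
  then have "\<bar>g x\<bar> \<le> max B 0" for x
  proof (cases "g x = 0")
    case False
    then have "x \<in> cball (1/2, 1/2) (1/4)" using assms unfolding bump_def by blast
    then have "norm (g x) \<le> B" using \<open>\<forall>y\<in>g ` cball (1/2, 1/2) (1/4). norm y \<le> B\<close> by blast
    then show ?thesis by simp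
  qed simp
  then show ?thesis using that by (metis max.cobounded2)
qed

lemma bump_derivative:
  assumes "bump g"
  shows "bump (\<lambda>x. frechet_derivative g (at x) v)"
  unfolding bump_def
proof (intro conjI allI impI)
  show "smooth_on (\<lambda>x. frechet_derivative g (at x) v) UNIV"
    using assms unfolding bump_def smooth_on_def by (metis times_differentiable_on.simps(2))
  fix x assume ne: "frechet_derivative g (at x) v \<noteq> 0"
  show "x \<in> cball (1/2, 1/2) (1/4)"
  proof (rule ccontr)
    assume x: "x \<notin> cball (1/2, 1/2) (1/4)"
    have "frechet_derivative g (at x) = frechet_derivative (\<lambda>x. 0) (at x)"
      by (rule frechet_derivative_cong_open(2)[of "- cball (1/2, 1/2) (1/4)"])
         (use x assms in \<open>auto simp: bump_def\<close>)
    then show False using ne by (simp add: frechet_derivative_const)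
  qed
qed

text \<open>Gives the uniform bound on the difference quotients in the dominated convergence
  argument for \<open>plane_coeff_derivative\<close>.\<close>

lemma bump_lipschitz:
  assumes "bump g" "\<And>x. \<bar>frechet_derivative g (at x) v\<bar> \<le> B"
  shows "\<bar>g (x + t *\<^sub>R v) - g x\<bar> \<le> \<bar>t\<bar> * B"
proof -
  have D: "((\<lambda>s. g (x + s *\<^sub>R (t *\<^sub>R v))) has_derivative (\<lambda>h. frechet_derivative g (at (x + s *\<^sub>R (t *\<^sub>R v))) (h *\<^sub>R (t *\<^sub>R v)))) (at s within {0..1})"
    for s
  proof (rule has_derivative_compose[where f = "\<lambda>s. x + s *\<^sub>R (t *\<^sub>R v)"])
    show "((\<lambda>s. x + s *\<^sub>R (t *\<^sub>R v)) has_derivative (\<lambda>h. h *\<^sub>R (t *\<^sub>R v))) (at s within {0..1})"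
      by (auto intro!: derivative_eq_intros)
    show "(g has_derivative frechet_derivative g (at (x + s *\<^sub>R (t *\<^sub>R v)))) (at (x + s *\<^sub>R (t *\<^sub>R v)))"
      using bump_differentiable[OF assms(1)] by (simp add: frechet_derivative_works)
  qed
  obtain s where s: "g (x + 1 *\<^sub>R (t *\<^sub>R v)) - g (x + 0 *\<^sub>R (t *\<^sub>R v)) = frechet_derivative g (at (x + s *\<^sub>R (t *\<^sub>R v))) ((1 - 0) *\<^sub>R (t *\<^sub>R v))"
    using mvt_simple[of 0 1 "\<lambda>s. g (x + s *\<^sub>R (t *\<^sub>R v))", OF _ D] by auto
  let ?D = "frechet_derivative g (at (x + s *\<^sub>R (t *\<^sub>R v)))"
  have "linear ?D" using bump_differentiable[OF assms(1)] by (rule linear_frechet_derivative)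
  then have "?D (t *\<^sub>R v) = t *\<^sub>R ?D v" by (rule linear_cmul)
  then have "g (x + t *\<^sub>R v) - g x = t * ?D v" using s by simp
  then show ?thesis using assms(2) by (simp add: abs_mult mult_left_mono)
qed

lemma bump_measurable: "bump g \<Longrightarrow> g \<in> borel_measurable borel"
  by (intro borel_measurable_continuous_onI bump_continuous)

lemma integrable_bounded_support:
  fixes f :: "plane \<Rightarrow> complex"
  assumes "f \<in> borel_measurable borel" "\<And>x. cmod (f x) \<le> B * indicator (cball a r) x"
  shows "integrable lborel f"
proof (rule Bochner_Integration.integrable_bound)
  have "emeasure lborel (cball a r) < \<infinity>" by (rule emeasure_lborel_cball_finite)
  then show "integrable lborel (\<lambda>x. B * indicator (cball a r) x :: real)" by simp
  show "AE x in lborel. cmod (f x) \<le> norm (B * indicator (cball a r) x)"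
    using assms(2) by (intro AE_I2) (smt (verit) norm_ge_zero real_norm_def)
qed (use assms in simp)

lemma lborel_integral_translate:
  fixes f :: "plane \<Rightarrow> complex"
  assumes "f \<in> borel_measurable borel"
  shows "(\<integral>x. f (x + a) \<partial>lborel) = (\<integral>x. f x \<partial>lborel)"
proof -
  have "(\<integral>x. f x \<partial>lborel) = (\<integral>x. f x \<partial>distr lborel borel ((+) a))" by (simp add: lborel_distr_plus)
  also have "\<dots> = (\<integral>x. f (a + x) \<partial>lborel)" by (rule integral_distr) (use assms in auto)
  finally show ?thesis by (simp add: add.commute)
qed

text \<open>Instead of integrating by parts, the integral is translated: the difference quotient of
  \<open>g\<close> along \<open>v\<close> has the coefficient of \<open>g\<close> times (echar k (t
  v) - 1)/t, and t tends to 0 on both sides.\<close>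

lemma plane_coeff_derivative:
  assumes g: "bump g"
  shows "plane_coeff (\<lambda>x. frechet_derivative g (at x) v) k = 2 * pi * \<i> * of_real (freq k \<bullet> v) * plane_coeff g k"
proof -
  let ?D = "\<lambda>x. frechet_derivative g (at x) v"
  have gm: "g \<in> borel_measurable borel" by (rule bump_measurable[OF g])
  have Dm: "?D \<in> borel_measurable borel" by (rule bump_measurable[OF bump_derivative[OF g]])
  obtain B where B: "B \<ge> 0" "\<And>x. \<bar>?D x\<bar> \<le> B" using bump_bounded[OF bump_derivative[OF g]] by blast
  obtain B0 where B0: "B0 \<ge> 0" "\<And>x. \<bar>g x\<bar> \<le> B0" using bump_bounded[OF g] by blast
  define t where "t n = 1 / real (Suc n)" for n
  have t: "0 < t n" "t n \<le> 1" for n by (auto simp: t_def)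
  have tlim: "t \<longlonglongrightarrow> 0" unfolding t_def by (rule LIMSEQ_Suc[OF lim_const_over_n])
  have tf: "filterlim t (at 0) sequentially"
  proof (rule filterlim_atI[OF tlim])
    show "\<forall>\<^sub>F n in sequentially. t n \<noteq> 0" using t(1) by (intro always_eventually allI) (simp add: less_imp_neq[symmetric])
  qed
  let ?e = "\<lambda>x. cnj (echar k x)"
  have em: "?e \<in> borel_measurable borel" by (simp add: cnj_echar)
  have gtm: "(\<lambda>x. g (x + a)) \<in> borel_measurable borel" for a
    by (intro measurable_compose[OF _ gm]) simp
  have gint: "integrable lborel (\<lambda>x. complex_of_real (g x) * ?e x)"
    by (rule integrable_bounded_support[of _ B0 "(1/2,1/2)" "1/4"])
       (use g B0 gm em in \<open>auto simp: bump_def norm_mult indicator_def\<close>)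
  have gtint: "integrable lborel (\<lambda>x. complex_of_real (g (x + a)) * ?e x)" for a
  proof (rule integrable_bounded_support[of _ B0 "(1/2,1/2) - a" "1/4"])
    fix x
    have "dist ((1/2,1/2) - a) x = dist (1/2,1/2) (x + a)" by (simp add: dist_norm algebra_simps)
    then show "cmod (complex_of_real (g (x + a)) * ?e x) \<le> B0 * indicator (cball ((1/2,1/2) - a) (1/4)) x"
      using g B0 by (auto simp: bump_def norm_mult indicator_def mem_cball)
  qed (use gtm em in auto)
  have lhs: "(\<lambda>n. \<integral>x. complex_of_real ((g (x + t n *\<^sub>R v) - g x) / t n) * ?e x \<partial>lborel)
      \<longlonglongrightarrow> (\<integral>x. complex_of_real (?D x) * ?e x \<partial>lborel)"
  \<comment> \<open>Since \<open>t n \<le> 1\<close>, all difference quotients are supported in the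
    ball enlarged by \<open>norm v\<close> and bounded by the Lipschitz constant
    \<open>B\<close>.\<close>
  proof (rule integral_dominated_convergence[where w = "\<lambda>x. B * indicator (cball (1/2, 1/2) (1/4 + norm v)) x"])
    have "emeasure lborel (cball (1/2::real, 1/2::real) (1/4 + norm v)) < \<infinity>" by (rule emeasure_lborel_cball_finite)
    then show "integrable lborel (\<lambda>x. B * indicator (cball (1/2::real, 1/2::real) (1/4 + norm v)) x :: real)" by simp
    show "AE x in lborel. (\<lambda>n. complex_of_real ((g (x + t n *\<^sub>R v) - g x) / t n) * ?e x) \<longlonglongrightarrow> complex_of_real (?D x) * ?e x"
    proof (intro AE_I2 tendsto_intros)
      fix x
      have "((\<lambda>s. g (x + s *\<^sub>R v)) has_derivative (\<lambda>h. frechet_derivative g (at (x + 0 *\<^sub>R v)) (h *\<^sub>R v))) (at 0)"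
      proof (rule has_derivative_compose[where f = "\<lambda>s. x + s *\<^sub>R v"])
        show "((\<lambda>s. x + s *\<^sub>R v) has_derivative (\<lambda>h. h *\<^sub>R v)) (at 0)"
          by (auto intro!: derivative_eq_intros)
        show "(g has_derivative frechet_derivative g (at (x + 0 *\<^sub>R v))) (at (x + 0 *\<^sub>R v))"
          using bump_differentiable[OF g] by (simp add: frechet_derivative_works)
      qed
      moreover have "(\<lambda>h. frechet_derivative g (at (x + 0 *\<^sub>R v)) (h *\<^sub>R v)) = times (?D x)"
        using linear_cmul[OF linear_frechet_derivative[OF bump_differentiable[OF g]]]
        by (simp add: fun_eq_iff mult.commute)
      ultimately have "DERIV (\<lambda>s. g (x + s *\<^sub>R v)) 0 :> ?D x"
        by (simp only: has_field_derivative_def)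
      then have "((\<lambda>s. (g (x + s *\<^sub>R v) - g x) / s) \<longlongrightarrow> ?D x) (at 0)"
        by (simp add: DERIV_def)
      from filterlim_compose[OF this tf]
      show "(\<lambda>n. (g (x + t n *\<^sub>R v) - g x) / t n) \<longlonglongrightarrow> ?D x" .
    qed
    show "AE x in lborel. cmod (complex_of_real ((g (x + t n *\<^sub>R v) - g x) / t n) * ?e x)
        \<le> B * indicator (cball (1/2, 1/2) (1/4 + norm v)) x" for n
    proof (rule AE_I2)
      fix x
      show "cmod (complex_of_real ((g (x + t n *\<^sub>R v) - g x) / t n) * ?e x)
        \<le> B * indicator (cball (1/2, 1/2) (1/4 + norm v)) x"
      proof (cases "x \<in> cball (1/2, 1/2) (1/4 + norm v)")
        case True
        have "\<bar>g (x + t n *\<^sub>R v) - g x\<bar> \<le> t n * B" using bump_lipschitz[OF g B(2), of x "t n"] t[of n] by simp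
        then have "\<bar>g (x + t n *\<^sub>R v) - g x\<bar> / t n \<le> B" using t[of n] by (simp add: divide_le_eq mult.commute)
        then show ?thesis using True t[of n]
          by (simp add: norm_mult abs_divide del: of_real_diff of_real_divide)
      next
        case False
        have "norm (t n *\<^sub>R v) \<le> norm v" using t[of n] by (simp add: mult_left_le_one_le)
        moreover have "dist (1/2, 1/2) x \<le> dist (1/2, 1/2) (x + t n *\<^sub>R v) + norm (t n *\<^sub>R v)"
          using dist_triangle[of "(1/2, 1/2)" x "x + t n *\<^sub>R v"] by (simp add: dist_norm)
        ultimately have "x + t n *\<^sub>R v \<notin> cball (1/2, 1/2) (1/4)" "x \<notin> cball (1/2, 1/2) (1/4)"
          using False norm_ge_zero[of v] unfolding mem_cball by linarith+
        then have "g (x + t n *\<^sub>R v) = 0" "g x = 0" using g unfolding bump_def by blast+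
        then show ?thesis using B by (simp add: indicator_def)
      qed
    qed
  qed (use gm gtm em Dm in auto)
  have rhs: "(\<integral>x. complex_of_real ((g (x + t n *\<^sub>R v) - g x) / t n) * ?e x \<partial>lborel)
      = (echar k (t n *\<^sub>R v) - 1) / of_real (t n) * plane_coeff g k" for n
  proof -
    have "(\<integral>x. complex_of_real (g (x + t n *\<^sub>R v)) * ?e x \<partial>lborel)
        = (\<integral>x. echar k (t n *\<^sub>R v) * (complex_of_real (g (x + t n *\<^sub>R v)) * ?e (x + t n *\<^sub>R v)) \<partial>lborel)"
    proof (rule Bochner_Integration.integral_cong[OF refl])
      fix x
      have "echar k (t n *\<^sub>R v) * cnj (echar k (t n *\<^sub>R v)) = 1" by (simp flip: complex_norm_square)
      then have "echar k (t n *\<^sub>R v) * ?e (x + t n *\<^sub>R v) = ?e x"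
        by (simp add: echar_add_right mult.left_commute)
      then show "complex_of_real (g (x + t n *\<^sub>R v)) * ?e x =
          echar k (t n *\<^sub>R v) * (complex_of_real (g (x + t n *\<^sub>R v)) * ?e (x + t n *\<^sub>R v))"
        by (metis mult.left_commute)
    qed
    also have "\<dots> = echar k (t n *\<^sub>R v) * plane_coeff g k"
      unfolding plane_coeff_def integral_mult_right_zero
      by (subst lborel_integral_translate[of "\<lambda>x. complex_of_real (g x) * ?e x"]) (use gm em in auto)
    finally have 1: "(\<integral>x. complex_of_real (g (x + t n *\<^sub>R v)) * ?e x \<partial>lborel) = echar k (t n *\<^sub>R v) * plane_coeff g k" .
    have "(\<integral>x. complex_of_real ((g (x + t n *\<^sub>R v) - g x) / t n) * ?e x \<partial>lborel)
       = (\<integral>x. (complex_of_real (g (x + t n *\<^sub>R v)) * ?e x - complex_of_real (g x) * ?e x) / of_real (t n) \<partial>lborel)"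
      by (intro Bochner_Integration.integral_cong refl) (simp add: diff_divide_distrib left_diff_distrib)
    also have "\<dots> = (echar k (t n *\<^sub>R v) * plane_coeff g k - plane_coeff g k) / of_real (t n)"
      using gtint gint by (simp add: 1) (simp add: plane_coeff_def)
    finally show ?thesis by (simp add: left_diff_distrib diff_divide_distrib)
  qed
  have "((\<lambda>s. (exp (of_real s * (2 * pi * \<i> * of_real (freq k \<bullet> v))) - 1) / of_real s) \<longlongrightarrow> 2 * pi * \<i> * of_real (freq k \<bullet> v)) (at (0::real))"
  proof -
    let ?c = "2 * pi * \<i> * complex_of_real (freq k \<bullet> v)"
    have "((\<lambda>z. exp (z * ?c)) has_field_derivative ?c) (at 0)"
      by (auto intro!: derivative_eq_intros)
    then have "((\<lambda>z. (exp (z * ?c) - 1) / z) \<longlongrightarrow> ?c) (at 0)" by (simp add: DERIV_def)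
    moreover have "filterlim complex_of_real (at 0) (at (0::real))"
    proof (rule filterlim_atI)
      show "(complex_of_real \<longlongrightarrow> 0) (at 0)"
        using tendsto_of_real[OF tendsto_ident_at, of 0 UNIV, where 'a = complex] by simp
    qed (simp add: eventually_at_filter)
    ultimately show ?thesis by (rule filterlim_compose)
  qed
  from filterlim_compose[OF this tf]
  have "(\<lambda>n. (echar k (t n *\<^sub>R v) - 1) / of_real (t n)) \<longlonglongrightarrow> 2 * pi * \<i> * of_real (freq k \<bullet> v)"
    by (simp add: echar_def mult_ac)
  then have "(\<lambda>n. (echar k (t n *\<^sub>R v) - 1) / of_real (t n) * plane_coeff g k) \<longlonglongrightarrow> 2 * pi * \<i> * of_real (freq k \<bullet> v) * plane_coeff g k"
    by (intro tendsto_intros)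
  with lhs show ?thesis unfolding rhs plane_coeff_def[of ?D] by (rule LIMSEQ_unique)
qed

lemma plane_coeff_bounded:
  assumes g: "bump g"
  shows "\<exists>C\<ge>0. \<forall>k. cmod (plane_coeff g k) \<le> C"
proof -
  obtain B where B: "B \<ge> 0" "\<And>x. \<bar>g x\<bar> \<le> B" using bump_bounded[OF g] by blast
  let ?w = "\<lambda>x. B * indicator (cball (1/2::real, 1/2::real) (1/4)) x :: real"
  have "emeasure lborel (cball (1/2::real, 1/2::real) (1/4)) < \<infinity>" by (rule emeasure_lborel_cball_finite)
  then have wi: "integrable lborel ?w" by simp
  have le: "cmod (complex_of_real (g x) * cnj (echar k x)) \<le> ?w x" for x k
    using g B by (auto simp: bump_def norm_mult indicator_def)
  have "cmod (plane_coeff g k) \<le> (\<integral>x. ?w x \<partial>lborel)" for k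
    unfolding plane_coeff_def
  proof (rule order_trans[OF integral_norm_bound integral_mono])
    have "(\<lambda>x. complex_of_real (g x) * cnj (echar k x)) \<in> borel_measurable borel"
      using bump_measurable[OF g] by (simp add: cnj_echar)
    from integrable_bounded_support[OF this le]
    show "integrable lborel (\<lambda>x. cmod (complex_of_real (g x) * cnj (echar k x)))" by (rule integrable_norm)
  qed (use wi le in auto)
  moreover have "(\<integral>x. ?w x \<partial>lborel) \<ge> 0" using B by (intro Bochner_Integration.integral_nonneg) auto
  ultimately show ?thesis by blast
qed

text \<open>Three derivatives per direction: one power of the frequency is later spent on the weight
  \<open>1 + norm (freq k)\<close>, and two must remain for summability. The factor (2 pi)^3 \<ge> 1
  is discarded.\<close>

lemma plane_coeff_cubic:
  assumes g: "bump g"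
  obtains g' where "bump g'" "\<And>k. \<bar>freq k \<bullet> v\<bar> ^ 3 * cmod (plane_coeff g k) \<le> cmod (plane_coeff g' k)"
proof -
  let ?D = "\<lambda>g x. frechet_derivative g (at x) v"
  define g' where "g' = ?D (?D (?D g))"
  have b: "bump g'" unfolding g'_def by (intro bump_derivative g)
  have eq: "plane_coeff g' k = (2 * pi * \<i> * of_real (freq k \<bullet> v)) ^ 3 * plane_coeff g k" for k
    unfolding g'_def
    by (simp only: plane_coeff_derivative bump_derivative g) (simp add: power3_eq_cube mult_ac)
  have 1: "\<bar>freq k \<bullet> v\<bar> ^ 3 \<le> cmod ((2 * pi * \<i> * of_real (freq k \<bullet> v)) ^ 3)" for k
  proof -
    have "1 \<le> (2 * pi) ^ 3" using pi_ge_two by (intro one_le_power) linarith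
    then have "1 * \<bar>freq k \<bullet> v\<bar> ^ 3 \<le> (2 * pi) ^ 3 * \<bar>freq k \<bullet> v\<bar> ^ 3" by (intro mult_right_mono) auto
    then show ?thesis by (simp add: norm_power norm_mult power_mult_distrib)
  qed
  show ?thesis
  proof (rule that[OF b])
    fix k
    show "\<bar>freq k \<bullet> v\<bar> ^ 3 * cmod (plane_coeff g k) \<le> cmod (plane_coeff g' k)"
      unfolding eq norm_mult[of "_ ^ 3"] by (intro mult_right_mono 1) simp
  qed
qed

text \<open>The four terms of the expanded product are bounded by the coefficients of
  \<open>g\<close>, of its third derivatives \<open>g1\<close> and \<open>g2\<close> in the two
  coordinate directions, and of the mixed derivative \<open>g3\<close>.\<close>

lemma plane_coeff_decay:
  assumes g: "bump g"
  shows "\<exists>C\<ge>0. \<forall>k. (1 + \<bar>real_of_int (fst k)\<bar> ^ 3) * (1 + \<bar>real_of_int (snd k)\<bar> ^ 3) * cmod (plane_coeff g k) \<le> C"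
proof -
  obtain g1 where g1: "bump g1" "\<And>k. \<bar>freq k \<bullet> (1,0)\<bar> ^ 3 * cmod (plane_coeff g k) \<le> cmod (plane_coeff g1 k)"
    using plane_coeff_cubic[OF g] by metis
  obtain g2 where g2: "bump g2" "\<And>k. \<bar>freq k \<bullet> (0,1)\<bar> ^ 3 * cmod (plane_coeff g k) \<le> cmod (plane_coeff g2 k)"
    using plane_coeff_cubic[OF g] by metis
  obtain g3 where g3: "bump g3" "\<And>k. \<bar>freq k \<bullet> (0,1)\<bar> ^ 3 * cmod (plane_coeff g1 k) \<le> cmod (plane_coeff g3 k)"
    using plane_coeff_cubic[OF g1(1)] by metis
  obtain C0 C1 C2 C3 where C: "C0 \<ge> 0" "C1 \<ge> 0" "C2 \<ge> 0" "C3 \<ge> 0"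
    "\<And>k. cmod (plane_coeff g k) \<le> C0" "\<And>k. cmod (plane_coeff g1 k) \<le> C1"
    "\<And>k. cmod (plane_coeff g2 k) \<le> C2" "\<And>k. cmod (plane_coeff g3 k) \<le> C3"
    using plane_coeff_bounded[OF g] plane_coeff_bounded[OF g1(1)] plane_coeff_bounded[OF g2(1)]
      plane_coeff_bounded[OF g3(1)] by metis
  have "(1 + \<bar>real_of_int (fst k)\<bar> ^ 3) * (1 + \<bar>real_of_int (snd k)\<bar> ^ 3) * cmod (plane_coeff g k) \<le> C0 + C1 + C2 + C3" for k
  proof -
    define a b c where "a = \<bar>real_of_int (fst k)\<bar> ^ 3" and "b = \<bar>real_of_int (snd k)\<bar> ^ 3" and "c = cmod (plane_coeff g k)"
    have ab: "a * c \<le> cmod (plane_coeff g1 k)" "b * c \<le> cmod (plane_coeff g2 k)"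
      "b * cmod (plane_coeff g1 k) \<le> cmod (plane_coeff g3 k)"
      using g1(2)[of k] g2(2)[of k] g3(2)[of k] by (simp_all add: a_def b_def c_def freq_def)
    have "b \<ge> 0" by (simp add: b_def)
    then have "b * (a * c) \<le> b * cmod (plane_coeff g1 k)" using ab(1) by (rule mult_left_mono[rotated])
    then have "b * (a * c) \<le> C3" using ab(3) C(8)[of k] by linarith
    moreover have "a * c \<le> C1" "b * c \<le> C2" "c \<le> C0"
      using ab C(5)[of k] C(6)[of k] C(7)[of k] by (auto simp: c_def intro: order_trans)
    moreover have "(1 + a) * (1 + b) * c = c + a * c + b * c + b * (a * c)" by (simp add: algebra_simps)
    ultimately show ?thesis unfolding a_def b_def c_def by linarith
  qed
  then show ?thesis using C(1-4) by (intro exI[of _ "C0 + C1 + C2 + C3"]) auto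
qed

section \<open>Summability over the lattice\<close>

lemma summable_on_int_inverse_square: "(\<lambda>n::int. 1 / (1 + (real_of_int n)\<^sup>2)) summable_on UNIV"
proof -
  have 1: "(\<lambda>n::nat. 1 / (1 + (real n)\<^sup>2)) summable_on UNIV"
  proof (rule summable_on_UNIV_nonneg_real_iff[THEN iffD2])
    show "summable (\<lambda>n::nat. 1 / (1 + (real n)\<^sup>2))"
    proof (rule summable_comparison_test'[where N = 1])
      show "summable (\<lambda>n. inverse (real n ^ 2))" by (rule inverse_power_summable) simp
      show "norm (1 / (1 + (real n)\<^sup>2)) \<le> inverse (real n ^ 2)" if "n \<ge> 1" for n
      proof -
        have "1 / (1 + (real n)\<^sup>2) \<le> 1 / (real n)\<^sup>2"
          using that by (intro divide_left_mono mult_pos_pos add_pos_nonneg) auto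
        then show ?thesis by (simp add: inverse_eq_divide abs_of_nonneg)
      qed
    qed
  qed simp
  have "(\<lambda>n::int. 1 / (1 + (real_of_int n)\<^sup>2)) summable_on (range int)"
    by (subst summable_on_reindex) (use 1 in \<open>auto simp: o_def inj_on_def\<close>)
  moreover have "(\<lambda>n::int. 1 / (1 + (real_of_int n)\<^sup>2)) summable_on (range (\<lambda>n. - int n))"
    by (subst summable_on_reindex) (use 1 in \<open>auto simp: o_def inj_on_def\<close>)
  ultimately have "(\<lambda>n::int. 1 / (1 + (real_of_int n)\<^sup>2)) summable_on (range int \<union> range (\<lambda>n. - int n))"
    by (rule summable_on_union)
  also have "range int \<union> range (\<lambda>n. - int n) = UNIV"
    by (auto intro: int_cases2)
  finally show ?thesis .
qed

lemma summable_on_Times_nonneg: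
  fixes f :: "'i \<Rightarrow> real" and g :: "'j \<Rightarrow> real"
  assumes f: "f summable_on A" "\<And>i. i \<in> A \<Longrightarrow> 0 \<le> f i" and g: "g summable_on B" "\<And>j. j \<in> B \<Longrightarrow> 0 \<le> g j"
  shows "(\<lambda>p. f (fst p) * g (snd p)) summable_on A \<times> B"
proof (rule nonneg_bdd_above_summable_on)
  show "bdd_above (sum (\<lambda>p. f (fst p) * g (snd p)) ` {F. F \<subseteq> A \<times> B \<and> finite F})"
  proof (rule bdd_aboveI2)
    fix F assume "F \<in> {F. F \<subseteq> A \<times> B \<and> finite F}"
    then have F: "F \<subseteq> A \<times> B" "finite F" by auto
    have AB: "fst ` F \<subseteq> A" "snd ` F \<subseteq> B" using F(1) by auto
    have "F \<subseteq> fst ` F \<times> snd ` F" by force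
    then have "sum (\<lambda>p. f (fst p) * g (snd p)) F \<le> sum (\<lambda>p. f (fst p) * g (snd p)) (fst ` F \<times> snd ` F)"
      using F(2) AB f(2) g(2) by (intro sum_mono2) (auto intro!: mult_nonneg_nonneg)
    also have "\<dots> = sum f (fst ` F) * sum g (snd ` F)"
      by (simp only: sum_product sum.cartesian_product case_prod_unfold)
    also have "\<dots> \<le> infsum f A * infsum g B"
      using F(2) AB f g by (intro mult_mono finite_sum_le_infsum sum_nonneg infsum_nonneg) auto
    finally show "sum (\<lambda>p. f (fst p) * g (snd p)) F \<le> infsum f A * infsum g B" .
  qed
qed (use f g in auto)

lemma summable_on_lattice:
  "(\<lambda>k::int \<times> int. 1 / (1 + (real_of_int (fst k))\<^sup>2) * (1 / (1 + (real_of_int (snd k))\<^sup>2))) summable_on UNIV"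
  using summable_on_Times_nonneg[OF summable_on_int_inverse_square _ summable_on_int_inverse_square]
  by (simp add: add_nonneg_nonneg)

text \<open>The weight \<open>1 + norm (freq k)\<close> goes beyond absolute convergence: it pays
  for the increments of characters in the commutator estimate.\<close>

lemma plane_coeff_summable:
  assumes g: "bump g"
  shows "(\<lambda>k. cmod (plane_coeff g k) * (1 + norm (freq k))) summable_on UNIV"
proof -
  obtain C where C: "C \<ge> 0" "\<And>k. (1 + \<bar>real_of_int (fst k)\<bar> ^ 3) * (1 + \<bar>real_of_int (snd k)\<bar> ^ 3) * cmod (plane_coeff g k) \<le> C"
    using plane_coeff_decay[OF g] by blast
  have el: "(1 + a) * (1 + a\<^sup>2) \<le> 4 * (1 + a ^ 3)" if "a \<ge> 0" for a :: real
  proof -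
    have "a \<le> 1 + a ^ 3" "a\<^sup>2 \<le> 1 + a ^ 3"
    proof -
      show "a \<le> 1 + a ^ 3"
      proof (cases "a \<le> 1")
        case True then show ?thesis using that by (simp add: add_increasing2)
      next
        case False then have "a ^ 1 \<le> a ^ 3" by (intro power_increasing) auto
        then show ?thesis by simp
      qed
      show "a\<^sup>2 \<le> 1 + a ^ 3"
      proof (cases "a \<le> 1")
        case True then have "a\<^sup>2 \<le> 1" using that by (simp add: power_le_one)
        then show ?thesis using that by (simp add: add_increasing2)
      next
        case False then have "a ^ 2 \<le> a ^ 3" by (intro power_increasing) auto
        then show ?thesis by simp
      qed
    qed
    moreover have "0 \<le> a ^ 3" using that by simp
    ultimately have "1 + a + a\<^sup>2 + a ^ 3 \<le> 4 * (1 + a ^ 3)"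
      unfolding distrib_left mult_1_right by (smt (verit))
    moreover have "(1 + a) * (1 + a\<^sup>2) = 1 + a + a\<^sup>2 + a ^ 3" by (simp add: power2_eq_square power3_eq_cube algebra_simps)
    ultimately show ?thesis by simp
  qed
  show ?thesis
  proof (rule summable_on_comparison_test)
    show "(\<lambda>k. 16 * C * (1 / (1 + (real_of_int (fst k))\<^sup>2) * (1 / (1 + (real_of_int (snd k))\<^sup>2)))) summable_on UNIV"
      by (intro summable_on_cmult_right summable_on_lattice)
    fix k :: "int \<times> int"
    define a b c where "a = \<bar>real_of_int (fst k)\<bar>" and "b = \<bar>real_of_int (snd k)\<bar>" and "c = cmod (plane_coeff g k)"
    have ab: "a \<ge> 0" "b \<ge> 0" "c \<ge> 0" by (auto simp: a_def b_def c_def)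
    have "norm (freq k) \<le> a + b"
      unfolding freq_def a_def b_def using norm_Pair_le[of "real_of_int (fst k)" "real_of_int (snd k)"] by simp
    then have "1 + norm (freq k) \<le> (1 + a) * (1 + b)" using mult_nonneg_nonneg[OF ab(1,2)] by (simp add: algebra_simps)
    then have "c * (1 + norm (freq k)) * ((1 + a\<^sup>2) * (1 + b\<^sup>2)) \<le> c * ((1 + a) * (1 + b)) * ((1 + a\<^sup>2) * (1 + b\<^sup>2))"
      using ab by (intro mult_right_mono mult_left_mono) auto
    also have "\<dots> = c * (((1 + a) * (1 + a\<^sup>2)) * ((1 + b) * (1 + b\<^sup>2)))" by (simp add: mult_ac)
    also have "\<dots> \<le> c * ((4 * (1 + a ^ 3)) * (4 * (1 + b ^ 3)))"
      using ab by (intro mult_left_mono mult_mono[OF el[OF ab(1)] el[OF ab(2)]]) auto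
    also have "\<dots> = 16 * ((1 + a ^ 3) * (1 + b ^ 3) * c)" by (simp only: mult_ac)
    also have "\<dots> \<le> 16 * C" using C(2)[of k] by (simp add: a_def b_def c_def)
    finally have "c * (1 + norm (freq k)) * ((1 + a\<^sup>2) * (1 + b\<^sup>2)) \<le> 16 * C" .
    moreover have "0 < (1 + a\<^sup>2) * (1 + b\<^sup>2)" by (intro mult_pos_pos add_pos_nonneg) auto
    ultimately have "c * (1 + norm (freq k)) \<le> 16 * C / ((1 + a\<^sup>2) * (1 + b\<^sup>2))"
      by (simp add: pos_le_divide_eq)
    then show "cmod (plane_coeff g k) * (1 + norm (freq k)) \<le> 16 * C * (1 / (1 + (real_of_int (fst k))\<^sup>2) * (1 / (1 + (real_of_int (snd k))\<^sup>2)))"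
      by (simp add: a_def b_def c_def)
  qed simp
qed

lemma fourier_coeff_bump:
  assumes g: "bump g"
  shows "fourier_coeff (\<lambda>x. complex_of_real (g x)) = plane_coeff g"
proof
  fix k
  have "indicator ({0..1} \<times> {0..1}) x *\<^sub>R (complex_of_real (g x) * cnj (echar k x)) = complex_of_real (g x) * cnj (echar k x)" for x
  proof (cases "g x = 0")
    case False
    then have "dist (1/2, 1/2) x \<le> 1/4" using g by (auto simp: bump_def)
    then have "dist (1/2) (fst x) \<le> 1/4" "dist (1/2) (snd x) \<le> 1/4"
      using dist_fst_le[of "(1/2,1/2)" x] dist_snd_le[of "(1/2,1/2)" x] by auto
    then have "fst x \<in> {0..1}" "snd x \<in> {0..1}" unfolding dist_real_def atLeastAtMost_iff by linarith+
    then show ?thesis by (simp add: indicator_def mem_Times_iff)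
  qed simp
  then show "fourier_coeff (\<lambda>x. complex_of_real (g x)) k = plane_coeff g k"
    unfolding fourier_coeff_def plane_coeff_def integral_torus by simp
qed

text \<open>The series converges uniformly to a continuous function with the same coefficients,
  hence equal to \<open>g\<close> almost everywhere. On the open square the exceptional set is open
  and null, hence empty.\<close>

lemma fourier_inversion_bump:
  assumes g: "bump g" and y: "y \<in> {0<..<1} \<times> {0<..<1}"
  shows "complex_of_real (g y) = (\<Sum>\<^sub>\<infinity>k. plane_coeff g k * echar k y)"
proof -
  let ?f = "plane_coeff g"
  define h where "h y = (\<Sum>\<^sub>\<infinity>k. ?f k * echar k y)" for y
  have "(\<lambda>k. cmod (?f k)) summable_on UNIV"
    by (rule summable_on_comparison_test[OF plane_coeff_summable[OF g]]) (auto simp: algebra_simps)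
  then have ul: "uniform_limit UNIV (\<lambda>K y. \<Sum>k\<in>K. ?f k * echar k y) h (finite_subsets_at_top UNIV)"
    unfolding h_def by (intro Weierstrass_m_test_general) (auto simp: norm_mult)
  have hc: "continuous_on UNIV h"
    by (rule uniform_limit_theorem[OF _ ul])
       (auto intro!: always_eventually continuous_intros)
  have hm: "h \<in> borel_measurable torus" by (intro measurable_torus borel_measurable_continuous_onI hc)
  obtain B where B: "B \<ge> 0" "\<And>x. \<bar>g x\<bar> \<le> B" using bump_bounded[OF g] by blast
  have gm: "(\<lambda>x. complex_of_real (g x)) \<in> borel_measurable torus"
    using bump_measurable[OF g] by (intro measurable_torus) simp
  have gi: "integrable torus (\<lambda>x. complex_of_real (g x))"
    by (rule integrable_torus_bounded[OF gm, of B]) (use B in simp)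
  have close: "\<exists>K. finite K \<and> k \<in> K \<and> (\<forall>x. cmod (h x - eval_series (restrict_freq K ?f) x) \<le> e)" if "e > 0" for e k
  proof -
    have "\<forall>\<^sub>F K in finite_subsets_at_top UNIV. \<forall>x\<in>UNIV. dist (\<Sum>k\<in>K. ?f k * echar k x) (h x) < e"
      using ul that unfolding uniform_limit_iff by blast
    then obtain K0 where K0: "finite K0" "\<And>K x. finite K \<Longrightarrow> K0 \<subseteq> K \<Longrightarrow> dist (\<Sum>k\<in>K. ?f k * echar k x) (h x) < e"
      by (auto simp: eventually_finite_subsets_at_top)
    have "cmod (h x - eval_series (restrict_freq (insert k K0) ?f) x) \<le> e" for x
    proof -
      have "dist (\<Sum>k\<in>insert k K0. ?f k * echar k x) (h x) < e"
        by (rule K0(2)) (use K0(1) in auto)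
      then show ?thesis using K0(1) by (subst eval_restrict) (simp_all only: dist_norm norm_minus_commute less_imp_le finite_insert)
    qed
    then show ?thesis using K0(1) by (intro exI[of _ "insert k K0"]) auto
  qed
  obtain K1 where K1: "finite K1" "\<And>x. cmod (h x - eval_series (restrict_freq K1 ?f) x) \<le> 1" using close[of 1 0] by auto
  have hi: "integrable torus h"
  proof (rule integrable_torus_bounded[OF hm])
    fix x
    show "cmod (h x) \<le> 1 + Linf_norm (restrict_freq K1 ?f)"
      using K1(2)[of x] cmod_eval_le_Linf[OF trig_poly_restrict[OF K1(1)], of ?f x]
        norm_triangle_ineq2[of "h x" "eval_series (restrict_freq K1 ?f) x"] by linarith
  qed
  have hco: "fourier_coeff h k = ?f k" for k
  proof -
    have "cmod (fourier_coeff h k - ?f k) \<le> e" if "e > 0" for e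
    proof -
      obtain K where K: "finite K" "k \<in> K" "\<And>x. cmod (h x - eval_series (restrict_freq K ?f) x) \<le> e"
        using close[OF \<open>e > 0\<close>] by blast
      let ?s = "eval_series (restrict_freq K ?f)"
      have si: "integrable torus ?s" by (intro L2_fun_integrable L2_fun_trig trig_poly_restrict K)
      have "fourier_coeff h k - ?f k = fourier_coeff (\<lambda>x. h x - ?s x) k"
        unfolding fourier_coeff_diff[OF hi si] fourier_coeff_trig[OF trig_poly_restrict[OF K(1)]]
        using K(2) by (simp add: restrict_freq_def)
      also have "cmod \<dots> \<le> (\<integral>x. cmod (h x - ?s x) \<partial>torus)"
        by (rule cmod_fourier_coeff_le) (use hi si in simp)
      also have "\<dots> \<le> e"
      proof -
        interpret prob_space torus by (rule prob_space_torus)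
        show ?thesis by (rule integral_le_const) (use hi si K in auto)
      qed
      finally show ?thesis .
    qed
    then have "cmod (fourier_coeff h k - ?f k) \<le> 0" by (meson field_le_epsilon add_0 order_refl dense_ge)
    then show ?thesis by simp
  qed
  let ?d = "\<lambda>x. complex_of_real (g x) - h x"
  have "AE x in torus. ?d x = 0"
  proof (rule fourier_coeff_unique)
    show "integrable torus ?d" using gi hi by simp
    show "fourier_coeff ?d k = 0" for k
      unfolding fourier_coeff_diff[OF gi hi] fourier_coeff_bump[OF g] by (simp add: hco)
  qed
  then have AE: "AE x in lborel. x \<in> {0..1} \<times> {0..1} \<longrightarrow> ?d x = 0"
    unfolding torus_def by (subst (asm) AE_restrict_space_iff) auto
  let ?U = "({0<..<1} \<times> {0<..<1}) \<inter> {x. ?d x \<noteq> 0}"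
  have cd: "continuous_on UNIV ?d" by (intro continuous_intros bump_continuous[OF g] hc)
  have "open {x. ?d x \<noteq> 0}"
    using open_Collect_neq[OF cd continuous_on_const[of UNIV 0]] by simp
  then have U: "open ?U" by (intro open_Int open_Times) auto
  have "?U \<in> null_sets lborel"
  proof (rule AE_iff_null_sets[THEN iffD2])
    show "?U \<in> sets lborel" using U by simp
    show "AE x in lborel. x \<notin> ?U" using AE by eventually_elim auto
  qed
  then have "negligible ?U" by (simp add: negligible_iff_null_sets null_sets_completionI)
  then have "?U = {}" using U open_not_negligible by blast
  then have "?d y = 0" using y by blast
  then show ?thesis by (simp add: h_def)
qed

text \<open>The frequencies of the expansion are scaled so that the ball of radius \<open>L\<close> sits well inside
  one period; hence the exponentials represent the symbol on that ball only.\<close>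

lemma wiener_expansion:
  fixes \<psi> :: "plane \<Rightarrow> real"
  assumes s: "smooth_on \<psi> UNIV" and R: "\<And>x. \<psi> x \<noteq> 0 \<Longrightarrow> norm x \<le> R"
  obtains c \<kappa> where "\<kappa> > 0" "(\<lambda>n. cmod (c n) * (1 + norm (freq n))) summable_on UNIV"
    "\<And>x. norm x \<le> L \<Longrightarrow> complex_of_real (\<psi> x) = (\<Sum>\<^sub>\<infinity>n. c n * echar n (\<kappa> *\<^sub>R x))"
proof -
  define M where "M = max (max L R) 1"
  define \<kappa> where "\<kappa> = 1 / (4 * M)"
  have M: "M \<ge> 1" "L \<le> M" "R \<le> M" by (auto simp: M_def)
  have k: "\<kappa> > 0" using M by (simp add: \<kappa>_def)
  let ?h = "(1/2, 1/2) :: plane"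
  define g where "g y = \<psi> ((- 1 / \<kappa>) *\<^sub>R ?h + (1 / \<kappa>) *\<^sub>R y)" for y
  have geq: "g y = \<psi> ((1 / \<kappa>) *\<^sub>R (y - ?h))" for y
  proof -
    have "(- 1 / \<kappa>) *\<^sub>R a + (1 / \<kappa>) *\<^sub>R y = (1 / \<kappa>) *\<^sub>R (y - a)" for a :: plane
      by (simp add: algebra_simps)
    then show ?thesis by (simp only: g_def)
  qed
  have g: "bump g"
    unfolding bump_def
  proof (intro conjI allI impI)
    show "smooth_on g UNIV" unfolding g_def by (rule smooth_on_affine[OF s])
    fix y assume "g y \<noteq> 0"
    then have "norm ((1 / \<kappa>) *\<^sub>R (y - ?h)) \<le> M" using R M(3) unfolding geq by (meson order_trans)
    then have "norm (y - ?h) / \<kappa> \<le> M" using k by simp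
    then have "norm (y - ?h) \<le> M * \<kappa>" using k by (simp add: pos_divide_le_eq)
    also have "\<dots> = 1/4" using M by (simp add: \<kappa>_def)
    finally show "y \<in> cball ?h (1/4)" by (simp add: mem_cball dist_norm norm_minus_commute)
  qed
  \<comment> \<open>\<open>g\<close> is \<psi> dilated and recentred at (1/2, 1/2); the phase undoes
    the recentring.\<close>
  define c where "c n = plane_coeff g n * echar n ?h" for n
  show ?thesis
  proof (rule that[OF k])
    show "(\<lambda>n. cmod (c n) * (1 + norm (freq n))) summable_on UNIV"
      using plane_coeff_summable[OF g] by (simp add: c_def norm_mult)
    fix x :: plane assume x: "norm x \<le> L"
    have "norm (\<kappa> *\<^sub>R x) \<le> \<kappa> * M" using k x M(2) by simp
    also have "\<dots> = 1/4" using M by (simp add: \<kappa>_def)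
    finally have n: "norm (\<kappa> *\<^sub>R x) \<le> 1/4" .
    have "\<bar>fst (\<kappa> *\<^sub>R x)\<bar> \<le> 1/4" "\<bar>snd (\<kappa> *\<^sub>R x)\<bar> \<le> 1/4"
    proof -
      have "norm (fst p) \<le> norm p" "norm (snd p) \<le> norm p" for p :: plane
        by (metis norm_fst_le prod.collapse) (metis norm_snd_le prod.collapse)
      from this[of "\<kappa> *\<^sub>R x"] n show "\<bar>fst (\<kappa> *\<^sub>R x)\<bar> \<le> 1/4" "\<bar>snd (\<kappa> *\<^sub>R x)\<bar> \<le> 1/4"
        unfolding real_norm_def by linarith+
    qed
    then have "\<kappa> *\<^sub>R x + ?h \<in> {0<..<1} \<times> {0<..<1}"
      unfolding mem_Times_iff fst_add snd_add fst_conv snd_conv greaterThanLessThan_iff by linarith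
    from fourier_inversion_bump[OF g this]
    have "complex_of_real (\<psi> x) = (\<Sum>\<^sub>\<infinity>n. plane_coeff g n * echar n (\<kappa> *\<^sub>R x + ?h))"
      using k by (simp add: geq)
    then show "complex_of_real (\<psi> x) = (\<Sum>\<^sub>\<infinity>n. c n * echar n (\<kappa> *\<^sub>R x))"
      by (simp add: c_def echar_add_right mult_ac)
  qed
qed

section \<open>A commutator estimate\<close>

text \<open>Interpolates between the Lipschitz bound 2 pi |\<theta>|, used for |\<theta>| \<le> 1,
  and the trivial bound 2, used otherwise.\<close>

lemma cmod_cis_minus_one_le:
  assumes "0 \<le> \<sigma>" "\<sigma> \<le> 1"
  shows "cmod (cis (2 * pi * \<theta>) - 1) \<le> 2 * pi * \<bar>\<theta>\<bar> powr \<sigma>"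
proof (cases "\<theta> = 0")
  case False
  have 1: "cmod (cis (2 * pi * \<theta>) - 1) \<le> 2 * pi * \<bar>\<theta>\<bar>"
    using iexp_approx1[of "2 * pi * \<theta>" 0] by (simp add: cis_conv_exp abs_mult)
  have 2: "cmod (cis (2 * pi * \<theta>) - 1) \<le> 2"
    using norm_triangle_ineq4[of "cis (2 * pi * \<theta>)" 1] by simp
  show ?thesis
  proof (cases "\<bar>\<theta>\<bar> \<le> 1")
    case True
    have "\<bar>\<theta>\<bar> powr 1 \<le> \<bar>\<theta>\<bar> powr \<sigma>" using assms True False by (intro powr_mono') auto
    then have "2 * pi * \<bar>\<theta>\<bar> \<le> 2 * pi * \<bar>\<theta>\<bar> powr \<sigma>" by (simp add: False)
    then show ?thesis using 1 by linarith
  next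
    case False
    then have "1 \<le> \<bar>\<theta>\<bar> powr \<sigma>" using assms by (intro ge_one_powr_ge_zero) auto
    then have "2 * pi * 1 \<le> 2 * pi * \<bar>\<theta>\<bar> powr \<sigma>" by (intro mult_left_mono) auto
    then show ?thesis using 2 pi_ge_two by linarith
  qed
qed simp

lemma powr_le_one_plus: "0 \<le> x \<Longrightarrow> 0 \<le> \<sigma> \<Longrightarrow> \<sigma> \<le> 1 \<Longrightarrow> x powr \<sigma> \<le> 1 + (x::real)"
proof (cases "x \<le> 1")
  case True
  assume a: "0 \<le> x" "0 \<le> \<sigma>" "\<sigma> \<le> 1"
  then have "x powr \<sigma> \<le> 1" using True by (intro powr_le1) auto
  then show ?thesis using a by linarith
next
  case False
  assume a: "0 \<le> x" "0 \<le> \<sigma>" "\<sigma> \<le> 1"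
  then have "x powr \<sigma> \<le> x powr 1" using False by (intro powr_mono) auto
  then show ?thesis using a by simp
qed

lemma norm_freq_le_bessel: "norm (freq k) \<le> bessel k powr (1/2)"
proof -
  have "1 * (norm (freq k))\<^sup>2 \<le> (4 * pi\<^sup>2) * (norm (freq k))\<^sup>2"
    using pi_ge_two power_mono[of 2 pi 2] by (intro mult_right_mono) auto
  then have "(norm (freq k))\<^sup>2 \<le> bessel k" by (simp add: bessel_def)
  then have "norm (freq k) \<le> sqrt (bessel k)" by (rule real_le_rsqrt)
  then show ?thesis by (simp add: powr_half_sqrt bessel_ge_1 order_trans[OF zero_le_one])
qed

text \<open>A character evaluated at a scaled frequency is also the phase of a translation acting on
  that frequency; this is how an expansion of a symbol becomes a superposition of
  translations.\<close>

lemma echar_scaled_commute: "echar n (c *\<^sub>R freq l) = echar l (c *\<^sub>R freq n)"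
  by (simp add: echar_def inner_commute)

lemma has_sum_finite_sum:
  fixes f :: "'i \<Rightarrow> 'j \<Rightarrow> complex"
  assumes "finite A" "\<And>i. i \<in> A \<Longrightarrow> (f i has_sum s i) B"
  shows "((\<lambda>j. \<Sum>i\<in>A. f i j) has_sum (\<Sum>i\<in>A. s i)) B"
  using assms by (induction A rule: finite_induct) (auto intro: has_sum_add)

text \<open>One constant serves all scales \<open>N\<close>, orders \<sigma> and factors. The
  condition on \<open>D\<close> involves every translate of \<open>a\<close>, since the multiplier
  is replaced by translations of \<open>a\<close>. The sign in \<open>- 1 / N\<close> reflects that
  output frequency 0 pairs \<open>l\<close> with \<open>- l\<close>.\<close>

definition commutator_const :: "(plane \<Rightarrow> real) \<Rightarrow> real \<Rightarrow> real \<Rightarrow> bool" where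
  "commutator_const \<psi> L C \<longleftrightarrow> 0 \<le> C \<and>
    (\<forall>N \<sigma> a b D. 0 < N \<longrightarrow> 0 \<le> \<sigma> \<longrightarrow> \<sigma> \<le> 1 \<longrightarrow> trig_poly a \<longrightarrow> trig_poly b \<longrightarrow>
      (\<forall>l. a l \<noteq> 0 \<longrightarrow> norm (freq l) \<le> L * N) \<longrightarrow> (\<forall>l. b l \<noteq> 0 \<longrightarrow> norm (freq l) \<le> L * N) \<longrightarrow>
      (\<forall>l. a l \<noteq> 0 \<longrightarrow> \<psi> ((- 1 / N) *\<^sub>R freq l) = 0) \<longrightarrow>
      (\<forall>y. sobolev_norm 0 (pw_mult (\<lambda>l. echar l y * a l) b) \<le> D) \<longrightarrow>
      sobolev_norm (- \<sigma>) (pw_mult a (\<lambda>k. of_real (\<psi> ((1 / N) *\<^sub>R freq k)) * b k)) \<le> C * N powr (- \<sigma>) * D)"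

lemma commutator_constD:
  assumes "commutator_const \<psi> L C" "0 < N" "0 \<le> \<sigma>" "\<sigma> \<le> 1" "trig_poly a" "trig_poly b"
    "\<And>l. a l \<noteq> 0 \<Longrightarrow> norm (freq l) \<le> L * N" "\<And>l. b l \<noteq> 0 \<Longrightarrow> norm (freq l) \<le> L * N"
    "\<And>l. a l \<noteq> 0 \<Longrightarrow> \<psi> ((- 1 / N) *\<^sub>R freq l) = 0"
    "\<And>y. sobolev_norm 0 (pw_mult (\<lambda>l. echar l y * a l) b) \<le> D"
  shows "sobolev_norm (- \<sigma>) (pw_mult a (\<lambda>k. of_real (\<psi> ((1 / N) *\<^sub>R freq k)) * b k)) \<le> C * N powr (- \<sigma>) * D"
  using assms(1)[unfolded commutator_const_def, THEN conjunct2, rule_format, OF assms(2-)] .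

text \<open>The symbol \<open>\<psi>\<close> vanishes on the frequencies of \<open>- a\<close>, so it may be replaced by its increment
  \<open>\<psi>((k - l)/N) - \<psi>(-l/N)\<close>, which is small for small output frequencies \<open>k\<close>.\<close>

lemma commutator_bound:
  fixes \<psi> :: "plane \<Rightarrow> real" and L :: real
  assumes s: "smooth_on \<psi> UNIV" and R: "\<And>x. \<psi> x \<noteq> 0 \<Longrightarrow> norm x \<le> R"
  shows "\<exists>C. commutator_const \<psi> L C"
proof -
  obtain c \<kappa> where k0: "\<kappa> > 0" and csum: "(\<lambda>n. cmod (c n) * (1 + norm (freq n))) summable_on UNIV"
    and ex: "\<And>x. norm x \<le> L \<Longrightarrow> complex_of_real (\<psi> x) = (\<Sum>\<^sub>\<infinity>n. c n * echar n (\<kappa> *\<^sub>R x))"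
    by (rule wiener_expansion[OF s, of R L], erule R, rule that)
  define S where "S = (\<Sum>\<^sub>\<infinity>n. cmod (c n) * (1 + norm (freq n)))"
  have S: "S \<ge> 0" unfolding S_def by (intro infsum_nonneg) auto
  have cabs: "(\<lambda>n. cmod (c n)) summable_on UNIV"
    by (rule summable_on_comparison_test[OF csum]) (auto simp: algebra_simps)
  have hs: "((\<lambda>n. c n * echar n (\<kappa> *\<^sub>R x)) has_sum complex_of_real (\<psi> x)) UNIV" if "norm x \<le> L" for x
  proof -
    have "(\<lambda>n. c n * echar n (\<kappa> *\<^sub>R x)) summable_on UNIV"
      by (rule abs_summable_summable) (use cabs in \<open>simp add: norm_mult\<close>)
    then show ?thesis unfolding ex[OF that] by (rule has_sum_infsum)
  qed
  show ?thesis
    unfolding commutator_const_def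
  proof (intro exI[of _ "2 * pi * (1 + \<kappa>) * S"] conjI allI impI)
    show "0 \<le> 2 * pi * (1 + \<kappa>) * S" using S k0 by simp
    fix N \<sigma> D :: real and a b
    assume N: "N > 0" and \<sigma>: "0 \<le> \<sigma>" "\<sigma> \<le> 1" and a: "trig_poly a" and b: "trig_poly b"
      and as': "\<forall>l. a l \<noteq> 0 \<longrightarrow> norm (freq l) \<le> L * N" and bs': "\<forall>l. b l \<noteq> 0 \<longrightarrow> norm (freq l) \<le> L * N"
      and a0': "\<forall>l. a l \<noteq> 0 \<longrightarrow> \<psi> ((- 1 / N) *\<^sub>R freq l) = 0"
      and D': "\<forall>y. sobolev_norm 0 (pw_mult (\<lambda>l. echar l y * a l) b) \<le> D"
    note as = as'[rule_format] and bs = bs'[rule_format] and a0 = a0'[rule_format] and D = D'[rule_format]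
    let ?A = "{l. a l \<noteq> 0}"
    define y where "y n = (- \<kappa> / N) *\<^sub>R freq n" for n
    define p where "p n = pw_mult (\<lambda>l. echar l (y n) * a l) b" for n
    define m where "m n k = c n * (echar n ((\<kappa> / N) *\<^sub>R freq k) - 1)" for n k
    define F where "F = pw_mult a (\<lambda>k. of_real (\<psi> ((1 / N) *\<^sub>R freq k)) * b k)"
    have nk: "norm ((1 / N) *\<^sub>R freq l) \<le> L" if "norm (freq l) \<le> L * N" for l
      using that N by (simp add: pos_divide_le_eq)
    \<comment> \<open>The expansions at (k - l)/N and at -l/N, where \<psi> vanishes, are
      subtracted. Both contain the phase \<open>echar l (y n)\<close>; what remains,
      \<open>m n k\<close>, does not involve \<open>l\<close> and acts as a multiplier on the
      product.\<close>
    have diff: "((\<lambda>n. m n k * (echar l (y n) * a l * b (k - l))) has_sum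
        (a l * (of_real (\<psi> ((1 / N) *\<^sub>R freq (k - l))) * b (k - l)))) UNIV" for k l
    proof (cases "a l = 0 \<or> b (k - l) = 0")
      case False
      have 1: "((\<lambda>n. c n * echar n (\<kappa> *\<^sub>R ((1 / N) *\<^sub>R freq (k - l)))) has_sum
          complex_of_real (\<psi> ((1 / N) *\<^sub>R freq (k - l)))) UNIV"
        by (rule hs[OF nk[OF bs]]) (use False in simp)
      have "norm ((- 1 / N) *\<^sub>R freq l) \<le> L" using nk[OF as[of l]] False by simp
      then have 2: "((\<lambda>n. c n * echar n (\<kappa> *\<^sub>R ((- 1 / N) *\<^sub>R freq l))) has_sum 0) UNIV"
        using hs[of "(- 1 / N) *\<^sub>R freq l"] a0[of l] False by simp
      have "((\<lambda>n. c n * echar n (\<kappa> *\<^sub>R ((1 / N) *\<^sub>R freq (k - l))) + (- 1) * (c n * echar n (\<kappa> *\<^sub>R ((- 1 / N) *\<^sub>R freq l))))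
          has_sum (complex_of_real (\<psi> ((1 / N) *\<^sub>R freq (k - l))) + (- 1) * 0)) UNIV"
        by (intro has_sum_add has_sum_cmult_right 1 2)
      moreover have "c n * echar n (\<kappa> *\<^sub>R ((1 / N) *\<^sub>R freq (k - l))) + (- 1) * (c n * echar n (\<kappa> *\<^sub>R ((- 1 / N) *\<^sub>R freq l)))
          = m n k * echar l (y n)" for n
      proof -
        have "\<kappa> *\<^sub>R ((1 / N) *\<^sub>R freq (k - l)) = (\<kappa> / N) *\<^sub>R freq k + (- \<kappa> / N) *\<^sub>R freq l"
          by (simp add: freq_diff scaleR_diff_right)
        moreover have "\<kappa> *\<^sub>R ((- 1 / N) *\<^sub>R freq l) = (- \<kappa> / N) *\<^sub>R freq l" by simp
        ultimately show ?thesis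
          unfolding m_def y_def echar_scaled_commute[of l]
          by (simp only: echar_add_right) (simp add: algebra_simps)
      qed
      ultimately have "((\<lambda>n. m n k * echar l (y n)) has_sum complex_of_real (\<psi> ((1 / N) *\<^sub>R freq (k - l)))) UNIV"
        by simp
      from has_sum_cmult_left[OF this, of "a l * b (k - l)"] show ?thesis
        by (simp add: mult_ac)
    qed auto
    have Fk: "F k = (\<Sum>\<^sub>\<infinity>n. m n k * p n k)" for k
    proof -
      have pnk: "m n k * p n k = (\<Sum>l\<in>?A. m n k * (echar l (y n) * a l * b (k - l)))" for n
        unfolding p_def
        by (subst pw_mult_finite[of ?A]) (use a in \<open>auto simp: trig_poly_def sum_distrib_left mult_ac\<close>)
      have "((\<lambda>n. \<Sum>l\<in>?A. m n k * (echar l (y n) * a l * b (k - l))) has_sum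
          (\<Sum>l\<in>?A. a l * (of_real (\<psi> ((1 / N) *\<^sub>R freq (k - l))) * b (k - l)))) UNIV"
        by (rule has_sum_finite_sum) (use a in \<open>auto simp: trig_poly_def intro: diff\<close>)
      then show ?thesis
        unfolding F_def pw_mult_trig[OF a] pnk by (rule infsumI[symmetric])
    qed
    have pt: "trig_poly (p n)" for n unfolding p_def by (intro trig_poly_pw_mult trig_poly_mult a b)
    have D0: "D \<ge> 0" using D[of 0] sobolev_norm_nonneg order_trans by blast
    \<comment> \<open>The increment of the n-th character is of size (\<kappa> |n| |k| /
      N)^\<sigma>: the power of |k| is absorbed by the norm of order \<open>- \<sigma>\<close>, that
      of |n| by the weighted summability of \<open>c\<close>.\<close>
    have mb: "cmod (m n k) \<le> (cmod (c n) * (1 + norm (freq n)) * (2 * pi * (1 + \<kappa>) * N powr (- \<sigma>))) * bessel k powr (\<sigma> / 2)" for n k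
    proof -
      define \<theta> where "\<theta> = freq n \<bullet> ((\<kappa> / N) *\<^sub>R freq k)"
      have "\<bar>\<theta>\<bar> \<le> norm (freq n) * norm ((\<kappa> / N) *\<^sub>R freq k)" unfolding \<theta>_def by (rule Cauchy_Schwarz_ineq2)
      also have "\<dots> = (\<kappa> * norm (freq n)) * (1 / N) * norm (freq k)" using k0 N by simp
      also have "\<dots> \<le> (\<kappa> * norm (freq n)) * (1 / N) * bessel k powr (1/2)"
        using k0 N by (intro mult_left_mono norm_freq_le_bessel) auto
      finally have "\<bar>\<theta>\<bar> powr \<sigma> \<le> ((\<kappa> * norm (freq n)) * (1 / N) * bessel k powr (1/2)) powr \<sigma>"
        using \<sigma> by (intro powr_mono2) auto
      also have "\<dots> = (\<kappa> * norm (freq n)) powr \<sigma> * N powr (- \<sigma>) * bessel k powr (\<sigma> / 2)"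
        using k0 N by (simp add: powr_mult powr_divide powr_powr powr_minus_divide)
      also have "\<dots> \<le> ((1 + \<kappa>) * (1 + norm (freq n))) * N powr (- \<sigma>) * bessel k powr (\<sigma> / 2)"
      proof (intro mult_right_mono)
        have "(\<kappa> * norm (freq n)) powr \<sigma> \<le> 1 + \<kappa> * norm (freq n)" using k0 \<sigma> by (intro powr_le_one_plus) auto
        also have "\<dots> \<le> (1 + \<kappa>) * (1 + norm (freq n))" using k0 by (simp add: algebra_simps)
        finally show "(\<kappa> * norm (freq n)) powr \<sigma> \<le> (1 + \<kappa>) * (1 + norm (freq n))" .
      qed auto
      finally have th: "\<bar>\<theta>\<bar> powr \<sigma> \<le> ((1 + \<kappa>) * (1 + norm (freq n))) * N powr (- \<sigma>) * bessel k powr (\<sigma> / 2)" .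
      have "cmod (m n k) = cmod (c n) * cmod (cis (2 * pi * \<theta>) - 1)" by (simp add: m_def norm_mult echar_eq_cis \<theta>_def)
      also have "\<dots> \<le> cmod (c n) * (2 * pi * (((1 + \<kappa>) * (1 + norm (freq n))) * N powr (- \<sigma>) * bessel k powr (\<sigma> / 2)))"
        by (intro mult_left_mono order_trans[OF cmod_cis_minus_one_le[OF \<sigma>]] th) auto
      finally show ?thesis by (simp only: mult_ac)
    qed
    have bound: "(\<lambda>k. m n k * p n k) \<in> sobolev (- \<sigma>) \<and>
        sobolev_norm (- \<sigma>) (\<lambda>k. m n k * p n k) \<le> cmod (c n) * (1 + norm (freq n)) * (2 * pi * (1 + \<kappa>) * N powr (- \<sigma>) * D)" for n
    proof -
      let ?c = "cmod (c n) * (1 + norm (freq n)) * (2 * pi * (1 + \<kappa>) * N powr (- \<sigma>))"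
      have c: "0 \<le> ?c" using k0 by simp
      have mb': "cmod (m n k) \<le> ?c * bessel k powr ((0 - (- \<sigma>)) / 2)" for k using mb[of n k] by simp
      have ps: "p n \<in> sobolev 0" by (rule trig_sobolev(1)[OF pt])
      have "sobolev_norm (- \<sigma>) (\<lambda>k. m n k * p n k) \<le> ?c * sobolev_norm 0 (p n)"
        by (rule sobolev_multiplier(2)[OF ps c mb'])
      also have "\<dots> \<le> ?c * D" using c D[of "y n"] by (intro mult_left_mono) (auto simp: p_def)
      finally show ?thesis using sobolev_multiplier(1)[OF ps c mb'] by (simp add: mult_ac)
    qed
    have "sobolev_norm (- \<sigma>) (\<lambda>k. \<Sum>\<^sub>\<infinity>n. m n k * p n k)
        \<le> (\<Sum>\<^sub>\<infinity>n. cmod (c n) * (1 + norm (freq n)) * (2 * pi * (1 + \<kappa>) * N powr (- \<sigma>) * D))"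
      by (rule sobolev_infsum(3)[where G = "\<lambda>n k. m n k * p n k"])
         (use bound summable_on_cmult_left[OF csum] in auto)
    also have "\<dots> = S * (2 * pi * (1 + \<kappa>) * N powr (- \<sigma>) * D)"
      unfolding S_def by (rule infsum_cmult_left) (use csum in simp)
    also have "(\<lambda>k. \<Sum>\<^sub>\<infinity>n. m n k * p n k) = F" using Fk by (simp add: fun_eq_iff)
    finally show "sobolev_norm (- \<sigma>) (pw_mult a (\<lambda>k. of_real (\<psi> ((1 / N) *\<^sub>R freq k)) * b k)) \<le> 2 * pi * (1 + \<kappa>) * S * N powr (- \<sigma>) * D"
      unfolding F_def by (simp add: mult_ac)
  qed
qed

section \<open>Littlewood--Paley symbols\<close>

lemma finite_bessel_le: "finite {k. bessel k \<le> M}"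
proof -
  define n where "n = nat \<lceil>sqrt (max M 0)\<rceil>"
  have "{k. bessel k \<le> M} \<subseteq> {- int n..int n} \<times> {- int n..int n}"
  proof
    fix k assume "k \<in> {k. bessel k \<le> M}"
    then have "bessel k \<le> max M 0" by simp
    then have "bessel k powr (1/2) \<le> sqrt (max M 0)"
      by (simp add: powr_half_sqrt less_imp_le[OF bessel_pos])
    then have "norm (freq k) \<le> sqrt (max M 0)" using norm_freq_le_bessel[of k] by linarith
    also have "\<dots> \<le> real n" unfolding n_def by (simp add: real_nat_ceiling_ge)
    finally have "norm (freq k) \<le> real n" .
    moreover have "\<bar>real_of_int (fst k)\<bar> \<le> norm (freq k)" "\<bar>real_of_int (snd k)\<bar> \<le> norm (freq k)"
      using norm_fst_le[of "real_of_int (fst k)" "real_of_int (snd k)"] norm_snd_le[of "real_of_int (snd k)" "real_of_int (fst k)"]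
      by (simp_all add: freq_def)
    ultimately have "\<bar>real_of_int (fst k)\<bar> \<le> real n" "\<bar>real_of_int (snd k)\<bar> \<le> real n" by linarith+
    then have "\<bar>fst k\<bar> \<le> int n" "\<bar>snd k\<bar> \<le> int n" by linarith+
    then show "k \<in> {- int n..int n} \<times> {- int n..int n}" by (auto simp: mem_Times_iff)
  qed
  then show ?thesis by (rule finite_subset) simp
qed

text \<open>Frequencies are measured by \<open>bessel\<close>, the quantity in the Sobolev weights;
  it is quadratic in the frequency, hence the base 4. Since \<open>bessel\<close> is at least 1, a
  lower bound of this form is available for the block -1 as well.\<close>

definition freq_ring :: "real \<Rightarrow> real \<Rightarrow> int \<Rightarrow> (int \<times> int) set" where
  "freq_ring c C j = {k. c * 4 powr j \<le> bessel k \<and> bessel k \<le> C * 4 powr j}"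

definition freq_ball :: "real \<Rightarrow> int \<Rightarrow> (int \<times> int) set" where
  "freq_ball C j = {k. bessel k \<le> C * 4 powr j}"

lemma finite_freq_ring: "finite (freq_ring c C j)"
  by (rule finite_subset[OF _ finite_bessel_le[of "C * 4 powr j"]]) (auto simp: freq_ring_def)

lemma finite_freq_ball: "finite (freq_ball C j)"
  by (simp add: freq_ball_def finite_bessel_le)

lemma four_powr: "(4::real) powr x = 2 powr (2 * x)"
  using powr_powr[of "2::real" 2 x] by simp

lemma norm_restrict_le:
  assumes f: "f \<in> sobolev s" and B: "0 \<le> B" "\<And>k. k \<in> K \<Longrightarrow> 1 \<le> B * bessel k powr (s / 2)"
  shows "sobolev_norm 0 (restrict_freq K f) \<le> B * sobolev_norm s f"
proof -
  have "sobolev_norm 0 (\<lambda>k. (if k \<in> K then 1 else 0) * f k) \<le> B * sobolev_norm s f"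
    by (rule sobolev_multiplier(2)[OF f]) (use B in auto)
  moreover have "(\<lambda>k. (if k \<in> K then 1 else 0) * f k) = restrict_freq K f"
    by (auto simp: restrict_freq_def)
  ultimately show ?thesis by simp
qed

lemma bessel_cancel: "bessel k powr a * bessel k powr (- a) = 1"
  by (simp flip: powr_add)

text \<open>For \<open>s \<le> 0\<close> the weight is smallest at the rim of the ball, so the whole
  ball costs no more than its outermost ring.\<close>

lemma freq_ball_bound:
  assumes C: "C > 0" and s: "s \<le> 0"
  shows "\<exists>B\<ge>0. \<forall>j. \<forall>f\<in>sobolev s. sobolev_norm 0 (restrict_freq (freq_ball C j) f) \<le> B * 2 powr (- real_of_int j * s) * sobolev_norm s f"
proof (intro exI[of _ "C powr (- s / 2)"] conjI allI ballI)
  fix j :: int and f assume f: "f \<in> sobolev s"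
  show "sobolev_norm 0 (restrict_freq (freq_ball C j) f) \<le> C powr (- s / 2) * 2 powr (- real_of_int j * s) * sobolev_norm s f"
  proof (rule norm_restrict_le[OF f])
    fix k assume k: "k \<in> freq_ball C j"
    have "bessel k powr (- s / 2) \<le> (C * 4 powr j) powr (- s / 2)"
      by (rule powr_mono2) (use k s in \<open>auto simp: freq_ball_def less_imp_le[OF bessel_pos]\<close>)
    also have "\<dots> = C powr (- s / 2) * 2 powr (- real_of_int j * s)"
      using C by (simp add: powr_mult powr_powr four_powr)
    finally have "bessel k powr (s / 2) * bessel k powr (- s / 2) \<le> bessel k powr (s / 2) * (C powr (- s / 2) * 2 powr (- real_of_int j * s))"
      by (rule mult_left_mono) simp
    then show "1 \<le> C powr (- s / 2) * 2 powr (- real_of_int j * s) * bessel k powr (s / 2)"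
      using bessel_cancel[of k "s / 2"] by (simp add: mult_ac)
  qed simp
qed simp

lemma freq_ring_bound:
  assumes c: "c > 0" and C: "C > 0"
  shows "\<exists>B\<ge>0. \<forall>j. \<forall>f\<in>sobolev s. sobolev_norm 0 (restrict_freq (freq_ring c C j) f) \<le> B * 2 powr (- real_of_int j * s) * sobolev_norm s f"
proof (intro exI[of _ "max (c powr (- s / 2)) (C powr (- s / 2))"] conjI allI ballI)
  let ?B = "max (c powr (- s / 2)) (C powr (- s / 2))"
  show "0 \<le> ?B" by (simp add: le_max_iff_disj)
  fix j :: int and f assume f: "f \<in> sobolev s"
  show "sobolev_norm 0 (restrict_freq (freq_ring c C j) f) \<le> ?B * 2 powr (- real_of_int j * s) * sobolev_norm s f"
  proof (rule norm_restrict_le[OF f])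
    show "0 \<le> ?B * 2 powr (- real_of_int j * s)" by (simp add: le_max_iff_disj)
    fix k assume k: "k \<in> freq_ring c C j"
    have "bessel k powr (- s / 2) \<le> ?B * 2 powr (- real_of_int j * s)"
    proof (cases "s \<le> 0")
      case True
      have "bessel k powr (- s / 2) \<le> (C * 4 powr j) powr (- s / 2)"
        by (rule powr_mono2) (use k True in \<open>auto simp: freq_ring_def less_imp_le[OF bessel_pos]\<close>)
      also have "\<dots> = C powr (- s / 2) * 2 powr (- real_of_int j * s)"
        using C by (simp add: powr_mult powr_powr four_powr)
      also have "\<dots> \<le> ?B * 2 powr (- real_of_int j * s)" by (intro mult_right_mono) auto
      finally show ?thesis .
    next
      case False
      have "bessel k powr (- s / 2) \<le> (c * 4 powr j) powr (- s / 2)"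
        by (rule powr_mono2') (use k False c in \<open>auto simp: freq_ring_def\<close>)
      also have "\<dots> = c powr (- s / 2) * 2 powr (- real_of_int j * s)"
        using c by (simp add: powr_mult powr_powr four_powr)
      also have "\<dots> \<le> ?B * 2 powr (- real_of_int j * s)" by (intro mult_right_mono) auto
      finally show ?thesis .
    qed
    then have "bessel k powr (s / 2) * bessel k powr (- s / 2) \<le> bessel k powr (s / 2) * (?B * 2 powr (- real_of_int j * s))"
      by (rule mult_left_mono) simp
    then show "1 \<le> ?B * 2 powr (- real_of_int j * s) * bessel k powr (s / 2)"
      using bessel_cancel[of k "s / 2"] by (simp add: mult_ac)
  qed
qed

section \<open>Symbols of the blocks\<close>

locale littlewood_paley =
  fixes P :: lp_pair
  assumes partition: "dyadic_partition P"
begin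

definition lp_sym :: "int \<Rightarrow> plane \<Rightarrow> real" where
  "lp_sym j x = (if j = -1 then fst P x else snd P ((2 powr (- real_of_int j)) *\<^sub>R x))"

lemma block_apply: "block P j f k = of_real (lp_sym j (freq k)) * f k"
  by (simp add: block_def lp_sym_def)

lemma lp_sym_nat: "lp_sym (int n) x = snd P ((1 / 2 ^ n) *\<^sub>R x)"
  by (simp add: lp_sym_def powr_minus powr_realpow divide_inverse)

lemma smooth_chi: "smooth_on (fst P) UNIV" and smooth_rho: "smooth_on (snd P) UNIV"
  and radial_chi: "radial (fst P)" and radial_rho: "radial (snd P)"
  using partition by (auto simp: dyadic_partition_def Let_def)

lemma lp_sym_nonneg: "0 \<le> lp_sym j x"
  using partition by (auto simp: dyadic_partition_def Let_def lp_sym_def)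

lemma lp_sym_sums: "(\<lambda>n. lp_sym (int n) x) sums (1 - fst P x)"
  unfolding lp_sym_nat using partition by (auto simp: dyadic_partition_def Let_def)

lemma int_ge_minus_one_cases:
  assumes "-1 \<le> (j::int)"
  obtains "j = -1" | n where "j = int n"
proof (cases "j = -1")
  case True
  then show ?thesis by (rule that(1))
next
  case False
  then have "0 \<le> j" using assms by linarith
  then obtain n where "j = int n" by (rule nonneg_int_cases)
  then show ?thesis by (rule that(2))
qed

lemma lp_sym_le_one:
  assumes "-1 \<le> j"
  shows "lp_sym j x \<le> 1"
proof -
  have s: "summable (\<lambda>n. lp_sym (int n) x)" "(\<Sum>n. lp_sym (int n) x) = 1 - fst P x"
    using lp_sym_sums by (auto simp: sums_iff)
  have chi: "fst P x = lp_sym (-1) x" by (simp add: lp_sym_def)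
  show ?thesis
  proof (cases rule: int_ge_minus_one_cases[OF assms])
    case 1
    have "0 \<le> (\<Sum>n. lp_sym (int n) x)" using s by (intro suminf_nonneg lp_sym_nonneg)
    then show ?thesis using s(2) 1 chi by simp
  next
    case (2 n)
    have "(\<Sum>i\<in>{n}. lp_sym (int i) x) \<le> (\<Sum>n. lp_sym (int n) x)"
      by (rule sum_le_suminf[OF s(1)]) (auto simp: lp_sym_nonneg)
    then show ?thesis using s(2) 2 chi lp_sym_nonneg[of "-1" x] by simp
  qed
qed

lemma lp_sym_disjoint:
  assumes "-1 \<le> i" "-1 \<le> j" "\<bar>i - j\<bar> > 1"
  shows "lp_sym i x * lp_sym j x = 0"
proof -
  have chi: "fst P x * snd P ((1 / 2 ^ n) *\<^sub>R x) = 0" if "n \<ge> 1" for n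
    using partition that by (auto simp: dyadic_partition_def Let_def)
  have rho: "snd P ((1 / 2 ^ m) *\<^sub>R x) * snd P ((1 / 2 ^ n) *\<^sub>R x) = 0" if "\<bar>int m - int n\<bar> > 1" for m n
    using partition that by (auto simp: dyadic_partition_def Let_def)
  show ?thesis
  proof (cases rule: int_ge_minus_one_cases[OF assms(1)])
    case 1
    then have "1 \<le> j" using assms by linarith
    then obtain n where "j = int n" using nonneg_int_cases[of j] by auto
    then have "j = int n" "n \<ge> 1" using \<open>1 \<le> j\<close> by auto
    then show ?thesis using 1 chi[of n] by (simp add: lp_sym_nat) (simp add: lp_sym_def)
  next
    case (2 m)
    show ?thesis
    proof (cases rule: int_ge_minus_one_cases[OF assms(2)])
      case 1
      then have "m \<ge> 1" using 2 assms by simp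
      then show ?thesis using 1 2 chi[of m] by (simp add: lp_sym_nat mult.commute) (simp add: lp_sym_def mult.commute)
    next
      case (2 n)
      then show ?thesis using \<open>i = int m\<close> assms rho[of m n] by (simp add: lp_sym_nat)
    qed
  qed
qed

lemma lp_sym_minus: "lp_sym j (- x) = lp_sym j x"
proof -
  have "fst P (- y) = fst P y" "snd P (- y) = snd P y" for y
    using radial_chi radial_rho unfolding radial_def by (metis norm_minus_cancel)+
  then show ?thesis by (simp add: lp_sym_def)
qed

lemma chi_bounded_support: "\<exists>R. \<forall>x. fst P x \<noteq> 0 \<longrightarrow> norm x \<le> R"
  using partition by (auto simp: dyadic_partition_def Let_def)

lemma rho_annulus: "\<exists>r R. 0 < r \<and> r < R \<and> (\<forall>x. snd P x \<noteq> 0 \<longrightarrow> r \<le> norm x \<and> norm x \<le> R)"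
  using partition by (auto simp: dyadic_partition_def Let_def)

lemma lp_sym_support:
  obtains r R where "r > 0" "R > 0" "\<And>j x. -1 \<le> j \<Longrightarrow> lp_sym j x \<noteq> 0 \<Longrightarrow> norm x \<le> R * 2 powr j"
    "\<And>j x. 0 \<le> j \<Longrightarrow> lp_sym j x \<noteq> 0 \<Longrightarrow> r * 2 powr j \<le> norm x"
proof -
  obtain R1 where R1: "\<And>x. fst P x \<noteq> 0 \<Longrightarrow> norm x \<le> R1" using chi_bounded_support by blast
  obtain r R2 where r: "0 < r" "r < R2" "\<And>x. snd P x \<noteq> 0 \<Longrightarrow> r \<le> norm x \<and> norm x \<le> R2" using rho_annulus by blast
  have sc: "norm ((2 powr (- real_of_int j)) *\<^sub>R x) = norm x / 2 powr j" for j and x :: plane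
    by (simp add: powr_minus divide_inverse mult.commute)
  show ?thesis
  \<comment> \<open>The factor 2 makes the bound for \<open>fst P\<close> fit the scale 2^(-1) of
    the block -1.\<close>
  proof (rule that[of r "max (2 * R1) R2"])
    show "r > 0" "max (2 * R1) R2 > 0" using r by auto
    show "norm x \<le> max (2 * R1) R2 * 2 powr j" if "-1 \<le> j" "lp_sym j x \<noteq> 0" for j x
    proof (cases "j = -1")
      case True
      then show ?thesis using R1[of x] that by (auto simp: lp_sym_def powr_minus le_max_iff_disj)
    next
      case False
      then have "norm x / 2 powr j \<le> R2" using r(3)[of "(2 powr (- real_of_int j)) *\<^sub>R x"] that unfolding sc by (simp add: lp_sym_def)
      then have "norm x \<le> R2 * 2 powr j" by (simp add: pos_divide_le_eq)
      also have "\<dots> \<le> max (2 * R1) R2 * 2 powr j" by (intro mult_right_mono) auto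
      finally show ?thesis .
    qed
    show "r * 2 powr j \<le> norm x" if "0 \<le> j" "lp_sym j x \<noteq> 0" for j x
    proof -
      have "r \<le> norm x / 2 powr j" using r(3)[of "(2 powr (- real_of_int j)) *\<^sub>R x"] that unfolding sc by (simp add: lp_sym_def)
      then show ?thesis by (simp add: pos_le_divide_eq)
    qed
  qed
qed

lemma lp_sym_ring:
  obtains c C where "c > 0" "C > 0" "\<And>j k. -1 \<le> j \<Longrightarrow> lp_sym j (freq k) \<noteq> 0 \<Longrightarrow> k \<in> freq_ring c C j"
proof -
  obtain r R where r: "r > 0" "R > 0" "\<And>j x. -1 \<le> j \<Longrightarrow> lp_sym j x \<noteq> 0 \<Longrightarrow> norm x \<le> R * 2 powr j"
    "\<And>j x. 0 \<le> j \<Longrightarrow> lp_sym j x \<noteq> 0 \<Longrightarrow> r * 2 powr j \<le> norm x"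
    using lp_sym_support by blast
  have sq: "(a * 2 powr j)\<^sup>2 = a\<^sup>2 * 4 powr j" for a and j :: int
    by (simp add: power_mult_distrib four_powr powr_power mult.commute)
  show ?thesis
  \<comment> \<open>The 1 in the minimum is for the block -1, where \<open>bessel k \<ge> 1\<close>
    is used; the summand 4 absorbs the 1 in \<open>bessel\<close>, as 1 \<le> 4 * 4^j for j \<ge>
    -1.\<close>
  proof (rule that[of "min 1 (4 * pi\<^sup>2 * r\<^sup>2)" "4 + 4 * pi\<^sup>2 * R\<^sup>2"])
    show "min 1 (4 * pi\<^sup>2 * r\<^sup>2) > 0" "4 + 4 * pi\<^sup>2 * R\<^sup>2 > 0" using r by (auto intro: add_pos_nonneg)
    fix j k assume j: "-1 \<le> j" and k: "lp_sym j (freq k) \<noteq> 0"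
    have "(norm (freq k))\<^sup>2 \<le> (R * 2 powr j)\<^sup>2" by (intro power_mono r(3) j k) auto
    then have up: "(norm (freq k))\<^sup>2 \<le> R\<^sup>2 * 4 powr j" by (simp only: sq)
    have "(4::real) powr (-1) \<le> 4 powr j" using j by (intro powr_mono) auto
    then have 4: "1 \<le> 4 * (4::real) powr j" by (simp add: powr_minus)
    have "bessel k \<le> 4 * 4 powr j + 4 * pi\<^sup>2 * (R\<^sup>2 * 4 powr j)"
      unfolding bessel_def using up 4 by (intro add_mono mult_left_mono) auto
    then have b1: "bessel k \<le> (4 + 4 * pi\<^sup>2 * R\<^sup>2) * 4 powr j" by (simp add: algebra_simps)
    have b2: "min 1 (4 * pi\<^sup>2 * r\<^sup>2) * 4 powr j \<le> bessel k"
    proof (cases "j = -1")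
      case True
      have "min 1 (4 * pi\<^sup>2 * r\<^sup>2) * 4 powr j \<le> 1 * 1" using True by (intro mult_mono) (auto simp: powr_minus)
      then show ?thesis using bessel_ge_1[of k] by linarith
    next
      case False
      then have "(r * 2 powr j)\<^sup>2 \<le> (norm (freq k))\<^sup>2" using j r by (intro power_mono r(4) k) auto
      then have "4 * pi\<^sup>2 * (r\<^sup>2 * 4 powr j) \<le> 4 * pi\<^sup>2 * (norm (freq k))\<^sup>2" by (intro mult_left_mono) (auto simp: sq)
      then have "(4 * pi\<^sup>2 * r\<^sup>2) * 4 powr j \<le> 4 * pi\<^sup>2 * (norm (freq k))\<^sup>2" by (simp only: mult.assoc)
      then have "(4 * pi\<^sup>2 * r\<^sup>2) * 4 powr j \<le> bessel k" unfolding bessel_def by linarith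
      moreover have "min 1 (4 * pi\<^sup>2 * r\<^sup>2) * 4 powr j \<le> (4 * pi\<^sup>2 * r\<^sup>2) * 4 powr j" by (intro mult_right_mono) auto
      ultimately show ?thesis by linarith
    qed
    show "k \<in> freq_ring (min 1 (4 * pi\<^sup>2 * r\<^sup>2)) (4 + 4 * pi\<^sup>2 * R\<^sup>2) j"
      using b1 b2 by (simp add: freq_ring_def)
  qed
qed

lemma trig_poly_block: "-1 \<le> j \<Longrightarrow> trig_poly (block P j f)"
proof -
  assume j: "-1 \<le> j"
  obtain c C where cC: "c > 0" "C > 0" "\<And>j k. -1 \<le> j \<Longrightarrow> lp_sym j (freq k) \<noteq> 0 \<Longrightarrow> k \<in> freq_ring c C j"
    using lp_sym_ring by blast
  show ?thesis unfolding trig_poly_def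
    by (rule finite_subset[OF _ finite_freq_ring[of c C j]]) (use cC(3)[OF j] in \<open>auto simp: block_apply\<close>)
qed

text \<open>The low-frequency part S_(j-1) f, that is, what the paraproduct multiplies with the
  block \<open>j\<close> of the other factor.\<close>

definition below :: "int \<Rightarrow> pdist \<Rightarrow> pdist" where
  "below j f = (\<Sum>i\<in>{-1..j - 2}. block P i f)"

lemma trig_poly_below: "trig_poly (below j f)"
  unfolding below_def by (intro trig_poly_sum trig_poly_block) auto

lemma below_apply: "below j f k = of_real (\<Sum>i\<in>{-1..j - 2}. lp_sym i (freq k)) * f k"
  by (simp add: below_def sum_pdist_apply block_apply sum_distrib_right)

text \<open>The tail of the partition of unity at \<open>x\<close> is the partition at x / 2^(j - 1)
  without its first member. So the low-frequency cut-off is a rescaled \<open>fst P\<close>, a fixed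
  smooth symbol of compact support, as the commutator estimate requires.\<close>

lemma sum_lp_sym:
  assumes "1 \<le> j"
  shows "(\<Sum>i\<in>{-1..j - 2}. lp_sym i x) = fst P ((2 powr (- real_of_int (j - 1))) *\<^sub>R x)"
proof -
  define n where "n = nat (j - 1)"
  have j: "j = int n + 1" using assms by (simp add: n_def)
  have "(\<lambda>i. lp_sym (int (i + n)) x) sums (1 - fst P x - (\<Sum>i<n. lp_sym (int i) x))"
    by (rule sums_split_initial_segment[OF lp_sym_sums])
  moreover have "(\<lambda>i. lp_sym (int (i + n)) x) = (\<lambda>i. lp_sym (int i) ((1 / 2 ^ n) *\<^sub>R x))"
    unfolding lp_sym_nat by (simp add: power_add)
  ultimately have "1 - fst P x - (\<Sum>i<n. lp_sym (int i) x) = 1 - fst P ((1 / 2 ^ n) *\<^sub>R x)"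
    using lp_sym_sums[of "(1 / 2 ^ n) *\<^sub>R x"] sums_unique2 by metis
  then have 1: "fst P ((1 / 2 ^ n) *\<^sub>R x) = fst P x + (\<Sum>i<n. lp_sym (int i) x)" by simp
  have "{-1..j - 2} = insert (-1) (int ` {..<n})"
  proof -
    have "int ` {..<n} = {0..<int n}"
      by (simp add: lessThan_atLeast0 image_int_atLeastLessThan)
    then show ?thesis using j by auto
  qed
  then have "(\<Sum>i\<in>{-1..j - 2}. lp_sym i x) = lp_sym (-1) x + (\<Sum>i<n. lp_sym (int i) x)"
    by (simp only:, subst sum.insert) (auto simp: sum.reindex)
  also have "\<dots> = fst P ((1 / 2 ^ n) *\<^sub>R x)" using 1 by (simp add: lp_sym_def)
  finally show ?thesis using j by (simp add: powr_minus powr_realpow divide_inverse)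
qed

lemma below_disjoint: "-1 \<le> j \<Longrightarrow> (\<Sum>i\<in>{-1..j - 2}. lp_sym i x) * lp_sym j x = 0"
  unfolding sum_distrib_right by (intro sum.neutral ballI lp_sym_disjoint) auto

end

section \<open>Paraproduct and resonant estimates\<close>

context littlewood_paley
begin

definition para_term :: "int \<Rightarrow> pdist \<Rightarrow> pdist \<Rightarrow> pdist" where
  "para_term j f g = pw_mult (below j f) (block P j g)"

lemma para_eq: "para P f g = (\<lambda>k. \<Sum>\<^sub>\<infinity>j\<in>{-1..}. para_term j f g k)"
  unfolding para_def
proof (rule ext, rule infsum_cong)
  fix k and j :: int assume "j \<in> {-1..}"
  then show "(\<Sum>i\<in>{-1..j - 2}. pw_mult (block P i f) (block P j g) k) = para_term j f g k"
    unfolding para_term_def below_def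
    by (subst pw_mult_sum_left) (auto simp: trig_poly_block sum_pdist_apply)
qed

lemma trig_poly_para_term: "-1 \<le> j \<Longrightarrow> trig_poly (para_term j f g)"
  unfolding para_term_def by (intro trig_poly_pw_mult trig_poly_below trig_poly_block)

lemma below_eq_0: "j < 1 \<Longrightarrow> below j f = 0"
  by (simp add: below_def)

lemma para_term_eq_0: "j < 1 \<Longrightarrow> para_term j f g = 0"
  by (simp add: para_term_def below_eq_0)

lemma below_support:
  assumes "below j f k \<noteq> 0"
  obtains i where "-1 \<le> i" "i \<le> j - 2" "lp_sym i (freq k) \<noteq> 0"
proof -
  have "(\<Sum>i\<in>{-1..j - 2}. lp_sym i (freq k)) \<noteq> 0" using assms by (auto simp: below_apply simp del: of_real_sum)
  then obtain i where "i \<in> {-1..j - 2}" "lp_sym i (freq k) \<noteq> 0" by (rule sum.not_neutral_contains_not_neutral)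
  then show ?thesis using that by auto
qed

lemma norm_freq_le_ring: "k \<in> freq_ring c C j \<Longrightarrow> norm (freq k) \<le> sqrt C * 2 powr j"
  and norm_freq_le_ball: "k \<in> freq_ball C j \<Longrightarrow> norm (freq k) \<le> sqrt C * 2 powr j"
proof -
  have *: "norm (freq k) \<le> sqrt C * 2 powr j" if "bessel k \<le> C * 4 powr j" for k
  proof -
    have "norm (freq k) \<le> sqrt (bessel k)"
      using norm_freq_le_bessel[of k] by (simp add: powr_half_sqrt less_imp_le[OF bessel_pos])
    also have "\<dots> \<le> sqrt (C * 4 powr j)" using that by (rule real_sqrt_le_mono)
    also have "\<dots> = sqrt C * 2 powr j"
    proof -
      have "(4::real) powr j = (2 powr j)\<^sup>2" by (simp add: four_powr power2_eq_square flip: powr_add)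
      then show ?thesis by (simp add: real_sqrt_mult)
    qed
    finally show ?thesis .
  qed
  show "k \<in> freq_ring c C j \<Longrightarrow> norm (freq k) \<le> sqrt C * 2 powr j"
    "k \<in> freq_ball C j \<Longrightarrow> norm (freq k) \<le> sqrt C * 2 powr j"
    using * by (auto simp: freq_ring_def freq_ball_def)
qed

lemma block_restrict:
  assumes "\<And>k. lp_sym j (freq k) \<noteq> 0 \<Longrightarrow> k \<in> K"
  shows "block P j g = (\<lambda>k. of_real (lp_sym j (freq k)) * restrict_freq K g k)"
  using assms by (auto simp: fun_eq_iff block_apply restrict_freq_def)

lemma lp_sym_scaled: "j \<noteq> -1 \<Longrightarrow> lp_sym j x = snd P ((1 / 2 powr j) *\<^sub>R x)"
  by (simp add: lp_sym_def powr_minus divide_inverse)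

text \<open>The commutator estimate is applied with \<psi> = \<open>snd P\<close> and a =
  \<open>below j f\<close>: the symbol of the block \<open>j\<close> vanishes on the frequencies of
  the low part and, being radial, on their negatives. The gain 2^(j t) is due to the increment of
  the symbol, not to the location of the output frequencies.\<close>

lemma para_term_bound_left:
  assumes t: "-1 \<le> t" "t \<le> 0"
  shows "\<exists>B\<ge>0. \<forall>j\<ge>-1. \<forall>f. \<forall>g\<in>sobolev s.
    sobolev_norm t (para_term j f g) \<le> B * 2 powr (real_of_int j * (t - s)) * Linf_norm (below j f) * sobolev_norm s g"
proof -
  obtain r R where R: "r > 0" "R > 0" "\<And>j x. -1 \<le> j \<Longrightarrow> lp_sym j x \<noteq> 0 \<Longrightarrow> norm x \<le> R * 2 powr j"
    "\<And>j x. 0 \<le> j \<Longrightarrow> lp_sym j x \<noteq> 0 \<Longrightarrow> r * 2 powr j \<le> norm x"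
    by (rule lp_sym_support, rule that)
  obtain c C where cC: "c > 0" "C > 0" "\<And>j k. -1 \<le> j \<Longrightarrow> lp_sym j (freq k) \<noteq> 0 \<Longrightarrow> k \<in> freq_ring c C j"
    by (rule lp_sym_ring, rule that)
  obtain Rr where Rr: "\<And>x. snd P x \<noteq> 0 \<Longrightarrow> norm x \<le> Rr" using rho_annulus by blast
  define L where "L = max R (sqrt C)"
  obtain B1 where B1c: "commutator_const (snd P) L B1"
    using commutator_bound[OF smooth_rho Rr, of L] by blast
  then have B1: "B1 \<ge> 0" by (simp add: commutator_const_def)
  obtain B2 where B2: "B2 \<ge> 0" "\<And>j f. f \<in> sobolev s \<Longrightarrow> sobolev_norm 0 (restrict_freq (freq_ring c C j) f) \<le> B2 * 2 powr (- real_of_int j * s) * sobolev_norm s f"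
    using freq_ring_bound[OF cC(1,2)] by blast
  show ?thesis
  proof (intro exI[of _ "B1 * B2"] conjI allI ballI impI)
    show "0 \<le> B1 * B2" using B1 B2(1) by simp
    fix j :: int and f g assume j: "-1 \<le> j" and g: "g \<in> sobolev s"
    let ?rhs = "B1 * B2 * 2 powr (real_of_int j * (t - s)) * Linf_norm (below j f) * sobolev_norm s g"
    show "sobolev_norm t (para_term j f g) \<le> ?rhs"
    proof (cases "j < 1")
      case True
      then show ?thesis by (simp add: para_term_eq_0 below_eq_0)
    next
      case False
      \<comment> \<open>Cutting \<open>g\<close> to the ring leaves its block unchanged and makes
        the L2 norm of order 2^(- j s).\<close>
      let ?a = "below j f" and ?b = "restrict_freq (freq_ring c C j) g" and ?N = "2 powr real_of_int j :: real"
      have bl: "block P j g = (\<lambda>k. of_real (snd P ((1 / ?N) *\<^sub>R freq k)) * ?b k)"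
        using block_restrict[of j "freq_ring c C j" g] cC(3)[OF j] False by (simp add: lp_sym_scaled)
      have tb: "trig_poly ?b" by (intro trig_poly_restrict finite_freq_ring)
      have La: "norm (freq l) \<le> L * ?N" if l: "?a l \<noteq> 0" for l
      proof -
        obtain i where i: "-1 \<le> i" "i \<le> j - 2" "lp_sym i (freq l) \<noteq> 0" using below_support[OF l] by blast
        have "norm (freq l) \<le> R * 2 powr i" using R(3) i by blast
        also have "\<dots> \<le> L * ?N" using i R(2) by (intro mult_mono powr_mono) (auto simp: L_def)
        finally show ?thesis .
      qed
      have Lb: "norm (freq l) \<le> L * ?N" if "?b l \<noteq> 0" for l
      proof -
        have "l \<in> freq_ring c C j" using that by (auto simp: restrict_freq_def split: if_splits)
        then have "norm (freq l) \<le> sqrt C * ?N" by (rule norm_freq_le_ring)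
        also have "\<dots> \<le> L * ?N" by (intro mult_right_mono) (auto simp: L_def)
        finally show ?thesis .
      qed
      have a0: "snd P ((- 1 / ?N) *\<^sub>R freq l) = 0" if "?a l \<noteq> 0" for l
      proof -
        have "(\<Sum>i\<in>{-1..j - 2}. lp_sym i (freq l)) \<noteq> 0" using that by (auto simp: below_apply simp del: of_real_sum)
        then have "lp_sym j (freq l) = 0" using below_disjoint[OF j, of "freq l"] by simp
        then have "lp_sym j (- freq l) = 0" by (simp add: lp_sym_minus)
        then show ?thesis using False by (simp add: lp_sym_scaled)
      qed
      have D: "sobolev_norm 0 (pw_mult (\<lambda>l. echar l y * ?a l) ?b) \<le> Linf_norm ?a * (B2 * 2 powr (- real_of_int j * s) * sobolev_norm s g)" for y
      proof -
        have "sobolev_norm 0 (pw_mult (\<lambda>l. echar l y * ?a l) ?b) \<le> Linf_norm (\<lambda>l. echar l y * ?a l) * sobolev_norm 0 ?b"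
          by (intro sobolev_norm_pw_mult_le trig_poly_mult trig_poly_below tb)
        also have "\<dots> \<le> Linf_norm ?a * (B2 * 2 powr (- real_of_int j * s) * sobolev_norm s g)"
          by (intro mult_mono Linf_translate trig_poly_below B2(2) g Linf_nonneg) simp
        finally show ?thesis .
      qed
      have "sobolev_norm (- (- t)) (pw_mult ?a (\<lambda>k. of_real (snd P ((1 / ?N) *\<^sub>R freq k)) * ?b k)) \<le>
          B1 * ?N powr (- (- t)) * (Linf_norm ?a * (B2 * 2 powr (- real_of_int j * s) * sobolev_norm s g))"
        by (rule commutator_constD[OF B1c]) (use t tb La Lb a0 D in \<open>auto simp: trig_poly_below\<close>)
      moreover have "?N powr t * 2 powr (- real_of_int j * s) = 2 powr (real_of_int j * (t - s))"
        by (simp add: powr_powr algebra_simps flip: powr_add)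
      ultimately show ?thesis unfolding para_term_def bl
        by (simp add: mult_ac)
    qed
  qed
qed

text \<open>The roles are exchanged: now \<psi> = \<open>fst P\<close> is the symbol of the low
  part, a = \<open>block P j g\<close> carries the sup norm and \<open>f\<close> the Sobolev norm.
  The condition \<open>s \<le> 0\<close> enters through the cut of \<open>f\<close> to a
  ball.\<close>

lemma para_term_bound_right0:
  assumes t: "-1 \<le> t" "t \<le> 0" and s: "s \<le> 0"
  shows "\<exists>B\<ge>0. \<forall>j\<ge>-1. \<forall>f\<in>sobolev s. \<forall>g.
    sobolev_norm t (para_term j f g) \<le> B * 2 powr (real_of_int j * (t - s)) * sobolev_norm s f * Linf_norm (block P j g)"
proof -
  obtain r R where R: "r > 0" "R > 0" "\<And>j x. -1 \<le> j \<Longrightarrow> lp_sym j x \<noteq> 0 \<Longrightarrow> norm x \<le> R * 2 powr j"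
    "\<And>j x. 0 \<le> j \<Longrightarrow> lp_sym j x \<noteq> 0 \<Longrightarrow> r * 2 powr j \<le> norm x"
    by (rule lp_sym_support, rule that)
  obtain c C where cC: "c > 0" "C > 0" "\<And>j k. -1 \<le> j \<Longrightarrow> lp_sym j (freq k) \<noteq> 0 \<Longrightarrow> k \<in> freq_ring c C j"
    by (rule lp_sym_ring, rule that)
  obtain Rr where Rr: "\<And>x. fst P x \<noteq> 0 \<Longrightarrow> norm x \<le> Rr" using chi_bounded_support by blast
  define L where "L = 2 * max R (sqrt C)"
  obtain B1 where B1c: "commutator_const (fst P) L B1"
    using commutator_bound[OF smooth_chi Rr, of L] by blast
  then have B1: "B1 \<ge> 0" by (simp add: commutator_const_def)
  obtain B2 where B2: "B2 \<ge> 0" "\<And>j f. f \<in> sobolev s \<Longrightarrow> sobolev_norm 0 (restrict_freq (freq_ball C j) f) \<le> B2 * 2 powr (- real_of_int j * s) * sobolev_norm s f"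
    using freq_ball_bound[OF cC(2) s] by blast
  show ?thesis
  proof (intro exI[of _ "B1 * B2 * 2 powr (- t)"] conjI allI ballI impI)
    show "0 \<le> B1 * B2 * 2 powr (- t)" using B1 B2(1) by simp
    fix j :: int and f g assume j: "-1 \<le> j" and f: "f \<in> sobolev s"
    let ?rhs = "B1 * B2 * 2 powr (- t) * 2 powr (real_of_int j * (t - s)) * sobolev_norm s f * Linf_norm (block P j g)"
    show "sobolev_norm t (para_term j f g) \<le> ?rhs"
    proof (cases "j < 1")
      case True
      then show ?thesis using B1 B2(1) Linf_nonneg[OF trig_poly_block[OF j]] by (simp add: para_term_eq_0)
    next
      case False
      \<comment> \<open>The low part of index \<open>j\<close> is \<open>fst P\<close> at scale 2^(j
        - 1), hence this \<open>?N\<close>; the mismatch with 2^j gives the factor 2^(- t) in the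
        constant.\<close>
      let ?a = "block P j g" and ?b = "restrict_freq (freq_ball C j) f" and ?N = "2 powr real_of_int (j - 1) :: real"
      have Ninv: "2 powr (- real_of_int (j - 1)) = 1 / ?N" by (rule powr_minus_divide)
      have N2: "2 powr real_of_int j = 2 * ?N" by (simp add: powr_diff)
      have ball: "k \<in> freq_ball C j" if "-1 \<le> i" "i \<le> j" "lp_sym i (freq k) \<noteq> 0" for i k
      proof -
        have "bessel k \<le> C * 4 powr i" using cC(3)[OF that(1,3)] by (simp add: freq_ring_def)
        also have "\<dots> \<le> C * 4 powr j" using that cC(2) by (intro mult_left_mono powr_mono) auto
        finally show ?thesis by (simp add: freq_ball_def)
      qed
      have bl: "below j f = (\<lambda>k. of_real (fst P ((1 / ?N) *\<^sub>R freq k)) * ?b k)"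
      proof
        fix k
        have "(\<Sum>i\<in>{-1..j - 2}. lp_sym i (freq k)) = fst P ((1 / ?N) *\<^sub>R freq k)"
          using sum_lp_sym[of j "freq k"] False unfolding Ninv by simp
        then have eq: "below j f k = of_real (fst P ((1 / ?N) *\<^sub>R freq k)) * f k" by (simp add: below_apply)
        show "below j f k = of_real (fst P ((1 / ?N) *\<^sub>R freq k)) * ?b k"
        proof (cases "k \<in> freq_ball C j")
          case False
          have "below j f k = 0"
          proof (rule ccontr)
            assume "below j f k \<noteq> 0"
            then obtain i where "-1 \<le> i" "i \<le> j - 2" "lp_sym i (freq k) \<noteq> 0" by (rule below_support)
            then have "k \<in> freq_ball C j" by (intro ball) auto
            then show False using False by blast
          qed
          then show ?thesis using False by (simp add: restrict_freq_def)
        qed (use eq in \<open>simp add: restrict_freq_def\<close>)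
      qed
      have tb: "trig_poly ?b" by (intro trig_poly_restrict finite_freq_ball)
      have Lb: "norm (freq l) \<le> L * ?N" if "?b l \<noteq> 0" for l
      proof -
        have "l \<in> freq_ball C j" using that by (auto simp: restrict_freq_def split: if_splits)
        then have "norm (freq l) \<le> sqrt C * 2 powr j" by (rule norm_freq_le_ball)
        also have "\<dots> = (2 * sqrt C) * ?N" by (simp add: N2)
        also have "\<dots> \<le> L * ?N" by (intro mult_right_mono) (auto simp: L_def)
        finally show ?thesis .
      qed
      have La: "norm (freq l) \<le> L * ?N" if "?a l \<noteq> 0" for l
      proof -
        have "norm (freq l) \<le> R * 2 powr j" using that j by (intro R(3)) (auto simp: block_apply)
        also have "\<dots> = (2 * R) * ?N" by (simp add: N2)
        also have "\<dots> \<le> L * ?N" by (intro mult_right_mono) (auto simp: L_def)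
        finally show ?thesis .
      qed
      have a0: "fst P ((- 1 / ?N) *\<^sub>R freq l) = 0" if "?a l \<noteq> 0" for l
      proof -
        have "lp_sym j (- freq l) \<noteq> 0" using that by (auto simp: block_apply lp_sym_minus)
        then have "(\<Sum>i\<in>{-1..j - 2}. lp_sym i (- freq l)) = 0" using below_disjoint[OF j, of "- freq l"] by simp
        then show ?thesis using sum_lp_sym[of j "- freq l"] False unfolding Ninv by simp
      qed
      have D: "sobolev_norm 0 (pw_mult (\<lambda>l. echar l y * ?a l) ?b) \<le> Linf_norm ?a * (B2 * 2 powr (- real_of_int j * s) * sobolev_norm s f)" for y
      proof -
        have "sobolev_norm 0 (pw_mult (\<lambda>l. echar l y * ?a l) ?b) \<le> Linf_norm (\<lambda>l. echar l y * ?a l) * sobolev_norm 0 ?b"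
          by (intro sobolev_norm_pw_mult_le trig_poly_mult trig_poly_block j tb)
        also have "\<dots> \<le> Linf_norm ?a * (B2 * 2 powr (- real_of_int j * s) * sobolev_norm s f)"
          by (intro mult_mono Linf_translate trig_poly_block j B2(2) f Linf_nonneg) simp
        finally show ?thesis .
      qed
      have "sobolev_norm (- (- t)) (pw_mult ?a (\<lambda>k. of_real (fst P ((1 / ?N) *\<^sub>R freq k)) * ?b k)) \<le>
          B1 * ?N powr (- (- t)) * (Linf_norm ?a * (B2 * 2 powr (- real_of_int j * s) * sobolev_norm s f))"
        by (rule commutator_constD[OF B1c]) (use t tb La Lb a0 D j in \<open>auto simp: trig_poly_block\<close>)
      moreover have "?N powr t * 2 powr (- real_of_int j * s) = 2 powr (- t) * 2 powr (real_of_int j * (t - s))"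
        by (simp add: powr_powr algebra_simps flip: powr_add)
      ultimately show ?thesis unfolding para_term_def bl pw_mult_commute[of _ ?a]
        by (simp add: mult_ac)
    qed
  qed
qed

lemma para_term_freq:
  obtains K where "K > 0" "\<And>j f g k. -1 \<le> j \<Longrightarrow> para_term j f g k \<noteq> 0 \<Longrightarrow> bessel k \<le> K * 4 powr j"
proof -
  obtain r R where R: "r > 0" "R > 0" "\<And>j x. -1 \<le> j \<Longrightarrow> lp_sym j x \<noteq> 0 \<Longrightarrow> norm x \<le> R * 2 powr j"
    "\<And>j x. 0 \<le> j \<Longrightarrow> lp_sym j x \<noteq> 0 \<Longrightarrow> r * 2 powr j \<le> norm x"
    by (rule lp_sym_support, rule that)
  show ?thesis
  proof (rule that[of "4 + 4 * pi\<^sup>2 * (2 * R)\<^sup>2"])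
    show "4 + 4 * pi\<^sup>2 * (2 * R)\<^sup>2 > 0" by (intro add_pos_nonneg) auto
    fix j f g k assume j: "-1 \<le> j" and ne: "para_term j f g k \<noteq> 0"
    then have "(\<Sum>l\<in>{l. below j f l \<noteq> 0}. below j f l * block P j g (k - l)) \<noteq> 0"
      unfolding para_term_def pw_mult_trig[OF trig_poly_below] by blast
    then obtain l where l: "below j f l * block P j g (k - l) \<noteq> 0" by (rule sum.not_neutral_contains_not_neutral)
    then obtain i where i: "-1 \<le> i" "i \<le> j - 2" "lp_sym i (freq l) \<noteq> 0" using below_support[of j f l] by auto
    have "norm (freq l) \<le> R * 2 powr i" using R(3) i by blast
    also have "\<dots> \<le> R * 2 powr j" using i R(2) by (intro mult_left_mono powr_mono) auto
    finally have 1: "norm (freq l) \<le> R * 2 powr j" .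
    have "norm (freq (k - l)) \<le> R * 2 powr j" using l j by (intro R(3)) (auto simp: block_apply)
    with 1 have "norm (freq k) \<le> (2 * R) * 2 powr j"
      using norm_triangle_ineq[of "freq l" "freq (k - l)"] by (simp add: freq_diff)
    then have "(norm (freq k))\<^sup>2 \<le> ((2 * R) * 2 powr j)\<^sup>2" by (intro power_mono) auto
    also have "\<dots> = (2 * R)\<^sup>2 * 4 powr j" unfolding power_mult_distrib[of "2 * R"] by (simp add: four_powr power2_eq_square flip: powr_add)
    finally have "4 * pi\<^sup>2 * (norm (freq k))\<^sup>2 \<le> 4 * pi\<^sup>2 * ((2 * R)\<^sup>2 * 4 powr j)" by (intro mult_left_mono) auto
    moreover have "(4::real) powr (-1) \<le> 4 powr j" using j by (intro powr_mono) auto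
    then have "1 \<le> 4 * (4::real) powr j" by (simp add: powr_minus)
    ultimately have "bessel k \<le> 4 * 4 powr j + 4 * pi\<^sup>2 * ((2 * R)\<^sup>2 * 4 powr j)" unfolding bessel_def by linarith
    then show "bessel k \<le> (4 + 4 * pi\<^sup>2 * (2 * R)\<^sup>2) * 4 powr j" by (simp only: distrib_right mult.assoc)
  qed
qed

text \<open>For positive \<open>t\<close> an upper bound on the output frequencies is enough: the
  weight costs at most a multiple of 2^(j t), which reduces the claim to t = 0.\<close>

lemma para_term_bound_right:
  assumes t: "-1 \<le> t" and s: "s \<le> 0"
  shows "\<exists>B\<ge>0. \<forall>j\<ge>-1. \<forall>f\<in>sobolev s. \<forall>g.
    sobolev_norm t (para_term j f g) \<le> B * 2 powr (real_of_int j * (t - s)) * sobolev_norm s f * Linf_norm (block P j g)"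
proof (cases "t \<le> 0")
  case True
  then show ?thesis using para_term_bound_right0[OF t _ s] by blast
next
  case False
  obtain B where B: "B \<ge> 0" "\<And>j f g. -1 \<le> j \<Longrightarrow> f \<in> sobolev s \<Longrightarrow>
      sobolev_norm 0 (para_term j f g) \<le> B * 2 powr (real_of_int j * (0 - s)) * sobolev_norm s f * Linf_norm (block P j g)"
    using para_term_bound_right0[of 0 s] s by auto
  obtain K where K: "K > 0" "\<And>j f g k. -1 \<le> j \<Longrightarrow> para_term j f g k \<noteq> 0 \<Longrightarrow> bessel k \<le> K * 4 powr j"
    by (rule para_term_freq, rule that)
  show ?thesis
  proof (intro exI[of _ "K powr (t / 2) * B"] conjI allI ballI impI)
    show "0 \<le> K powr (t / 2) * B" using B by simp
    fix j :: int and f g assume j: "-1 \<le> j" and f: "f \<in> sobolev s"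
    let ?F = "para_term j f g"
    have "sobolev_norm t ?F \<le> (K powr (t / 2) * 2 powr (real_of_int j * t)) * sobolev_norm 0 ?F"
    proof (rule sobolev_compare(2))
      show "?F \<in> sobolev 0" by (intro trig_sobolev(1) trig_poly_para_term j)
      fix k
      show "sobolev_wt t ?F k \<le> (K powr (t / 2) * 2 powr (real_of_int j * t)) * sobolev_wt 0 ?F k"
      proof (cases "?F k = 0")
        case False
        have "bessel k powr (t / 2) \<le> (K * 4 powr j) powr (t / 2)"
          by (rule powr_mono2) (use \<open>\<not> t \<le> 0\<close> K(2)[OF j False] in \<open>auto simp: less_imp_le[OF bessel_pos]\<close>)
        also have "\<dots> = K powr (t / 2) * 2 powr (real_of_int j * t)"
          using K by (simp add: powr_mult four_powr powr_powr)
        finally have "bessel k powr (t / 2) \<le> K powr (t / 2) * 2 powr (real_of_int j * t)" .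
        then show ?thesis unfolding sobolev_wt_def by (simp add: mult_right_mono)
      qed (simp add: sobolev_wt_def)
    qed simp
    also have "\<dots> \<le> (K powr (t / 2) * 2 powr (real_of_int j * t)) * (B * 2 powr (real_of_int j * (0 - s)) * sobolev_norm s f * Linf_norm (block P j g))"
      by (intro mult_left_mono B(2) j f) simp
    also have "\<dots> = K powr (t / 2) * B * (2 powr (real_of_int j * t) * 2 powr (real_of_int j * (0 - s))) * sobolev_norm s f * Linf_norm (block P j g)"
      by (simp only: mult_ac)
    also have "2 powr (real_of_int j * t) * 2 powr (real_of_int j * (0 - s)) = 2 powr (real_of_int j * (t - s))"
      by (simp add: algebra_simps flip: powr_add)
    finally show "sobolev_norm t ?F \<le> K powr (t / 2) * B * 2 powr (real_of_int j * (t - s)) * sobolev_norm s f * Linf_norm (block P j g)" .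
  qed
qed

end

lemma scal_1 [simp]: "scal 1 f = f"
  by (simp add: scal_def)

lemma summable_two_powr:
  assumes "\<delta> > 0"
  shows "(\<lambda>j::int. 2 powr (- real_of_int j * \<delta>)) summable_on {-1..}"
proof -
  define q where "q = (2::real) powr (- \<delta>)"
  have q: "0 < q" "q < 1" using assms by (auto simp: q_def powr_less_one)
  have r: "{-1::int..} = (\<lambda>n. int n - 1) ` UNIV"
  proof (intro equalityI subsetI)
    fix j :: int assume "j \<in> {-1..}"
    then have "j = int (nat (j + 1)) - 1" by simp
    then show "j \<in> (\<lambda>n. int n - 1) ` UNIV" by (rule image_eqI) simp
  qed auto
  have "(\<lambda>n. 2 powr \<delta> * q ^ n) summable_on UNIV"
    using q by (intro summable_on_cmult_right summable_on_UNIV_nonneg_real_iff[THEN iffD2] summable_geometric) auto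
  moreover have "2 powr (- real_of_int (int n - 1) * \<delta>) = 2 powr \<delta> * q ^ n" for n
  proof -
    have "q ^ n = 2 powr (- \<delta> * real n)" using q by (simp add: q_def powr_realpow[symmetric] powr_powr)
    then show ?thesis by (simp add: algebra_simps flip: powr_add)
  qed
  then have eq: "(\<lambda>j::int. 2 powr (- real_of_int j * \<delta>)) \<circ> (\<lambda>n. int n - 1) = (\<lambda>n. 2 powr \<delta> * q ^ n)"
    by (simp only: o_def)
  ultimately show ?thesis
    unfolding r by (subst summable_on_reindex) (simp_all only: eq, simp add: inj_on_def)
qed

context littlewood_paley
begin

section \<open>Besov norms of sums and of trigonometric polynomials\<close>

lemma block_lin: "block P j (scal a f + scal b g) = scal a (block P j f) + scal b (block P j g)"
  by (simp add: fun_eq_iff block_apply scal_def algebra_simps)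

lemma block_add: "block P j (f + g) = block P j f + block P j g"
  by (simp add: fun_eq_iff block_apply algebra_simps)

lemma block_uminus: "block P j (- f) = - block P j f"
  by (simp add: fun_eq_iff block_apply)

lemma block_0 [simp]: "block P j 0 = 0"
  by (simp add: fun_eq_iff block_apply)

lemma besov_Linf_le:
  assumes "g \<in> besov P b" "-1 \<le> j"
  shows "Linf_norm (block P j g) \<le> 2 powr (- real_of_int j * b) * besov_norm P b g"
proof -
  have "2 powr (real_of_int j * b) * Linf_norm (block P j g) \<le> besov_norm P b g"
    unfolding besov_norm_def by (rule cSUP_upper) (use assms in \<open>auto simp: besov_def\<close>)
  then have "2 powr (- real_of_int j * b) * (2 powr (real_of_int j * b) * Linf_norm (block P j g)) \<le> 2 powr (- real_of_int j * b) * besov_norm P b g"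
    by (rule mult_left_mono) simp
  then show ?thesis by (simp add: mult.assoc[symmetric] flip: powr_add)
qed

lemma besov_norm_nonneg: "g \<in> besov P b \<Longrightarrow> 0 \<le> besov_norm P b g"
  using besov_Linf_le[of g b 0] Linf_nonneg[OF trig_poly_block[of 0 g]] by simp

lemma besov_I:
  assumes "\<And>j. -1 \<le> j \<Longrightarrow> 2 powr (real_of_int j * b) * Linf_norm (block P j g) \<le> M"
  shows "g \<in> besov P b" "besov_norm P b g \<le> M"
proof -
  show "g \<in> besov P b" unfolding besov_def by (auto intro!: bdd_aboveI2 assms)
  show "besov_norm P b g \<le> M" unfolding besov_norm_def by (rule cSUP_least) (auto intro!: assms)
qed

lemma besov_add:
  assumes "f \<in> besov P b" "g \<in> besov P b"
  shows "f + g \<in> besov P b" "besov_norm P b (f + g) \<le> besov_norm P b f + besov_norm P b g"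
proof -
  have "2 powr (real_of_int j * b) * Linf_norm (block P j (f + g)) \<le> besov_norm P b f + besov_norm P b g"
    if "-1 \<le> j" for j
  proof -
    have "Linf_norm (block P j (f + g)) \<le> Linf_norm (block P j f) + Linf_norm (block P j g)"
      unfolding block_add by (intro Linf_add trig_poly_block that)
    also have "\<dots> \<le> 2 powr (- real_of_int j * b) * (besov_norm P b f + besov_norm P b g)"
      using besov_Linf_le[OF assms(1) that] besov_Linf_le[OF assms(2) that] by (simp add: distrib_left)
    finally have "2 powr (real_of_int j * b) * Linf_norm (block P j (f + g)) \<le>
        2 powr (real_of_int j * b) * (2 powr (- real_of_int j * b) * (besov_norm P b f + besov_norm P b g))"
      by (rule mult_left_mono) simp
    then show ?thesis by (simp add: mult.assoc[symmetric] flip: powr_add)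
  qed
  from besov_I[OF this] show "f + g \<in> besov P b" "besov_norm P b (f + g) \<le> besov_norm P b f + besov_norm P b g" by auto
qed

lemma besov_uminus:
  assumes "f \<in> besov P b"
  shows "- f \<in> besov P b" "besov_norm P b (- f) = besov_norm P b f"
  using assms by (simp_all add: besov_def besov_norm_def block_uminus)

lemma besov_diff:
  assumes "f \<in> besov P b" "g \<in> besov P b"
  shows "f - g \<in> besov P b" "besov_norm P b (f - g) \<le> besov_norm P b f + besov_norm P b g"
  using besov_add[OF assms(1) besov_uminus(1)[OF assms(2)]] besov_uminus(2)[OF assms(2)] by auto

lemma trig_poly_besov:
  assumes "trig_poly f"
  shows "f \<in> besov P b"
proof -
  obtain r R where R: "r > 0" "R > 0" "\<And>j x. -1 \<le> j \<Longrightarrow> lp_sym j x \<noteq> 0 \<Longrightarrow> norm x \<le> R * 2 powr j"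
    "\<And>j x. 0 \<le> j \<Longrightarrow> lp_sym j x \<noteq> 0 \<Longrightarrow> r * 2 powr j \<le> norm x"
    by (rule lp_sym_support, rule that)
  define M where "M = (\<Sum>k\<in>{k. f k \<noteq> 0}. norm (freq k))"
  define S where "S = (\<Sum>k\<in>{k. f k \<noteq> 0}. cmod (f k))"
  have fin: "finite {k. f k \<noteq> 0}" using assms by (simp add: trig_poly_def)
  have kM: "norm (freq k) \<le> M" if "f k \<noteq> 0" for k
    unfolding M_def by (rule member_le_sum) (use that fin in auto)
  have S0: "S \<ge> 0" unfolding S_def by (intro sum_nonneg) simp
  \<comment> \<open>Blocks beyond \<open>n\<close> vanish, because their frequencies would exceed
    \<open>M\<close>; the remaining ones are bounded by the sum of all coefficients.\<close>
  obtain n :: nat where n: "M / r < 2 ^ n" using real_arch_pow[of 2 "M / r"] by auto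
  have "2 powr (real_of_int j * b) * Linf_norm (block P j f) \<le> max (2 powr (- b)) (2 powr (real n * \<bar>b\<bar>)) * S" if j: "-1 \<le> j" for j
  proof (cases "j \<le> int n")
    case True
    have "Linf_norm (block P j f) \<le> (\<Sum>k\<in>{k. block P j f k \<noteq> 0}. cmod (block P j f k))"
      by (intro Linf_le_sum trig_poly_block j)
    also have "\<dots> \<le> (\<Sum>k\<in>{k. block P j f k \<noteq> 0}. cmod (f k))"
      using lp_sym_le_one[OF j] lp_sym_nonneg by (intro sum_mono) (simp add: block_apply norm_mult mult_left_le_one_le)
    also have "\<dots> \<le> S" unfolding S_def by (intro sum_mono2 fin) (auto simp: block_apply)
    finally have 1: "Linf_norm (block P j f) \<le> S" .
    have "real_of_int j * b \<le> max (- b) (real n * \<bar>b\<bar>)"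
    proof (cases "j = -1")
      case False
      then have "real_of_int j * b \<le> real_of_int j * \<bar>b\<bar>" using j by (intro mult_left_mono) auto
      also have "\<dots> \<le> real n * \<bar>b\<bar>" using True by (intro mult_right_mono) auto
      finally have "real_of_int j * b \<le> real n * \<bar>b\<bar>" .
      then show ?thesis by simp
    qed simp
    then have "2 powr (real_of_int j * b) \<le> 2 powr max (- b) (real n * \<bar>b\<bar>)" by simp
    also have "\<dots> \<le> max (2 powr (- b)) (2 powr (real n * \<bar>b\<bar>))" by (simp add: max_def)
    finally show ?thesis using 1 S0 Linf_nonneg[OF trig_poly_block[OF j]] by (intro mult_mono) (auto simp: le_max_iff_disj)
  next
    case False
    have "block P j f = 0"
    proof
      fix k
      show "block P j f k = 0 k"
      proof (rule ccontr)
        assume "block P j f k \<noteq> 0 k"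
        then have k: "f k \<noteq> 0" "lp_sym j (freq k) \<noteq> 0" by (auto simp: block_apply)
        have "r * 2 powr j \<le> M" using R(4)[of j "freq k"] k kM False by fastforce
        then have "2 powr j \<le> M / r" using R(1) by (simp add: field_simps)
        moreover have "(2::real) ^ n \<le> 2 powr j" using False by (subst powr_realpow[symmetric]) auto
        ultimately show False using n by linarith
      qed
    qed
    then show ?thesis using S0 by (simp add: le_max_iff_disj)
  qed
  then show ?thesis by (rule besov_I(1))
qed

text \<open>For \<open>b < 0\<close> the geometric sum over the lower blocks is dominated by a
  multiple of its last term; induction on \<open>j\<close> gives the explicit constant 1 / (2^(- b)
  - 1).\<close>

lemma below_Linf_le:
  assumes b: "b < 0"
  shows "\<exists>K\<ge>0. \<forall>j\<ge>-1. \<forall>f\<in>besov P b. Linf_norm (below j f) \<le> K * 2 powr (- real_of_int j * b) * besov_norm P b f"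
proof (intro exI[of _ "1 / (2 powr (- b) - 1)"] conjI allI ballI impI)
  have q: "2 powr (- b) > 1" using b by simp
  then show "0 \<le> 1 / (2 powr (- b) - 1)" by simp
  fix j :: int and f assume j: "-1 \<le> j" and f: "f \<in> besov P b"
  have geo: "(\<Sum>i\<in>{-1..j - 2}. 2 powr (- real_of_int i * b)) \<le> 2 powr (- real_of_int j * b) / (2 powr (- b) - 1)"
    using j
  proof (induction j rule: int_ge_induct)
    case base
    then show ?case using q by simp
  next
    case (step j)
    show ?case
    proof (cases "j \<ge> 1 - 1")
      case True
      have eq: "{-1..(j + 1) - 2} = insert (j - 1) {-1..j - 2}" using True by auto
      have "(\<Sum>i\<in>{-1..(j + 1) - 2}. 2 powr (- real_of_int i * b)) = 2 powr (- real_of_int (j - 1) * b) + (\<Sum>i\<in>{-1..j - 2}. 2 powr (- real_of_int i * b))"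
        unfolding eq by (subst sum.insert) auto
      also have "\<dots> \<le> 2 powr (- real_of_int j * b) + 2 powr (- real_of_int j * b) / (2 powr (- b) - 1)"
        using step.IH b by (intro add_mono) (auto simp: algebra_simps)
      also have "\<dots> = 2 powr (- real_of_int j * b) * 2 powr (- b) / (2 powr (- b) - 1)"
      proof -
        have "x + x / (y - 1) = x * y / (y - 1)" if "1 < y" for x y :: real
          using that by (simp add: field_simps)
        then show ?thesis using q by blast
      qed
      also have "2 powr (- real_of_int j * b) * 2 powr (- b) = 2 powr (- real_of_int (j + 1) * b)"
        by (simp add: algebra_simps flip: powr_add)
      finally show ?thesis .
    next
      case False
      then show ?thesis using step.hyps q by simp
    qed
  qed
  have "Linf_norm (below j f) \<le> (\<Sum>i\<in>{-1..j - 2}. Linf_norm (block P i f))"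
    unfolding below_def by (rule Linf_sum) (auto intro: trig_poly_block)
  also have "\<dots> \<le> (\<Sum>i\<in>{-1..j - 2}. 2 powr (- real_of_int i * b) * besov_norm P b f)"
    by (intro sum_mono besov_Linf_le f) auto
  also have "\<dots> = (\<Sum>i\<in>{-1..j - 2}. 2 powr (- real_of_int i * b)) * besov_norm P b f"
    by (simp add: sum_distrib_right)
  also have "\<dots> \<le> 2 powr (- real_of_int j * b) / (2 powr (- b) - 1) * besov_norm P b f"
    by (intro mult_right_mono geo besov_norm_nonneg f)
  finally show "Linf_norm (below j f) \<le> 1 / (2 powr (- b) - 1) * 2 powr (- real_of_int j * b) * besov_norm P b f"
    by simp
qed

text \<open>An infinite sum that does not converge has the default value 0, which is not additive.
  Summability at each frequency is therefore tracked alongside every bound, so that the linearity of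
  \<open>para\<close> can be used.\<close>

definition para_ok :: "pdist \<Rightarrow> pdist \<Rightarrow> bool" where
  "para_ok f g \<longleftrightarrow> (\<forall>k. (\<lambda>j. para_term j f g k) summable_on {-1..})"

text \<open>The strict inequality between the exponents leaves a surplus \<delta>, which makes the
  series over \<open>j\<close> geometric.\<close>

lemma para_sum_bound:
  assumes "\<And>j. -1 \<le> j \<Longrightarrow> sobolev_norm t (para_term j f g) \<le> 2 powr (- real_of_int j * \<delta>) * M" and "\<delta> > 0"
  shows "para_ok f g" "para P f g \<in> sobolev t"
    "sobolev_norm t (para P f g) \<le> (\<Sum>\<^sub>\<infinity>j\<in>{-1::int..}. 2 powr (- real_of_int j * \<delta>)) * M"
proof -
  note s = summable_two_powr[OF assms(2)]
  have sM: "(\<lambda>j. 2 powr (- real_of_int j * \<delta>) * M) summable_on {-1::int..}"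
    by (rule summable_on_cmult_left[OF s])
  have G: "para_term j f g \<in> sobolev t" if "j \<in> {-1..}" for j
    using that by (auto intro: trig_sobolev(1) trig_poly_para_term)
  have le: "sobolev_norm t (para_term j f g) \<le> 2 powr (- real_of_int j * \<delta>) * M" if "j \<in> {-1..}" for j
    using that assms(1) by simp
  note * = sobolev_infsum[OF G le sM]
  show "para_ok f g"
    unfolding para_ok_def by (rule allI, rule abs_summable_summable, rule *(1))
  show "para P f g \<in> sobolev t" unfolding para_eq by (rule *(2))
  have "sobolev_norm t (para P f g) \<le> (\<Sum>\<^sub>\<infinity>j\<in>{-1::int..}. 2 powr (- real_of_int j * \<delta>) * M)"
    unfolding para_eq by (rule *(3))
  then show "sobolev_norm t (para P f g) \<le> (\<Sum>\<^sub>\<infinity>j\<in>{-1::int..}. 2 powr (- real_of_int j * \<delta>)) * M"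
    by (subst (asm) infsum_cmult_left) (use s in auto)
qed

lemma infsum_two_powr_nonneg: "0 \<le> (\<Sum>\<^sub>\<infinity>j\<in>{-1::int..}. 2 powr (- real_of_int j * \<delta>))"
  by (intro infsum_nonneg) simp

lemma para_bound_sobolev_besov:
  assumes "-1 \<le> t" "s \<le> 0" "t < s + b"
  shows "\<exists>B\<ge>0. \<forall>f\<in>sobolev s. \<forall>g\<in>besov P b. para_ok f g \<and> para P f g \<in> sobolev t \<and>
    sobolev_norm t (para P f g) \<le> B * sobolev_norm s f * besov_norm P b g"
proof -
  obtain B where B: "B \<ge> 0" "\<And>j f g. -1 \<le> j \<Longrightarrow> f \<in> sobolev s \<Longrightarrow>
    sobolev_norm t (para_term j f g) \<le> B * 2 powr (real_of_int j * (t - s)) * sobolev_norm s f * Linf_norm (block P j g)"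
    using para_term_bound_right[OF assms(1,2)] by blast
  define \<delta> where "\<delta> = s + b - t"
  have d: "\<delta> > 0" using assms by (simp add: \<delta>_def)
  let ?S = "\<Sum>\<^sub>\<infinity>j\<in>{-1::int..}. 2 powr (- real_of_int j * \<delta>)"
  show ?thesis
  proof (intro exI[of _ "?S * B"] conjI ballI)
    show "0 \<le> ?S * B" using B infsum_two_powr_nonneg[of \<delta>] by simp
    fix f g assume f: "f \<in> sobolev s" and g: "g \<in> besov P b"
    have "sobolev_norm t (para_term j f g) \<le> 2 powr (- real_of_int j * \<delta>) * (B * sobolev_norm s f * besov_norm P b g)" if j: "-1 \<le> j" for j
    proof -
      have "sobolev_norm t (para_term j f g) \<le> B * 2 powr (real_of_int j * (t - s)) * sobolev_norm s f * (2 powr (- real_of_int j * b) * besov_norm P b g)"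
        by (rule order_trans[OF B(2)[OF j f] mult_left_mono]) (use B besov_Linf_le[OF g j] in auto)
      also have "\<dots> = (2 powr (real_of_int j * (t - s)) * 2 powr (- real_of_int j * b)) * (B * sobolev_norm s f * besov_norm P b g)"
        by (simp only: mult_ac)
      also have "2 powr (real_of_int j * (t - s)) * 2 powr (- real_of_int j * b) = 2 powr (- real_of_int j * \<delta>)"
        by (simp add: \<delta>_def algebra_simps flip: powr_add)
      finally show ?thesis .
    qed
    from para_sum_bound[OF this d]
    show "para_ok f g" "para P f g \<in> sobolev t" "sobolev_norm t (para P f g) \<le> ?S * B * sobolev_norm s f * besov_norm P b g"
      by (auto simp: mult.assoc)
  qed
qed

text \<open>The Sobolev factor is quantified first although it stands on the right of the
  paraproduct, so that this bound and the mirrored one both have the form expected by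
  \<open>noise_bounded_bilinear\<close>.\<close>

lemma para_bound_besov_sobolev:
  assumes "-1 \<le> t" "t \<le> 0" "b < 0" "t < b + s"
  shows "\<exists>B\<ge>0. \<forall>g\<in>sobolev s. \<forall>f\<in>besov P b. para_ok f g \<and> para P f g \<in> sobolev t \<and>
    sobolev_norm t (para P f g) \<le> B * sobolev_norm s g * besov_norm P b f"
proof -
  obtain B where B: "B \<ge> 0" "\<And>j f g. -1 \<le> j \<Longrightarrow> g \<in> sobolev s \<Longrightarrow>
    sobolev_norm t (para_term j f g) \<le> B * 2 powr (real_of_int j * (t - s)) * Linf_norm (below j f) * sobolev_norm s g"
    using para_term_bound_left[OF assms(1,2)] by blast
  obtain K where K: "K \<ge> 0" "\<And>j f. -1 \<le> j \<Longrightarrow> f \<in> besov P b \<Longrightarrow> Linf_norm (below j f) \<le> K * 2 powr (- real_of_int j * b) * besov_norm P b f"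
    using below_Linf_le[OF assms(3)] by blast
  define \<delta> where "\<delta> = s + b - t"
  have d: "\<delta> > 0" using assms by (simp add: \<delta>_def)
  let ?S = "\<Sum>\<^sub>\<infinity>j\<in>{-1::int..}. 2 powr (- real_of_int j * \<delta>)"
  show ?thesis
  proof (intro exI[of _ "?S * (B * K)"] conjI ballI)
    show "0 \<le> ?S * (B * K)" using B K infsum_two_powr_nonneg[of \<delta>] by simp
    fix g f assume g: "g \<in> sobolev s" and f: "f \<in> besov P b"
    have "sobolev_norm t (para_term j f g) \<le> 2 powr (- real_of_int j * \<delta>) * (B * K * (sobolev_norm s g * besov_norm P b f))" if j: "-1 \<le> j" for j
    proof -
      have "sobolev_norm t (para_term j f g) \<le> B * 2 powr (real_of_int j * (t - s)) * (K * 2 powr (- real_of_int j * b) * besov_norm P b f) * sobolev_norm s g"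
        by (rule order_trans[OF B(2)[OF j g]], intro mult_right_mono mult_left_mono K(2) j f) (use B in auto)
      also have "\<dots> = (2 powr (real_of_int j * (t - s)) * 2 powr (- real_of_int j * b)) * (B * K * (sobolev_norm s g * besov_norm P b f))"
        by (simp only: mult_ac)
      also have "2 powr (real_of_int j * (t - s)) * 2 powr (- real_of_int j * b) = 2 powr (- real_of_int j * \<delta>)"
        by (simp add: \<delta>_def algebra_simps flip: powr_add)
      finally show ?thesis .
    qed
    from para_sum_bound[OF this d]
    show "para_ok f g" "para P f g \<in> sobolev t" "sobolev_norm t (para P f g) \<le> ?S * (B * K) * sobolev_norm s g * besov_norm P b f"
      by (auto simp: mult.assoc)
  qed
qed

lemma below_lin: "below j (scal a f + scal b g) = scal a (below j f) + scal b (below j g)"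
  by (simp add: fun_eq_iff below_apply scal_def algebra_simps)

lemma para_term_lin_left:
  assumes "-1 \<le> j"
  shows "para_term j (scal a f + scal b g) h = scal a (para_term j f h) + scal b (para_term j g h)"
  unfolding para_term_def below_lin
  by (simp add: pw_mult_add_left pw_mult_scal_left trig_poly_block assms)

lemma para_term_lin_right:
  "para_term j h (scal a f + scal b g) = scal a (para_term j h f) + scal b (para_term j h g)"
  unfolding para_term_def block_lin
  by (simp add: pw_mult_add_right pw_mult_scal_right trig_poly_below)

lemma para_lin_left:
  assumes "para_ok f h" "para_ok g h"
  shows "para_ok (scal a f + scal b g) h" "para P (scal a f + scal b g) h = scal a (para P f h) + scal b (para P g h)"
proof -
  have "((\<lambda>j. para_term j (scal a f + scal b g) h k) has_sum (a * para P f h k + b * para P g h k)) {-1..}" for k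
  proof -
    have "((\<lambda>j. a * para_term j f h k + b * para_term j g h k) has_sum (a * para P f h k + b * para P g h k)) {-1..}"
      unfolding para_eq using assms by (intro has_sum_add has_sum_cmult_right has_sum_infsum) (auto simp: para_ok_def)
    then show ?thesis
      by (rule has_sum_cong[THEN iffD1, rotated]) (simp add: para_term_lin_left, simp add: scal_def)
  qed
  then show "para_ok (scal a f + scal b g) h" "para P (scal a f + scal b g) h = scal a (para P f h) + scal b (para P g h)"
    by (auto simp: para_ok_def para_eq fun_eq_iff scal_def has_sum_iff)
qed

lemma para_lin_right:
  assumes "para_ok h f" "para_ok h g"
  shows "para_ok h (scal a f + scal b g)" "para P h (scal a f + scal b g) = scal a (para P h f) + scal b (para P h g)"
proof -
  have "((\<lambda>j. para_term j h (scal a f + scal b g) k) has_sum (a * para P h f k + b * para P h g k)) {-1..}" for k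
  proof -
    have "((\<lambda>j. a * para_term j h f k + b * para_term j h g k) has_sum (a * para P h f k + b * para P h g k)) {-1..}"
      unfolding para_eq using assms by (intro has_sum_add has_sum_cmult_right has_sum_infsum) (auto simp: para_ok_def)
    then show ?thesis
      by (rule has_sum_cong[THEN iffD1, rotated]) (simp add: para_term_lin_right, simp add: scal_def)
  qed
  then show "para_ok h (scal a f + scal b g)" "para P h (scal a f + scal b g) = scal a (para P h f) + scal b (para P h g)"
    by (auto simp: para_ok_def para_eq fun_eq_iff scal_def has_sum_iff)
qed

section \<open>The resonant product\<close>

definition res_pairs :: "(int \<times> int) set" where
  "res_pairs = {(i, j). -1 \<le> i \<and> -1 \<le> j \<and> \<bar>i - j\<bar> \<le> 1}"

definition res_term :: "int \<times> int \<Rightarrow> pdist \<Rightarrow> pdist \<Rightarrow> pdist" where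
  "res_term p f g = pw_mult (block P (fst p) f) (block P (snd p) g)"

definition res_ok :: "pdist \<Rightarrow> pdist \<Rightarrow> bool" where
  "res_ok f g \<longleftrightarrow> (\<forall>k. (\<lambda>p. res_term p f g k) summable_on res_pairs)"

lemma reson_eq: "reson P f g = (\<lambda>k. \<Sum>\<^sub>\<infinity>p\<in>res_pairs. res_term p f g k)"
  unfolding reson_def res_pairs_def res_term_def by (simp add: case_prod_unfold)

lemma res_pairs_ge: "p \<in> res_pairs \<Longrightarrow> -1 \<le> fst p \<and> -1 \<le> snd p"
  by (auto simp: res_pairs_def)

lemma reson_commute: "reson P f g = reson P g f"
proof
  fix k
  have "bij_betw prod.swap res_pairs res_pairs"
    by (rule bij_betwI[where g = prod.swap]) (auto simp: res_pairs_def)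
  from infsum_reindex_bij_betw[OF this, of "\<lambda>p. res_term p g f k"]
  show "reson P f g k = reson P g f k"
    by (simp add: reson_eq res_term_def pw_mult_commute[of "block P _ f"])
qed

lemma block_L2_bound:
  "\<exists>B\<ge>0. \<forall>j\<ge>-1. \<forall>f\<in>sobolev s. sobolev_norm 0 (block P j f) \<le> B * 2 powr (- real_of_int j * s) * sobolev_norm s f"
proof -
  obtain c C where cC: "c > 0" "C > 0" "\<And>j k. -1 \<le> j \<Longrightarrow> lp_sym j (freq k) \<noteq> 0 \<Longrightarrow> k \<in> freq_ring c C j"
    by (rule lp_sym_ring, rule that)
  obtain B where B: "B \<ge> 0" "\<And>j f. f \<in> sobolev s \<Longrightarrow> sobolev_norm 0 (restrict_freq (freq_ring c C j) f) \<le> B * 2 powr (- real_of_int j * s) * sobolev_norm s f"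
    using freq_ring_bound[OF cC(1,2)] by blast
  have "sobolev_norm 0 (block P j f) \<le> B * 2 powr (- real_of_int j * s) * sobolev_norm s f" if "-1 \<le> j" "f \<in> sobolev s" for j f
  proof -
    have "sobolev_norm 0 (block P j f) \<le> sobolev_norm 0 (restrict_freq (freq_ring c C j) f)"
    proof (rule sobolev_compare1(2))
      show "restrict_freq (freq_ring c C j) f \<in> sobolev 0" by (intro trig_sobolev(1) trig_poly_restrict finite_freq_ring)
      show "sobolev_wt 0 (block P j f) k \<le> sobolev_wt 0 (restrict_freq (freq_ring c C j) f) k" for k
        using cC(3)[OF that(1), of k] lp_sym_le_one[OF that(1), of "freq k"] lp_sym_nonneg[of j "freq k"]
        by (cases "lp_sym j (freq k) = 0")
           (simp_all add: sobolev_wt_def block_apply restrict_freq_def norm_mult mult_left_le_one_le)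
    qed
    then show ?thesis using B(2)[OF that(2), of j] by linarith
  qed
  then show ?thesis using B(1) by blast
qed

text \<open>Both factors of a resonant term have comparable frequency, so the regularities add up
  term by term and a positive sum suffices for absolute convergence in L2. No frequency localization
  of the product is used.\<close>

lemma reson_bound:
  assumes ab: "0 < a + b"
  shows "\<exists>B\<ge>0. \<forall>f\<in>sobolev a. \<forall>g\<in>besov P b. res_ok f g \<and> reson P f g \<in> sobolev 0 \<and>
    sobolev_norm 0 (reson P f g) \<le> B * sobolev_norm a f * besov_norm P b g"
proof -
  obtain B where B: "B \<ge> 0" "\<And>j f. -1 \<le> j \<Longrightarrow> f \<in> sobolev a \<Longrightarrow> sobolev_norm 0 (block P j f) \<le> B * 2 powr (- real_of_int j * a) * sobolev_norm a f"
    using block_L2_bound by blast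
  \<comment> \<open>The exponent \<open>a + b\<close> is split evenly over the two indices to get a
    product weight; since |i - j| \<le> 1 this changes each term by at most the factor
    \<open>E\<close>.\<close>
  define \<delta> where "\<delta> = (a + b) / 2"
  have d: "\<delta> > 0" using ab by (simp add: \<delta>_def)
  define w where "w p = 2 powr (- real_of_int (fst p) * \<delta>) * 2 powr (- real_of_int (snd p) * \<delta>)" for p :: "int \<times> int"
  have "w summable_on {-1..} \<times> {-1..}"
    unfolding w_def[abs_def] by (rule summable_on_Times_nonneg) (simp_all only: summable_two_powr[OF d] powr_ge_zero)
  then have w: "w summable_on res_pairs"
    by (rule summable_on_subset_banach) (auto simp: res_pairs_def)
  define E where "E = 2 powr (\<bar>a - b\<bar> / 2)"
  have wE: "2 powr (- real_of_int (fst p) * a) * 2 powr (- real_of_int (snd p) * b) \<le> E * w p" if "p \<in> res_pairs" for p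
  proof -
    define i j where "i = real_of_int (fst p)" and "j = real_of_int (snd p)"
    have ij: "\<bar>i - j\<bar> \<le> 1" using that by (auto simp: i_def j_def res_pairs_def)
    have "- ((i - j) / 2 * (a - b)) \<le> \<bar>(i - j) / 2 * (a - b)\<bar>" by linarith
    also have "\<dots> = \<bar>i - j\<bar> * (\<bar>a - b\<bar> / 2)" by (simp add: abs_mult)
    also have "\<dots> \<le> 1 * (\<bar>a - b\<bar> / 2)" using ij by (intro mult_right_mono) auto
    finally have "- ((i - j) / 2 * (a - b)) \<le> \<bar>a - b\<bar> / 2" by simp
    moreover have "- i * a + (- j * b) = - i * \<delta> + (- j * \<delta>) + (- ((i - j) / 2 * (a - b)))"
      by (simp add: \<delta>_def field_simps)
    ultimately have "- i * a + (- j * b) \<le> \<bar>a - b\<bar> / 2 + (- i * \<delta> + (- j * \<delta>))" by linarith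
    then have "2 powr (- i * a + (- j * b)) \<le> 2 powr (\<bar>a - b\<bar> / 2 + (- i * \<delta> + (- j * \<delta>)))" by (intro powr_mono) auto
    then show ?thesis unfolding E_def w_def i_def j_def by (simp only: powr_add)
  qed
  let ?S = "\<Sum>\<^sub>\<infinity>p\<in>res_pairs. w p"
  have S0: "?S \<ge> 0" by (intro infsum_nonneg) (simp add: w_def)
  show ?thesis
  proof (intro exI[of _ "?S * (B * E)"] conjI ballI)
    show "0 \<le> ?S * (B * E)" using S0 B by (simp add: E_def)
    fix f g assume f: "f \<in> sobolev a" and g: "g \<in> besov P b"
    let ?M = "B * E * sobolev_norm a f * besov_norm P b g"
    have le: "sobolev_norm 0 (res_term p f g) \<le> w p * ?M" if p: "p \<in> res_pairs" for p
    proof -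
      have ge: "-1 \<le> fst p" "-1 \<le> snd p" using res_pairs_ge[OF p] by auto
      have "sobolev_norm 0 (res_term p f g) = sobolev_norm 0 (pw_mult (block P (snd p) g) (block P (fst p) f))"
        by (simp add: res_term_def pw_mult_commute)
      also have "\<dots> \<le> Linf_norm (block P (snd p) g) * sobolev_norm 0 (block P (fst p) f)"
        by (intro sobolev_norm_pw_mult_le trig_poly_block ge)
      also have "\<dots> \<le> (2 powr (- real_of_int (snd p) * b) * besov_norm P b g) * (B * 2 powr (- real_of_int (fst p) * a) * sobolev_norm a f)"
        by (intro mult_mono besov_Linf_le g ge B(2) f mult_nonneg_nonneg besov_norm_nonneg) auto
      also have "\<dots> = (2 powr (- real_of_int (fst p) * a) * 2 powr (- real_of_int (snd p) * b)) * (B * sobolev_norm a f * besov_norm P b g)"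
        by (simp only: mult_ac)
      also have "\<dots> \<le> (E * w p) * (B * sobolev_norm a f * besov_norm P b g)"
        by (intro mult_right_mono wE p mult_nonneg_nonneg besov_norm_nonneg g B) auto
      finally show ?thesis by (simp only: mult_ac)
    qed
    have tr: "res_term p f g \<in> sobolev 0" if "p \<in> res_pairs" for p
      unfolding res_term_def by (intro trig_sobolev(1) trig_poly_pw_mult trig_poly_block) (use res_pairs_ge[OF that] in auto)
    have wM: "(\<lambda>p. w p * ?M) summable_on res_pairs" by (rule summable_on_cmult_left[OF w])
    note * = sobolev_infsum[OF tr le wM]
    show "res_ok f g" unfolding res_ok_def by (rule allI, rule abs_summable_summable, rule *(1))
    show "reson P f g \<in> sobolev 0" unfolding reson_eq by (rule *(2))
    have "sobolev_norm 0 (reson P f g) \<le> (\<Sum>\<^sub>\<infinity>p\<in>res_pairs. w p * ?M)" unfolding reson_eq by (rule *(3))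
    also have "\<dots> = ?S * ?M" by (rule infsum_cmult_left) (use w in auto)
    finally show "sobolev_norm 0 (reson P f g) \<le> ?S * (B * E) * sobolev_norm a f * besov_norm P b g"
      by (simp only: mult.assoc)
  qed
qed

lemma reson_lin_left:
  assumes "res_ok f h" "res_ok g h"
  shows "res_ok (scal a f + scal b g) h" "reson P (scal a f + scal b g) h = scal a (reson P f h) + scal b (reson P g h)"
proof -
  have "((\<lambda>p. res_term p (scal a f + scal b g) h k) has_sum (a * reson P f h k + b * reson P g h k)) res_pairs" for k
  proof -
    have "((\<lambda>p. a * res_term p f h k + b * res_term p g h k) has_sum (a * reson P f h k + b * reson P g h k)) res_pairs"
      unfolding reson_eq using assms by (intro has_sum_add has_sum_cmult_right has_sum_infsum) (auto simp: res_ok_def)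
    then show ?thesis
    proof (rule has_sum_cong[THEN iffD1, rotated])
      fix p assume "p \<in> res_pairs"
      then have "trig_poly (block P (snd p) h)" using res_pairs_ge by (blast intro: trig_poly_block)
      then show "a * res_term p f h k + b * res_term p g h k = res_term p (scal a f + scal b g) h k"
        unfolding res_term_def block_lin by (simp add: pw_mult_add_left pw_mult_scal_left) (simp add: scal_def)
    qed
  qed
  then show "res_ok (scal a f + scal b g) h" "reson P (scal a f + scal b g) h = scal a (reson P f h) + scal b (reson P g h)"
    by (auto simp: res_ok_def reson_eq fun_eq_iff scal_def has_sum_iff)
qed

lemma res_ok_commute: "res_ok f g \<longleftrightarrow> res_ok g f"
proof -
  have *: "res_ok g f" if "res_ok f g" for f g
    unfolding res_ok_def
  proof
    fix k
    have "bij_betw prod.swap res_pairs res_pairs"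
      by (rule bij_betwI[where g = prod.swap]) (auto simp: res_pairs_def)
    from summable_on_reindex_bij_betw[OF this, of "\<lambda>p. res_term p f g k"]
    have "(\<lambda>p. res_term (prod.swap p) f g k) summable_on res_pairs" using that by (simp add: res_ok_def)
    then show "(\<lambda>p. res_term p g f k) summable_on res_pairs"
      by (simp add: res_term_def pw_mult_commute[of "block P _ f"])
  qed
  show ?thesis using *[of f g] *[of g f] by blast
qed

lemma reson_lin_right:
  assumes "res_ok h f" "res_ok h g"
  shows "res_ok h (scal a f + scal b g)" "reson P h (scal a f + scal b g) = scal a (reson P h f) + scal b (reson P h g)"
  using reson_lin_left[of f h g a b] assms by (simp_all add: res_ok_commute[of h] reson_commute[of h])

end

text \<open>The sup norm is invariant under translations, so a multiplier that is a superposition of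
  translations is bounded by the sum of the moduli of its coefficients, uniformly in the scale
  \<open>N\<close>.\<close>

lemma wiener_multiplier_bound:
  fixes \<psi> :: "plane \<Rightarrow> real"
  assumes s: "smooth_on \<psi> UNIV" and R: "\<And>x. \<psi> x \<noteq> 0 \<Longrightarrow> norm x \<le> R"
  shows "\<exists>B\<ge>0. \<forall>N>0. \<forall>h. trig_poly h \<longrightarrow> (\<forall>l. h l \<noteq> 0 \<longrightarrow> norm (freq l) \<le> L * N) \<longrightarrow>
    Linf_norm (\<lambda>k. of_real (\<psi> ((1 / N) *\<^sub>R freq k)) * h k) \<le> B * Linf_norm h"
proof -
  obtain c \<kappa> where k0: "\<kappa> > 0" and csum: "(\<lambda>n. cmod (c n) * (1 + norm (freq n))) summable_on UNIV"
    and ex: "\<And>x. norm x \<le> L \<Longrightarrow> complex_of_real (\<psi> x) = (\<Sum>\<^sub>\<infinity>n. c n * echar n (\<kappa> *\<^sub>R x))"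
    by (rule wiener_expansion[OF s, of R L], erule R, rule that)
  have cabs: "(\<lambda>n. cmod (c n)) summable_on UNIV"
    by (rule summable_on_comparison_test[OF csum]) (auto simp: algebra_simps)
  define S where "S = (\<Sum>\<^sub>\<infinity>n. cmod (c n))"
  have S: "S \<ge> 0" unfolding S_def by (intro infsum_nonneg) auto
  have hs: "((\<lambda>n. c n * echar n (\<kappa> *\<^sub>R x)) has_sum complex_of_real (\<psi> x)) UNIV" if "norm x \<le> L" for x
  proof -
    have "(\<lambda>n. c n * echar n (\<kappa> *\<^sub>R x)) summable_on UNIV"
      by (rule abs_summable_summable) (use cabs in \<open>simp add: norm_mult\<close>)
    then show ?thesis unfolding ex[OF that] by (rule has_sum_infsum)
  qed
  show ?thesis
  proof (intro exI[of _ S] conjI allI impI Linf_le)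
    show "0 \<le> S" by (rule S)
    fix N :: real and h x assume N: "N > 0" and h: "trig_poly h" and hL: "\<forall>l. h l \<noteq> 0 \<longrightarrow> norm (freq l) \<le> L * N"
    let ?A = "{k. h k \<noteq> 0}"
    have fin: "finite ?A" using h by (simp add: trig_poly_def)
    define y where "y n = (\<kappa> / N) *\<^sub>R freq n" for n
    let ?e = "\<lambda>n. eval_series (\<lambda>k. echar k (y n) * h k) x"
    have ev: "c n * ?e n = (\<Sum>k\<in>?A. (c n * echar n (\<kappa> *\<^sub>R ((1 / N) *\<^sub>R freq k))) * (h k * echar k x))" for n
      unfolding eval_series_finite[OF fin, of "\<lambda>k. echar k (y n) * h k", OF Collect_mono, of x, simplified]
      by (simp add: sum_distrib_left y_def echar_scaled_commute[of n] mult_ac)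
    have "((\<lambda>n. c n * ?e n) has_sum (\<Sum>k\<in>?A. complex_of_real (\<psi> ((1 / N) *\<^sub>R freq k)) * (h k * echar k x))) UNIV"
      unfolding ev
    proof (rule has_sum_finite_sum[OF fin], rule has_sum_cmult_left, rule hs)
      fix k assume "k \<in> ?A"
      then have "norm (freq k) \<le> L * N" using hL by blast
      then show "norm ((1 / N) *\<^sub>R freq k) \<le> L" using N by (simp add: pos_divide_le_eq)
    qed
    then have eq: "(\<Sum>k\<in>?A. complex_of_real (\<psi> ((1 / N) *\<^sub>R freq k)) * (h k * echar k x)) = (\<Sum>\<^sub>\<infinity>n. c n * ?e n)"
      by (rule infsumI[symmetric])
    have le: "cmod (c n * ?e n) \<le> cmod (c n) * Linf_norm h" for n
      unfolding norm_mult eval_series_translate[OF h] by (intro mult_left_mono cmod_eval_le_Linf h) simp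
    have cs: "(\<lambda>n. cmod (c n) * Linf_norm h) summable_on UNIV" by (rule summable_on_cmult_left[OF cabs])
    have ab: "(\<lambda>n. cmod (c n * ?e n)) summable_on UNIV"
      by (rule summable_on_comparison_test[OF cs le]) simp
    have "eval_series (\<lambda>k. of_real (\<psi> ((1 / N) *\<^sub>R freq k)) * h k) x =
        (\<Sum>k\<in>?A. complex_of_real (\<psi> ((1 / N) *\<^sub>R freq k)) * (h k * echar k x))"
      by (subst eval_series_finite[OF fin]) (auto simp: mult.assoc)
    then have "cmod (eval_series (\<lambda>k. of_real (\<psi> ((1 / N) *\<^sub>R freq k)) * h k) x) = cmod (\<Sum>\<^sub>\<infinity>n. c n * ?e n)"
      by (simp only: eq)
    also have "\<dots> \<le> (\<Sum>\<^sub>\<infinity>n. cmod (c n * ?e n))" by (rule norm_infsum_bound[OF ab])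
    also have "\<dots> \<le> (\<Sum>\<^sub>\<infinity>n. cmod (c n) * Linf_norm h)" by (intro infsum_mono ab cs le)
    also have "\<dots> = S * Linf_norm h" unfolding S_def by (rule infsum_cmult_left) (use cabs in auto)
    finally show "cmod (eval_series (\<lambda>k. of_real (\<psi> ((1 / N) *\<^sub>R freq k)) * h k) x) \<le> S * Linf_norm h" .
  qed
qed

context littlewood_paley
begin

text \<open>Where the block \<open>j\<close> lives only its two neighbours can be non-zero;
  \<open>1 \<le> j\<close> keeps the block -1 away, so all three symbols are dilates of
  \<open>snd P\<close>.\<close>

lemma lp_sym_three:
  assumes "1 \<le> j" "lp_sym j x \<noteq> 0"
  shows "lp_sym (j - 1) x + lp_sym j x + lp_sym (j + 1) x = 1"
proof -
  define n where "n = nat (j - 1)"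
  have j: "j = int n + 1" using assms by (simp add: n_def)
  have z: "lp_sym i x = 0" if "-1 \<le> i" "\<bar>i - j\<bar> > 1" for i
    using lp_sym_disjoint[of i j x] that assms by auto
  have "fst P x = lp_sym (-1) x" by (simp add: lp_sym_def)
  also have "\<dots> = 0" using assms by (intro z) auto
  finally have "(\<lambda>i. lp_sym (int i) x) sums 1" using lp_sym_sums[of x] by simp
  moreover have "(\<lambda>i. lp_sym (int i) x) sums (\<Sum>i\<in>{n, n + 1, n + 2}. lp_sym (int i) x)"
    by (rule sums_finite) (auto intro!: z simp: j)
  ultimately have "(\<Sum>i\<in>{n, n + 1, n + 2}. lp_sym (int i) x) = 1" by (rule sums_unique2[symmetric])
  then show ?thesis by (simp add: j algebra_simps)
qed

lemma one_minus_lap_inv: "inv_one_minus_lap f - laplacian (inv_one_minus_lap f) = f"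
proof
  fix k
  let ?g = "f k / complex_of_real (bessel k)" and ?a = "4 * pi\<^sup>2 * (norm (freq k))\<^sup>2"
  have "(inv_one_minus_lap f - laplacian (inv_one_minus_lap f)) k = ?g - (- complex_of_real ?a * ?g)"
    by (simp only: laplacian_def inv_one_minus_lap_def minus_apply)
  also have "\<dots> = complex_of_real (bessel k) * ?g"
    by (simp only: bessel_def of_real_add of_real_1 distrib_right mult_minus_left mult_1_left) (simp only: diff_minus_eq_add)
  also have "\<dots> = f k" by simp
  finally show "(inv_one_minus_lap f - laplacian (inv_one_minus_lap f)) k = f k" .
qed

text \<open>For large \<open>j\<close> the resolvent is recovered from \<open>- \<Delta> X = f - X\<close> by inverting the Laplacian on the
  annulus and absorbing the term with \<open>X\<close>; the finitely many remaining blocks are treated crudely.\<close>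

lemma inv_lap_block_bound:
  "\<exists>B\<ge>0. \<forall>j\<ge>-1. \<forall>f. Linf_norm (block P j (inv_one_minus_lap f)) \<le> B * 4 powr (- real_of_int j) * Linf_norm (block P j f)"
proof -
  let ?L = "\<lambda>j f. Linf_norm (block P j f)"
  obtain r R where R: "r > 0" "R > 0" "\<And>j x. -1 \<le> j \<Longrightarrow> lp_sym j x \<noteq> 0 \<Longrightarrow> norm x \<le> R * 2 powr j"
    "\<And>j x. 0 \<le> j \<Longrightarrow> lp_sym j x \<noteq> 0 \<Longrightarrow> r * 2 powr j \<le> norm x"
    by (rule lp_sym_support, rule that)
  obtain c C where cC: "c > 0" "C > 0" "\<And>j k. -1 \<le> j \<Longrightarrow> lp_sym j (freq k) \<noteq> 0 \<Longrightarrow> k \<in> freq_ring c C j"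
    by (rule lp_sym_ring, rule that)
  obtain r' R' where r': "0 < r'" "r' < R'" "\<And>x. snd P x \<noteq> 0 \<Longrightarrow> r' \<le> norm x \<and> norm x \<le> R'" using rho_annulus by blast
  \<comment> \<open>The symbols of the blocks j - 1, j, j + 1 at scale 2^j, summing to 1 wherever
    the symbol of block \<open>j\<close> is non-zero; divided by |x|^2 the sum inverts the Laplacian
    there up to a constant. The zeros fit the affine form of
    \<open>smooth_on_affine\<close>.\<close>
  define \<rho> where "\<rho> x = (snd P (0 + 2 *\<^sub>R x) + snd P x) + snd P (0 + (1/2) *\<^sub>R x)" for x :: plane
  define q where "q x = \<rho> x / (norm x)\<^sup>2" for x
  have rs: "smooth_on \<rho> UNIV" unfolding \<rho>_def
    by (intro smooth_on_add open_UNIV smooth_on_affine smooth_rho)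
  have r0: "\<rho> x = 0" if "norm x < r' / 2" for x
  proof -
    have "snd P (2 *\<^sub>R x) = 0" "snd P x = 0" "snd P ((1/2) *\<^sub>R x) = 0"
      using r'(3)[of "2 *\<^sub>R x"] r'(3)[of x] r'(3)[of "(1/2) *\<^sub>R x"] that r'(1) by fastforce+
    then show ?thesis by (simp add: \<rho>_def)
  qed
  have qs: "smooth_on q UNIV"
    unfolding q_def by (rule smooth_on_divide_norm_square[OF rs, of "r' / 2"], use r'(1) in simp, rule r0)
  have qR: "norm x \<le> 2 * R'" if "q x \<noteq> 0" for x
  proof -
    have "\<rho> x \<noteq> 0" using that by (auto simp: q_def)
    then have "snd P (2 *\<^sub>R x) \<noteq> 0 \<or> snd P x \<noteq> 0 \<or> snd P ((1/2) *\<^sub>R x) \<noteq> 0" by (auto simp: \<rho>_def)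
    moreover have "norm (2 *\<^sub>R x) = 2 * norm x" "norm ((1/2) *\<^sub>R x) = norm x / 2" by simp_all
    ultimately show ?thesis
      using r'(3)[of "2 *\<^sub>R x"] r'(3)[of x] r'(3)[of "(1/2) *\<^sub>R x"] r'(1,2) norm_ge_zero[of x]
      by (elim disjE) linarith+
  qed
  obtain B where B: "B \<ge> 0" "\<And>N h. N > 0 \<Longrightarrow> trig_poly h \<Longrightarrow> (\<And>l. h l \<noteq> 0 \<Longrightarrow> norm (freq l) \<le> R * N) \<Longrightarrow>
    Linf_norm (\<lambda>k. of_real (q ((1 / N) *\<^sub>R freq k)) * h k) \<le> B * Linf_norm h"
    using wiener_multiplier_bound[OF qs qR, of R] by blast
  have big: "?L j (inv_one_minus_lap f) \<le> B * 4 powr (- real_of_int j) * ?L j f"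
    if j: "1 \<le> j" and Bj: "B \<le> 4 powr j" for j f
  proof -
    let ?X = "inv_one_minus_lap f" and ?N = "2 powr real_of_int j :: real"
    \<comment> \<open>At each frequency 4 pi^2 |k|^2 times X equals f - X; \<open>q\<close> supplies
      4^j / |k|^2 and the scalar the remaining factor.\<close>
    let ?h = "scal (of_real (1 / (4 * pi\<^sup>2 * ?N\<^sup>2))) (block P j f - block P j ?X)"
    have NN: "?N\<^sup>2 = 4 powr j" by (simp add: four_powr power2_eq_square flip: powr_add)
    have tf: "trig_poly (block P j f)" "trig_poly (block P j ?X)" using j by (auto intro: trig_poly_block)
    have sc: "(1 / ?N) *\<^sub>R x = (2 powr (- real_of_int j)) *\<^sub>R x" for x :: plane by (simp add: powr_minus_divide)
    have eq: "block P j ?X = (\<lambda>k. of_real (q ((1 / ?N) *\<^sub>R freq k)) * ?h k)"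
    proof
      fix k
      show "block P j ?X k = of_real (q ((1 / ?N) *\<^sub>R freq k)) * ?h k"
      proof (cases "lp_sym j (freq k) = 0")
        case False
        let ?n = "norm (freq k)"
        have n0: "?n > 0" using R(4)[of j "freq k"] False j R(1) by (smt (verit) mult_pos_pos powr_gt_zero)
        have "snd P (2 *\<^sub>R ((1 / ?N) *\<^sub>R freq k)) = lp_sym (j - 1) (freq k)"
          using j by (simp add: lp_sym_def powr_diff powr_minus divide_inverse)
        moreover have "snd P ((1 / ?N) *\<^sub>R freq k) = lp_sym j (freq k)"
          using j by (simp add: lp_sym_def sc)
        moreover have "snd P ((1/2) *\<^sub>R ((1 / ?N) *\<^sub>R freq k)) = lp_sym (j + 1) (freq k)"
        proof -
          have "2 powr (- real_of_int (j + 1)) = (2::real) powr (- 1 + - real_of_int j)"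
            by (intro arg_cong[where f = "\<lambda>t. 2 powr t"]) simp
          also have "\<dots> = (1/2) * (1 / ?N)" unfolding powr_add by (simp only: powr_minus_divide) simp
          finally show ?thesis using j by (simp add: lp_sym_def)
        qed
        ultimately have "\<rho> ((1 / ?N) *\<^sub>R freq k) = 1"
          using lp_sym_three[OF j False] by (simp only: \<rho>_def add_0)
        then have q: "q ((1 / ?N) *\<^sub>R freq k) = ?N\<^sup>2 / ?n\<^sup>2"
          by (simp add: q_def power_mult_distrib power_divide)
        have "block P j f k - block P j ?X k = of_real (lp_sym j (freq k)) * (f k - f k / of_real (bessel k))"
          by (simp add: block_apply inv_one_minus_lap_def right_diff_distrib)
        also have "f k - f k / of_real (bessel k) = of_real (4 * pi\<^sup>2 * ?n\<^sup>2) * (f k / of_real (bessel k))"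
        proof -
          have "f k = of_real (bessel k) * (f k / of_real (bessel k))" by simp
          then have "f k - f k / of_real (bessel k) = (of_real (bessel k) - 1) * (f k / of_real (bessel k))"
            by (simp only: left_diff_distrib mult_1_left)
          then show ?thesis by (simp add: bessel_def)
        qed
        finally have d: "block P j f k - block P j ?X k = of_real (4 * pi\<^sup>2 * ?n\<^sup>2) * block P j ?X k"
          by (simp add: block_apply inv_one_minus_lap_def)
        have "of_real (q ((1 / ?N) *\<^sub>R freq k)) * ?h k = of_real (?N\<^sup>2 / ?n\<^sup>2 * (1 / (4 * pi\<^sup>2 * ?N\<^sup>2)) * (4 * pi\<^sup>2 * ?n\<^sup>2)) * block P j ?X k"
          using d unfolding q scal_def by (simp add: mult.assoc)
        also have "?N\<^sup>2 / ?n\<^sup>2 * (1 / (4 * pi\<^sup>2 * ?N\<^sup>2)) * (4 * pi\<^sup>2 * ?n\<^sup>2) = 1" using n0 by (simp add: field_simps)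
        finally show ?thesis by (simp only: of_real_1 mult_1_left)
      qed (simp add: block_apply scal_def)
    qed
    have "?L j ?X \<le> B * Linf_norm ?h"
    proof (subst eq, rule B(2))
      show "trig_poly ?h" by (intro trig_poly_scal trig_poly_diff tf)
      show "norm (freq l) \<le> R * ?N" if "?h l \<noteq> 0" for l
        using that j by (intro R(3)) (auto simp: scal_def block_apply)
    qed simp
    also have "\<dots> \<le> B * (1 / (4 * pi\<^sup>2 * ?N\<^sup>2) * (?L j f + ?L j ?X))"
    proof (intro mult_left_mono B(1))
      have "Linf_norm ?h \<le> cmod (of_real (1 / (4 * pi\<^sup>2 * ?N\<^sup>2))) * Linf_norm (block P j f - block P j ?X)"
        by (intro Linf_scal_le trig_poly_diff tf)
      also have "\<dots> = 1 / (4 * pi\<^sup>2 * ?N\<^sup>2) * Linf_norm (block P j f - block P j ?X)" by (simp only: norm_of_real) simp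
      also have "\<dots> \<le> 1 / (4 * pi\<^sup>2 * ?N\<^sup>2) * (?L j f + ?L j ?X)"
        by (intro mult_left_mono Linf_diff tf) simp
      finally show "Linf_norm ?h \<le> 1 / (4 * pi\<^sup>2 * ?N\<^sup>2) * (?L j f + ?L j ?X)" .
    qed
    finally have le: "?L j ?X \<le> B / (4 * pi\<^sup>2 * ?N\<^sup>2) * (?L j f + ?L j ?X)"
      by simp
    \<comment> \<open>For B \<le> 4^j this factor is at most 1/2, so the term with X on the right
      can be absorbed into the left.\<close>
    define w where "w = B / (4 * pi\<^sup>2 * ?N\<^sup>2)"
    have p1: "2 \<le> 4 * pi\<^sup>2" using pi_ge_two power_mono[of 2 pi 2] by auto
    have "w \<le> B / (2 * ?N\<^sup>2)"
      unfolding w_def using p1 B(1) by (intro divide_left_mono mult_right_mono mult_pos_pos) auto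
    define t where "t = B / ?N\<^sup>2"
    from \<open>w \<le> B / (2 * ?N\<^sup>2)\<close> have wB: "w \<le> t / 2" by (simp add: t_def)
    have "t \<le> 1" using Bj NN by (simp add: t_def pos_divide_le_eq)
    then have w2: "w \<le> 1/2" using wB by linarith
    have X0: "0 \<le> ?L j ?X" "0 \<le> ?L j f" using tf Linf_nonneg by auto
    have "w * ?L j ?X \<le> 1/2 * ?L j ?X" by (intro mult_right_mono w2 X0)
    then have "?L j ?X \<le> 2 * w * ?L j f"
      using le unfolding w_def[symmetric] distrib_left by linarith
    also have "\<dots> \<le> t * ?L j f" using wB by (intro mult_right_mono X0) auto
    also have "t = B * 4 powr (- real_of_int j)" unfolding t_def NN by (simp add: powr_minus_divide)
    finally show ?thesis .
  qed
  obtain J0 :: nat where J0: "B < 2 ^ J0" using real_arch_pow[of 2 B] by auto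
  define J where "J = int J0 + 1"
  have J: "1 \<le> J" "B \<le> 4 powr J"
  proof -
    show "1 \<le> J" by (simp add: J_def)
    have "(2::real) ^ J0 = 2 powr real J0" by (simp add: powr_realpow)
    also have "\<dots> \<le> 2 powr (2 * real_of_int J)" by (intro powr_mono) (auto simp: J_def)
    also have "\<dots> = 4 powr J" by (simp add: four_powr)
    finally show "B \<le> 4 powr J" using J0 by linarith
  qed
  define M where "M = real (card (freq_ball C J))"
  have small: "?L j (inv_one_minus_lap f) \<le> M * 4 powr J * 4 powr (- real_of_int j) * ?L j f"
    if j: "-1 \<le> j" "j \<le> J" for j f
  proof -
    let ?X = "inv_one_minus_lap f"
    have tf: "trig_poly (block P j f)" "trig_poly (block P j ?X)" using j by (auto intro: trig_poly_block)
    have F0: "0 \<le> ?L j f" by (rule Linf_nonneg[OF tf(1)])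
    have sub: "{k. block P j ?X k \<noteq> 0} \<subseteq> freq_ball C J"
    proof
      fix k assume "k \<in> {k. block P j ?X k \<noteq> 0}"
      then have "k \<in> freq_ring c C j" using cC(3)[OF j(1)] by (auto simp: block_apply)
      then have "bessel k \<le> C * 4 powr j" by (simp add: freq_ring_def)
      also have "\<dots> \<le> C * 4 powr J" using j cC(2) by (intro mult_left_mono powr_mono) auto
      finally show "k \<in> freq_ball C J" by (simp add: freq_ball_def)
    qed
    have "?L j ?X \<le> (\<Sum>k\<in>{k. block P j ?X k \<noteq> 0}. cmod (block P j ?X k))"
      by (rule Linf_le_sum[OF tf(2)])
    also have "\<dots> \<le> (\<Sum>k\<in>freq_ball C J. cmod (block P j ?X k))"
      by (intro sum_mono2 sub finite_freq_ball) auto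
    also have "\<dots> \<le> (\<Sum>k\<in>freq_ball C J. ?L j f)"
    proof (rule sum_mono)
      fix k
      have "cmod (block P j ?X k) = cmod (block P j f k) / bessel k"
        by (simp add: block_apply inv_one_minus_lap_def norm_mult norm_divide less_imp_le[OF bessel_pos])
      also have "\<dots> \<le> cmod (block P j f k) / 1" using bessel_ge_1 by (intro divide_left_mono) auto
      also have "\<dots> \<le> ?L j f" using cmod_coeff_le_Linf[OF tf(1)] by simp
      finally show "cmod (block P j ?X k) \<le> ?L j f" .
    qed
    also have "\<dots> = M * ?L j f" by (simp add: M_def)
    also have "\<dots> \<le> M * (4 powr J * 4 powr (- real_of_int j)) * ?L j f"
    proof -
      have "(1::real) = 4 powr 0" by simp
      also have "\<dots> \<le> 4 powr (real_of_int J + - real_of_int j)" using j by (intro powr_mono) auto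
      finally have "1 \<le> 4 powr J * (4::real) powr (- real_of_int j)" by (simp only: powr_add)
      then have "M * 1 \<le> M * (4 powr J * 4 powr (- real_of_int j))" by (intro mult_left_mono) (auto simp: M_def)
      then show ?thesis using F0 by (intro mult_right_mono) auto
    qed
    finally show ?thesis by (simp only: mult.assoc)
  qed
  show ?thesis
  proof (intro exI[of _ "max B (M * 4 powr J)"] conjI allI impI)
    show "0 \<le> max B (M * 4 powr J)" using B(1) by auto
    fix j :: int and f assume j: "-1 \<le> j"
    have F0: "0 \<le> 4 powr (- real_of_int j) * ?L j f" using Linf_nonneg[OF trig_poly_block[OF j]] by simp
    have "\<exists>B'\<le>max B (M * 4 powr J). ?L j (inv_one_minus_lap f) \<le> B' * (4 powr (- real_of_int j) * ?L j f)"
    proof (cases "j \<le> J")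
      case True
      then show ?thesis using small[OF j True, of f] by (intro exI[of _ "M * 4 powr J"]) (auto simp: mult.assoc)
    next
      case False
      have "(4::real) powr J \<le> 4 powr j" using False by (intro powr_mono) auto
      then have "B \<le> 4 powr j" using J(2) by linarith
      then show ?thesis using big[of j f] J False by (intro exI[of _ B]) (auto simp: mult.assoc)
    qed
    then obtain B' where B': "B' \<le> max B (M * 4 powr J)" "?L j (inv_one_minus_lap f) \<le> B' * (4 powr (- real_of_int j) * ?L j f)" by blast
    from mult_right_mono[OF B'(1) F0] B'(2)
    show "?L j (inv_one_minus_lap f) \<le> max B (M * 4 powr J) * 4 powr (- real_of_int j) * ?L j f"
      by (simp only: mult.assoc)
  qed
qed

lemma inv_lap_besov:
  "\<exists>B\<ge>0. \<forall>f\<in>besov P b. inv_one_minus_lap f \<in> besov P (b + 2) \<and> besov_norm P (b + 2) (inv_one_minus_lap f) \<le> B * besov_norm P b f"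
proof -
  obtain B where B: "B \<ge> 0" "\<And>j f. -1 \<le> j \<Longrightarrow> Linf_norm (block P j (inv_one_minus_lap f)) \<le> B * 4 powr (- real_of_int j) * Linf_norm (block P j f)"
    using inv_lap_block_bound by blast
  have "2 powr (real_of_int j * (b + 2)) * Linf_norm (block P j (inv_one_minus_lap f)) \<le> B * besov_norm P b f"
    if f: "f \<in> besov P b" and j: "-1 \<le> j" for f j
  proof -
    have "2 powr (real_of_int j * (b + 2)) * Linf_norm (block P j (inv_one_minus_lap f))
        \<le> 2 powr (real_of_int j * (b + 2)) * (B * 4 powr (- real_of_int j) * (2 powr (- real_of_int j * b) * besov_norm P b f))"
      by (intro mult_left_mono order_trans[OF B(2)[OF j]] besov_Linf_le f j) (use B(1) in auto)
    also have "\<dots> = (2 powr (real_of_int j * (b + 2)) * (4 powr (- real_of_int j) * 2 powr (- real_of_int j * b))) * (B * besov_norm P b f)"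
      by (simp only: mult_ac)
    also have "2 powr (real_of_int j * (b + 2)) * (4 powr (- real_of_int j) * 2 powr (- real_of_int j * b)) = (1::real)"
      unfolding four_powr by (simp add: algebra_simps flip: powr_add)
    finally show ?thesis by simp
  qed
  then show ?thesis using besov_I B(1) by (intro exI[of _ B]) blast
qed

text \<open>Leibniz rule for a first-order multiplier \<open>m\<close>, in the form that trades a derivative of the
  second factor for derivatives of the product and of the first factor.\<close>

lemma para_leibniz:
  fixes m :: "int \<times> int \<Rightarrow> complex"
  assumes m: "\<And>k l. m (k + l) = m k + m l" and ok: "para_ok f g" "para_ok (\<lambda>k. m k * f k) g"
  shows "para_ok f (\<lambda>k. m k * g k)"
    "para P f (\<lambda>k. m k * g k) = (\<lambda>k. m k * para P f g k) - para P (\<lambda>k. m k * f k) g"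
proof -
  have trm: "para_term j f (\<lambda>k. m k * g k) k = m k * para_term j f g k - para_term j (\<lambda>k. m k * f k) g k" for j k
  proof -
    let ?A = "{l. below j f l \<noteq> 0}"
    have fin: "finite ?A" using trig_poly_below by (simp add: trig_poly_def)
    have mm: "m k = m l + m (k - l)" for l using m[of l "k - l"] by simp
    have bm: "below j (\<lambda>k. m k * f k) l = m l * below j f l" for l by (simp add: below_apply mult_ac)
    have bl: "block P j (\<lambda>k. m k * g k) l = m l * block P j g l" for l by (simp add: block_apply mult_ac)
    have e1: "para_term j (\<lambda>k. m k * f k) g k = (\<Sum>l\<in>?A. m l * below j f l * block P j g (k - l))"
      unfolding para_term_def by (subst pw_mult_finite[OF fin]) (auto simp: bm)
    have e2: "m k * para_term j f g k = (\<Sum>l\<in>?A. m k * below j f l * block P j g (k - l))"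
      unfolding para_term_def pw_mult_trig[OF trig_poly_below] by (simp add: sum_distrib_left mult.assoc)
    have e3: "para_term j f (\<lambda>k. m k * g k) k = (\<Sum>l\<in>?A. m (k - l) * below j f l * block P j g (k - l))"
      unfolding para_term_def pw_mult_trig[OF trig_poly_below] bl by (simp only: mult_ac)
    show ?thesis
      unfolding e1 e2 e3 sum_subtractf[symmetric]
    proof (rule sum.cong[OF refl])
      fix l
      show "m (k - l) * below j f l * block P j g (k - l) =
          m k * below j f l * block P j g (k - l) - m l * below j f l * block P j g (k - l)"
        unfolding mm[of l] by (simp add: algebra_simps)
    qed
  qed
  have "((\<lambda>j. para_term j f (\<lambda>k. m k * g k) k) has_sum (m k * para P f g k + (- 1) * para P (\<lambda>k. m k * f k) g k)) {-1..}" for k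
  proof -
    have "((\<lambda>j. m k * para_term j f g k + (- 1) * para_term j (\<lambda>k. m k * f k) g k) has_sum (m k * para P f g k + (- 1) * para P (\<lambda>k. m k * f k) g k)) {-1..}"
      unfolding para_eq using ok by (intro has_sum_add has_sum_cmult_right has_sum_infsum) (auto simp: para_ok_def)
    then show ?thesis by (simp add: trm)
  qed
  then show "para_ok f (\<lambda>k. m k * g k)"
    "para P f (\<lambda>k. m k * g k) = (\<lambda>k. m k * para P f g k) - para P (\<lambda>k. m k * f k) g"
    by (auto simp: para_ok_def para_eq fun_eq_iff has_sum_iff)
qed

end

section \<open>The paracontrolled structure of the Anderson Hamiltonian\<close>

lemma diff_eq_scal: "f - g = scal 1 f + scal (- 1) g"
  by (simp add: fun_eq_iff scal_def)

lemma scal_eq_lin: "scal c f = scal c f + scal 0 f"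
  by (simp add: fun_eq_iff scal_def)

definition one_minus_lap :: "pdist \<Rightarrow> pdist" where
  "one_minus_lap f = (\<lambda>k. of_real (bessel k) * f k)"

lemma one_minus_lap_lin: "one_minus_lap (scal a f + scal b g) = scal a (one_minus_lap f) + scal b (one_minus_lap g)"
  by (simp add: fun_eq_iff one_minus_lap_def scal_def algebra_simps)

lemma laplacian_eq: "laplacian f = f - one_minus_lap f"
  by (simp add: fun_eq_iff laplacian_def one_minus_lap_def bessel_def algebra_simps)

lemma inv_one_minus_lap_lin: "inv_one_minus_lap (scal a f + scal b g) = scal a (inv_one_minus_lap f) + scal b (inv_one_minus_lap g)"
  by (simp add: fun_eq_iff inv_one_minus_lap_def scal_def add_divide_distrib)

lemma laplacian_lin: "laplacian (scal a f + scal b g) = scal a (laplacian f) + scal b (laplacian g)"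
  by (simp add: fun_eq_iff laplacian_def scal_def algebra_simps)

lemma partial1_lin: "partial1 (scal a f + scal b g) = scal a (partial1 f) + scal b (partial1 g)"
  by (simp add: fun_eq_iff partial1_def scal_def algebra_simps)

lemma partial2_lin: "partial2 (scal a f + scal b g) = scal a (partial2 f) + scal b (partial2 g)"
  by (simp add: fun_eq_iff partial2_def scal_def algebra_simps)

lemma inv_one_minus_lap_sobolev:
  assumes "f \<in> sobolev s"
  shows "inv_one_minus_lap f \<in> sobolev (s + 2)" "sobolev_norm (s + 2) (inv_one_minus_lap f) \<le> sobolev_norm s f"
proof -
  have "cmod (1 / of_real (bessel k)) \<le> 1 * bessel k powr ((s - (s + 2)) / 2)" for k
    by (simp add: norm_divide powr_minus_divide less_imp_le[OF bessel_pos])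
  from sobolev_multiplier[OF assms, of 1 "\<lambda>k. 1 / of_real (bessel k)" "s + 2", OF _ this]
  show "inv_one_minus_lap f \<in> sobolev (s + 2)" "sobolev_norm (s + 2) (inv_one_minus_lap f) \<le> sobolev_norm s f"
    by (simp_all add: inv_one_minus_lap_def)
qed

lemma one_minus_lap_sobolev:
  assumes "f \<in> sobolev (s + 2)"
  shows "one_minus_lap f \<in> sobolev s" "sobolev_norm s (one_minus_lap f) \<le> sobolev_norm (s + 2) f"
proof -
  have "cmod (of_real (bessel k)) \<le> 1 * bessel k powr ((s + 2 - s) / 2)" for k
    by (simp add: less_imp_le[OF bessel_pos])
  from sobolev_multiplier[OF assms, of 1 "\<lambda>k. of_real (bessel k)" s, OF _ this]
  show "one_minus_lap f \<in> sobolev s" "sobolev_norm s (one_minus_lap f) \<le> sobolev_norm (s + 2) f"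
    by (simp_all add: one_minus_lap_def)
qed

lemma laplacian_sobolev:
  assumes "f \<in> sobolev s"
  shows "laplacian f \<in> sobolev (s - 2)" "sobolev_norm (s - 2) (laplacian f) \<le> sobolev_norm s f"
proof -
  have "cmod (- of_real (4 * pi\<^sup>2 * (norm (freq k))\<^sup>2)) \<le> 1 * bessel k powr ((s - (s - 2)) / 2)" for k
  proof -
    have "cmod (- of_real (4 * pi\<^sup>2 * (norm (freq k))\<^sup>2)) = 4 * pi\<^sup>2 * (norm (freq k))\<^sup>2"
      unfolding norm_minus_cancel norm_of_real by simp
    also have "\<dots> \<le> bessel k" by (simp add: bessel_def)
    finally show ?thesis by (simp add: less_imp_le[OF bessel_pos])
  qed
  from sobolev_multiplier[OF assms, of 1 "\<lambda>k. - of_real (4 * pi\<^sup>2 * (norm (freq k))\<^sup>2)" "s - 2", OF _ this]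
  show "laplacian f \<in> sobolev (s - 2)" "sobolev_norm (s - 2) (laplacian f) \<le> sobolev_norm s f"
    by (simp_all add: laplacian_def)
qed

text \<open>Additivity of the symbol is the Leibniz rule on the Fourier side; the bound says that
  the order is one.\<close>

definition deriv_mult :: "(int \<times> int \<Rightarrow> complex) \<Rightarrow> bool" where
  "deriv_mult m \<longleftrightarrow> (\<forall>k l. m (k + l) = m k + m l) \<and> (\<forall>k. cmod (m k) \<le> bessel k powr (1/2))"

definition partial_sym1 :: "int \<times> int \<Rightarrow> complex" where
  "partial_sym1 k = 2 * complex_of_real pi * \<i> * of_int (fst k)"

definition partial_sym2 :: "int \<times> int \<Rightarrow> complex" where
  "partial_sym2 k = 2 * complex_of_real pi * \<i> * of_int (snd k)"

lemma partial1_eq: "partial1 f = (\<lambda>k. partial_sym1 k * f k)"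
  and partial2_eq: "partial2 f = (\<lambda>k. partial_sym2 k * f k)"
  by (simp_all add: partial1_def partial2_def partial_sym1_def partial_sym2_def)

lemma deriv_mult_partial: "deriv_mult partial_sym1" "deriv_mult partial_sym2"
proof -
  have n: "(norm (freq k))\<^sup>2 = (real_of_int (fst k))\<^sup>2 + (real_of_int (snd k))\<^sup>2" for k
    by (simp add: freq_def norm_Pair)
  have *: "2 * pi * \<bar>x\<bar> \<le> bessel k powr (1/2)" if "x\<^sup>2 \<le> (norm (freq k))\<^sup>2" for x k
  proof -
    have "(2 * pi * \<bar>x\<bar>)\<^sup>2 = 4 * pi\<^sup>2 * x\<^sup>2" by (simp add: power_mult_distrib)
    also have "\<dots> \<le> 4 * pi\<^sup>2 * (norm (freq k))\<^sup>2" using that by (intro mult_left_mono) auto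
    also have "\<dots> \<le> bessel k" by (simp add: bessel_def)
    finally have "2 * pi * \<bar>x\<bar> \<le> sqrt (bessel k)" by (rule real_le_rsqrt)
    then show ?thesis by (simp add: powr_half_sqrt less_imp_le[OF bessel_pos])
  qed
  show "deriv_mult partial_sym1" "deriv_mult partial_sym2"
  proof -
    have "cmod (partial_sym1 k) \<le> bessel k powr (1/2)" "cmod (partial_sym2 k) \<le> bessel k powr (1/2)" for k
      using *[of "real_of_int (fst k)" k] *[of "real_of_int (snd k)" k]
      by (simp_all add: n partial_sym1_def partial_sym2_def norm_mult)
    then show "deriv_mult partial_sym1" "deriv_mult partial_sym2"
      by (simp_all add: deriv_mult_def partial_sym1_def partial_sym2_def distrib_left)
  qed
qed

lemma partial_sym_square: "partial_sym1 k * (partial_sym1 k * z) + partial_sym2 k * (partial_sym2 k * z) = - of_real (4 * pi\<^sup>2 * (norm (freq k))\<^sup>2) * z"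
proof -
  have n: "(norm (freq k))\<^sup>2 = (real_of_int (fst k))\<^sup>2 + (real_of_int (snd k))\<^sup>2"
    by (simp add: freq_def norm_Pair)
  show ?thesis unfolding n partial_sym1_def partial_sym2_def
    by (simp add: power2_eq_square algebra_simps)
qed

lemma deriv_mult_sobolev:
  assumes m: "deriv_mult m" and f: "f \<in> sobolev s"
  shows "(\<lambda>k. m k * f k) \<in> sobolev (s - 1)" "sobolev_norm (s - 1) (\<lambda>k. m k * f k) \<le> sobolev_norm s f"
  using sobolev_multiplier[OF f, of 1 m "s - 1"] m by (auto simp: deriv_mult_def)

context littlewood_paley
begin

lemma para_diff_left:
  assumes "para_ok f h" "para_ok g h"
  shows "para_ok (f - g) h" "para P (f - g) h = para P f h - para P g h"
  using para_lin_left[OF assms, of 1 "-1"] by (simp_all only: diff_eq_scal[symmetric])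

lemma para_diff_right:
  assumes "para_ok h f" "para_ok h g"
  shows "para_ok h (f - g)" "para P h (f - g) = para P h f - para P h g"
  using para_lin_right[OF assms, of 1 "-1"] by (simp_all only: diff_eq_scal[symmetric])

lemma reson_diff_left:
  assumes "res_ok f h" "res_ok g h"
  shows "res_ok (f - g) h" "reson P (f - g) h = reson P f h - reson P g h"
  using reson_lin_left[OF assms, of 1 "-1"] by (simp_all only: diff_eq_scal[symmetric])

lemma reson_diff_right:
  assumes "res_ok h f" "res_ok h g"
  shows "res_ok h (f - g)" "reson P h (f - g) = reson P h f - reson P h g"
  using reson_lin_right[OF assms, of 1 "-1"] by (simp_all only: diff_eq_scal[symmetric])

end

text \<open>\<gamma> = 1 - 8 \<kappa> and \<kappa> < 1/24 turn the conditions on exponents below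
  into linear inequalities in \<kappa>. For instance \<Delta>u \<prec> X has every regularity in
  [-1, -9 \<kappa>), and -1 + 3 \<kappa> is well inside.\<close>

locale anderson = littlewood_paley +
  fixes C :: "pdist \<Rightarrow> pdist \<Rightarrow> pdist \<Rightarrow> pdist" and \<gamma> \<kappa> :: real
  assumes comm: "is_commutator_operator P C" and gamma: "2/3 < \<gamma>" "\<gamma> < 1" and kappa: "\<kappa> = (1 - \<gamma>) / 8"
begin

lemma kappa_bounds: "0 < \<kappa>" "\<kappa> < 1/24" "\<gamma> = 1 - 8 * \<kappa>"
  using gamma kappa by auto

definition noise :: "pdist \<times> pdist \<Rightarrow> bool" where
  "noise \<Xi> \<longleftrightarrow> fst \<Xi> \<in> besov P (-1 - \<kappa>) \<and> snd \<Xi> \<in> besov P (-2 * \<kappa>)"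

definition noise_norm :: "pdist \<times> pdist \<Rightarrow> real" where
  "noise_norm \<Xi> = besov_norm P (-1 - \<kappa>) (fst \<Xi>) + besov_norm P (-2 * \<kappa>) (snd \<Xi>)"

text \<open>The two components are treated as independent data, so noises form a linear space.
  Differences are then admissible arguments, and bounds for operators linear in the noise yield
  their continuity.\<close>

definition noise_diff :: "pdist \<times> pdist \<Rightarrow> pdist \<times> pdist \<Rightarrow> pdist \<times> pdist" where
  "noise_diff \<Xi> \<Xi>' = (fst \<Xi> - fst \<Xi>', snd \<Xi> - snd \<Xi>')"

lemma noiseD: "noise \<Xi> \<Longrightarrow> fst \<Xi> \<in> besov P (-1 - \<kappa>)" "noise \<Xi> \<Longrightarrow> snd \<Xi> \<in> besov P (-2 * \<kappa>)"
  by (simp_all add: noise_def)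

lemma noise_noise_diff: "noise \<Xi> \<Longrightarrow> noise \<Xi>' \<Longrightarrow> noise (noise_diff \<Xi> \<Xi>')"
  by (simp add: noise_def noise_diff_def besov_diff)

lemma noise_norm_parts:
  assumes "noise \<Xi>"
  shows "besov_norm P (-1 - \<kappa>) (fst \<Xi>) \<le> noise_norm \<Xi>" "besov_norm P (-2 * \<kappa>) (snd \<Xi>) \<le> noise_norm \<Xi>" "0 \<le> noise_norm \<Xi>"
  using besov_norm_nonneg[OF noiseD(1)[OF assms]] besov_norm_nonneg[OF noiseD(2)[OF assms]] by (auto simp: noise_norm_def)

lemma X_of_diff: "X_of (noise_diff \<Xi> \<Xi>') = X_of \<Xi> - X_of \<Xi>'"
  using inv_one_minus_lap_lin[of 1 "fst \<Xi>" "-1" "fst \<Xi>'"] by (simp only: X_of_def noise_diff_def fst_conv diff_eq_scal)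

text \<open>Linear growth in the noise norm, with one constant for all noises: applied to
  \<open>noise_diff\<close> it becomes a Lipschitz estimate in the noise when \<open>F\<close> is
  linear in it.\<close>

definition noise_bounded :: "real \<Rightarrow> real \<Rightarrow> (pdist \<times> pdist \<Rightarrow> pdist \<Rightarrow> pdist) \<Rightarrow> bool" where
  "noise_bounded r s F \<longleftrightarrow> (\<exists>B\<ge>0. \<forall>u\<in>sobolev r. \<forall>\<Xi>. noise \<Xi> \<longrightarrow>
    F \<Xi> u \<in> sobolev s \<and> sobolev_norm s (F \<Xi> u) \<le> B * (sobolev_norm r u * noise_norm \<Xi>))"

lemma noise_boundedE:
  assumes "noise_bounded r s F"
  obtains B where "B \<ge> 0" "\<And>u \<Xi>. u \<in> sobolev r \<Longrightarrow> noise \<Xi> \<Longrightarrow> F \<Xi> u \<in> sobolev s \<and> sobolev_norm s (F \<Xi> u) \<le> B * (sobolev_norm r u * noise_norm \<Xi>)"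
  using assms unfolding noise_bounded_def by blast

lemma noise_bounded_mem: "noise_bounded r s F \<Longrightarrow> u \<in> sobolev r \<Longrightarrow> noise \<Xi> \<Longrightarrow> F \<Xi> u \<in> sobolev s"
  unfolding noise_bounded_def by blast

lemma noise_bounded_add:
  assumes "noise_bounded r s F" "noise_bounded r s G"
  shows "noise_bounded r s (\<lambda>\<Xi> u. F \<Xi> u + G \<Xi> u)"
proof -
  obtain B where B: "B \<ge> 0" "\<And>u \<Xi>. u \<in> sobolev r \<Longrightarrow> noise \<Xi> \<Longrightarrow> F \<Xi> u \<in> sobolev s \<and> sobolev_norm s (F \<Xi> u) \<le> B * (sobolev_norm r u * noise_norm \<Xi>)"
    by (rule noise_boundedE[OF assms(1)], rule that)
  obtain D where D: "D \<ge> 0" "\<And>u \<Xi>. u \<in> sobolev r \<Longrightarrow> noise \<Xi> \<Longrightarrow> G \<Xi> u \<in> sobolev s \<and> sobolev_norm s (G \<Xi> u) \<le> D * (sobolev_norm r u * noise_norm \<Xi>)"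
    by (rule noise_boundedE[OF assms(2)], rule that)
  show ?thesis unfolding noise_bounded_def
  proof (intro exI[of _ "B + D"] conjI ballI allI impI)
    fix u \<Xi> assume a: "u \<in> sobolev r" "noise \<Xi>"
    note b = B(2)[OF a] and d = D(2)[OF a]
    note s = sobolev_add[OF conjunct1[OF b] conjunct1[OF d]]
    show "F \<Xi> u + G \<Xi> u \<in> sobolev s" by (rule s(1))
    show "sobolev_norm s (F \<Xi> u + G \<Xi> u) \<le> (B + D) * (sobolev_norm r u * noise_norm \<Xi>)"
      unfolding distrib_right by (rule order_trans[OF s(2) add_mono[OF conjunct2[OF b] conjunct2[OF d]]])
  qed (use B D in auto)
qed

lemma noise_bounded_comp:
  assumes F: "noise_bounded r s F" and L: "\<And>f. f \<in> sobolev s \<Longrightarrow> L f \<in> sobolev t" "\<And>f. f \<in> sobolev s \<Longrightarrow> sobolev_norm t (L f) \<le> sobolev_norm s f"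
  shows "noise_bounded r t (\<lambda>\<Xi> u. L (F \<Xi> u))"
proof -
  obtain B where B: "B \<ge> 0" "\<And>u \<Xi>. u \<in> sobolev r \<Longrightarrow> noise \<Xi> \<Longrightarrow> F \<Xi> u \<in> sobolev s \<and> sobolev_norm s (F \<Xi> u) \<le> B * (sobolev_norm r u * noise_norm \<Xi>)"
    by (rule noise_boundedE[OF F], rule that)
  show ?thesis unfolding noise_bounded_def
    by (intro exI[of _ B] conjI ballI allI impI B(1) L(1) order_trans[OF L(2)]; drule (1) B(2); blast)
qed

text \<open>Composes a product bound with an operator \<open>M\<close> acting on u and a map
  \<open>N\<close> that turns noise into Besov data. The predicate \<open>ok\<close> rides along, so
  that the summability facts come out of the same application.\<close>

lemma noise_bounded_bilinear:
  assumes Q: "\<exists>B\<ge>0. \<forall>f\<in>sobolev a. \<forall>g\<in>besov P b. ok f g \<and> Q f g \<in> sobolev s \<and> sobolev_norm s (Q f g) \<le> B * sobolev_norm a f * besov_norm P b g"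
    and M: "\<And>u. u \<in> sobolev r \<Longrightarrow> M u \<in> sobolev a \<and> sobolev_norm a (M u) \<le> sobolev_norm r u"
    and N: "\<exists>D\<ge>0. \<forall>\<Xi>. noise \<Xi> \<longrightarrow> N \<Xi> \<in> besov P b \<and> besov_norm P b (N \<Xi>) \<le> D * noise_norm \<Xi>"
  shows "noise_bounded r s (\<lambda>\<Xi> u. Q (M u) (N \<Xi>))" "u \<in> sobolev r \<Longrightarrow> noise \<Xi> \<Longrightarrow> ok (M u) (N \<Xi>)"
proof -
  show "u \<in> sobolev r \<Longrightarrow> noise \<Xi> \<Longrightarrow> ok (M u) (N \<Xi>)" using assms by meson
  obtain B where B: "B \<ge> 0" "\<And>f g. f \<in> sobolev a \<Longrightarrow> g \<in> besov P b \<Longrightarrow> Q f g \<in> sobolev s \<and> sobolev_norm s (Q f g) \<le> B * sobolev_norm a f * besov_norm P b g"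
    using Q by blast
  obtain D where D: "D \<ge> 0" "\<And>\<Xi>. noise \<Xi> \<Longrightarrow> N \<Xi> \<in> besov P b \<and> besov_norm P b (N \<Xi>) \<le> D * noise_norm \<Xi>" using N by blast
  show "noise_bounded r s (\<lambda>\<Xi> u. Q (M u) (N \<Xi>))" unfolding noise_bounded_def
  proof (intro exI[of _ "B * D"] conjI ballI allI impI)
    fix u \<Xi> assume u: "u \<in> sobolev r" and n: "noise \<Xi>"
    note b = B(2)[OF conjunct1[OF M[OF u]] conjunct1[OF D(2)[OF n]]]
    show "Q (M u) (N \<Xi>) \<in> sobolev s" using b by blast
    have "B * sobolev_norm a (M u) * besov_norm P b (N \<Xi>) \<le> B * sobolev_norm r u * (D * noise_norm \<Xi>)"
      using M[OF u] D(2)[OF n] B(1) by (intro mult_mono mult_left_mono) (auto intro: besov_norm_nonneg)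
    then show "sobolev_norm s (Q (M u) (N \<Xi>)) \<le> B * D * (sobolev_norm r u * noise_norm \<Xi>)"
      using b by (simp add: mult_ac)
  qed (use B D in auto)
qed

section \<open>Regularity of the products of u with the noise\<close>

lemma X_bound:
  "\<exists>D\<ge>0. \<forall>\<Xi>. noise \<Xi> \<longrightarrow> X_of \<Xi> \<in> besov P (1 - \<kappa>) \<and> besov_norm P (1 - \<kappa>) (X_of \<Xi>) \<le> D * noise_norm \<Xi>"
proof -
  have "-1 - \<kappa> + 2 = 1 - \<kappa>" by simp
  then obtain B where B: "B \<ge> 0" "\<And>f. f \<in> besov P (-1 - \<kappa>) \<Longrightarrow> inv_one_minus_lap f \<in> besov P (1 - \<kappa>) \<and> besov_norm P (1 - \<kappa>) (inv_one_minus_lap f) \<le> B * besov_norm P (-1 - \<kappa>) f"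
    using inv_lap_besov[of "-1 - \<kappa>"] by metis
  have "besov_norm P (1 - \<kappa>) (X_of \<Xi>) \<le> B * noise_norm \<Xi>" if n: "noise \<Xi>" for \<Xi>
    unfolding X_of_def using B(2)[OF noiseD(1)[OF n]] mult_left_mono[OF noise_norm_parts(1)[OF n] B(1)] by linarith
  then show ?thesis using B noiseD(1) by (auto simp: X_of_def)
qed

lemma fst_bound: "\<exists>D\<ge>0. \<forall>\<Xi>. noise \<Xi> \<longrightarrow> fst \<Xi> \<in> besov P (-1 - \<kappa>) \<and> besov_norm P (-1 - \<kappa>) (fst \<Xi>) \<le> D * noise_norm \<Xi>"
  and snd_bound: "\<exists>D\<ge>0. \<forall>\<Xi>. noise \<Xi> \<longrightarrow> snd \<Xi> \<in> besov P (-2 * \<kappa>) \<and> besov_norm P (-2 * \<kappa>) (snd \<Xi>) \<le> D * noise_norm \<Xi>"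
  using noiseD noise_norm_parts by (intro exI[of _ 1]; simp)+

text \<open>Paraproducts \<open>M u \<prec> X\<close> for an operator \<open>M\<close> losing \<open>\<gamma> - s\<close> derivatives.\<close>

lemma para_X_bound:
  assumes "\<And>u. u \<in> sobolev \<gamma> \<Longrightarrow> M u \<in> sobolev s \<and> sobolev_norm s (M u) \<le> sobolev_norm \<gamma> u"
    and s: "s \<le> 0" "-1 \<le> t" "t < s + (1 - \<kappa>)"
  shows "noise_bounded \<gamma> t (\<lambda>\<Xi> u. para P (M u) (X_of \<Xi>))" "u \<in> sobolev \<gamma> \<Longrightarrow> noise \<Xi> \<Longrightarrow> para_ok (M u) (X_of \<Xi>)"
  by (rule noise_bounded_bilinear[OF para_bound_sobolev_besov[OF s(2,1,3)] assms(1) X_bound]; assumption)+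

lemma sobolev_gamma_L2: "u \<in> sobolev \<gamma> \<Longrightarrow> u \<in> sobolev 0 \<and> sobolev_norm 0 u \<le> sobolev_norm \<gamma> u"
  using sobolev_mono[of u \<gamma> 0] gamma by simp

lemma para_u_X: "noise_bounded \<gamma> (1 - 2 * \<kappa>) (\<lambda>\<Xi> u. para P u (X_of \<Xi>))" "u \<in> sobolev \<gamma> \<Longrightarrow> noise \<Xi> \<Longrightarrow> para_ok u (X_of \<Xi>)"
  using para_X_bound[where M = "\<lambda>u. u" and s = 0 and t = "1 - 2 * \<kappa>", OF sobolev_gamma_L2] kappa_bounds by auto

lemma para_lap_X: "noise_bounded \<gamma> (-1 + 3 * \<kappa>) (\<lambda>\<Xi> u. para P (laplacian u) (X_of \<Xi>))" "u \<in> sobolev \<gamma> \<Longrightarrow> noise \<Xi> \<Longrightarrow> para_ok (laplacian u) (X_of \<Xi>)"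
  using para_X_bound[where M = laplacian and s = "\<gamma> - 2" and t = "-1 + 3 * \<kappa>", OF conjI[OF laplacian_sobolev]] kappa_bounds by auto

lemma para_xi_u: "noise_bounded \<gamma> (-1 + 3 * \<kappa>) (\<lambda>\<Xi> u. para P (fst \<Xi>) u)" "u \<in> sobolev \<gamma> \<Longrightarrow> noise \<Xi> \<Longrightarrow> para_ok (fst \<Xi>) u"
  using noise_bounded_bilinear[OF para_bound_besov_sobolev[of "-1 + 3 * \<kappa>" "-1 - \<kappa>" \<gamma>] _ fst_bound, of \<gamma> "\<lambda>u. u"] kappa_bounds by auto

lemma para_Xi2_u: "noise_bounded \<gamma> 0 (\<lambda>\<Xi> u. para P (snd \<Xi>) u)" "u \<in> sobolev \<gamma> \<Longrightarrow> noise \<Xi> \<Longrightarrow> para_ok (snd \<Xi>) u"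
  using noise_bounded_bilinear[OF para_bound_besov_sobolev[of 0 "-2 * \<kappa>" \<gamma>] _ snd_bound, of \<gamma> "\<lambda>u. u"] kappa_bounds by auto

lemma para_u_Xi2: "noise_bounded \<gamma> (-1 + 3 * \<kappa>) (\<lambda>\<Xi> u. para P u (snd \<Xi>))" "u \<in> sobolev \<gamma> \<Longrightarrow> noise \<Xi> \<Longrightarrow> para_ok u (snd \<Xi>)"
  using noise_bounded_bilinear[OF para_bound_sobolev_besov[of "-1 + 3 * \<kappa>" 0 "-2 * \<kappa>"] sobolev_gamma_L2 snd_bound] kappa_bounds by auto

lemma reson_u_Xi2: "noise_bounded \<gamma> 0 (\<lambda>\<Xi> u. reson P u (snd \<Xi>))" "u \<in> sobolev \<gamma> \<Longrightarrow> noise \<Xi> \<Longrightarrow> res_ok u (snd \<Xi>)"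
  using noise_bounded_bilinear[OF reson_bound[of \<gamma> "-2 * \<kappa>"] _ snd_bound, of \<gamma> "\<lambda>u. u"] kappa_bounds by auto

lemma reson_v_xi: "noise_bounded (1 + 3 * \<kappa>) 0 (\<lambda>\<Xi> v. reson P v (fst \<Xi>))" "v \<in> sobolev (1 + 3 * \<kappa>) \<Longrightarrow> noise \<Xi> \<Longrightarrow> res_ok v (fst \<Xi>)"
  using noise_bounded_bilinear[OF reson_bound[of "1 + 3 * \<kappa>" "-1 - \<kappa>"] _ fst_bound, of "1 + 3 * \<kappa>" "\<lambda>u. u"] kappa_bounds by auto

text \<open>Derivatives of X are avoided as Besov data. The Leibniz rule writes \<partial>u \<prec>
  \<partial>X as \<partial>(\<partial>u \<prec> X) - \<partial>\<partial>u \<prec> X, and both terms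
  are paraproducts with X itself.\<close>

lemma para_grad_X:
  assumes m: "deriv_mult m"
  shows "noise_bounded \<gamma> (-1 + 3 * \<kappa>) (\<lambda>\<Xi> u. para P (\<lambda>k. m k * u k) (\<lambda>k. m k * X_of \<Xi> k))"
    and "u \<in> sobolev \<gamma> \<Longrightarrow> noise \<Xi> \<Longrightarrow> para_ok (\<lambda>k. m k * u k) (X_of \<Xi>)"
    and "u \<in> sobolev \<gamma> \<Longrightarrow> noise \<Xi> \<Longrightarrow> para_ok (\<lambda>k. m k * (m k * u k)) (X_of \<Xi>)"
    and "u \<in> sobolev \<gamma> \<Longrightarrow> noise \<Xi> \<Longrightarrow> para_ok (\<lambda>k. m k * u k) (\<lambda>k. m k * X_of \<Xi> k)"
    and "u \<in> sobolev \<gamma> \<Longrightarrow> noise \<Xi> \<Longrightarrow> para P (\<lambda>k. m k * u k) (\<lambda>k. m k * X_of \<Xi> k) =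
      (\<lambda>k. m k * para P (\<lambda>k. m k * u k) (X_of \<Xi>) k) - para P (\<lambda>k. m k * (m k * u k)) (X_of \<Xi>)"
proof -
  have M1: "(\<lambda>k. m k * u k) \<in> sobolev (\<gamma> - 1) \<and> sobolev_norm (\<gamma> - 1) (\<lambda>k. m k * u k) \<le> sobolev_norm \<gamma> u" if "u \<in> sobolev \<gamma>" for u
    using deriv_mult_sobolev[OF m that] by simp
  have M2: "(\<lambda>k. m k * (m k * u k)) \<in> sobolev (\<gamma> - 2) \<and> sobolev_norm (\<gamma> - 2) (\<lambda>k. m k * (m k * u k)) \<le> sobolev_norm \<gamma> u" if "u \<in> sobolev \<gamma>" for u
    using deriv_mult_sobolev[OF m, of "\<lambda>k. m k * u k" "\<gamma> - 1"] M1[OF that] by simp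
  have P1: "noise_bounded \<gamma> (3 * \<kappa>) (\<lambda>\<Xi> u. para P (\<lambda>k. m k * u k) (X_of \<Xi>))"
    and ok1: "u \<in> sobolev \<gamma> \<Longrightarrow> noise \<Xi> \<Longrightarrow> para_ok (\<lambda>k. m k * u k) (X_of \<Xi>)" for u \<Xi>
    using para_X_bound[where M = "\<lambda>u k. m k * u k" and s = "\<gamma> - 1" and t = "3 * \<kappa>", OF M1] kappa_bounds gamma by auto
  have P2: "noise_bounded \<gamma> (-1 + 3 * \<kappa>) (\<lambda>\<Xi> u. para P (\<lambda>k. m k * (m k * u k)) (X_of \<Xi>))"
    and ok2: "u \<in> sobolev \<gamma> \<Longrightarrow> noise \<Xi> \<Longrightarrow> para_ok (\<lambda>k. m k * (m k * u k)) (X_of \<Xi>)" for u \<Xi>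
    using para_X_bound[where M = "\<lambda>u k. m k * (m k * u k)" and s = "\<gamma> - 2" and t = "-1 + 3 * \<kappa>", OF M2] kappa_bounds gamma by auto
  show "u \<in> sobolev \<gamma> \<Longrightarrow> noise \<Xi> \<Longrightarrow> para_ok (\<lambda>k. m k * u k) (X_of \<Xi>)"
    "u \<in> sobolev \<gamma> \<Longrightarrow> noise \<Xi> \<Longrightarrow> para_ok (\<lambda>k. m k * (m k * u k)) (X_of \<Xi>)" by (fact ok1 ok2)+
  have add: "m (k + l) = m k + m l" for k l using m by (simp add: deriv_mult_def)
  note L = para_leibniz[where m = m, OF add ok1 ok2]
  show "u \<in> sobolev \<gamma> \<Longrightarrow> noise \<Xi> \<Longrightarrow> para_ok (\<lambda>k. m k * u k) (\<lambda>k. m k * X_of \<Xi> k)" by (rule L(1))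
  have eq: "para P (\<lambda>k. m k * u k) (\<lambda>k. m k * X_of \<Xi> k) = (\<lambda>k. m k * para P (\<lambda>k. m k * u k) (X_of \<Xi>) k) - para P (\<lambda>k. m k * (m k * u k)) (X_of \<Xi>)"
    if "u \<in> sobolev \<gamma>" "noise \<Xi>" for u \<Xi> using L(2) that by blast
  then show "u \<in> sobolev \<gamma> \<Longrightarrow> noise \<Xi> \<Longrightarrow> para P (\<lambda>k. m k * u k) (\<lambda>k. m k * X_of \<Xi> k) =
      (\<lambda>k. m k * para P (\<lambda>k. m k * u k) (X_of \<Xi>) k) - para P (\<lambda>k. m k * (m k * u k)) (X_of \<Xi>)" .
  have "3 * \<kappa> - 1 = -1 + 3 * \<kappa>" by simp
  note D = deriv_mult_sobolev[OF m, where s = "3 * \<kappa>", unfolded this]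
  have "noise_bounded \<gamma> (-1 + 3 * \<kappa>) (\<lambda>\<Xi> u. (\<lambda>k. m k * para P (\<lambda>k. m k * u k) (X_of \<Xi>) k) + - para P (\<lambda>k. m k * (m k * u k)) (X_of \<Xi>))"
    by (rule noise_bounded_add[OF noise_bounded_comp[OF P1 D] noise_bounded_comp[OF P2, of uminus]]) (simp_all only: sobolev_minus_iff sobolev_norm_minus order_refl)
  then show "noise_bounded \<gamma> (-1 + 3 * \<kappa>) (\<lambda>\<Xi> u. para P (\<lambda>k. m k * u k) (\<lambda>k. m k * X_of \<Xi> k))"
    using eq unfolding noise_bounded_def by simp
qed

lemma para_grad:
  "noise_bounded \<gamma> (-1 + 3 * \<kappa>) (\<lambda>\<Xi> u. para P (partial1 u) (partial1 (X_of \<Xi>)))"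
  "noise_bounded \<gamma> (-1 + 3 * \<kappa>) (\<lambda>\<Xi> u. para P (partial2 u) (partial2 (X_of \<Xi>)))"
  using para_grad_X(1)[OF deriv_mult_partial(1)] para_grad_X(1)[OF deriv_mult_partial(2)]
  unfolding partial1_eq partial2_eq .

lemma products_ok:
  assumes u: "u \<in> sobolev \<gamma>" and n: "noise \<Xi>"
  shows "para_ok u (X_of \<Xi>)" "para_ok (laplacian u) (X_of \<Xi>)"
    "para_ok (partial1 u) (partial1 (X_of \<Xi>))" "para_ok (partial2 u) (partial2 (X_of \<Xi>))"
    "para_ok (fst \<Xi>) u" "para_ok u (snd \<Xi>)" "para_ok (snd \<Xi>) u" "res_ok u (snd \<Xi>)"
  unfolding partial1_eq partial2_eq
  by (intro para_u_X para_lap_X para_grad_X(4) deriv_mult_partial para_xi_u para_u_Xi2 para_Xi2_u reson_u_Xi2 u n)+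

section \<open>The operators B and T\<close>

definition B_src :: "pdist \<times> pdist \<Rightarrow> pdist \<Rightarrow> pdist" where
  "B_src \<Xi> u = para P (laplacian u) (X_of \<Xi>)
      + scal 2 (para P (partial1 u) (partial1 (X_of \<Xi>)) + para P (partial2 u) (partial2 (X_of \<Xi>)))
      + para P (fst \<Xi>) u + para P u (snd \<Xi>)"

lemma B_op_eq: "B_op P \<Xi> u = inv_one_minus_lap (B_src \<Xi> u)"
  by (simp add: B_op_def B_src_def)

lemma B_src_bound: "noise_bounded \<gamma> (-1 + 3 * \<kappa>) B_src"
proof -
  have e: "B_src \<Xi> u = para P (laplacian u) (X_of \<Xi>)
      + (para P (partial1 u) (partial1 (X_of \<Xi>)) + para P (partial2 u) (partial2 (X_of \<Xi>)))
      + (para P (partial1 u) (partial1 (X_of \<Xi>)) + para P (partial2 u) (partial2 (X_of \<Xi>)))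
      + para P (fst \<Xi>) u + para P u (snd \<Xi>)" for \<Xi> u
    by (simp add: B_src_def scal_def fun_eq_iff)
  show ?thesis unfolding e[abs_def] by (intro noise_bounded_add para_lap_X(1) para_grad para_xi_u(1) para_u_Xi2(1))
qed

lemma B_op_bound: "noise_bounded \<gamma> (1 + 3 * \<kappa>) (B_op P)"
proof -
  have "-1 + 3 * \<kappa> + 2 = 1 + 3 * \<kappa>" by simp
  note i = inv_one_minus_lap_sobolev[where s = "-1 + 3 * \<kappa>", unfolded this]
  show ?thesis unfolding B_op_eq[abs_def] by (rule noise_bounded_comp[OF B_src_bound i])
qed

lemma B_op_lin:
  assumes u: "u \<in> sobolev \<gamma>" and v: "v \<in> sobolev \<gamma>" and n: "noise \<Xi>"
  shows "B_op P \<Xi> (scal a u + scal b v) = scal a (B_op P \<Xi> u) + scal b (B_op P \<Xi> v)"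
proof -
  note ou = products_ok[OF u n] and ov = products_ok[OF v n]
  have "B_src \<Xi> (scal a u + scal b v) = scal a (B_src \<Xi> u) + scal b (B_src \<Xi> v)"
    unfolding B_src_def laplacian_lin partial1_lin partial2_lin
    unfolding para_lin_left(2)[OF ou(2) ov(2)] para_lin_left(2)[OF ou(3) ov(3)] para_lin_left(2)[OF ou(4) ov(4)]
      para_lin_right(2)[OF ou(5) ov(5)] para_lin_left(2)[OF ou(6) ov(6)]
    by (simp add: fun_eq_iff scal_def algebra_simps)
  then show ?thesis by (simp add: B_op_eq inv_one_minus_lap_lin)
qed

lemma inv_one_minus_lap_diff: "inv_one_minus_lap (f - g) = inv_one_minus_lap f - inv_one_minus_lap g"
  by (simp add: fun_eq_iff inv_one_minus_lap_def diff_divide_distrib)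

lemma partial_diff: "partial1 (f - g) = partial1 f - partial1 g" "partial2 (f - g) = partial2 f - partial2 g"
  by (simp_all add: fun_eq_iff partial1_def partial2_def algebra_simps)

lemma B_op_noise_diff:
  assumes u: "u \<in> sobolev \<gamma>" and n: "noise \<Xi>" "noise \<Xi>'"
  shows "B_op P (noise_diff \<Xi> \<Xi>') u = B_op P \<Xi> u - B_op P \<Xi>' u"
proof -
  note o1 = products_ok[OF u n(1)] and o2 = products_ok[OF u n(2)]
  have fs: "fst (noise_diff \<Xi> \<Xi>') = fst \<Xi> - fst \<Xi>'" "snd (noise_diff \<Xi> \<Xi>') = snd \<Xi> - snd \<Xi>'"
    by (simp_all add: noise_diff_def)
  have "B_src (noise_diff \<Xi> \<Xi>') u = B_src \<Xi> u - B_src \<Xi>' u"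
    unfolding B_src_def X_of_diff fs partial_diff
    unfolding para_diff_right(2)[OF o1(2) o2(2)] para_diff_right(2)[OF o1(3) o2(3)] para_diff_right(2)[OF o1(4) o2(4)]
      para_diff_left(2)[OF o1(5) o2(5)] para_diff_right(2)[OF o1(6) o2(6)]
    by (simp add: fun_eq_iff scal_def algebra_simps)
  then show ?thesis by (simp add: B_op_eq inv_one_minus_lap_diff)
qed

definition T_op :: "pdist \<times> pdist \<Rightarrow> pdist \<Rightarrow> pdist" where
  "T_op \<Xi> u = para P u (X_of \<Xi>) + B_op P \<Xi> u"

lemma R_op_eq: "R_op P \<Xi> u = u - T_op \<Xi> u"
  by (simp add: R_op_def T_op_def algebra_simps)

lemma T_op_bound: "noise_bounded \<gamma> (1 - 2 * \<kappa>) T_op"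
  unfolding T_op_def[abs_def]
  by (rule noise_bounded_add[OF para_u_X(1) noise_bounded_comp[OF B_op_bound, of "\<lambda>f. f"]])
    (use kappa_bounds(1) sobolev_mono[of _ "1 + 3 * \<kappa>" "1 - 2 * \<kappa>"] in auto)

lemma T_op_lin:
  assumes u: "u \<in> sobolev \<gamma>" and v: "v \<in> sobolev \<gamma>" and n: "noise \<Xi>"
  shows "T_op \<Xi> (scal a u + scal b v) = scal a (T_op \<Xi> u) + scal b (T_op \<Xi> v)"
  unfolding T_op_def B_op_lin[OF assms] para_lin_left(2)[OF products_ok(1)[OF u n] products_ok(1)[OF v n]]
  by (simp add: fun_eq_iff scal_def algebra_simps)

lemma T_op_diff:
  assumes "u \<in> sobolev \<gamma>" "v \<in> sobolev \<gamma>" "noise \<Xi>"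
  shows "T_op \<Xi> (u - v) = T_op \<Xi> u - T_op \<Xi> v"
  using T_op_lin[OF assms, of 1 "-1"] by (simp only: diff_eq_scal[symmetric])

lemma T_op_noise_diff:
  assumes u: "u \<in> sobolev \<gamma>" and n: "noise \<Xi>" "noise \<Xi>'"
  shows "T_op (noise_diff \<Xi> \<Xi>') u = T_op \<Xi> u - T_op \<Xi>' u"
  unfolding T_op_def B_op_noise_diff[OF assms] X_of_diff para_diff_right(2)[OF products_ok(1)[OF u n(1)] products_ok(1)[OF u n(2)]]
  by (simp add: algebra_simps)

text \<open>The Leibniz rule is applied twice in each coordinate, and (1 - \<Delta>) X = \<xi>. The
  products with derivatives of u explain the first terms of B: they cancel in (1 - \<Delta>)(u
  \<prec> X + B u).\<close>

lemma one_minus_lap_para_X: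
  assumes u: "u \<in> sobolev \<gamma>" and n: "noise \<Xi>"
  shows "para_ok u (fst \<Xi>)"
    "one_minus_lap (para P u (X_of \<Xi>)) = para P u (fst \<Xi>) - para P (laplacian u) (X_of \<Xi>)
      - scal 2 (para P (partial1 u) (partial1 (X_of \<Xi>)) + para P (partial2 u) (partial2 (X_of \<Xi>)))"
proof -
  let ?X = "X_of \<Xi>"
  have add: "m (k + l) = m k + m l" if "deriv_mult m" for m k l using that by (simp add: deriv_mult_def)
  have step: "para_ok u (\<lambda>k. m k * (m k * ?X k)) \<and> para P u (\<lambda>k. m k * (m k * ?X k)) =
      (\<lambda>k. m k * (m k * para P u ?X k)) - scal 2 (para P (\<lambda>k. m k * u k) (\<lambda>k. m k * ?X k)) - para P (\<lambda>k. m k * (m k * u k)) ?X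
      \<and> para_ok (\<lambda>k. m k * (m k * u k)) ?X" if m: "deriv_mult m" for m
  proof -
    note ok = para_grad_X(2-4)[OF m u n] and eq = para_grad_X(5)[OF m u n]
    note L1 = para_leibniz[where m = m, OF add[OF m] products_ok(1)[OF u n] ok(1)]
    note L2 = para_leibniz[where m = m, OF add[OF m] L1(1) ok(3)]
    have "para P u (\<lambda>k. m k * (m k * ?X k)) =
      (\<lambda>k. m k * (m k * para P u ?X k)) - scal 2 (para P (\<lambda>k. m k * u k) (\<lambda>k. m k * ?X k)) - para P (\<lambda>k. m k * (m k * u k)) ?X"
      unfolding L2(2) L1(2) eq by (simp add: fun_eq_iff scal_def algebra_simps)
    then show ?thesis using L2(1) ok(2) by blast
  qed
  let ?m1 = partial_sym1 and ?m2 = partial_sym2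
  note s1 = step[OF deriv_mult_partial(1)] and s2 = step[OF deriv_mult_partial(2)]
  have lapeq: "laplacian f = scal 1 (\<lambda>k. ?m1 k * (?m1 k * f k)) + scal 1 (\<lambda>k. ?m2 k * (?m2 k * f k))" for f
    by (simp add: fun_eq_iff laplacian_def partial_sym_square)
  have okL: "para_ok u (laplacian ?X)" unfolding lapeq using s1 s2 by (intro para_lin_right) auto
  have pL: "para P u (laplacian ?X) = para P u (\<lambda>k. ?m1 k * (?m1 k * ?X k)) + para P u (\<lambda>k. ?m2 k * (?m2 k * ?X k))"
    unfolding lapeq using s1 s2 by (subst para_lin_right(2)) auto
  have pl: "para P (laplacian u) ?X = para P (\<lambda>k. ?m1 k * (?m1 k * u k)) ?X + para P (\<lambda>k. ?m2 k * (?m2 k * u k)) ?X"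
    unfolding lapeq using s1 s2 by (subst para_lin_left(2)) auto
  have xi: "fst \<Xi> = ?X - laplacian ?X" unfolding X_of_def by (rule one_minus_lap_inv[symmetric])
  have ox: "para_ok u ?X" by (rule products_ok(1)[OF u n])
  show "para_ok u (fst \<Xi>)" unfolding xi by (rule para_diff_right(1)[OF ox okL])
  have pxi: "para P u (fst \<Xi>) = para P u ?X - para P u (laplacian ?X)" unfolding xi by (rule para_diff_right(2)[OF ox okL])
  have "one_minus_lap (para P u ?X) = para P u ?X - laplacian (para P u ?X)" by (simp add: laplacian_eq)
  also have "laplacian (para P u ?X) = (\<lambda>k. ?m1 k * (?m1 k * para P u ?X k)) + (\<lambda>k. ?m2 k * (?m2 k * para P u ?X k))"
    by (simp add: lapeq)
  finally show "one_minus_lap (para P u (X_of \<Xi>)) = para P u (fst \<Xi>) - para P (laplacian u) (X_of \<Xi>)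
      - scal 2 (para P (partial1 u) (partial1 (X_of \<Xi>)) + para P (partial2 u) (partial2 (X_of \<Xi>)))"
    unfolding pxi pL pl partial1_eq partial2_eq s1[THEN conjunct2, THEN conjunct1] s2[THEN conjunct2, THEN conjunct1]
    by (simp add: fun_eq_iff scal_def algebra_simps)
qed

text \<open>What is left of A, apart from the terms in R, after the cancellation; all of it is in
  L2. The summand \<open>u\<close> comes from writing \<Delta> as 1 - (1 - \<Delta>).\<close>

definition E_op :: "pdist \<times> pdist \<Rightarrow> pdist \<Rightarrow> pdist" where
  "E_op \<Xi> u = u + C u (X_of \<Xi>) (fst \<Xi>) + reson P u (snd \<Xi>) + para P (snd \<Xi>) u + reson P (B_op P \<Xi> u) (fst \<Xi>)"

text \<open>The terms u \<prec> \<xi>, \<xi> \<prec> u and u \<prec> \<Xi>2 of negative regularity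
  appear in (1 - \<Delta>) u through u \<prec> X and B u. They cancel their counterparts in A, the
  last one against a part of the product u \<Xi>2.\<close>

lemma A_op_eq:
  assumes u: "u \<in> sobolev \<gamma>" and n: "noise \<Xi>"
  shows "A_op P C \<Xi> u = E_op \<Xi> u + reson P (R_op P \<Xi> u) (fst \<Xi>) - one_minus_lap (R_op P \<Xi> u)"
proof -
  have B: "one_minus_lap (B_op P \<Xi> u) = B_src \<Xi> u"
    by (simp add: one_minus_lap_def B_op_eq inv_one_minus_lap_def)
  have oR: "one_minus_lap (R_op P \<Xi> u) = one_minus_lap u - one_minus_lap (para P u (X_of \<Xi>)) - B_src \<Xi> u"
    unfolding B[symmetric] R_op_def by (simp add: fun_eq_iff one_minus_lap_def algebra_simps)
  show ?thesis
    unfolding A_op_def reson_xi_def E_op_def dist_mult_def oR one_minus_lap_para_X(2)[OF assms] B_src_def laplacian_eq[of u]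
    by (simp add: fun_eq_iff algebra_simps)
qed

lemma C_admissible: "0 < \<gamma> \<and> \<gamma> < 1 \<and> (1 - \<kappa>) + (-1 - \<kappa>) < 0 \<and> 0 < \<gamma> + (1 - \<kappa>) + (-1 - \<kappa>)"
  using kappa_bounds gamma by auto

lemmas C_props = conjunct2[OF comm[unfolded is_commutator_operator_def], rule_format, OF C_admissible]

lemmas C_lin1 = C_props[THEN conjunct2, THEN conjunct1, rule_format]
  and C_lin2 = C_props[THEN conjunct2, THEN conjunct2, THEN conjunct1, rule_format]
  and C_lin3 = C_props[THEN conjunct2, THEN conjunct2, THEN conjunct2, THEN conjunct1, rule_format]

lemma C_bound: "\<exists>B\<ge>0. \<forall>f\<in>sobolev \<gamma>. \<forall>g\<in>besov P (1 - \<kappa>). \<forall>h\<in>besov P (-1 - \<kappa>). C f g h \<in> sobolev 0 \<and>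
  sobolev_norm 0 (C f g h) \<le> B * sobolev_norm \<gamma> f * besov_norm P (1 - \<kappa>) g * besov_norm P (-1 - \<kappa>) h"
proof -
  obtain B where B: "\<And>f g h. f \<in> sobolev \<gamma> \<Longrightarrow> g \<in> besov P (1 - \<kappa>) \<Longrightarrow> h \<in> besov P (-1 - \<kappa>) \<Longrightarrow>
      sobolev_norm (\<gamma> + (1 - \<kappa>) + (-1 - \<kappa>)) (C f g h) \<le> B * sobolev_norm \<gamma> f * besov_norm P (1 - \<kappa>) g * besov_norm P (-1 - \<kappa>) h"
    using C_props[THEN conjunct2, THEN conjunct2, THEN conjunct2, THEN conjunct2] by blast
  show ?thesis
  \<comment> \<open>The constant in \<open>is_commutator_operator\<close> may be negative, so its
    absolute value is taken.\<close>
  proof (intro exI[of _ "\<bar>B\<bar>"] conjI ballI)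
    fix f g h assume a: "f \<in> sobolev \<gamma>" "g \<in> besov P (1 - \<kappa>)" "h \<in> besov P (-1 - \<kappa>)"
    note m = sobolev_mono[OF C_props[THEN conjunct1, rule_format, OF a], of 0]
    show "C f g h \<in> sobolev 0" using m C_admissible by auto
    have "sobolev_norm 0 (C f g h) \<le> B * sobolev_norm \<gamma> f * besov_norm P (1 - \<kappa>) g * besov_norm P (-1 - \<kappa>) h"
      using m(2) B[OF a] C_admissible by linarith
    also have "\<dots> \<le> \<bar>B\<bar> * sobolev_norm \<gamma> f * besov_norm P (1 - \<kappa>) g * besov_norm P (-1 - \<kappa>) h"
      using besov_norm_nonneg a by (intro mult_right_mono) auto
    finally show "sobolev_norm 0 (C f g h) \<le> \<bar>B\<bar> * sobolev_norm \<gamma> f * besov_norm P (1 - \<kappa>) g * besov_norm P (-1 - \<kappa>) h" .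
  qed simp
qed

definition E1_op :: "pdist \<times> pdist \<Rightarrow> pdist \<Rightarrow> pdist" where
  "E1_op \<Xi> u = reson P u (snd \<Xi>) + para P (snd \<Xi>) u"

text \<open>The part of \<open>E_op\<close> quadratic in the noise, polarized: with separate slots
  for the two noises it is linear in each, and differences telescope.\<close>

definition E2_op :: "pdist \<times> pdist \<Rightarrow> pdist \<times> pdist \<Rightarrow> pdist \<Rightarrow> pdist" where
  "E2_op \<Xi> \<Xi>' u = C u (X_of \<Xi>) (fst \<Xi>') + reson P (B_op P \<Xi> u) (fst \<Xi>')"

lemma E_op_eq: "E_op \<Xi> u = u + E1_op \<Xi> u + E2_op \<Xi> \<Xi> u"
  by (simp add: E_op_def E1_op_def E2_op_def algebra_simps)

lemma E1_op_bound: "noise_bounded \<gamma> 0 E1_op"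
  unfolding E1_op_def[abs_def] by (rule noise_bounded_add[OF reson_u_Xi2(1) para_Xi2_u(1)])

lemma reson_B_op: "u \<in> sobolev \<gamma> \<Longrightarrow> noise \<Xi> \<Longrightarrow> noise \<Xi>' \<Longrightarrow> res_ok (B_op P \<Xi> u) (fst \<Xi>')"
  by (rule reson_v_xi(2)[OF noise_bounded_mem[OF B_op_bound]])

lemma E2_op_bound:
  "\<exists>B\<ge>0. \<forall>u\<in>sobolev \<gamma>. \<forall>\<Xi> \<Xi>'. noise \<Xi> \<longrightarrow> noise \<Xi>' \<longrightarrow> E2_op \<Xi> \<Xi>' u \<in> sobolev 0 \<and>
    sobolev_norm 0 (E2_op \<Xi> \<Xi>' u) \<le> B * (sobolev_norm \<gamma> u * noise_norm \<Xi> * noise_norm \<Xi>')"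
proof -
  obtain B1 where B1: "B1 \<ge> 0" "\<And>f g h. f \<in> sobolev \<gamma> \<Longrightarrow> g \<in> besov P (1 - \<kappa>) \<Longrightarrow> h \<in> besov P (-1 - \<kappa>) \<Longrightarrow> C f g h \<in> sobolev 0 \<and>
      sobolev_norm 0 (C f g h) \<le> B1 * sobolev_norm \<gamma> f * besov_norm P (1 - \<kappa>) g * besov_norm P (-1 - \<kappa>) h"
    using C_bound by meson
  obtain B2 where B2: "B2 \<ge> 0" "\<And>\<Xi>. noise \<Xi> \<Longrightarrow> X_of \<Xi> \<in> besov P (1 - \<kappa>) \<and> besov_norm P (1 - \<kappa>) (X_of \<Xi>) \<le> B2 * noise_norm \<Xi>"
    using X_bound by meson
  obtain B3 where B3: "B3 \<ge> 0" "\<And>u \<Xi>. u \<in> sobolev \<gamma> \<Longrightarrow> noise \<Xi> \<Longrightarrow> B_op P \<Xi> u \<in> sobolev (1 + 3 * \<kappa>) \<and>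
      sobolev_norm (1 + 3 * \<kappa>) (B_op P \<Xi> u) \<le> B3 * (sobolev_norm \<gamma> u * noise_norm \<Xi>)"
    by (rule noise_boundedE[OF B_op_bound], rule that)
  obtain B4 where B4: "B4 \<ge> 0" "\<And>v \<Xi>. v \<in> sobolev (1 + 3 * \<kappa>) \<Longrightarrow> noise \<Xi> \<Longrightarrow> reson P v (fst \<Xi>) \<in> sobolev 0 \<and>
      sobolev_norm 0 (reson P v (fst \<Xi>)) \<le> B4 * (sobolev_norm (1 + 3 * \<kappa>) v * noise_norm \<Xi>)"
    by (rule noise_boundedE[OF reson_v_xi(1)], rule that)
  show ?thesis
  proof (intro exI[of _ "B1 * B2 + B4 * B3"] conjI ballI allI impI)
    show "0 \<le> B1 * B2 + B4 * B3" using B1 B2 B3 B4 by simp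
    fix u \<Xi> \<Xi>' assume u: "u \<in> sobolev \<gamma>" and n: "noise \<Xi>" and n': "noise \<Xi>'"
    note b2 = B2(2)[OF n] and b3 = B3(2)[OF u n]
    note b1 = B1(2)[OF u b2[THEN conjunct1] noiseD(1)[OF n']] and b4 = B4(2)[OF b3[THEN conjunct1] n']
    note s = sobolev_add[OF b1[THEN conjunct1] b4[THEN conjunct1]]
    show "E2_op \<Xi> \<Xi>' u \<in> sobolev 0" unfolding E2_op_def by (rule s(1))
    have 1: "B1 * sobolev_norm \<gamma> u * besov_norm P (1 - \<kappa>) (X_of \<Xi>) * besov_norm P (-1 - \<kappa>) (fst \<Xi>')
        \<le> B1 * sobolev_norm \<gamma> u * (B2 * noise_norm \<Xi>) * noise_norm \<Xi>'"
      using b2 B1(1) B2(1) noise_norm_parts[OF n] noise_norm_parts[OF n'] besov_norm_nonneg[OF noiseD(1)[OF n']] besov_norm_nonneg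
      by (intro mult_mono mult_left_mono) auto
    have 2: "B4 * (sobolev_norm (1 + 3 * \<kappa>) (B_op P \<Xi> u) * noise_norm \<Xi>') \<le> B4 * (B3 * (sobolev_norm \<gamma> u * noise_norm \<Xi>) * noise_norm \<Xi>')"
      using b3 B4(1) noise_norm_parts(3)[OF n'] by (intro mult_right_mono mult_left_mono) auto
    have "sobolev_norm 0 (E2_op \<Xi> \<Xi>' u) \<le> B1 * sobolev_norm \<gamma> u * (B2 * noise_norm \<Xi>) * noise_norm \<Xi>' + B4 * (B3 * (sobolev_norm \<gamma> u * noise_norm \<Xi>) * noise_norm \<Xi>')"
      unfolding E2_op_def
      by (rule order_trans[OF s(2)]) (intro add_mono order_trans[OF conjunct2[OF b1] 1] order_trans[OF conjunct2[OF b4] 2])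
    then show "sobolev_norm 0 (E2_op \<Xi> \<Xi>' u) \<le> (B1 * B2 + B4 * B3) * (sobolev_norm \<gamma> u * noise_norm \<Xi> * noise_norm \<Xi>')" by (simp add: algebra_simps)
  qed
qed

lemma X_besov: "noise \<Xi> \<Longrightarrow> X_of \<Xi> \<in> besov P (1 - \<kappa>)"
  using X_bound by blast

lemma E_op_lin:
  assumes u: "u \<in> sobolev \<gamma>" and v: "v \<in> sobolev \<gamma>" and n: "noise \<Xi>"
  shows "E_op \<Xi> (scal a u + scal b v) = scal a (E_op \<Xi> u) + scal b (E_op \<Xi> v)"
proof -
  note ou = products_ok[OF u n] and ov = products_ok[OF v n]
  show ?thesis
    unfolding E_op_def B_op_lin[OF assms] C_lin1[OF u v X_besov[OF n] noiseD(1)[OF n]]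
      reson_lin_left(2)[OF ou(8) ov(8)] para_lin_right(2)[OF ou(7) ov(7)]
      reson_lin_left(2)[OF reson_B_op[OF u n n] reson_B_op[OF v n n]]
    by (simp add: fun_eq_iff scal_def algebra_simps)
qed

lemma E_op_diff:
  assumes "u \<in> sobolev \<gamma>" "v \<in> sobolev \<gamma>" "noise \<Xi>"
  shows "E_op \<Xi> (u - v) = E_op \<Xi> u - E_op \<Xi> v"
  using E_op_lin[OF assms, of 1 "-1"] by (simp only: diff_eq_scal[symmetric])

lemma E_op_noise_diff:
  assumes u: "u \<in> sobolev \<gamma>" and n: "noise \<Xi>" and n': "noise \<Xi>'"
  shows "E_op \<Xi> u - E_op \<Xi>' u = E1_op (noise_diff \<Xi> \<Xi>') u + E2_op (noise_diff \<Xi> \<Xi>') \<Xi> u + E2_op \<Xi>' (noise_diff \<Xi> \<Xi>') u"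
proof -
  have fs: "fst (noise_diff \<Xi> \<Xi>') = fst \<Xi> - fst \<Xi>'" "snd (noise_diff \<Xi> \<Xi>') = snd \<Xi> - snd \<Xi>'"
    by (simp_all add: noise_diff_def)
  note o = products_ok[OF u n] and o' = products_ok[OF u n']
  have C2: "C u (X_of \<Xi> - X_of \<Xi>') (fst \<Xi>) = C u (X_of \<Xi>) (fst \<Xi>) - C u (X_of \<Xi>') (fst \<Xi>)"
    using C_lin2[OF u X_besov[OF n] X_besov[OF n'] noiseD(1)[OF n], of 1 "-1"] by (simp only: diff_eq_scal[symmetric])
  have C3: "C u (X_of \<Xi>') (fst \<Xi> - fst \<Xi>') = C u (X_of \<Xi>') (fst \<Xi>) - C u (X_of \<Xi>') (fst \<Xi>')"
    using C_lin3[OF u X_besov[OF n'] noiseD(1)[OF n] noiseD(1)[OF n'], of 1 "-1"] by (simp only: diff_eq_scal[symmetric])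
  show ?thesis
    unfolding E_op_def E1_op_def E2_op_def fs X_of_diff B_op_noise_diff[OF assms] C2 C3
      reson_diff_right(2)[OF o(8) o'(8)] para_diff_left(2)[OF o(7) o'(7)]
      reson_diff_left(2)[OF reson_B_op[OF u n n] reson_B_op[OF u n' n]]
      reson_diff_right(2)[OF reson_B_op[OF u n' n] reson_B_op[OF u n' n']]
    by (simp add: algebra_simps)
qed

section \<open>The resolvent and the weighted pair space\<close>

definition J_op :: "real \<Rightarrow> pdist \<Rightarrow> pdist" where
  "J_op K f = (\<lambda>k. f k / of_real (K + bessel k))"

lemma J_op_lin: "J_op K (scal a f + scal b g) = scal a (J_op K f) + scal b (J_op K g)"
  by (simp add: fun_eq_iff J_op_def scal_def add_divide_distrib)

text \<open>Interpolation: b = \<open>bessel k\<close> and \<open>K\<close> are both at most K + b,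
  and are raised to the powers \<theta> and 1 - \<theta>. The part of the two derivatives not spent
  on regularity becomes a negative power of \<open>K\<close>.\<close>

lemma J_op_symbol:
  assumes "K \<ge> 1" "0 \<le> \<theta>" "\<theta> \<le> 1"
  shows "bessel k powr \<theta> / (K + bessel k) \<le> K powr (\<theta> - 1)"
proof -
  have b: "bessel k > 0" "bessel k \<ge> 0" by (rule bessel_pos, rule less_imp_le[OF bessel_pos])
  have "bessel k powr \<theta> * K powr (1 - \<theta>) \<le> (K + bessel k) powr \<theta> * (K + bessel k) powr (1 - \<theta>)"
    using b assms by (intro mult_mono powr_mono2) auto
  also have "\<dots> = K + bessel k" using b assms by (simp flip: powr_add)
  finally have "bessel k powr \<theta> * K powr (1 - \<theta>) \<le> K + bessel k" .
  then have "bessel k powr \<theta> * (K powr (1 - \<theta>) * K powr (\<theta> - 1)) \<le> (K + bessel k) * K powr (\<theta> - 1)"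
    by (simp add: mult.assoc[symmetric] mult_right_mono)
  moreover have "K powr (1 - \<theta>) * K powr (\<theta> - 1) = 1" using assms by (simp flip: powr_add)
  ultimately show ?thesis using b assms by (simp add: pos_divide_le_eq mult.commute)
qed

lemma J_op_sobolev:
  assumes "K \<ge> 1" "f \<in> sobolev s" "s \<le> t" "t \<le> s + 2"
  shows "J_op K f \<in> sobolev t" "sobolev_norm t (J_op K f) \<le> K powr ((t - s) / 2 - 1) * sobolev_norm s f"
proof -
  have "cmod (1 / of_real (K + bessel k)) \<le> K powr ((t - s) / 2 - 1) * bessel k powr ((s - t) / 2)" for k
  proof -
    have "bessel k powr ((s - t) / 2) * bessel k powr ((t - s) / 2) = 1"
      using bessel_pos[of k] bessel_neq_0[of k] by (simp flip: powr_add add: diff_divide_distrib)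
    then have "1 / (K + bessel k) = bessel k powr ((t - s) / 2) / (K + bessel k) * bessel k powr ((s - t) / 2)"
      by (simp add: mult.commute)
    also have "\<dots> \<le> K powr ((t - s) / 2 - 1) * bessel k powr ((s - t) / 2)" (is "_ \<le> ?b")
      using assms by (intro mult_right_mono J_op_symbol) auto
    finally have "1 / (K + bessel k) \<le> ?b" .
    moreover have "\<bar>K + bessel k\<bar> = K + bessel k" using add_pos_pos[OF _ bessel_pos, of K k] assms(1) by simp
    ultimately show ?thesis by (simp add: norm_divide del: of_real_add)
  qed
  from sobolev_multiplier[OF assms(2) _ this]
  show "J_op K f \<in> sobolev t" "sobolev_norm t (J_op K f) \<le> K powr ((t - s) / 2 - 1) * sobolev_norm s f"
    by (simp_all add: J_op_def)
qed

lemma one_minus_lap_J_op_sobolev: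
  assumes "K \<ge> 1" "f \<in> sobolev s" "s - 2 \<le> t" "t \<le> s"
  shows "J_op K (one_minus_lap f) \<in> sobolev t" "sobolev_norm t (J_op K (one_minus_lap f)) \<le> K powr ((t - s) / 2) * sobolev_norm s f"
proof -
  have *: "one_minus_lap f \<in> sobolev (s - 2)" "sobolev_norm (s - 2) (one_minus_lap f) \<le> sobolev_norm s f"
    using one_minus_lap_sobolev[of f "s - 2"] assms(2) by auto
  note j = J_op_sobolev[OF assms(1) *(1), of t]
  show "J_op K (one_minus_lap f) \<in> sobolev t" using j assms by simp
  have e: "(t - (s - 2)) / 2 - 1 = (t - s) / 2" by (simp add: field_simps)
  have "sobolev_norm t (J_op K (one_minus_lap f)) \<le> K powr ((t - s) / 2) * sobolev_norm (s - 2) (one_minus_lap f)"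
    using j(2)[unfolded e] assms by auto
  also have "\<dots> \<le> K powr ((t - s) / 2) * sobolev_norm s f" using * by (intro mult_left_mono) auto
  finally show "sobolev_norm t (J_op K (one_minus_lap f)) \<le> K powr ((t - s) / 2) * sobolev_norm s f" .
qed

definition pair_space :: "(pdist \<times> pdist) set" where
  "pair_space = sobolev \<gamma> \<times> sobolev (1 + 3 * \<kappa>)"

definition pair_norm :: "real \<Rightarrow> pdist \<times> pdist \<Rightarrow> real" where
  "pair_norm K x = sobolev_norm \<gamma> (fst x) + K powr (-1/4) * sobolev_norm (1 + 3 * \<kappa>) (snd x)"

text \<open>The solution of u = R + t with (K + 1 - \<Delta>) u = g + (1 - \<Delta>) t. In the
  second component J (1 - \<Delta>) t - t is rewritten as - K J t: a difference of two terms of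
  regularity 1 - 2 \<kappa> becomes one term of regularity above 1 + 3 \<kappa>, at the price of the
  factor \<open>K\<close>.\<close>

definition J_pair :: "real \<Rightarrow> pdist \<Rightarrow> pdist \<Rightarrow> pdist \<times> pdist" where
  "J_pair K g t = (J_op K g + J_op K (one_minus_lap t), J_op K g - scal (of_real K) (J_op K t))"

lemma J_pair_diff: "J_pair K g t - J_pair K g' t' = J_pair K (g - g') (t - t')"
  by (simp add: J_pair_def J_op_def one_minus_lap_def scal_def fun_eq_iff diff_divide_distrib algebra_simps)

lemma pair_space_diff: "x \<in> pair_space \<Longrightarrow> y \<in> pair_space \<Longrightarrow> x - y \<in> pair_space"
  unfolding pair_space_def by (auto intro: sobolev_diff)

lemma J_pair_mem:
  assumes "K \<ge> 1" "g \<in> sobolev 0" "t \<in> sobolev (1 - 2 * \<kappa>)"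
  shows "J_pair K g t \<in> pair_space"
proof -
  have "J_op K g \<in> sobolev \<gamma>" "J_op K g \<in> sobolev (1 + 3 * \<kappa>)"
    using assms kappa_bounds by (intro J_op_sobolev(1)[of K g 0]; simp)+
  moreover have "J_op K (one_minus_lap t) \<in> sobolev \<gamma>"
    using assms kappa_bounds by (intro one_minus_lap_J_op_sobolev(1)[of K t "1 - 2 * \<kappa>"]) auto
  moreover have "J_op K t \<in> sobolev (1 + 3 * \<kappa>)"
    using assms kappa_bounds by (intro J_op_sobolev(1)[of K t "1 - 2 * \<kappa>"]) auto
  ultimately show ?thesis
    unfolding J_pair_def pair_space_def by (intro SigmaI sobolev_add(1) sobolev_diff(1) sobolev_scal(1))
qed

text \<open>The entries of the map are K^(\<gamma>/2 - 1) and K^(-3 \<kappa>) into the first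
  component, K^((1 + 3 \<kappa>)/2 - 1) and the growing K^(5 \<kappa>/2) into the second. The weight
  K^(-1/4) outweighs the last one; K^(1/4), the cost of bounding \<open>r\<close> by the weighted
  norm, is covered by the first, as \<gamma>/2 - 1 < -1/2.\<close>

lemma J_pair_bound:
  assumes K: "K \<ge> 1" and g: "g \<in> sobolev 0" and t: "t \<in> sobolev (1 - 2 * \<kappa>)"
    and nn: "0 \<le> a" "0 \<le> r" "0 \<le> M"
    and gb: "sobolev_norm 0 g \<le> M * (a + r)" and tb: "sobolev_norm (1 - 2 * \<kappa>) t \<le> M * a"
  shows "pair_norm K (J_pair K g t) \<le> 4 * M * K powr (-\<kappa>) * (a + K powr (-1/4) * r)"
proof -
  define w z where "w = K powr (-1/4)" and "z = K powr (-\<kappa>)"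
  have wz: "0 \<le> w" "0 \<le> z" by (auto simp: w_def z_def)
  have kb: "\<kappa> < 1/24" "\<kappa> > 0" "\<gamma> = 1 - 8 * \<kappa>" using kappa_bounds by auto
  have ex: "\<gamma> / 2 - 1 \<le> -\<kappa>" "\<gamma> / 2 - 1 \<le> -\<kappa> - 1/4" "(\<gamma> - (1 - 2 * \<kappa>)) / 2 \<le> -\<kappa>" "(1 + 3 * \<kappa>) / 2 - 1 \<le> -\<kappa>"
    "(1 + 3 * \<kappa>) / 2 - 1 - 1/4 \<le> -\<kappa>" "(1 + 3 * \<kappa> - (1 - 2 * \<kappa>)) / 2 - 1/4 \<le> -\<kappa>"
    using kb by (simp_all add: field_simps)
  have pw: "K powr p \<le> z" if "p \<le> -\<kappa>" for p using K that by (auto simp: z_def intro: powr_mono)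
  have pw': "w * K powr p \<le> z" if "p - 1/4 \<le> -\<kappa>" for p
    using pw[OF that] K by (simp add: w_def flip: powr_add)
  have pw'': "K powr p \<le> w * z" if "p \<le> -\<kappa> - 1/4" for p
    using powr_mono[OF that K] by (simp add: w_def z_def add.commute flip: powr_add)
  let ?g = "sobolev_norm 0 g" and ?t = "sobolev_norm (1 - 2 * \<kappa>) t"
  note j1 = J_op_sobolev[OF K g, of \<gamma>] and j2 = J_op_sobolev[OF K g, of "1 + 3 * \<kappa>"]
    and j3 = one_minus_lap_J_op_sobolev[OF K t, of \<gamma>] and j4 = J_op_sobolev[OF K t, of "1 + 3 * \<kappa>"]
  have A: "sobolev_norm \<gamma> (fst (J_pair K g t)) \<le> K powr (\<gamma> / 2 - 1) * ?g + K powr ((\<gamma> - (1 - 2 * \<kappa>)) / 2) * ?t"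
    unfolding J_pair_def fst_conv using j1 j3 kb by (intro order_trans[OF sobolev_add(2)] add_mono) auto
  have B: "sobolev_norm (1 + 3 * \<kappa>) (snd (J_pair K g t)) \<le> K powr ((1 + 3 * \<kappa>) / 2 - 1) * ?g + K * (K powr ((1 + 3 * \<kappa> - (1 - 2 * \<kappa>)) / 2 - 1) * ?t)"
    unfolding J_pair_def snd_conv
    using j2 j4 kb K sobolev_scal[OF j4(1), of "of_real K"]
    by (intro order_trans[OF sobolev_diff(2)] add_mono order_trans[OF sobolev_scal(2)]) (auto intro!: mult_left_mono)
  have e: "K * K powr ((1 + 3 * \<kappa> - (1 - 2 * \<kappa>)) / 2 - 1) = K powr ((1 + 3 * \<kappa> - (1 - 2 * \<kappa>)) / 2)"
    using K by (simp add: powr_diff)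
  have "K powr (\<gamma> / 2 - 1) * ?g \<le> K powr (\<gamma> / 2 - 1) * (M * a) + K powr (\<gamma> / 2 - 1) * (M * r)"
    using mult_left_mono[OF gb, of "K powr (\<gamma> / 2 - 1)"] by (simp add: algebra_simps)
  also have "\<dots> \<le> z * (M * a) + (w * z) * (M * r)"
    using nn by (intro add_mono mult_right_mono pw pw'' ex) auto
  finally have 1: "K powr (\<gamma> / 2 - 1) * ?g \<le> z * (M * a) + (w * z) * (M * r)" .
  have 2: "K powr ((\<gamma> - (1 - 2 * \<kappa>)) / 2) * ?t \<le> z * (M * a)"
    using wz nn tb by (intro mult_mono pw ex) auto
  have "w * (K powr ((1 + 3 * \<kappa>) / 2 - 1) * ?g) \<le> (w * K powr ((1 + 3 * \<kappa>) / 2 - 1)) * (M * a) + w * (K powr ((1 + 3 * \<kappa>) / 2 - 1) * (M * r))"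
    using mult_left_mono[OF gb, of "w * K powr ((1 + 3 * \<kappa>) / 2 - 1)"] wz by (simp add: algebra_simps)
  also have "\<dots> \<le> z * (M * a) + w * (z * (M * r))"
    using nn wz by (intro add_mono mult_right_mono mult_left_mono pw pw' ex) auto
  finally have 3: "w * (K powr ((1 + 3 * \<kappa>) / 2 - 1) * ?g) \<le> z * (M * a) + w * (z * (M * r))" .
  have "(w * K powr ((1 + 3 * \<kappa> - (1 - 2 * \<kappa>)) / 2)) * ?t \<le> z * (M * a)"
    using wz nn tb by (intro mult_mono pw' ex) auto
  then have 4: "w * (K * (K powr ((1 + 3 * \<kappa> - (1 - 2 * \<kappa>)) / 2 - 1) * ?t)) \<le> z * (M * a)"
    unfolding e[symmetric] by (simp add: mult_ac)
  have "pair_norm K (J_pair K g t) \<le> (K powr (\<gamma> / 2 - 1) * ?g + K powr ((\<gamma> - (1 - 2 * \<kappa>)) / 2) * ?t)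
      + w * (K powr ((1 + 3 * \<kappa>) / 2 - 1) * ?g + K * (K powr ((1 + 3 * \<kappa> - (1 - 2 * \<kappa>)) / 2 - 1) * ?t))"
    unfolding pair_norm_def w_def[symmetric] using wz by (intro add_mono A mult_left_mono[OF B])
  also have "\<dots> \<le> 4 * (z * (M * a)) + 2 * (w * (z * (M * r)))"
    using 1 2 3 4 by (simp add: distrib_left mult_ac)
  also have "\<dots> \<le> 4 * (z * (M * a)) + 4 * (w * (z * (M * r)))" using nn wz by simp
  also have "\<dots> = 4 * M * z * (a + w * r)" by (simp add: algebra_simps)
  finally show ?thesis by (simp only: w_def z_def)
qed

lemma pair_norm_nonneg: "0 \<le> pair_norm K x"
  by (simp add: pair_norm_def)

lemma fst_le_pair_norm:
  assumes "x \<in> pair_space"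
  shows "fst x \<in> sobolev 0" "sobolev_norm 0 (fst x) \<le> pair_norm K x"
proof -
  have "fst x \<in> sobolev \<gamma>" using assms by (auto simp: pair_space_def)
  note m = sobolev_mono[OF this, of 0]
  show "fst x \<in> sobolev 0" using m gamma by simp
  have "0 \<le> K powr (-1/4) * sobolev_norm (1 + 3 * \<kappa>) (snd x)" by simp
  then show "sobolev_norm 0 (fst x) \<le> pair_norm K x" using m gamma unfolding pair_norm_def by linarith
qed

lemma pair_norm_triangle:
  assumes "x \<in> pair_space" "y \<in> pair_space"
  shows "pair_norm K (x + y) \<le> pair_norm K x + pair_norm K y"
proof -
  have "sobolev_norm \<gamma> (fst x + fst y) \<le> sobolev_norm \<gamma> (fst x) + sobolev_norm \<gamma> (fst y)"
    "sobolev_norm (1 + 3 * \<kappa>) (snd x + snd y) \<le> sobolev_norm (1 + 3 * \<kappa>) (snd x) + sobolev_norm (1 + 3 * \<kappa>) (snd y)"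
    using assms by (auto simp: pair_space_def intro!: sobolev_add)
  from this(1) mult_left_mono[OF this(2), of "K powr (-1/4)"] show ?thesis
    by (simp add: pair_norm_def distrib_left)
qed

section \<open>The fixed-point map\<close>

definition G_op :: "pdist \<times> pdist \<Rightarrow> pdist \<times> pdist \<Rightarrow> pdist" where
  "G_op \<Xi> x = E_op \<Xi> (fst x) + reson P (snd x) (fst \<Xi>)"

lemma G_op_diff:
  assumes "x \<in> pair_space" "y \<in> pair_space" "noise \<Xi>"
  shows "G_op \<Xi> (x - y) = G_op \<Xi> x - G_op \<Xi> y"
proof -
  have m: "fst x \<in> sobolev \<gamma>" "fst y \<in> sobolev \<gamma>" "snd x \<in> sobolev (1 + 3 * \<kappa>)" "snd y \<in> sobolev (1 + 3 * \<kappa>)"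
    using assms by (auto simp: pair_space_def)
  show ?thesis
    using E_op_diff[OF m(1,2) assms(3)] reson_diff_left(2)[OF reson_v_xi(2)[OF m(3) assms(3)] reson_v_xi(2)[OF m(4) assms(3)]]
    by (simp add: G_op_def)
qed

text \<open>Everything the contraction argument uses, with a single \<open>M\<close>. Noises in a
  bounded set can share it, so one \<open>K\<close> works for a noise and its
  approximations.\<close>

definition op_bounded :: "real \<Rightarrow> pdist \<times> pdist \<Rightarrow> bool" where
  "op_bounded M \<Xi> \<longleftrightarrow> 0 \<le> M \<and> noise \<Xi> \<and> (\<forall>x\<in>pair_space. G_op \<Xi> x \<in> sobolev 0 \<and> T_op \<Xi> (fst x) \<in> sobolev (1 - 2 * \<kappa>) \<and>
    sobolev_norm 0 (G_op \<Xi> x) \<le> M * (sobolev_norm \<gamma> (fst x) + sobolev_norm (1 + 3 * \<kappa>) (snd x)) \<and>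
    sobolev_norm (1 - 2 * \<kappa>) (T_op \<Xi> (fst x)) \<le> M * sobolev_norm \<gamma> (fst x))"

lemma op_boundedD:
  assumes "op_bounded M \<Xi>"
  shows "0 \<le> M" "noise \<Xi>" "x \<in> pair_space \<Longrightarrow> G_op \<Xi> x \<in> sobolev 0" "x \<in> pair_space \<Longrightarrow> T_op \<Xi> (fst x) \<in> sobolev (1 - 2 * \<kappa>)"
    "x \<in> pair_space \<Longrightarrow> sobolev_norm 0 (G_op \<Xi> x) \<le> M * (sobolev_norm \<gamma> (fst x) + sobolev_norm (1 + 3 * \<kappa>) (snd x))"
    "x \<in> pair_space \<Longrightarrow> sobolev_norm (1 - 2 * \<kappa>) (T_op \<Xi> (fst x)) \<le> M * sobolev_norm \<gamma> (fst x)"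
  proof -
  note a = assms[unfolded op_bounded_def]
  show "0 \<le> M" "noise \<Xi>" using a by (rule conjunct1, rule conjunct1[OF conjunct2])
  assume x: "x \<in> pair_space"
  note b = bspec[OF conjunct2[OF conjunct2[OF a]] x]
  show "G_op \<Xi> x \<in> sobolev 0" "T_op \<Xi> (fst x) \<in> sobolev (1 - 2 * \<kappa>)"
    "sobolev_norm 0 (G_op \<Xi> x) \<le> M * (sobolev_norm \<gamma> (fst x) + sobolev_norm (1 + 3 * \<kappa>) (snd x))"
    "sobolev_norm (1 - 2 * \<kappa>) (T_op \<Xi> (fst x)) \<le> M * sobolev_norm \<gamma> (fst x)"
    by (rule b[THEN conjunct1] b[THEN conjunct2, THEN conjunct1] b[THEN conjunct2, THEN conjunct2, THEN conjunct1] b[THEN conjunct2, THEN conjunct2, THEN conjunct2])+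
qed

text \<open>Boundedness and Lipschitz dependence on the noise with the same \<open>M\<close>: the
  terms linear in the noise are evaluated at the difference, the quadratic ones are
  telescoped.\<close>

lemma op_bounds:
  assumes N: "0 \<le> N"
  shows "\<exists>M. (\<forall>\<Xi>. noise \<Xi> \<longrightarrow> noise_norm \<Xi> \<le> N \<longrightarrow> op_bounded M \<Xi>) \<and>
    (\<forall>\<Xi> \<Xi>'. noise \<Xi> \<longrightarrow> noise \<Xi>' \<longrightarrow> noise_norm \<Xi> \<le> N \<longrightarrow> noise_norm \<Xi>' \<le> N \<longrightarrow> (\<forall>x\<in>pair_space.
      sobolev_norm 0 (G_op \<Xi> x - G_op \<Xi>' x) \<le> M * noise_norm (noise_diff \<Xi> \<Xi>') * (sobolev_norm \<gamma> (fst x) + sobolev_norm (1 + 3 * \<kappa>) (snd x)) \<and>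
      sobolev_norm (1 - 2 * \<kappa>) (T_op \<Xi> (fst x) - T_op \<Xi>' (fst x)) \<le> M * noise_norm (noise_diff \<Xi> \<Xi>') * sobolev_norm \<gamma> (fst x)))"
proof -
  obtain B1 where B1: "B1 \<ge> 0" "\<And>u \<Xi>. u \<in> sobolev \<gamma> \<Longrightarrow> noise \<Xi> \<Longrightarrow> E1_op \<Xi> u \<in> sobolev 0 \<and>
      sobolev_norm 0 (E1_op \<Xi> u) \<le> B1 * (sobolev_norm \<gamma> u * noise_norm \<Xi>)" by (rule noise_boundedE[OF E1_op_bound], rule that)
  obtain B2 where B2: "B2 \<ge> 0" "\<And>u \<Xi> \<Xi>'. u \<in> sobolev \<gamma> \<Longrightarrow> noise \<Xi> \<Longrightarrow> noise \<Xi>' \<Longrightarrow> E2_op \<Xi> \<Xi>' u \<in> sobolev 0 \<and>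
      sobolev_norm 0 (E2_op \<Xi> \<Xi>' u) \<le> B2 * (sobolev_norm \<gamma> u * noise_norm \<Xi> * noise_norm \<Xi>')" using E2_op_bound by meson
  obtain B3 where B3: "B3 \<ge> 0" "\<And>v \<Xi>. v \<in> sobolev (1 + 3 * \<kappa>) \<Longrightarrow> noise \<Xi> \<Longrightarrow> reson P v (fst \<Xi>) \<in> sobolev 0 \<and>
      sobolev_norm 0 (reson P v (fst \<Xi>)) \<le> B3 * (sobolev_norm (1 + 3 * \<kappa>) v * noise_norm \<Xi>)" by (rule noise_boundedE[OF reson_v_xi(1)], rule that)
  obtain B4 where B4: "B4 \<ge> 0" "\<And>u \<Xi>. u \<in> sobolev \<gamma> \<Longrightarrow> noise \<Xi> \<Longrightarrow> T_op \<Xi> u \<in> sobolev (1 - 2 * \<kappa>) \<and>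
      sobolev_norm (1 - 2 * \<kappa>) (T_op \<Xi> u) \<le> B4 * (sobolev_norm \<gamma> u * noise_norm \<Xi>)" by (rule noise_boundedE[OF T_op_bound], rule that)
  define B where "B = B1 + B2 + B3 + B4"
  have up: "x \<le> B * y" if "x \<le> b * y" "b \<in> {B1, B2, B3, B4}" "0 \<le> y" for x b y
    by (rule order_trans[OF that(1)], rule mult_right_mono[OF _ that(3)]) (use that(2) B1 B2 B3 B4 in \<open>auto simp: B_def\<close>)
  \<comment> \<open>1 is for the summand \<open>u\<close> of \<open>E_op\<close>, \<open>B\<close>
    for differences of the linear parts, \<open>B * N\<close> and \<open>B * (N * N)\<close> for a
    linear and a quadratic dependence on the noise; the 2 accounts for the two terms of the
    telescoped quadratic part.\<close>
  define M where "M = 1 + B + 2 * (B * N) + B * (N * N)"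
  have B: "0 \<le> B" "0 \<le> B * N" "0 \<le> B * (N * N)" using B1 B2 B3 B4 N by (auto simp: B_def)
  show ?thesis
  proof (intro exI[of _ M] conjI allI impI ballI)
    fix \<Xi> assume n: "noise \<Xi>" and nN: "noise_norm \<Xi> \<le> N"
    show "op_bounded M \<Xi>" unfolding op_bounded_def
    proof (intro conjI ballI n)
      show "0 \<le> M" using B by (simp add: M_def)
      fix x assume "x \<in> pair_space"
      then have u: "fst x \<in> sobolev \<gamma>" and v: "snd x \<in> sobolev (1 + 3 * \<kappa>)" by (auto simp: pair_space_def)
      note b1 = B1(2)[OF u n] and b2 = B2(2)[OF u n n] and b3 = B3(2)[OF v n] and b4 = B4(2)[OF u n] and l = sobolev_gamma_L2[OF u]
      define a r \<nu> where "a = sobolev_norm \<gamma> (fst x)" and "r = sobolev_norm (1 + 3 * \<kappa>) (snd x)" and "\<nu> = noise_norm \<Xi>"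
      have ar: "0 \<le> a" "0 \<le> r" "0 \<le> \<nu>" "\<nu> \<le> N" using noise_norm_parts(3)[OF n] nN by (auto simp: a_def r_def \<nu>_def)
      note defs = a_def[symmetric] r_def[symmetric] \<nu>_def[symmetric]
      show "G_op \<Xi> x \<in> sobolev 0" "T_op \<Xi> (fst x) \<in> sobolev (1 - 2 * \<kappa>)"
        unfolding G_op_def E_op_eq using b1 b2 b3 b4 l by (blast intro: sobolev_add(1))+
      have k: "B * (a * \<nu>) \<le> B * (a * N)" "B * (a * \<nu> * \<nu>) \<le> B * (a * N * N)" "B * (r * \<nu>) \<le> B * (r * N)"
        using ar B N by (auto intro!: mult_left_mono mult_mono)
      have "sobolev_norm 0 (G_op \<Xi> x) \<le> ((a + B * (a * N)) + B * (a * N * N)) + B * (r * N)"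
        unfolding G_op_def E_op_eq using b1 b2 b3 l ar unfolding defs
        by (intro order_trans[OF sobolev_add(2)] add_mono sobolev_add(1) order_trans[OF up k(1)] order_trans[OF up k(2)] order_trans[OF up k(3)]) auto
      also have "\<dots> \<le> M * (a + r)"
      proof -
        have "0 \<le> B * a" "0 \<le> B * r" "0 \<le> B * N * a" "0 \<le> B * N * r" "0 \<le> B * (N * N) * r" using B ar by auto
        then show ?thesis using ar by (simp add: M_def algebra_simps)
      qed
      finally show "sobolev_norm 0 (G_op \<Xi> x) \<le> M * (sobolev_norm \<gamma> (fst x) + sobolev_norm (1 + 3 * \<kappa>) (snd x))" unfolding defs .
      have "sobolev_norm (1 - 2 * \<kappa>) (T_op \<Xi> (fst x)) \<le> B * (a * N)"
        using b4 ar unfolding defs by (intro order_trans[OF up k(1)]) auto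
      also have "\<dots> = (B * N) * a" by simp
      also have "\<dots> \<le> M * a" using B ar by (intro mult_right_mono) (simp_all add: M_def)
      finally show "sobolev_norm (1 - 2 * \<kappa>) (T_op \<Xi> (fst x)) \<le> M * sobolev_norm \<gamma> (fst x)" unfolding defs .
    qed
  next
    fix \<Xi> \<Xi>' x assume n: "noise \<Xi>" and n': "noise \<Xi>'" and nN: "noise_norm \<Xi> \<le> N" "noise_norm \<Xi>' \<le> N" and "x \<in> pair_space"
    then have u: "fst x \<in> sobolev \<gamma>" and v: "snd x \<in> sobolev (1 + 3 * \<kappa>)" by (auto simp: pair_space_def)
    let ?D = "noise_diff \<Xi> \<Xi>'"
    have nd: "noise ?D" by (rule noise_noise_diff[OF n n'])
    define a r d where "a = sobolev_norm \<gamma> (fst x)" and "r = sobolev_norm (1 + 3 * \<kappa>) (snd x)" and "d = noise_norm ?D"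
    have ar: "0 \<le> a" "0 \<le> r" "0 \<le> d" using noise_norm_parts(3)[OF nd] by (auto simp: a_def r_def d_def)
    note defs = a_def[symmetric] r_def[symmetric] d_def[symmetric]
    note b1 = B1(2)[OF u nd] and b2 = B2(2)[OF u nd n] and b2' = B2(2)[OF u n' nd] and b3 = B3(2)[OF v nd] and b4 = B4(2)[OF u nd]
    have rd: "reson P (snd x) (fst \<Xi>) - reson P (snd x) (fst \<Xi>') = reson P (snd x) (fst ?D)"
      unfolding noise_diff_def fst_conv by (rule reson_diff_right(2)[symmetric]) (rule reson_v_xi(2)[OF v] n n')+
    have G: "G_op \<Xi> x - G_op \<Xi>' x = E1_op ?D (fst x) + E2_op ?D \<Xi> (fst x) + E2_op \<Xi>' ?D (fst x) + reson P (snd x) (fst ?D)"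
      unfolding G_op_def E_op_noise_diff[OF u n n', symmetric] rd[symmetric] by (simp add: algebra_simps)
    have k: "B * (a * d * noise_norm \<Xi>) \<le> B * (a * d * N)" "B * (a * noise_norm \<Xi>' * d) \<le> B * (a * N * d)"
      using ar B N nN by (auto intro!: mult_left_mono mult_right_mono)
    have "sobolev_norm 0 (G_op \<Xi> x - G_op \<Xi>' x) \<le> ((B * (a * d) + B * (a * d * N)) + B * (a * N * d)) + B * (r * d)"
      unfolding G using b1 b2 b2' b3 ar noise_norm_parts(3)[OF n] noise_norm_parts(3)[OF n'] unfolding defs
      by (intro order_trans[OF sobolev_add(2)] add_mono sobolev_add(1) order_trans[OF up k(1)] order_trans[OF up k(2)] up) auto
    also have "\<dots> = (B + 2 * (B * N)) * (d * a) + B * (d * r)" by (simp add: algebra_simps)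
    also have "\<dots> \<le> M * (d * a) + M * (d * r)" using B ar by (intro add_mono mult_right_mono) (simp_all add: M_def)
    finally show "sobolev_norm 0 (G_op \<Xi> x - G_op \<Xi>' x) \<le> M * noise_norm ?D * (sobolev_norm \<gamma> (fst x) + sobolev_norm (1 + 3 * \<kappa>) (snd x))"
      unfolding defs by (simp add: distrib_left mult.assoc)
    have "sobolev_norm (1 - 2 * \<kappa>) (T_op ?D (fst x)) \<le> B * (a * d)" using b4 ar unfolding defs by (intro up) auto
    also have "\<dots> \<le> M * (a * d)" using B ar by (intro mult_right_mono) (simp_all add: M_def)
    finally show "sobolev_norm (1 - 2 * \<kappa>) (T_op \<Xi> (fst x) - T_op \<Xi>' (fst x)) \<le> M * noise_norm ?D * sobolev_norm \<gamma> (fst x)"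
      unfolding T_op_noise_diff[OF u n n'] defs by (simp add: mult_ac)
  qed
qed

definition Sol :: "pdist \<times> pdist \<Rightarrow> real \<Rightarrow> pdist \<Rightarrow> pdist \<times> pdist \<Rightarrow> pdist \<times> pdist" where
  "Sol \<Xi> K f x = J_pair K (f + G_op \<Xi> x) (T_op \<Xi> (fst x))"

lemma Sol_mem:
  assumes "op_bounded M \<Xi>" "K \<ge> 1" "f \<in> sobolev 0" "x \<in> pair_space"
  shows "Sol \<Xi> K f x \<in> pair_space"
  unfolding Sol_def using op_boundedD(3,4)[OF assms(1,4)] assms by (intro J_pair_mem sobolev_add(1))

lemma Sol_linear_part_bound:
  assumes b: "op_bounded M \<Xi>" and K: "K \<ge> 1" and x: "x \<in> pair_space"
  shows "pair_norm K (J_pair K (G_op \<Xi> x) (T_op \<Xi> (fst x))) \<le> 4 * M * K powr (-\<kappa>) * pair_norm K x"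
  unfolding pair_norm_def[of K x] using op_boundedD[OF b] x by (intro J_pair_bound[OF K]) auto

lemma Sol_diff:
  assumes b: "op_bounded M \<Xi>" and x: "x \<in> pair_space" "y \<in> pair_space"
  shows "Sol \<Xi> K f x - Sol \<Xi> K f y = J_pair K (G_op \<Xi> (x - y)) (T_op \<Xi> (fst (x - y)))"
proof -
  have "T_op \<Xi> (fst x - fst y) = T_op \<Xi> (fst x) - T_op \<Xi> (fst y)"
    using x op_boundedD(2)[OF b] by (intro T_op_diff) (auto simp: pair_space_def)
  then show ?thesis unfolding Sol_def J_pair_diff G_op_diff[OF x op_boundedD(2)[OF b]] by simp
qed

lemma Sol_fixpoint:
  assumes b: "op_bounded M \<Xi>" and K: "K \<ge> 1" "4 * M * K powr (-\<kappa>) \<le> 1/2" and f: "f \<in> sobolev 0"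
  shows "\<exists>x\<in>pair_space. Sol \<Xi> K f x = x"
  unfolding pair_space_def
proof (rule sobolev_pair_fixpoint[where w = "K powr (-1/4)" and q = "1/2"])
  show "Sol \<Xi> K f x \<in> sobolev \<gamma> \<times> sobolev (1 + 3 * \<kappa>)" if "x \<in> sobolev \<gamma> \<times> sobolev (1 + 3 * \<kappa>)" for x
    using Sol_mem[OF b K(1) f] that unfolding pair_space_def by blast
  fix x y assume "x \<in> sobolev \<gamma> \<times> sobolev (1 + 3 * \<kappa>)" "y \<in> sobolev \<gamma> \<times> sobolev (1 + 3 * \<kappa>)"
  then have x: "x \<in> pair_space" "y \<in> pair_space" by (auto simp: pair_space_def)
  have "pair_norm K (Sol \<Xi> K f x - Sol \<Xi> K f y) \<le> 4 * M * K powr (-\<kappa>) * pair_norm K (x - y)"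
    unfolding Sol_diff[OF b x] by (rule Sol_linear_part_bound[OF b K(1) pair_space_diff[OF x]])
  also have "\<dots> \<le> 1/2 * pair_norm K (x - y)" by (rule mult_right_mono[OF K(2) pair_norm_nonneg])
  finally show "sobolev_norm \<gamma> (fst (Sol \<Xi> K f x) - fst (Sol \<Xi> K f y)) + K powr (-1/4) * sobolev_norm (1 + 3 * \<kappa>) (snd (Sol \<Xi> K f x) - snd (Sol \<Xi> K f y))
      \<le> 1/2 * (sobolev_norm \<gamma> (fst x - fst y) + K powr (-1/4) * sobolev_norm (1 + 3 * \<kappa>) (snd x - snd y))"
    by (simp add: pair_norm_def)
qed (use K in auto)

text \<open>The difference of the fixed points splits into the change of the map at \<open>x\<close>
  and the contraction of the second map from \<open>x\<close> to \<open>x'\<close>. The latter has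
  factor 1/2 and is absorbed, which doubles 4 \<delta> to 8 \<delta>.\<close>

lemma Sol_stable:
  assumes b: "op_bounded M \<Xi>" "op_bounded M \<Xi>'" and K: "K \<ge> 1" "4 * M * K powr (-\<kappa>) \<le> 1/2"
    and x: "x \<in> pair_space" "Sol \<Xi> K f x = x" and x': "x' \<in> pair_space" "Sol \<Xi>' K f x' = x'"
    and d: "0 \<le> \<delta>" "sobolev_norm 0 (G_op \<Xi> x - G_op \<Xi>' x) \<le> \<delta> * (sobolev_norm \<gamma> (fst x) + sobolev_norm (1 + 3 * \<kappa>) (snd x))"
      "sobolev_norm (1 - 2 * \<kappa>) (T_op \<Xi> (fst x) - T_op \<Xi>' (fst x)) \<le> \<delta> * sobolev_norm \<gamma> (fst x)"
  shows "pair_norm K (x - x') \<le> 8 * \<delta> * pair_norm K x"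
proof -
  let ?g = "G_op \<Xi> x - G_op \<Xi>' x" and ?t = "T_op \<Xi> (fst x) - T_op \<Xi>' (fst x)"
  have m: "?g \<in> sobolev 0" "?t \<in> sobolev (1 - 2 * \<kappa>)"
    using op_boundedD(3,4)[OF b(1) x(1)] op_boundedD(3,4)[OF b(2) x(1)] by (auto intro: sobolev_diff)
  have xx: "x - x' \<in> pair_space" by (rule pair_space_diff[OF x(1) x'(1)])
  let ?p = "J_pair K ?g ?t" and ?q = "J_pair K (G_op \<Xi>' (x - x')) (T_op \<Xi>' (fst (x - x')))"
  have "x - x' = (Sol \<Xi> K f x - Sol \<Xi>' K f x) + (Sol \<Xi>' K f x - Sol \<Xi>' K f x')" using x x' by simp
  also have "Sol \<Xi> K f x - Sol \<Xi>' K f x = ?p" unfolding Sol_def J_pair_diff by simp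
  also have "Sol \<Xi>' K f x - Sol \<Xi>' K f x' = ?q" by (rule Sol_diff[OF b(2) x(1) x'(1)])
  finally have e: "x - x' = ?p + ?q" .
  have ps: "?p \<in> pair_space" "?q \<in> pair_space"
    using m op_boundedD(3,4)[OF b(2) xx] K by (auto intro: J_pair_mem)
  have q: "pair_norm K ?q \<le> 1/2 * pair_norm K (x - x')"
    by (rule order_trans[OF Sol_linear_part_bound[OF b(2) K(1) xx] mult_right_mono[OF K(2) pair_norm_nonneg]])
  have p: "pair_norm K ?p \<le> 4 * \<delta> * K powr (-\<kappa>) * pair_norm K x"
    unfolding pair_norm_def[of K x] using d by (intro J_pair_bound[OF K(1) m]) simp_all
  have "K powr (-\<kappa>) \<le> 1" using powr_mono[of "-\<kappa>" 0 K] K(1) kappa_bounds(1) by simp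
  moreover have "0 \<le> 4 * \<delta>" using d(1) by simp
  ultimately have k: "4 * \<delta> * K powr (-\<kappa>) * pair_norm K x \<le> 4 * \<delta> * 1 * pair_norm K x"
    by (intro mult_right_mono[OF mult_left_mono] pair_norm_nonneg)
  have "pair_norm K (x - x') \<le> pair_norm K ?p + pair_norm K ?q" by (rule pair_norm_triangle[OF ps, of K, folded e])
  with q p k show ?thesis by linarith
qed

section \<open>Fixed points and the equation K u - A u = f\<close>

lemma J_op_resolvent:
  assumes "K \<ge> 1"
  shows "J_op K (one_minus_lap f) = f - scal (of_real K) (J_op K f)" "scal (of_real K) (J_op K f) + one_minus_lap (J_op K f) = f"
    "J_op K (scal (of_real K) f + one_minus_lap f) = f"
proof -
  have "K + bessel k \<noteq> 0" for k using bessel_pos[of k] assms by linarith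
  then have nz: "complex_of_real (K + bessel k) \<noteq> 0" for k by (simp only: of_real_eq_0_iff not_False_eq_True)
  have *: "b * (z / (a + b)) = z - a * (z / (a + b))" if "a + b \<noteq> 0" for a b z :: complex
    using that by (simp add: field_simps)
  show 1: "J_op K (one_minus_lap f) = f - scal (of_real K) (J_op K f)"
    using *[of "of_real K" "of_real (bessel k)" "f k" for k] nz by (simp add: fun_eq_iff J_op_def one_minus_lap_def scal_def)
  then show "scal (of_real K) (J_op K f) + one_minus_lap (J_op K f) = f"
    by (simp add: fun_eq_iff J_op_def one_minus_lap_def scal_def algebra_simps)
  show "J_op K (scal (of_real K) f + one_minus_lap f) = f"
    using J_op_lin[of K "of_real K" f 1 "one_minus_lap f"] 1 by simp
qed

lemma one_minus_lap_diff: "one_minus_lap (f - g) = one_minus_lap f - one_minus_lap g"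
  by (simp add: fun_eq_iff one_minus_lap_def algebra_simps)

lemma J_op_simps: "J_op K f + J_op K g = J_op K (f + g)" "J_op K f - J_op K g = J_op K (f - g)" "scal c (J_op K f) = J_op K (scal c f)"
  by (simp_all add: fun_eq_iff J_op_def scal_def add_divide_distrib diff_divide_distrib)

lemma scal_add: "scal c (f + g) = scal c f + scal c g" "scal c (f - g) = scal c f - scal c g"
  by (simp_all add: fun_eq_iff scal_def algebra_simps)

lemma one_minus_lap_add: "one_minus_lap (f + g) = one_minus_lap f + one_minus_lap g"
  by (simp add: fun_eq_iff one_minus_lap_def algebra_simps)

text \<open>The two components of the fixed-point equation force
  \<open>snd x = R_op P \<Xi> (fst x)\<close>. The resolvent lifts g in L2 and t in H^(1 - 2
  \<kappa>) to H^2, so R is in H^2 although it was sought in H^(1 + 3 \<kappa>).\<close>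

lemma Sol_A_op:
  assumes b: "op_bounded M \<Xi>" and K: "K \<ge> 1" and f: "f \<in> sobolev 0" and x: "x \<in> pair_space" "Sol \<Xi> K f x = x"
  shows "fst x \<in> A_dom P \<Xi> \<gamma>" "scal (of_real K) (fst x) - A_op P C \<Xi> (fst x) = f"
proof -
  obtain u R where xe: "x = (u, R)" by (cases x)
  have u: "u \<in> sobolev \<gamma>" and n: "noise \<Xi>" using x(1) op_boundedD(2)[OF b] by (auto simp: pair_space_def xe)
  define g t where "g = f + G_op \<Xi> x" and "t = T_op \<Xi> u"
  have gs: "g \<in> sobolev 0" unfolding g_def by (intro sobolev_add(1) f op_boundedD(3)[OF b] x)
  have ts: "t \<in> sobolev (1 - 2 * \<kappa>)" unfolding t_def using op_boundedD(4)[OF b x(1)] by (simp add: xe)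
  have eq: "u = J_op K g + J_op K (one_minus_lap t)" "R = J_op K g - scal (of_real K) (J_op K t)"
    using x(2) by (simp_all add: Sol_def xe J_pair_def g_def t_def)
  note J = J_op_resolvent[OF K]
  have Rt: "R = u - t" unfolding eq J(1) by simp
  then have RR: "R_op P \<Xi> u = R" by (simp add: R_op_eq t_def)
  have "J_op K t \<in> sobolev 2" using K ts kappa_bounds by (intro J_op_sobolev(1)[of K t "1 - 2 * \<kappa>"]) auto
  moreover have "J_op K g \<in> sobolev 2" using K gs by (intro J_op_sobolev(1)[of K g 0]) auto
  ultimately have "R \<in> sobolev 2" unfolding eq by (intro sobolev_diff(1) sobolev_scal(1))
  then show "fst x \<in> A_dom P \<Xi> \<gamma>" using u RR by (simp add: A_dom_def xe)
  have G: "G_op \<Xi> x = E_op \<Xi> u + reson P R (fst \<Xi>)" by (simp add: G_op_def xe)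
  have "scal (of_real K) u + one_minus_lap u = (scal (of_real K) (J_op K g) + one_minus_lap (J_op K g))
      + (scal (of_real K) (J_op K (one_minus_lap t)) + one_minus_lap (J_op K (one_minus_lap t)))"
    unfolding eq(1) scal_add one_minus_lap_add by (simp only: add_ac)
  also have "\<dots> = g + one_minus_lap t" unfolding J(2) ..
  finally have "scal (of_real K) u + one_minus_lap R = g"
    unfolding Rt one_minus_lap_diff add_diff_eq by simp
  then show "scal (of_real K) (fst x) - A_op P C \<Xi> (fst x) = f"
    unfolding xe fst_conv A_op_eq[OF u n] RR g_def G[unfolded xe] by (simp add: algebra_simps)
qed

text \<open>The converse: every domain element is a fixed point for its own right-hand side, so the
  stability estimate applies to it.\<close>

lemma A_dom_Sol:
  assumes u: "u \<in> A_dom P \<Xi> \<gamma>" and b: "op_bounded M \<Xi>" and K: "K \<ge> 1"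
  shows "A_op P C \<Xi> u \<in> sobolev 0" "(u, R_op P \<Xi> u) \<in> pair_space"
    "Sol \<Xi> K (scal (of_real K) u - A_op P C \<Xi> u) (u, R_op P \<Xi> u) = (u, R_op P \<Xi> u)"
proof -
  have n: "noise \<Xi>" by (rule op_boundedD(2)[OF b])
  let ?R = "R_op P \<Xi> u"
  have us: "u \<in> sobolev \<gamma>" and R2: "?R \<in> sobolev 2" using u by (auto simp: A_dom_def)
  show x: "(u, ?R) \<in> pair_space" using us sobolev_mono(1)[OF R2, of "1 + 3 * \<kappa>"] kappa_bounds(1,2) by (simp add: pair_space_def)
  have A: "A_op P C \<Xi> u = G_op \<Xi> (u, ?R) - one_minus_lap ?R" using A_op_eq[OF us n] by (simp add: G_op_def)
  show "A_op P C \<Xi> u \<in> sobolev 0" unfolding A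
    using op_boundedD(3)[OF b x] one_minus_lap_sobolev(1)[of ?R 0] R2 by (intro sobolev_diff(1)) simp_all
  note J = J_op_resolvent[OF K]
  have T: "T_op \<Xi> u = u - ?R" by (simp add: R_op_eq)
  have g: "scal (of_real K) u - A_op P C \<Xi> u + G_op \<Xi> (u, ?R) = scal (of_real K) u + one_minus_lap ?R"
    unfolding A by simp
  have "J_op K (scal (of_real K) u + one_minus_lap ?R) + J_op K (one_minus_lap (u - ?R)) = J_op K (scal (of_real K) u + one_minus_lap u)"
    unfolding J_op_simps one_minus_lap_diff by simp
  moreover have "J_op K (scal (of_real K) u + one_minus_lap ?R) - scal (of_real K) (J_op K (u - ?R)) = J_op K (scal (of_real K) ?R + one_minus_lap ?R)"
    unfolding J_op_simps scal_add by (simp add: algebra_simps)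
  ultimately show "Sol \<Xi> K (scal (of_real K) u - A_op P C \<Xi> u) (u, ?R) = (u, ?R)"
    unfolding Sol_def g J_pair_def fst_conv T J(3) by simp
qed

end

section \<open>Products with trigonometric polynomials\<close>

text \<open>Multiplication by the weight is an isometry onto H^0 that commutes with frequency
  cut-offs.\<close>

lemma sobolev_tail:
  assumes f: "f \<in> sobolev s" and e: "e > 0"
  shows "\<exists>K. finite K \<and> (\<forall>L. finite L \<and> K \<subseteq> L \<longrightarrow> sobolev_norm s (f - restrict_freq L f) \<le> e)"
proof -
  define g :: pdist where "g = (\<lambda>k. of_real (bessel k powr (s/2)) * f k)"
  have eq: "bessel k powr 0 * (cmod (of_real (bessel k powr (s/2)) * h k))\<^sup>2 = bessel k powr s * (cmod (h k))\<^sup>2" for h :: pdist and k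
  proof -
    have "(bessel k powr (s/2))\<^sup>2 = bessel k powr s" by (simp add: power2_eq_square flip: powr_add)
    then show ?thesis by (simp add: norm_mult power_mult_distrib)
  qed
  have norm: "sobolev_norm 0 (\<lambda>k. of_real (bessel k powr (s/2)) * h k) = sobolev_norm s h" for h
    unfolding sobolev_norm_def eq ..
  have g: "g \<in> sobolev 0" using f unfolding g_def sobolev_def mem_Collect_eq eq .
  obtain K where K: "finite K" "\<And>L. finite L \<Longrightarrow> K \<subseteq> L \<Longrightarrow> (sobolev_norm 0 (g - restrict_freq L g))\<^sup>2 \<le> e\<^sup>2"
    using sobolev_0_tail[OF g, of "e\<^sup>2"] e by auto
  have "sobolev_norm s (f - restrict_freq L f) \<le> e" if L: "finite L" "K \<subseteq> L" for L
  proof -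
    have "g - restrict_freq L g = (\<lambda>k. of_real (bessel k powr (s/2)) * (f - restrict_freq L f) k)"
      by (simp add: fun_eq_iff g_def restrict_freq_def)
    then have "(sobolev_norm s (f - restrict_freq L f))\<^sup>2 \<le> e\<^sup>2" using K(2)[OF L] norm[of "f - restrict_freq L f"] by simp
    then show ?thesis using e by (simp add: power2_le_iff_abs_le)
  qed
  then show ?thesis using K(1) by blast
qed

context littlewood_paley
begin

lemma finite_blocks: "finite {j. -1 \<le> j \<and> lp_sym j x \<noteq> 0}"
proof -
  obtain r R where R: "r > 0" "R > 0" "\<And>j x. -1 \<le> j \<Longrightarrow> lp_sym j x \<noteq> 0 \<Longrightarrow> norm x \<le> R * 2 powr j"
    "\<And>j x. 0 \<le> j \<Longrightarrow> lp_sym j x \<noteq> 0 \<Longrightarrow> r * 2 powr j \<le> norm x"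
    by (rule lp_sym_support, rule that)
  obtain N where N: "norm x / r < 2 ^ N" using real_arch_pow[of 2] by auto
  have "j \<in> {-1..int N}" if j: "-1 \<le> j" "lp_sym j x \<noteq> 0" for j
  proof (rule ccontr)
    assume "j \<notin> {-1..int N}"
    then have "int N \<le> j" "0 \<le> j" using j by auto
    then have "2 ^ N \<le> 2 powr real_of_int j" by (simp flip: powr_realpow)
    then have "norm x / r < 2 powr real_of_int j" using N by linarith
    then have "norm x < r * 2 powr real_of_int j" using R(1) by (simp add: pos_divide_less_eq mult.commute)
    then show False using R(4)[OF \<open>0 \<le> j\<close> j(2)] by simp
  qed
  then have "{j. -1 \<le> j \<and> lp_sym j x \<noteq> 0} \<subseteq> {-1..int N}" by blast
  then show ?thesis by (rule finite_subset) simp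
qed

lemma sum_blocks:
  assumes J: "finite J" "J \<subseteq> {-1..}" "\<And>j. -1 \<le> j \<Longrightarrow> lp_sym j x \<noteq> 0 \<Longrightarrow> j \<in> J"
  shows "(\<Sum>j\<in>J. lp_sym j x) = 1"
proof -
  define N where "N = nat (Max (insert 0 J) + 1)"
  have N: "j < int N" if "j \<in> J" for j using Max_ge[of "insert 0 J" j] J(1) that by (auto simp: N_def)
  have "(\<Sum>j\<in>J. lp_sym j x) = (\<Sum>j\<in>{-1..<int N}. lp_sym j x)"
    by (rule sum.mono_neutral_left) (use J N in force)+
  also have "{-1..<int N} = insert (-1) (int ` {..<N})" by (force simp: image_iff elim: int_ge_minus_one_cases)
  also have "(\<Sum>j\<in>insert (-1) (int ` {..<N}). lp_sym j x) = lp_sym (-1) x + (\<Sum>n<N. lp_sym (int n) x)"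
    by (subst sum.insert) (auto simp: sum.reindex)
  also have "(\<Sum>n<N. lp_sym (int n) x) = 1 - fst P x"
  proof -
    have "lp_sym (int n) x = 0" if "n \<notin> {..<N}" for n using J(3)[of "int n"] N[of "int n"] that by force
    then show ?thesis using sums_unique2[OF sums_finite lp_sym_sums, of "{..<N}"] by blast
  qed
  finally show ?thesis by (simp add: lp_sym_def)
qed

lemma finite_blocks_trig:
  assumes "trig_poly g"
  shows "finite {j. -1 \<le> j \<and> block P j g \<noteq> 0}"
proof (rule finite_subset)
  show "{j. -1 \<le> j \<and> block P j g \<noteq> 0} \<subseteq> (\<Union>k\<in>{k. g k \<noteq> 0}. {j. -1 \<le> j \<and> lp_sym j (freq k) \<noteq> 0})"
    by (auto simp: fun_eq_iff block_apply)
  show "finite (\<Union>k\<in>{k. g k \<noteq> 0}. {j. -1 \<le> j \<and> lp_sym j (freq k) \<noteq> 0})"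
    using assms by (auto simp: trig_poly_def finite_blocks)
qed

text \<open>It is enough that the right factor is finite: only finitely many \<open>j\<close> occur,
  and each low part of \<open>f\<close> is finite as well, however rough \<open>f\<close> may
  be.\<close>

lemma trig_poly_para:
  assumes "trig_poly g"
  shows "trig_poly (para P f g)"
proof -
  let ?J = "{j. -1 \<le> j \<and> block P j g \<noteq> 0}"
  have "para P f g = (\<Sum>j\<in>?J. para_term j f g)"
  proof
    fix k
    have "(\<Sum>\<^sub>\<infinity>j\<in>{-1..}. para_term j f g k) = (\<Sum>\<^sub>\<infinity>j\<in>?J. para_term j f g k)"
      by (rule infsum_cong_neutral) (auto simp: para_term_def)
    then show "para P f g k = (\<Sum>j\<in>?J. para_term j f g) k"
      by (simp add: para_eq sum_pdist_apply finite_blocks_trig[OF assms])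
  qed
  then show ?thesis by (auto intro!: trig_poly_sum trig_poly_para_term)
qed

lemma trig_poly_reson:
  assumes "trig_poly g"
  shows "trig_poly (reson P f g)"
proof -
  let ?J = "{j. -1 \<le> j \<and> block P j g \<noteq> 0}"
  let ?A = "{p \<in> res_pairs. snd p \<in> ?J}"
  have "?A \<subseteq> (\<Union>j\<in>?J. {j - 1..j + 1} \<times> {j})" by (auto simp: res_pairs_def)
  then have fin: "finite ?A" by (rule finite_subset) (use finite_blocks_trig[OF assms] in auto)
  have "reson P f g = (\<Sum>p\<in>?A. res_term p f g)"
  proof
    fix k
    have "(\<Sum>\<^sub>\<infinity>p\<in>res_pairs. res_term p f g k) = (\<Sum>\<^sub>\<infinity>p\<in>?A. res_term p f g k)"
      by (rule infsum_cong_neutral) (auto simp: res_term_def res_pairs_def)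
    then show "reson P f g k = (\<Sum>p\<in>?A. res_term p f g) k"
      using fin by (simp add: reson_eq sum_pdist_apply)
  qed
  moreover have "trig_poly (res_term p f g)" if "p \<in> ?A" for p
    using that res_pairs_ge[of p] by (auto simp: res_term_def intro!: trig_poly_pw_mult trig_poly_block)
  ultimately show ?thesis by (auto intro!: trig_poly_sum)
qed

text \<open>Locality: if \<open>g\<close> is finitely supported, the coefficient \<open>k\<close> of
  a product sees only finitely many coefficients of \<open>f\<close>. With its versions for
  \<open>para\<close> and \<open>reson\<close> this permits the exact replacement of a rough
  \<open>f\<close> by a truncation.\<close>

lemma pw_mult_cong:
  assumes "\<And>l. g (k - l) \<noteq> 0 \<Longrightarrow> f l = f' l"
  shows "pw_mult f g k = pw_mult f' g k"
  unfolding pw_mult_def by (rule infsum_cong) (use assms in force)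

lemma pw_mult_block_cong:
  assumes "\<And>l. g (k - l) \<noteq> 0 \<Longrightarrow> f l = f' l"
  shows "pw_mult (block P i f) (block P j g) k = pw_mult (block P i f') (block P j g) k"
  by (rule pw_mult_cong) (use assms in \<open>auto simp: block_apply\<close>)

lemma para_cong:
  assumes "\<And>l. g (k - l) \<noteq> 0 \<Longrightarrow> f l = f' l"
  shows "para P f g k = para P f' g k"
  unfolding para_def by (intro infsum_cong sum.cong refl pw_mult_block_cong assms)

lemma reson_cong:
  assumes "\<And>l. g (k - l) \<noteq> 0 \<Longrightarrow> f l = f' l"
  shows "reson P f g k = reson P f' g k"
  unfolding reson_eq res_term_def by (intro infsum_cong pw_mult_block_cong assms)

text \<open>Brings a sum over i \<le> j - 2 to a finite rectangle of indices, which the two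
  paraproducts and the resonant product can share.\<close>

lemma infsum_lower_triangle:
  fixes t :: "int \<Rightarrow> int \<Rightarrow> complex"
  assumes fin: "finite A" "finite B" "A \<subseteq> {-1..}" "B \<subseteq> {-1..}" and t: "\<And>i j. -1 \<le> i \<Longrightarrow> -1 \<le> j \<Longrightarrow> t i j \<noteq> 0 \<Longrightarrow> i \<in> A \<and> j \<in> B"
  shows "(\<Sum>\<^sub>\<infinity>j\<in>{-1..}. \<Sum>i\<in>{-1..j - 2}. t i j) = (\<Sum>i\<in>A. \<Sum>j\<in>B. if i \<le> j - 2 then t i j else 0)"
proof -
  have "(\<Sum>\<^sub>\<infinity>j\<in>{-1..}. \<Sum>i\<in>{-1..j - 2}. t i j) = (\<Sum>\<^sub>\<infinity>j\<in>B. \<Sum>i\<in>A. if i \<le> j - 2 then t i j else 0)"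
  proof (rule infsum_cong_neutral)
    show "(\<Sum>i\<in>A. if i \<le> j - 2 then t i j else 0) = 0" if "j \<in> B - {-1..}" for j using that fin by auto
    show "(\<Sum>i\<in>{-1..j - 2}. t i j) = 0" if "j \<in> {-1..} - B" for j
      by (intro sum.neutral ballI, rule ccontr) (use that t[of _ j] in fastforce)
    show "(\<Sum>i\<in>{-1..j - 2}. t i j) = (\<Sum>i\<in>A. if i \<le> j - 2 then t i j else 0)" if "j \<in> {-1..} \<inter> B" for j
    proof -
      have "(\<Sum>i\<in>{-1..j - 2}. t i j) = (\<Sum>i\<in>{i \<in> A. i \<le> j - 2}. t i j)"
        by (rule sum.mono_neutral_right) (use that t fin in force)+
      then show ?thesis using fin by (simp add: sum.inter_filter)
    qed
  qed
  also have "\<dots> = (\<Sum>j\<in>B. \<Sum>i\<in>A. if i \<le> j - 2 then t i j else 0)" using fin by simp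
  finally show ?thesis by (simp add: sum.swap[of _ A B])
qed

text \<open>The conditions i \<le> j - 2, |i - j| \<le> 1 and j \<le> i - 2 split all index pairs;
  then the partition of unity sums to one in each factor. At a fixed \<open>k\<close> the
  coefficients of \<open>f\<close> enter only at the finitely many frequencies in \<open>F\<close>,
  so \<open>f\<close> may be arbitrary.\<close>

lemma dist_mult_trig:
  assumes g: "trig_poly g"
  shows "dist_mult P f g = pw_mult f g"
proof
  fix k
  define F where "F = (\<lambda>n. k - n) ` {n. g n \<noteq> 0}"
  have finF: "finite F" using g by (simp add: F_def trig_poly_def)
  have memF: "l \<in> F" if "g (k - l) \<noteq> 0" for l
    unfolding F_def by (rule image_eqI[of _ _ "k - l"]) (use that in auto)
  define J where "J = {j. -1 \<le> j \<and> block P j g \<noteq> 0}"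
  define I where "I = (\<Union>l\<in>F. {i. -1 \<le> i \<and> lp_sym i (freq l) \<noteq> 0})"
  have fin: "finite I" "finite J" "I \<subseteq> {-1..}" "J \<subseteq> {-1..}"
    using finF g by (auto simp: I_def J_def finite_blocks finite_blocks_trig)
  have mult: "pw_mult f h k = (\<Sum>l\<in>F. f l * h (k - l))" if "\<And>n. h n \<noteq> 0 \<Longrightarrow> g n \<noteq> 0" for f h :: pdist
  proof -
    have "(\<Sum>\<^sub>\<infinity>l. f l * h (k - l)) = (\<Sum>\<^sub>\<infinity>l\<in>F. f l * h (k - l))"
    proof (rule infsum_cong_neutral)
      show "f l * h (k - l) = 0" if "l \<in> UNIV - F" for l
        using memF[of l] that \<open>\<And>n. h n \<noteq> 0 \<Longrightarrow> g n \<noteq> 0\<close>[of "k - l"] by auto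
    qed auto
    then show ?thesis using finF by (simp add: pw_mult_def)
  qed
  define t where "t i j = pw_mult (block P i f) (block P j g) k" for i j
  have t_eq: "t i j = (\<Sum>l\<in>F. of_real (lp_sym i (freq l)) * f l * (of_real (lp_sym j (freq (k - l))) * g (k - l)))" for i j
    unfolding t_def by (subst mult) (auto simp: block_apply)
  have t0: "i \<in> I \<and> j \<in> J" if "-1 \<le> i" "-1 \<le> j" "t i j \<noteq> 0" for i j
  proof
    show "i \<in> I" by (rule ccontr) (use that t_eq in \<open>auto simp: I_def\<close>)
    show "j \<in> J" by (rule ccontr) (use that t_def in \<open>auto simp: J_def\<close>)
  qed
  have 1: "para P f g k = (\<Sum>i\<in>I. \<Sum>j\<in>J. if i \<le> j - 2 then t i j else 0)"
    unfolding para_def t_def[symmetric] by (rule infsum_lower_triangle[OF fin t0])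
  have "para P g f k = (\<Sum>\<^sub>\<infinity>j\<in>{-1..}. \<Sum>i\<in>{-1..j - 2}. t j i)"
    unfolding para_def t_def by (subst pw_mult_commute) simp
  also have "\<dots> = (\<Sum>i\<in>J. \<Sum>j\<in>I. if i \<le> j - 2 then t j i else 0)"
    by (rule infsum_lower_triangle[OF fin(2,1,4,3)]) (use t0 in blast)
  finally have 2: "para P g f k = (\<Sum>i\<in>I. \<Sum>j\<in>J. if j \<le> i - 2 then t i j else 0)" by (simp add: sum.swap[of _ I J])
  have "reson P f g k = (\<Sum>\<^sub>\<infinity>p\<in>I \<times> J. if \<bar>fst p - snd p\<bar> \<le> 1 then t (fst p) (snd p) else 0)"
    unfolding reson_eq res_term_def t_def[symmetric]
    by (rule infsum_cong_neutral) (use t0 fin in \<open>auto simp: res_pairs_def\<close>)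
  then have 3: "reson P f g k = (\<Sum>i\<in>I. \<Sum>j\<in>J. if \<bar>i - j\<bar> \<le> 1 then t i j else 0)"
    using fin by (simp add: sum.cartesian_product case_prod_unfold)
  have split: "(if i \<le> j - 2 then t i j else 0) + (if \<bar>i - j\<bar> \<le> 1 then t i j else 0) + (if j \<le> i - 2 then t i j else 0) = t i j" for i j
    by auto
  have "dist_mult P f g k = (\<Sum>i\<in>I. \<Sum>j\<in>J. t i j)"
    unfolding dist_mult_def plus_fun_apply 1 2 3 sum.distrib[symmetric] split ..
  also have "\<dots> = (\<Sum>l\<in>F. \<Sum>i\<in>I. \<Sum>j\<in>J. of_real (lp_sym i (freq l)) * f l * (of_real (lp_sym j (freq (k - l))) * g (k - l)))"
    unfolding t_eq sum.swap[of _ F J] sum.swap[of _ F I] ..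
  also have "\<dots> = (\<Sum>l\<in>F. f l * g (k - l))"
  proof (rule sum.cong[OF refl])
    fix l assume l: "l \<in> F"
    have "(\<Sum>i\<in>I. lp_sym i (freq l)) = 1" by (rule sum_blocks) (use l fin in \<open>auto simp: I_def\<close>)
    moreover have "(\<Sum>j\<in>J. lp_sym j (freq (k - l))) = 1" if "g (k - l) \<noteq> 0"
      by (rule sum_blocks) (use that fin in \<open>auto simp: J_def fun_eq_iff block_apply\<close>)
    moreover have "(\<Sum>i\<in>I. \<Sum>j\<in>J. of_real (lp_sym i (freq l)) * f l * (of_real (lp_sym j (freq (k - l))) * g (k - l)))
        = of_real (\<Sum>i\<in>I. lp_sym i (freq l)) * f l * (of_real (\<Sum>j\<in>J. lp_sym j (freq (k - l))) * g (k - l))"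
      by (simp add: sum_distrib_left sum_distrib_right mult_ac sum.swap[of _ I J])
    ultimately show "(\<Sum>i\<in>I. \<Sum>j\<in>J. of_real (lp_sym i (freq l)) * f l * (of_real (lp_sym j (freq (k - l))) * g (k - l))) = f l * g (k - l)"
      by (cases "g (k - l) = 0") simp_all
  qed
  also have "\<dots> = pw_mult f g k" by (rule mult[symmetric])
  finally show "dist_mult P f g k = pw_mult f g k" .
qed

end

context anderson
begin

text \<open>The operator \<open>C\<close> is prescribed on smooth arguments only. Its value at
  \<open>u\<close> is approximated by truncations of \<open>u\<close> in the norm of order \<gamma>,
  while the coefficient \<open>k\<close> of the right side does not change at all once the
  truncation contains the finite set \<open>F\<close>.\<close>

lemma C_trig:
  assumes u: "u \<in> sobolev \<gamma>" and X: "trig_poly X" and h: "trig_poly h"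
  shows "C u X h = reson P (para P u X) h - pw_mult u (reson P X h)"
proof
  fix k
  let ?R = "\<lambda>u. reson P (para P u X) h - pw_mult u (reson P X h)"
  obtain B where B: "B \<ge> 0" "\<And>f. f \<in> sobolev \<gamma> \<Longrightarrow> C f X h \<in> sobolev 0 \<and>
      sobolev_norm 0 (C f X h) \<le> B * sobolev_norm \<gamma> f * besov_norm P (1 - \<kappa>) X * besov_norm P (-1 - \<kappa>) h"
    using C_bound trig_poly_besov[OF X] trig_poly_besov[OF h] by meson
  define M where "M = B * besov_norm P (1 - \<kappa>) X * besov_norm P (-1 - \<kappa>) h"
  have M: "0 \<le> M" using B(1) besov_norm_nonneg trig_poly_besov[OF X] trig_poly_besov[OF h] by (simp add: M_def)
  have tr: "trig_poly (reson P X h)" by (rule trig_poly_reson[OF h])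
  \<comment> \<open>All frequencies of \<open>u\<close> that can reach \<open>k\<close>: through
    \<open>X\<close> and then \<open>h\<close> in the first term, or through the product with
    \<open>reson P X h\<close>.\<close>
  define F where "F = (\<lambda>(n, m). k - n - m) ` ({n. h n \<noteq> 0} \<times> {n. X n \<noteq> 0}) \<union> (\<lambda>n. k - n) ` {n. reson P X h n \<noteq> 0}"
  have finF: "finite F" using X h tr by (simp add: F_def trig_poly_def)
  have F: "l \<in> F" if "h n \<noteq> 0 \<and> X (k - n - l) \<noteq> 0 \<or> reson P X h (k - l) \<noteq> 0" for n l
  proof -
    have "l = (case (n, k - n - l) of (n, m) \<Rightarrow> k - n - m)" "l = k - (k - l)" by auto
    then show ?thesis using that unfolding F_def by blast
  qed
  have loc: "?R u k = ?R v k" if "\<And>l. l \<in> F \<Longrightarrow> u l = v l" for v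
  proof -
    have "reson P (para P u X) h k = reson P (para P v X) h k"
    proof (intro reson_cong para_cong)
      fix n l assume "h (k - n) \<noteq> 0" "X (n - l) \<noteq> 0"
      then show "u l = v l" using F[of "k - n" l] that by (simp add: algebra_simps)
    qed
    moreover have "pw_mult u (reson P X h) k = pw_mult v (reson P X h) k"
      by (rule pw_mult_cong) (use F that in blast)
    ultimately show ?thesis by simp
  qed
  have "cmod (C u X h k - ?R u k) \<le> e * M" if e: "e > 0" for e
  proof -
    obtain K where K: "finite K" "\<And>L. finite L \<Longrightarrow> K \<subseteq> L \<Longrightarrow> sobolev_norm \<gamma> (u - restrict_freq L u) \<le> e"
      using sobolev_tail[OF u e] by blast
    define v where "v = restrict_freq (K \<union> F) u"
    have v: "trig_poly v" unfolding v_def by (intro trig_poly_restrict finite_UnI K finF)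
    have uv: "sobolev_norm \<gamma> (u - v) \<le> e" unfolding v_def by (rule K(2)) (use K(1) finF in auto)
    have vs: "v \<in> sobolev \<gamma>" by (rule trig_sobolev(1)[OF v])
    have "C v X h = ?R v"
      using conjunct1[OF comm[unfolded is_commutator_operator_def]] smooth_pdist_trig[OF v] smooth_pdist_trig[OF X] smooth_pdist_trig[OF h] by blast
    moreover have "?R u k = ?R v k" by (rule loc) (simp add: v_def restrict_freq_def)
    ultimately have "C u X h k - ?R u k = (C u X h - C v X h) k" by simp
    also have "C u X h - C v X h = C (u - v) X h"
      using C_lin1[OF u vs trig_poly_besov[OF X] trig_poly_besov[OF h], of 1 "-1"] by (simp only: diff_eq_scal[symmetric])
    finally have eq: "C u X h k - ?R u k = C (u - v) X h k" .
    have d: "u - v \<in> sobolev \<gamma>" by (rule sobolev_diff(1)[OF u vs])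
    have "cmod (C (u - v) X h k) \<le> sobolev_norm 0 (C (u - v) X h)"
      using sobolev_coeff_le[of "C (u - v) X h" 0 k] B(2)[OF d] by simp
    also have "\<dots> \<le> sobolev_norm \<gamma> (u - v) * M" using B(2)[OF d] by (simp add: M_def mult_ac)
    also have "\<dots> \<le> e * M" by (rule mult_right_mono[OF uv M])
    finally show ?thesis unfolding eq .
  qed
  then have "cmod (C u X h k - ?R u k) \<le> 0 + \<delta>" if "\<delta> > 0" for \<delta>
  proof -
    have "cmod (C u X h k - ?R u k) \<le> (\<delta> / (M + 1)) * M" using that M by (intro \<open>\<And>e. e > 0 \<Longrightarrow> _\<close>) auto
    also have "\<dots> \<le> \<delta>" using that M by (simp add: field_simps)
    finally show ?thesis by simp
  qed
  then have "cmod (C u X h k - ?R u k) \<le> 0" by (rule field_le_epsilon)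
  then show "C u X h k = ?R u k" by simp
qed

end

section \<open>Trigonometric noise\<close>

text \<open>Multiplication by the character \<open>echar l\<close>, seen on coefficients.\<close>

definition shift_freq :: "int \<times> int \<Rightarrow> pdist \<Rightarrow> pdist" where
  "shift_freq l f = (\<lambda>k. f (k - l))"

lemma bij_shift: "bij_betw (\<lambda>k. k - l) UNIV (UNIV :: (int \<times> int) set)"
  by (rule bij_betwI[where g = "\<lambda>k. k + l"]) auto

lemma shift_freq_sobolev: "f \<in> sobolev 0 \<Longrightarrow> shift_freq l f \<in> sobolev 0"
  using summable_on_reindex_bij_betw[OF bij_shift, of "\<lambda>k. (cmod (f k))\<^sup>2" l]
  by (simp add: sobolev_0_summable shift_freq_def)

lemma l2_inner_shift: "l2_inner (shift_freq l f) g = l2_inner f (shift_freq (- l) g)"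
  using infsum_reindex_bij_betw[OF bij_shift, of "\<lambda>k. f k * cnj (g (k + l))" l]
  by (simp add: l2_inner_def shift_freq_def)

lemma sobolev_sum: "(\<And>i. i \<in> I \<Longrightarrow> f i \<in> sobolev s) \<Longrightarrow> (\<Sum>i\<in>I. f i) \<in> sobolev s"
  by (induction I rule: infinite_finite_induct) (auto intro: sobolev_add(1) trig_sobolev(1))

lemma l2_inner_sum_left:
  assumes "g \<in> sobolev 0" "\<And>i. i \<in> I \<Longrightarrow> f i \<in> sobolev 0"
  shows "l2_inner (\<Sum>i\<in>I. f i) g = (\<Sum>i\<in>I. l2_inner (f i) g)"
  using assms(2)
proof (induction I rule: infinite_finite_induct)
  case (insert i I)
  then have "l2_inner (f i + sum f I) g = l2_inner (f i) g + l2_inner (sum f I) g"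
    by (intro l2_inner_add_left sobolev_sum assms(1)) auto
  moreover have "l2_inner (sum f I) g = (\<Sum>i\<in>I. l2_inner (f i) g)" by (rule insert(3)) (use insert in auto)
  ultimately show ?case by (simp only: sum.insert[OF insert(1,2)])
qed (simp_all add: l2_inner_def)

lemma pw_mult_eq_sum_shift:
  assumes "finite S" "{k. a k \<noteq> 0} \<subseteq> S"
  shows "pw_mult a f = (\<Sum>l\<in>S. scal (a l) (shift_freq l f))"
  by (rule ext) (simp add: pw_mult_finite[OF assms] sum_pdist_apply scal_def shift_freq_def)

text \<open>The shifts by \<open>l\<close> and \<open>- l\<close> are adjoint to each other, and
  \<open>a (- k) = cnj (a k)\<close> says that \<open>a\<close> is a real function.\<close>

lemma pw_mult_symmetric:
  assumes a: "trig_poly a" "\<And>k. a (- k) = cnj (a k)" and f: "f \<in> sobolev 0" and g: "g \<in> sobolev 0"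
  shows "pw_mult a f \<in> sobolev 0" "l2_inner (pw_mult a f) g = l2_inner f (pw_mult a g)"
proof -
  let ?S = "{k. a k \<noteq> 0}"
  have S: "finite ?S" "?S \<subseteq> ?S" using a(1) by (auto simp: trig_poly_def)
  note pw = pw_mult_eq_sum_shift[OF S]
  have m: "scal (a l) (shift_freq l h) \<in> sobolev 0" if "h \<in> sobolev 0" for l h
    using that by (intro sobolev_scal(1) shift_freq_sobolev)
  show "pw_mult a f \<in> sobolev 0" unfolding pw by (intro sobolev_sum m f)
  have e: "l2_inner (pw_mult a h) h' = (\<Sum>l\<in>?S. a l * l2_inner (shift_freq l h) h')" if "h \<in> sobolev 0" "h' \<in> sobolev 0" for h h'
    unfolding pw using that by (subst l2_inner_sum_left) (auto simp: m l2_inner_scal_left)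
  have "l2_inner f (pw_mult a g) = cnj (l2_inner (pw_mult a g) f)" by (simp add: l2_inner_cnj)
  also have "\<dots> = (\<Sum>l\<in>?S. a (- l) * l2_inner (shift_freq (- l) f) g)"
    unfolding e[OF g f] by (simp add: a(2) l2_inner_shift[of _ g f] l2_inner_cnj)
  also have "\<dots> = (\<Sum>l\<in>?S. a l * l2_inner (shift_freq l f) g)"
    by (rule sum.reindex_bij_witness[of _ uminus uminus]) (use a(2) in auto)
  also have "\<dots> = l2_inner (pw_mult a f) g" by (rule e[OF f g, symmetric])
  finally show "l2_inner (pw_mult a f) g = l2_inner f (pw_mult a g)" ..
qed

definition smooth_op :: "pdist \<Rightarrow> real \<Rightarrow> pdist \<Rightarrow> pdist" where
  "smooth_op a c u = laplacian u + pw_mult a u - scal (of_real c) u"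

lemma smooth_op_symmetric:
  assumes a: "trig_poly a" "\<And>k. a (- k) = cnj (a k)" and u: "u \<in> sobolev 2" and v: "v \<in> sobolev 2"
  shows "smooth_op a c u \<in> sobolev 0" "l2_inner (smooth_op a c u) v = l2_inner u (smooth_op a c v)"
proof -
  have uv: "u \<in> sobolev 0" "v \<in> sobolev 0" using sobolev_mono(1)[OF u, of 0] sobolev_mono(1)[OF v, of 0] by auto
  have l: "laplacian u \<in> sobolev 0" "laplacian v \<in> sobolev 0" using laplacian_sobolev(1)[OF u] laplacian_sobolev(1)[OF v] by auto
  note p = pw_mult_symmetric(1)[OF a uv(1) uv(1)] pw_mult_symmetric(1)[OF a uv(2) uv(2)]
  note s = sobolev_scal(1)[OF uv(1), of "of_real c"] sobolev_scal(1)[OF uv(2), of "of_real c"]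
  show "smooth_op a c u \<in> sobolev 0" unfolding smooth_op_def by (intro sobolev_diff(1) sobolev_add(1) l p s)
  have lap: "l2_inner (laplacian u) v = l2_inner u (laplacian v)" by (simp add: l2_inner_def laplacian_def mult_ac)
  have add: "l2_inner f (g + h) = l2_inner f g + l2_inner f h" if "f \<in> sobolev 0" "g \<in> sobolev 0" "h \<in> sobolev 0" for f g h
    using l2_inner_add_left[OF that(2,3,1)] by (metis complex_cnj_add l2_inner_cnj)
  have "l2_inner (smooth_op a c u) v = l2_inner (laplacian u) v + l2_inner (pw_mult a u) v - of_real c * l2_inner u v"
    unfolding smooth_op_def using l p s uv by (simp add: l2_inner_diff_left l2_inner_add_left l2_inner_scal_left sobolev_add(1))
  moreover have "l2_inner u (smooth_op a c v) = l2_inner u (laplacian v) + l2_inner u (pw_mult a v) - of_real c * l2_inner u v"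
    unfolding smooth_op_def using l p s uv by (simp add: l2_inner_diff_right add l2_inner_scal_right sobolev_add(1))
  ultimately show "l2_inner (smooth_op a c u) v = l2_inner u (smooth_op a c v)"
    by (simp add: lap pw_mult_symmetric(2)[OF a uv])
qed

lemma smooth_op_lin:
  assumes "trig_poly a"
  shows "smooth_op a c (u + v) = smooth_op a c u + smooth_op a c v" "smooth_op a c (scal z u) = scal z (smooth_op a c u)"
  unfolding smooth_op_def pw_mult_add_right[OF assms] pw_mult_scal_right[OF assms]
  by (simp_all add: fun_eq_iff laplacian_def scal_def algebra_simps)

context anderson
begin

text \<open>The properties of a mollified noise that matter: finiteness, reality, and a second
  component tied to the first by renormalization with \<open>c\<close>. For such noises the
  paracontrolled operator acts as an ordinary Schroedinger operator.\<close>

definition trig_noise :: "real \<Rightarrow> pdist \<times> pdist \<Rightarrow> bool" where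
  "trig_noise c \<Xi> \<longleftrightarrow> trig_poly (fst \<Xi>) \<and> (\<forall>k. fst \<Xi> (- k) = cnj (fst \<Xi> k)) \<and>
    snd \<Xi> = reson P (fst \<Xi>) (X_of \<Xi>) - const_dist (of_real c)"

lemma trig_noiseD:
  assumes "trig_noise c \<Xi>"
  shows "trig_poly (fst \<Xi>)" "trig_poly (X_of \<Xi>)" "trig_poly (snd \<Xi>)" "noise \<Xi>"
proof -
  show 1: "trig_poly (fst \<Xi>)" using assms by (simp add: trig_noise_def)
  show 2: "trig_poly (X_of \<Xi>)"
    using trig_poly_mult'[OF 1, of "\<lambda>k. 1 / of_real (bessel k)"] by (simp add: X_of_def inv_one_minus_lap_def)
  show 3: "trig_poly (snd \<Xi>)"
    using assms trig_poly_diff[OF trig_poly_reson[OF 2] trig_poly_const_dist] by (simp add: trig_noise_def)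
  show "noise \<Xi>" using 1 3 by (simp add: noise_def trig_poly_besov)
qed

lemma B_op_trig:
  assumes n: "trig_noise c \<Xi>" and u: "u \<in> sobolev \<gamma>"
  shows "B_op P \<Xi> u \<in> sobolev 2"
proof -
  note t = trig_noiseD[OF n]
  have "trig_poly (partial1 (X_of \<Xi>))" "trig_poly (partial2 (X_of \<Xi>))"
    unfolding partial1_eq partial2_eq by (intro trig_poly_mult t)+
  with t have p: "para P (laplacian u) (X_of \<Xi>) \<in> sobolev 0" "para P (partial1 u) (partial1 (X_of \<Xi>)) \<in> sobolev 0"
    "para P (partial2 u) (partial2 (X_of \<Xi>)) \<in> sobolev 0" "para P u (snd \<Xi>) \<in> sobolev 0"
    by (auto intro!: trig_sobolev(1) trig_poly_para)
  have "para P (fst \<Xi>) u \<in> sobolev 0"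
    \<comment> \<open>The one paraproduct whose right factor is not finite. A trigonometric
      polynomial lies in every Besov space, and the negative exponent -\<gamma>/2 leaves 0 <
      -\<gamma>/2 + \<gamma>.\<close>
    using para_bound_besov_sobolev[of 0 "-\<gamma>/2" \<gamma>] gamma u trig_poly_besov[OF t(1)] by fastforce
  then have "B_src \<Xi> u \<in> sobolev 0" unfolding B_src_def by (intro sobolev_add(1) sobolev_scal(1) p)
  from inv_one_minus_lap_sobolev(1)[OF this] show ?thesis by (simp add: B_op_eq)
qed

lemma A_dom_trig:
  assumes n: "trig_noise c \<Xi>" and u: "u \<in> A_dom P \<Xi> \<gamma>"
  shows "u \<in> sobolev 2"
proof -
  have "u = para P u (X_of \<Xi>) + B_op P \<Xi> u + R_op P \<Xi> u" by (simp add: R_op_def)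
  moreover have "para P u (X_of \<Xi>) \<in> sobolev 2" by (rule trig_sobolev(1)[OF trig_poly_para[OF trig_noiseD(2)[OF n]]])
  moreover have "B_op P \<Xi> u \<in> sobolev 2" using u by (intro B_op_trig[OF n]) (simp add: A_dom_def)
  moreover have "R_op P \<Xi> u \<in> sobolev 2" using u by (simp add: A_dom_def)
  ultimately show ?thesis by (metis sobolev_add(1))
qed

lemma pw_mult_const: "pw_mult (const_dist c) f = scal c f"
proof
  fix k
  have "pw_mult (const_dist c) f k = (\<Sum>l\<in>{0}. const_dist c l * f (k - l))"
    by (rule pw_mult_finite) (auto simp: const_dist_def)
  then show "pw_mult (const_dist c) f k = scal c f k" by (simp add: const_dist_def scal_def)
qed

lemma pw_mult_diff_trig:
  assumes "trig_poly a" "trig_poly b"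
  shows "pw_mult (a - b) f = pw_mult a f - pw_mult b f"
proof
  fix k
  let ?S = "{k. a k \<noteq> 0} \<union> {k. b k \<noteq> 0}"
  have "finite ?S" using assms by (simp add: trig_poly_def)
  note e = pw_mult_finite[OF this]
  have "pw_mult (a - b) f k = (\<Sum>l\<in>?S. (a - b) l * f (k - l))" by (rule e) auto
  moreover have "pw_mult a f k = (\<Sum>l\<in>?S. a l * f (k - l))" "pw_mult b f k = (\<Sum>l\<in>?S. b l * f (k - l))" by (rule e; blast)+
  ultimately show "pw_mult (a - b) f k = (pw_mult a f - pw_mult b f) k" by (simp add: sum_subtractf left_diff_distrib)
qed

text \<open>With C explicit, (u \<prec> X) \<circ> \<xi> - u (X \<circ> \<xi>) and u \<Xi>2 = u (X
  \<circ> \<xi>) - c u add up to (u \<prec> X) \<circ> \<xi> - c u. The resonant products of B u and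
  R with \<xi> complete this to u \<circ> \<xi> - c u, and together with the two paraproducts the
  full product with \<xi> appears.\<close>

lemma A_op_trig:
  assumes n: "trig_noise c \<Xi>" and u: "u \<in> A_dom P \<Xi> \<gamma>"
  shows "A_op P C \<Xi> u = smooth_op (fst \<Xi>) c u"
proof -
  note t = trig_noiseD[OF n]
  have us: "u \<in> sobolev \<gamma>" and R: "R_op P \<Xi> u \<in> sobolev 2" using u by (auto simp: A_dom_def)
  let ?p = "para P u (X_of \<Xi>)" and ?b = "B_op P \<Xi> u" and ?r = "R_op P \<Xi> u"
  have ok: "res_ok ?p (fst \<Xi>)" "res_ok ?b (fst \<Xi>)" "res_ok ?r (fst \<Xi>)"
    using reson_v_xi(2)[OF trig_sobolev(1)[OF trig_poly_para[OF t(2)]] t(4)] reson_B_op[OF us t(4,4)]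
      reson_v_xi(2)[OF sobolev_mono(1)[OF R] t(4)] kappa_bounds(2) by auto
  have add: "res_ok (f + g) h \<and> reson P (f + g) h = reson P f h + reson P g h" if "res_ok f h" "res_ok g h" for f g h
    using reson_lin_left[OF that, of 1 1] by simp
  have "u = ?p + ?b + ?r" by (simp add: R_op_def)
  then have "reson P u (fst \<Xi>) = reson P (?p + ?b + ?r) (fst \<Xi>)" by simp
  also have "\<dots> = reson P ?p (fst \<Xi>) + reson P ?b (fst \<Xi>) + reson P ?r (fst \<Xi>)"
    using add ok by metis
  finally have res: "reson P ?p (fst \<Xi>) + reson P ?b (fst \<Xi>) + reson P ?r (fst \<Xi>) = reson P u (fst \<Xi>)" ..
  have tr: "trig_poly (reson P (X_of \<Xi>) (fst \<Xi>))" by (rule trig_poly_reson[OF t(1)])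
  have snd: "snd \<Xi> = reson P (X_of \<Xi>) (fst \<Xi>) - const_dist (of_real c)"
    using n by (simp add: trig_noise_def reson_commute)
  have "pw_mult (snd \<Xi>) u = pw_mult (reson P (X_of \<Xi>) (fst \<Xi>)) u - scal (of_real c) u"
    unfolding snd pw_mult_diff_trig[OF tr trig_poly_const_dist] pw_mult_const ..
  then have d: "dist_mult P u (snd \<Xi>) = pw_mult u (reson P (X_of \<Xi>) (fst \<Xi>)) - scal (of_real c) u"
    by (simp add: dist_mult_trig[OF t(3)] pw_mult_commute[of u])
  have "A_op P C \<Xi> u = laplacian u + dist_mult P u (fst \<Xi>) - scal (of_real c) u"
    unfolding A_op_def reson_xi_def C_trig[OF us t(2,1)] d unfolding dist_mult_def res[symmetric] by (simp add: algebra_simps)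
  then show ?thesis by (simp add: smooth_op_def dist_mult_trig[OF t(1)] pw_mult_commute)
qed

end

section \<open>Self-adjointness\<close>

context anderson
begin

lemma K_decay:
  assumes "e > 0"
  shows "\<exists>K\<ge>1. M * K powr (-\<kappa>) \<le> e"
proof -
  have "((\<lambda>K. M * K powr (-\<kappa>)) \<longlongrightarrow> M * 0) at_top"
    by (intro tendsto_intros tendsto_neg_powr filterlim_ident) (use kappa_bounds in auto)
  then have "eventually (\<lambda>K. M * K powr (-\<kappa>) < e) at_top"
    using assms by (auto dest: order_tendstoD(2))
  with eventually_ge_at_top[of 1] have "eventually (\<lambda>K. 1 \<le> K \<and> M * K powr (-\<kappa>) < e) at_top" by eventually_elim simp
  then obtain K where "1 \<le> K \<and> M * K powr (-\<kappa>) < e" using eventually_happens'[OF trivial_limit_at_top_linorder] by blast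
  then show ?thesis by (intro exI[of _ K]) simp
qed

lemma op_bounded_exists:
  assumes "noise \<Xi>"
  shows "\<exists>M. op_bounded M \<Xi>"
  using op_bounds[OF noise_norm_parts(3)[OF assms]] assms by blast

lemma A_dom_surj:
  assumes "noise \<Xi>"
  shows "\<exists>K. \<forall>f\<in>sobolev 0. \<exists>u\<in>A_dom P \<Xi> \<gamma>. scal (of_real K) u - A_op P C \<Xi> u = f"
proof -
  obtain M where M: "op_bounded M \<Xi>" using op_bounded_exists[OF assms] by blast
  obtain K where K: "K \<ge> 1" "4 * M * K powr (-\<kappa>) \<le> 1/2" using K_decay[of "1/2" "4 * M"] by auto
  show ?thesis
  proof (intro exI[of _ K] ballI)
    fix f assume f: "f \<in> sobolev 0"
    from Sol_fixpoint[OF M K f] obtain x where "x \<in> pair_space" "Sol \<Xi> K f x = x" by blast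
    from Sol_A_op[OF M K(1) f this] show "\<exists>u\<in>A_dom P \<Xi> \<gamma>. scal (of_real K) u - A_op P C \<Xi> u = f" by blast
  qed
qed

text \<open>For smooth data \<open>g\<close> the solutions of \<open>K u - A u = K g\<close> approach \<open>g\<close> as \<open>K\<close> grows.\<close>

lemma A_dom_dense:
  assumes n: "noise \<Xi>" and f: "f \<in> sobolev 0" and e: "e > 0"
  shows "\<exists>u\<in>A_dom P \<Xi> \<gamma>. sobolev_norm 0 (f - u) < e"
proof -
  obtain M where M: "op_bounded M \<Xi>" using op_bounded_exists[OF n] by blast
  obtain L where L: "finite L" "\<And>S. finite S \<Longrightarrow> L \<subseteq> S \<Longrightarrow> sobolev_norm 0 (f - restrict_freq S f) \<le> e / 3"
    using sobolev_tail[OF f, of "e / 3"] e by auto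
  define g where "g = restrict_freq L f"
  have tg: "trig_poly g" unfolding g_def by (rule trig_poly_restrict[OF L(1)])
  note g = trig_sobolev(1)[OF tg]
  have fg: "sobolev_norm 0 (f - g) \<le> e / 3" unfolding g_def by (rule L(2)) (use L in auto)
  define c where "c = sobolev_norm \<gamma> g + sobolev_norm (1 + 3 * \<kappa>) g"
  \<comment> \<open>One coefficient sum handles three demands: the contraction, the correction by
    the noise, and the distance of \<open>g\<close> from K J g.\<close>
  obtain K where K: "K \<ge> 1" "(8 * M + 8 * M * c + sobolev_norm 2 g) * K powr (-\<kappa>) \<le> min (1/2) (e / 3)"
    using K_decay[of "min (1/2) (e / 3)" "8 * M + 8 * M * c + sobolev_norm 2 g"] e by auto
  have nn: "0 \<le> M" "0 \<le> c" "0 \<le> sobolev_norm 2 g" "0 \<le> K powr (-\<kappa>)" using op_boundedD(1)[OF M] by (auto simp: c_def)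
  then have p: "0 \<le> M * K powr (-\<kappa>)" "0 \<le> M * c * K powr (-\<kappa>)" "0 \<le> sobolev_norm 2 g * K powr (-\<kappa>)" by auto
  have K1: "4 * M * K powr (-\<kappa>) \<le> 1/2" and K2: "8 * M * c * K powr (-\<kappa>) + sobolev_norm 2 g * K powr (-\<kappa>) \<le> e / 3"
  proof -
    have "(8 * M + 8 * M * c + sobolev_norm 2 g) * K powr (-\<kappa>) = 8 * (M * K powr (-\<kappa>)) + 8 * (M * c * K powr (-\<kappa>)) + sobolev_norm 2 g * K powr (-\<kappa>)"
      by (simp add: distrib_right mult.assoc)
    then have "8 * (M * K powr (-\<kappa>)) + 8 * (M * c * K powr (-\<kappa>)) + sobolev_norm 2 g * K powr (-\<kappa>) \<le> 1/2"
      "8 * (M * K powr (-\<kappa>)) + 8 * (M * c * K powr (-\<kappa>)) + sobolev_norm 2 g * K powr (-\<kappa>) \<le> e / 3"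
      using order_trans[OF K(2) min.cobounded1] order_trans[OF K(2) min.cobounded2] by (simp_all only:)
    with p have "4 * (M * K powr (-\<kappa>)) \<le> 1/2" "8 * (M * c * K powr (-\<kappa>)) + sobolev_norm 2 g * K powr (-\<kappa>) \<le> e / 3" by linarith+
    then show "4 * M * K powr (-\<kappa>) \<le> 1/2" "8 * M * c * K powr (-\<kappa>) + sobolev_norm 2 g * K powr (-\<kappa>) \<le> e / 3"
      by (simp_all only: mult.assoc)
  qed
  define h where "h = scal (of_real K) g"
  have h: "h \<in> sobolev s" for s unfolding h_def by (intro sobolev_scal(1) g)
  obtain x where x: "x \<in> pair_space" "Sol \<Xi> K h x = x" using Sol_fixpoint[OF M K(1) K1 h] by blast
  have u: "fst x \<in> A_dom P \<Xi> \<gamma>" by (rule Sol_A_op(1)[OF M K(1) h x])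
  define y where "y = J_pair K h 0"
  define z where "z = J_pair K (G_op \<Xi> x) (T_op \<Xi> (fst x))"
  have z0: "0 \<in> sobolev (1 - 2 * \<kappa>)" by (rule trig_sobolev(1)) simp
  have xyz: "x = y + z" using x(2) J_pair_diff[of K "h + G_op \<Xi> x" "T_op \<Xi> (fst x)" "G_op \<Xi> x" "T_op \<Xi> (fst x)"]
    by (simp add: Sol_def y_def z_def algebra_simps)
  have ps: "y \<in> pair_space" "z \<in> pair_space"
    unfolding y_def z_def using op_boundedD(3,4)[OF M x(1)] K h z0 by (auto intro!: J_pair_mem)
  have Jh: "J_op K h = scal (of_real K) (J_op K g)" by (simp add: h_def J_op_simps)
  \<comment> \<open>K times the resolvent has norm at most 1 on every H^s, so these bounds do not
    deteriorate as \<open>K\<close> grows.\<close>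
  have "sobolev_norm s (J_op K h) \<le> sobolev_norm s g" for s
  proof -
    have "sobolev_norm s (J_op K h) \<le> K * sobolev_norm s (J_op K g)"
      unfolding Jh using sobolev_scal(2)[OF J_op_sobolev(1)[OF K(1) g], of s s "of_real K"] K(1) by simp
    also have "\<dots> \<le> K * (K powr (-1) * sobolev_norm s g)"
      using J_op_sobolev(2)[OF K(1) g, of s s] K(1) by (intro mult_left_mono) simp_all
    also have "\<dots> = sobolev_norm s g" using K(1) by (simp add: powr_minus_divide)
    finally show ?thesis .
  qed
  moreover have y: "y = (J_op K h, J_op K h)"
    by (simp add: y_def J_pair_def J_op_def one_minus_lap_def scal_def fun_eq_iff)
  ultimately have "pair_norm K y \<le> sobolev_norm \<gamma> g + K powr (-1/4) * sobolev_norm (1 + 3 * \<kappa>) g"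
    unfolding pair_norm_def by (intro add_mono mult_left_mono) auto
  also have "\<dots> \<le> c" unfolding c_def using K(1) powr_mono[of "-1/4" 0 K] by (intro add_mono mult_left_le_one_le) auto
  finally have yc: "pair_norm K y \<le> c" .
  have zx: "pair_norm K z \<le> 4 * M * K powr (-\<kappa>) * pair_norm K x" unfolding z_def by (rule Sol_linear_part_bound[OF M K(1) x(1)])
  have "pair_norm K x \<le> pair_norm K y + pair_norm K z" unfolding xyz by (rule pair_norm_triangle[OF ps])
  moreover have "4 * M * K powr (-\<kappa>) * pair_norm K x \<le> 1/2 * pair_norm K x" by (rule mult_right_mono[OF K1 pair_norm_nonneg])
  ultimately have x2: "pair_norm K x \<le> 2 * c" using yc zx by linarith
  have "sobolev_norm 0 (fst z) \<le> 4 * M * K powr (-\<kappa>) * (2 * c)"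
    using fst_le_pair_norm(2)[OF ps(2), of K] zx mult_left_mono[OF x2, of "4 * M * K powr (-\<kappa>)"] p by linarith
  then have z: "sobolev_norm 0 (fst z) \<le> 8 * M * c * K powr (-\<kappa>)" by (simp add: mult_ac)
  have "sobolev_norm 0 (J_op K (one_minus_lap g)) \<le> K powr (-1) * sobolev_norm 2 g"
    using one_minus_lap_J_op_sobolev(2)[OF K(1) g, of 2 0] by simp
  also have "\<dots> \<le> K powr (-\<kappa>) * sobolev_norm 2 g" using K(1) kappa_bounds(2) by (intro mult_right_mono powr_mono) auto
  finally have w: "sobolev_norm 0 (J_op K (one_minus_lap g)) \<le> sobolev_norm 2 g * K powr (-\<kappa>)" by (simp add: mult.commute)
  have wm: "J_op K (one_minus_lap g) \<in> sobolev 0" using one_minus_lap_J_op_sobolev(1)[OF K(1) g, of 2 0] by simp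
  \<comment> \<open>g - K J g = J (1 - \<Delta>) g is of order 1/K because \<open>g\<close> is in
    H^2.\<close>
  have "f - fst x = (f - g) + (J_op K (one_minus_lap g) - fst z)"
    unfolding xyz y J_op_resolvent(1)[OF K(1)] Jh by (simp add: algebra_simps)
  moreover have "sobolev_norm 0 ((f - g) + (J_op K (one_minus_lap g) - fst z)) \<le> sobolev_norm 0 (f - g) + (sobolev_norm 0 (J_op K (one_minus_lap g)) + sobolev_norm 0 (fst z))"
    using f g fst_le_pair_norm(1)[OF ps(2)] wm
    by (intro order_trans[OF sobolev_add(2)] add_left_mono sobolev_diff) auto
  ultimately have "sobolev_norm 0 (f - fst x) \<le> sobolev_norm 0 (f - g) + (sobolev_norm 0 (J_op K (one_minus_lap g)) + sobolev_norm 0 (fst z))" by (simp only:)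
  with fg w z K2 e have "sobolev_norm 0 (f - fst x) < e" by linarith
  with u show ?thesis by blast
qed

lemma R_op_lin:
  assumes "u \<in> sobolev \<gamma>" "v \<in> sobolev \<gamma>" "noise \<Xi>"
  shows "R_op P \<Xi> (scal a u + scal b v) = scal a (R_op P \<Xi> u) + scal b (R_op P \<Xi> v)"
  unfolding R_op_eq T_op_lin[OF assms] scal_add by (simp add: algebra_simps)

lemma A_dom_lin:
  assumes u: "u \<in> A_dom P \<Xi> \<gamma>" and v: "v \<in> A_dom P \<Xi> \<gamma>" and n: "noise \<Xi>"
  shows "scal a u + scal b v \<in> A_dom P \<Xi> \<gamma>"
    "A_op P C \<Xi> (scal a u + scal b v) = scal a (A_op P C \<Xi> u) + scal b (A_op P C \<Xi> v)"
proof -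
  have us: "u \<in> sobolev \<gamma>" "v \<in> sobolev \<gamma>" "R_op P \<Xi> u \<in> sobolev 2" "R_op P \<Xi> v \<in> sobolev 2"
    using u v by (auto simp: A_dom_def)
  have s: "scal a u + scal b v \<in> sobolev \<gamma>" by (intro sobolev_add(1) sobolev_scal(1) us)
  note R = R_op_lin[OF us(1,2) n]
  show "scal a u + scal b v \<in> A_dom P \<Xi> \<gamma>" unfolding A_dom_def mem_Collect_eq R
    by (intro conjI s sobolev_add(1) sobolev_scal(1) us)
  have ok: "res_ok (R_op P \<Xi> u) (fst \<Xi>)" "res_ok (R_op P \<Xi> v) (fst \<Xi>)"
    using us kappa_bounds(2) by (auto intro!: reson_v_xi(2) n sobolev_mono(1)[of _ 2])
  show "A_op P C \<Xi> (scal a u + scal b v) = scal a (A_op P C \<Xi> u) + scal b (A_op P C \<Xi> v)"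
    unfolding A_op_eq[OF s n] A_op_eq[OF us(1) n] A_op_eq[OF us(2) n] R E_op_lin[OF us(1,2) n] reson_lin_left(2)[OF ok] one_minus_lap_lin scal_add
    by (simp add: algebra_simps)
qed

lemma A_self_adjoint:
  assumes n: "noise \<Xi>" and sym: "\<And>u v. u \<in> A_dom P \<Xi> \<gamma> \<Longrightarrow> v \<in> A_dom P \<Xi> \<gamma> \<Longrightarrow> l2_inner (A_op P C \<Xi> u) v = l2_inner u (A_op P C \<Xi> v)"
  shows "self_adjoint_on_L2 (A_dom P \<Xi> \<gamma>) (\<lambda>u. A_op P C \<Xi> u - scal (of_real K') u)"
proof -
  obtain K where K: "\<forall>f\<in>sobolev 0. \<exists>u\<in>A_dom P \<Xi> \<gamma>. scal (of_real K) u - A_op P C \<Xi> u = f" using A_dom_surj[OF n] by blast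
  obtain M where M: "op_bounded M \<Xi>" using op_bounded_exists[OF n] by blast
  show ?thesis
  proof (rule self_adjoint_on_L2_I)
    show sub: "A_dom P \<Xi> \<gamma> \<subseteq> sobolev 0" using sobolev_mono(1)[of _ \<gamma> 0] gamma by (auto simp: A_dom_def)
    show "A_op P C \<Xi> u \<in> sobolev 0" if "u \<in> A_dom P \<Xi> \<gamma>" for u by (rule A_dom_Sol(1)[OF that M order_refl])
    obtain u0 where u0: "u0 \<in> A_dom P \<Xi> \<gamma>" using A_dom_dense[OF n trig_sobolev(1)[OF trig_poly_0], of 1] by auto
    \<comment> \<open>0 is in the domain as a combination of any of its elements; one exists by
      density.\<close>
    have "scal 0 u0 + scal 0 u0 = 0" by (simp add: scal_def fun_eq_iff)
    with A_dom_lin(1)[OF u0 u0 n, of 0 0] show "0 \<in> A_dom P \<Xi> \<gamma>" by (simp only:)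
    show "u + v \<in> A_dom P \<Xi> \<gamma> \<and> A_op P C \<Xi> (u + v) = A_op P C \<Xi> u + A_op P C \<Xi> v" if "u \<in> A_dom P \<Xi> \<gamma>" "v \<in> A_dom P \<Xi> \<gamma>" for u v
      using A_dom_lin[OF that n, of 1 1] by simp
    show "scal c u \<in> A_dom P \<Xi> \<gamma> \<and> A_op P C \<Xi> (scal c u) = scal c (A_op P C \<Xi> u)" if "u \<in> A_dom P \<Xi> \<gamma>" for c u
      using A_dom_lin[OF that that n, of c 0] by (simp only: scal_eq_lin[symmetric] simp_thms)
    show "\<exists>u\<in>A_dom P \<Xi> \<gamma>. scal (of_real K) u - A_op P C \<Xi> u = f" if "f \<in> sobolev 0" for f using K that by blast
  qed (use sym A_dom_dense[OF n] in auto)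
qed

text \<open>Range and density are inherited: the domain of the paracontrolled operator for this
  noise lies in H^2, and the two operators agree on it. Symmetry holds on all of H^2, so equality of
  the two domains need not be shown beforehand.\<close>

lemma smooth_op_self_adjoint:
  assumes n: "trig_noise c \<Xi>"
  shows "self_adjoint_on_L2 (sobolev 2) (\<lambda>u. smooth_op (fst \<Xi>) c u - scal (of_real K') u)"
proof -
  note t = trig_noiseD[OF n]
  have h: "fst \<Xi> (- k) = cnj (fst \<Xi> k)" for k using n by (simp add: trig_noise_def)
  obtain K where K: "\<forall>f\<in>sobolev 0. \<exists>u\<in>A_dom P \<Xi> \<gamma>. scal (of_real K) u - A_op P C \<Xi> u = f" using A_dom_surj[OF t(4)] by blast
  show ?thesis
  proof (rule self_adjoint_on_L2_I)
    show "sobolev 2 \<subseteq> sobolev 0" using sobolev_mono(1)[of _ 2 0] by auto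
    show "0 \<in> sobolev 2" by (rule trig_sobolev(1)) simp
    show "\<exists>u\<in>sobolev 2. scal (of_real K) u - smooth_op (fst \<Xi>) c u = f" if "f \<in> sobolev 0" for f
      using K that A_op_trig[OF n] A_dom_trig[OF n] by metis
    show "\<exists>u\<in>sobolev 2. sobolev_norm 0 (f - u) < e" if "f \<in> sobolev 0" "e > 0" for f e
      using A_dom_dense[OF t(4) that] A_dom_trig[OF n] by blast
  qed (use smooth_op_symmetric[OF t(1) h] smooth_op_lin[OF t(1)] in \<open>auto intro: sobolev_add(1) sobolev_scal(1)\<close>)
qed

text \<open>The approximant u' solves the equation for \<Xi>' with the same \<open>K\<close> and the
  same right-hand side \<open>f\<close> as u. Hence A u - A' u' = K (u - u'), and closeness of the
  solutions already gives closeness of the images.\<close>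

lemma A_op_approx:
  assumes n: "noise \<Xi>" and u: "u \<in> A_dom P \<Xi> \<gamma>" and e: "e > 0"
  shows "\<exists>\<delta>>0. \<forall>\<Xi>'. noise \<Xi>' \<longrightarrow> noise_norm (noise_diff \<Xi> \<Xi>') \<le> \<delta> \<longrightarrow>
    (\<exists>u'\<in>A_dom P \<Xi>' \<gamma>. sobolev_norm 0 (u - u') \<le> e \<and> sobolev_norm 0 (A_op P C \<Xi> u - A_op P C \<Xi>' u') \<le> e)"
proof -
  define N where "N = noise_norm \<Xi> + 1"
  have N: "0 \<le> N" "noise_norm \<Xi> \<le> N" using noise_norm_parts(3)[OF n] by (auto simp: N_def)
  obtain M where M: "\<And>\<Xi>. noise \<Xi> \<Longrightarrow> noise_norm \<Xi> \<le> N \<Longrightarrow> op_bounded M \<Xi>"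
    and D: "\<And>\<Xi> \<Xi>' x. noise \<Xi> \<Longrightarrow> noise \<Xi>' \<Longrightarrow> noise_norm \<Xi> \<le> N \<Longrightarrow> noise_norm \<Xi>' \<le> N \<Longrightarrow> x \<in> pair_space \<Longrightarrow>
      sobolev_norm 0 (G_op \<Xi> x - G_op \<Xi>' x) \<le> M * noise_norm (noise_diff \<Xi> \<Xi>') * (sobolev_norm \<gamma> (fst x) + sobolev_norm (1 + 3 * \<kappa>) (snd x)) \<and>
      sobolev_norm (1 - 2 * \<kappa>) (T_op \<Xi> (fst x) - T_op \<Xi>' (fst x)) \<le> M * noise_norm (noise_diff \<Xi> \<Xi>') * sobolev_norm \<gamma> (fst x)"
    using op_bounds[OF N(1)] by blast
  note b = M[OF n N(2)]
  have M0: "0 \<le> M" by (rule op_boundedD(1)[OF b])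
  obtain K where K: "K \<ge> 1" "4 * M * K powr (-\<kappa>) \<le> 1/2" using K_decay[of "1/2" "4 * M"] by auto
  define f where "f = scal (of_real K) u - A_op P C \<Xi> u"
  define x where "x = (u, R_op P \<Xi> u)"
  note A = A_dom_Sol[OF u b K(1)]
  have x: "x \<in> pair_space" "Sol \<Xi> K f x = x" using A by (simp_all add: x_def f_def)
  have us: "u \<in> sobolev 0" using fst_le_pair_norm(1)[OF x(1)] by (simp add: x_def)
  have f: "f \<in> sobolev 0" unfolding f_def by (intro sobolev_diff(1) sobolev_scal(1) us A(1))
  define p where "p = 8 * M * pair_norm K x"
  have p: "0 \<le> p" using M0 pair_norm_nonneg by (simp add: p_def)
  \<comment> \<open>The bound 1 keeps \<Xi>' in the ball of radius \<open>N\<close>, so that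
    \<open>M\<close> and \<open>K\<close> still serve; the other bound absorbs the factor
    \<open>K\<close>.\<close>
  define \<delta> where "\<delta> = min 1 (e / (K * p + 1))"
  have d: "\<delta> > 0" "\<delta> \<le> 1" using e p K(1) by (auto simp: \<delta>_def intro!: divide_pos_pos add_nonneg_pos)
  have dp: "K * (\<delta> * p) \<le> e"
  proof -
    have "\<delta> * (K * p) \<le> e / (K * p + 1) * (K * p)" using p K(1) by (intro mult_right_mono) (auto simp: \<delta>_def)
    also have "\<dots> \<le> e" using p K(1) e by (simp add: divide_le_eq add_nonneg_pos)
    finally show ?thesis by (simp add: mult_ac)
  qed
  show ?thesis
  proof (intro exI[of _ \<delta>] conjI allI impI d(1))
    fix \<Xi>' assume n': "noise \<Xi>'" and nd: "noise_norm (noise_diff \<Xi> \<Xi>') \<le> \<delta>"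
    have "noise_norm \<Xi>' \<le> noise_norm \<Xi> + noise_norm (noise_diff \<Xi> \<Xi>')"
    proof -
      have e: "fst \<Xi>' = fst \<Xi> - (fst \<Xi> - fst \<Xi>')" "snd \<Xi>' = snd \<Xi> - (snd \<Xi> - snd \<Xi>')" by simp_all
      have "besov_norm P (-1 - \<kappa>) (fst \<Xi> - (fst \<Xi> - fst \<Xi>')) \<le> besov_norm P (-1 - \<kappa>) (fst \<Xi>) + besov_norm P (-1 - \<kappa>) (fst \<Xi> - fst \<Xi>')"
        "besov_norm P (-2 * \<kappa>) (snd \<Xi> - (snd \<Xi> - snd \<Xi>')) \<le> besov_norm P (-2 * \<kappa>) (snd \<Xi>) + besov_norm P (-2 * \<kappa>) (snd \<Xi> - snd \<Xi>')"
        by (intro besov_diff noiseD n n')+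
      then show ?thesis unfolding e[symmetric] noise_norm_def noise_diff_def fst_conv snd_conv by linarith
    qed
    then have N': "noise_norm \<Xi>' \<le> N" using nd d(2) by (simp add: N_def)
    note b' = M[OF n' N'] and D' = D[OF n n' N(2) N' x(1)]
    obtain x' where x': "x' \<in> pair_space" "Sol \<Xi>' K f x' = x'" using Sol_fixpoint[OF b' K f] by blast
    note A' = Sol_A_op[OF b' K(1) f x']
    let ?d = "noise_norm (noise_diff \<Xi> \<Xi>')"
    have d0: "0 \<le> M * ?d" using M0 noise_norm_parts(3)[OF noise_noise_diff[OF n n']] by simp
    have "pair_norm K (x - x') \<le> 8 * (M * ?d) * pair_norm K x"
      by (rule Sol_stable[OF b b' K x x' d0 conjunct1[OF D'] conjunct2[OF D']])
    also have "\<dots> = ?d * p" by (simp add: p_def)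
    also have "\<dots> \<le> \<delta> * p" by (rule mult_right_mono[OF nd p])
    finally have "pair_norm K (x - x') \<le> \<delta> * p" .
    with fst_le_pair_norm(1)[OF pair_space_diff[OF x(1) x'(1)]] fst_le_pair_norm(2)[OF pair_space_diff[OF x(1) x'(1)], of K]
    have ud: "u - fst x' \<in> sobolev 0" "sobolev_norm 0 (u - fst x') \<le> \<delta> * p" by (simp_all add: x_def)
    have Ku: "K * sobolev_norm 0 (u - fst x') \<le> e" using mult_left_mono[OF ud(2), of K] K(1) dp by linarith
    have "A_op P C \<Xi> u = scal (of_real K) u - f" by (simp add: f_def)
    moreover have "A_op P C \<Xi>' (fst x') = scal (of_real K) (fst x') - f" unfolding A'(2)[symmetric] by simp
    ultimately have "A_op P C \<Xi> u - A_op P C \<Xi>' (fst x') = (scal (of_real K) u - f) - (scal (of_real K) (fst x') - f)" by (simp only:)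
    also have "\<dots> = scal (of_real K) (u - fst x')" by (simp add: scal_add)
    finally have "sobolev_norm 0 (A_op P C \<Xi> u - A_op P C \<Xi>' (fst x')) \<le> K * sobolev_norm 0 (u - fst x')"
      using sobolev_scal(2)[OF ud(1), of "of_real K"] K(1) by simp
    moreover have "1 * sobolev_norm 0 (u - fst x') \<le> K * sobolev_norm 0 (u - fst x')" using K(1) by (intro mult_right_mono) auto
    ultimately show "\<exists>u'\<in>A_dom P \<Xi>' \<gamma>. sobolev_norm 0 (u - u') \<le> e \<and> sobolev_norm 0 (A_op P C \<Xi> u - A_op P C \<Xi>' u') \<le> e"
      using A'(1) Ku by (intro bexI[of _ "fst x'"] conjI) auto
  qed
qed

lemma l2_inner_perturb:
  assumes "f \<in> sobolev 0" "f' \<in> sobolev 0" "g \<in> sobolev 0" "g' \<in> sobolev 0"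
    and e: "sobolev_norm 0 (f - f') \<le> e" "sobolev_norm 0 (g - g') \<le> e" "e \<le> 1"
  shows "cmod (l2_inner f g - l2_inner f' g') \<le> e * (sobolev_norm 0 f + sobolev_norm 0 g + 1)"
proof -
  have e0: "0 \<le> e" by (rule order_trans[OF _ e(1)]) simp
  have d: "f - f' \<in> sobolev 0" "g - g' \<in> sobolev 0" using assms by (auto intro: sobolev_diff)
  have eq: "l2_inner f g - l2_inner f' g' = l2_inner (f - f') g + l2_inner f (g - g') - l2_inner (f - f') (g - g')"
    using assms d by (simp add: l2_inner_diff_left l2_inner_diff_right)
  have 1: "cmod (l2_inner (f - f') g) \<le> e * sobolev_norm 0 g"
    by (rule order_trans[OF l2_inner_cauchy_schwarz[OF d(1) assms(3)] mult_right_mono[OF e(1)]]) simp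
  have 2: "cmod (l2_inner f (g - g')) \<le> sobolev_norm 0 f * e"
    by (rule order_trans[OF l2_inner_cauchy_schwarz[OF assms(1) d(2)] mult_left_mono[OF e(2)]]) simp
  have 3: "cmod (l2_inner (f - f') (g - g')) \<le> e * 1"
    by (rule order_trans[OF l2_inner_cauchy_schwarz[OF d] mult_mono[OF e(1) order_trans[OF e(2,3)] e0]]) simp
  have "cmod (a + b - c) \<le> cmod a + cmod b + cmod c" for a b c :: complex
    using norm_triangle_ineq4[of "a + b" c] norm_triangle_ineq[of a b] by linarith
  then have "cmod (l2_inner f g - l2_inner f' g') \<le> cmod (l2_inner (f - f') g) + cmod (l2_inner f (g - g')) + cmod (l2_inner (f - f') (g - g'))"
    unfolding eq .
  also have "\<dots> \<le> e * sobolev_norm 0 g + sobolev_norm 0 f * e + e * 1" by (rule add_mono[OF add_mono[OF 1 2] 3])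
  also have "\<dots> = e * (sobolev_norm 0 f + sobolev_norm 0 g + 1)" by (simp add: algebra_simps)
  finally show ?thesis .
qed

text \<open>\<open>u\<close> and \<open>v\<close> need not lie in the domain for the approximating
  noise. They and their images are replaced by approximants from that domain, where symmetry is
  known, with an error proportional to e.\<close>

lemma A_op_symmetric:
  assumes n: "noise \<Xi>" and approx: "\<And>\<delta>. \<delta> > 0 \<Longrightarrow> \<exists>\<Xi>' c. trig_noise c \<Xi>' \<and> noise_norm (noise_diff \<Xi> \<Xi>') \<le> \<delta>"
    and u: "u \<in> A_dom P \<Xi> \<gamma>" and v: "v \<in> A_dom P \<Xi> \<gamma>"
  shows "l2_inner (A_op P C \<Xi> u) v = l2_inner u (A_op P C \<Xi> v)"
proof -
  obtain M where M: "op_bounded M \<Xi>" using op_bounded_exists[OF n] by blast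
  let ?A = "A_op P C \<Xi>"
  have A: "?A u \<in> sobolev 0" "?A v \<in> sobolev 0" using A_dom_Sol(1)[OF _ M order_refl] u v by auto
  have uv: "u \<in> sobolev 0" "v \<in> sobolev 0" using u v sobolev_mono(1)[of _ \<gamma> 0] gamma by (auto simp: A_dom_def)
  define B where "B = sobolev_norm 0 (?A u) + sobolev_norm 0 v + 1 + (sobolev_norm 0 u + sobolev_norm 0 (?A v) + 1)"
  have B: "B > 0" unfolding B_def by (intro add_nonneg_pos add_nonneg_nonneg) auto
  have "cmod (l2_inner (?A u) v - l2_inner u (?A v)) \<le> e * B" if e: "e > 0" "e \<le> 1" for e
  proof -
    obtain \<delta>1 where 1: "\<delta>1 > 0" "\<And>\<Xi>'. noise \<Xi>' \<Longrightarrow> noise_norm (noise_diff \<Xi> \<Xi>') \<le> \<delta>1 \<Longrightarrow>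
      \<exists>u'\<in>A_dom P \<Xi>' \<gamma>. sobolev_norm 0 (u - u') \<le> e \<and> sobolev_norm 0 (?A u - A_op P C \<Xi>' u') \<le> e"
      using A_op_approx[OF n u e(1)] by blast
    obtain \<delta>2 where 2: "\<delta>2 > 0" "\<And>\<Xi>'. noise \<Xi>' \<Longrightarrow> noise_norm (noise_diff \<Xi> \<Xi>') \<le> \<delta>2 \<Longrightarrow>
      \<exists>u'\<in>A_dom P \<Xi>' \<gamma>. sobolev_norm 0 (v - u') \<le> e \<and> sobolev_norm 0 (?A v - A_op P C \<Xi>' u') \<le> e"
      using A_op_approx[OF n v e(1)] by blast
    obtain \<Xi>' c where t: "trig_noise c \<Xi>'" "noise_norm (noise_diff \<Xi> \<Xi>') \<le> min \<delta>1 \<delta>2"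
      using approx[of "min \<delta>1 \<delta>2"] 1(1) 2(1) by auto
    note n' = trig_noiseD(4)[OF t(1)]
    let ?A' = "A_op P C \<Xi>'"
    obtain u' where u': "u' \<in> A_dom P \<Xi>' \<gamma>" "sobolev_norm 0 (u - u') \<le> e" "sobolev_norm 0 (?A u - ?A' u') \<le> e" using 1(2)[OF n'] t(2) by auto
    obtain v' where v': "v' \<in> A_dom P \<Xi>' \<gamma>" "sobolev_norm 0 (v - v') \<le> e" "sobolev_norm 0 (?A v - ?A' v') \<le> e" using 2(2)[OF n'] t(2) by auto
    have s: "u' \<in> sobolev 2" "v' \<in> sobolev 2" using A_dom_trig[OF t(1)] u' v' by auto
    have s0: "u' \<in> sobolev 0" "v' \<in> sobolev 0" using s sobolev_mono(1)[of _ 2 0] by auto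
    have h: "fst \<Xi>' (- k) = cnj (fst \<Xi>' k)" for k using t(1) by (simp add: trig_noise_def)
    note sy = smooth_op_symmetric[OF trig_noiseD(1)[OF t(1)] h]
    have A': "?A' u' \<in> sobolev 0" "?A' v' \<in> sobolev 0" "l2_inner (?A' u') v' = l2_inner u' (?A' v')"
      unfolding A_op_trig[OF t(1) u'(1)] A_op_trig[OF t(1) v'(1)] using sy s by auto
    have "cmod (l2_inner (?A u) v - l2_inner (?A' u') v') \<le> e * (sobolev_norm 0 (?A u) + sobolev_norm 0 v + 1)"
      by (rule l2_inner_perturb[OF A(1) A'(1) uv(2) s0(2) u'(3) v'(2) e(2)])
    moreover have "cmod (l2_inner u (?A v) - l2_inner u' (?A' v')) \<le> e * (sobolev_norm 0 u + sobolev_norm 0 (?A v) + 1)"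
      by (rule l2_inner_perturb[OF uv(1) s0(1) A(2) A'(2) u'(2) v'(3) e(2)])
    moreover have "l2_inner (?A u) v - l2_inner u (?A v) = (l2_inner (?A u) v - l2_inner (?A' u') v') - (l2_inner u (?A v) - l2_inner u' (?A' v'))"
      using A'(3) by simp
    moreover note norm_triangle_ineq4[of "l2_inner (?A u) v - l2_inner (?A' u') v'" "l2_inner u (?A v) - l2_inner u' (?A' v')"]
    ultimately show ?thesis unfolding B_def distrib_left[of e "_ + _ + 1"] by (simp only:)
  qed
  then have "cmod (l2_inner (?A u) v - l2_inner u (?A v)) \<le> 0 + d" if d: "d > 0" for d
  proof -
    have "cmod (l2_inner (?A u) v - l2_inner u (?A v)) \<le> min 1 (d / B) * B"
      using d B by (intro \<open>\<And>e. 0 < e \<Longrightarrow> e \<le> 1 \<Longrightarrow> _\<close>) auto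
    also have "\<dots> \<le> d / B * B" using B by (intro mult_right_mono) auto
    finally show ?thesis using B by simp
  qed
  then have "cmod (l2_inner (?A u) v - l2_inner u (?A v)) \<le> 0" by (rule field_le_epsilon)
  then show ?thesis by simp
qed

end

section \<open>Mollified noises approximate the enhanced noise\<close>

lemma trig_poly_xi_eps:
  assumes m: "mollifier_symbol m" and "\<epsilon> > 0"
  shows "trig_poly (xi_eps m \<epsilon> f)"
proof -
  obtain r where r: "\<And>x. m x \<noteq> 0 \<Longrightarrow> norm x \<le> r" using m by (auto simp: mollifier_symbol_def)
  have "bessel k \<le> 1 + 4 * pi\<^sup>2 * (r / \<epsilon>)\<^sup>2" if "xi_eps m \<epsilon> f k \<noteq> 0" for k
  proof -
    have "norm (\<epsilon> *\<^sub>R freq k) \<le> r" using that by (intro r) (auto simp: xi_eps_def)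
    then have "norm (freq k) \<le> r / \<epsilon>" using assms(2) by (simp add: pos_le_divide_eq mult.commute)
    then have "(norm (freq k))\<^sup>2 \<le> (r / \<epsilon>)\<^sup>2" by (intro power_mono) auto
    then show ?thesis unfolding bessel_def by (intro add_left_mono mult_left_mono) auto
  qed
  then have "{k. xi_eps m \<epsilon> f k \<noteq> 0} \<subseteq> {k. bessel k \<le> 1 + 4 * pi\<^sup>2 * (r / \<epsilon>)\<^sup>2}" by blast
  then show ?thesis unfolding trig_poly_def by (rule finite_subset) (rule finite_bessel_le)
qed

lemma xi_eps_minus:
  assumes "mollifier_symbol m" "\<And>k. f (- k) = cnj (f k)"
  shows "xi_eps m \<epsilon> f (- k) = cnj (xi_eps m \<epsilon> f k)"
proof -
  have "m (\<epsilon> *\<^sub>R freq (- k)) = m (\<epsilon> *\<^sub>R freq k)"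
    using assms(1) unfolding mollifier_symbol_def radial_def by (metis freq_minus norm_minus_cancel scaleR_minus_right)
  then show ?thesis by (simp add: xi_eps_def assms(2))
qed

context anderson
begin

lemma trig_noise_mollified:
  assumes "mollifier_symbol m" "\<And>k. f (- k) = cnj (f k)" "\<epsilon> > 0"
  shows "trig_noise (c_eps m \<epsilon>) (xi_eps m \<epsilon> f, Xi2_eps P m \<epsilon> f)"
  using trig_poly_xi_eps[OF assms(1,3)] xi_eps_minus[where f = f, OF assms(1,2)]
  by (simp add: trig_noise_def Xi2_eps_def X_of_def)

lemma besov_norm_diff_commute:
  assumes "f \<in> besov P b" "g \<in> besov P b"
  shows "besov_norm P b (f - g) = besov_norm P b (g - f)"
  using besov_uminus(2)[OF besov_diff(1)[OF assms]] by simp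

lemma enhanced_noise_approx:
  assumes m: "mollifier_symbol m" and h: "\<And>k. fst \<Xi> (- k) = cnj (fst \<Xi> k)" and lim: "enhanced_noise_limit P m \<Xi>" and \<delta>: "\<delta> > 0"
  shows "noise \<Xi>" "\<exists>\<Xi>' c. trig_noise c \<Xi>' \<and> noise_norm (noise_diff \<Xi> \<Xi>') \<le> \<delta>"
proof -
  \<comment> \<open>The single exponent a = -1 - \<kappa> in the limit gives the regularities of
    both components of \<open>noise\<close>.\<close>
  have e: "2 * (-1 - \<kappa>) + 2 = -2 * \<kappa>" by simp
  have "-1 - \<kappa> < -1" using kappa_bounds by simp
  then have "fst \<Xi> \<in> besov P (-1 - \<kappa>) \<and> snd \<Xi> \<in> besov P (-2 * \<kappa>) \<and>
      ((\<lambda>\<epsilon>. besov_norm P (-1 - \<kappa>) (xi_eps m \<epsilon> (fst \<Xi>) - fst \<Xi>)) \<longlongrightarrow> 0) (at_right 0) \<and>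
      ((\<lambda>\<epsilon>. besov_norm P (-2 * \<kappa>) (Xi2_eps P m \<epsilon> (fst \<Xi>) - snd \<Xi>)) \<longlongrightarrow> 0) (at_right 0)"
    using lim unfolding enhanced_noise_limit_def e[symmetric] by blast
  then have n: "fst \<Xi> \<in> besov P (-1 - \<kappa>)" "snd \<Xi> \<in> besov P (-2 * \<kappa>)"
    and t: "((\<lambda>\<epsilon>. besov_norm P (-1 - \<kappa>) (xi_eps m \<epsilon> (fst \<Xi>) - fst \<Xi>)) \<longlongrightarrow> 0) (at_right 0)"
      "((\<lambda>\<epsilon>. besov_norm P (-2 * \<kappa>) (Xi2_eps P m \<epsilon> (fst \<Xi>) - snd \<Xi>)) \<longlongrightarrow> 0) (at_right 0)" by auto
  show "noise \<Xi>" using n by (simp add: noise_def)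
  have "\<forall>\<^sub>F \<epsilon> in at_right 0. besov_norm P (-1 - \<kappa>) (xi_eps m \<epsilon> (fst \<Xi>) - fst \<Xi>) < \<delta> / 2 \<and>
      besov_norm P (-2 * \<kappa>) (Xi2_eps P m \<epsilon> (fst \<Xi>) - snd \<Xi>) < \<delta> / 2 \<and> 0 < \<epsilon>"
    using order_tendstoD(2)[OF t(1), of "\<delta> / 2"] order_tendstoD(2)[OF t(2), of "\<delta> / 2"] \<delta> eventually_at_right_less[of 0]
    by (auto intro: eventually_conj)
  then obtain \<epsilon> where \<epsilon>: "besov_norm P (-1 - \<kappa>) (xi_eps m \<epsilon> (fst \<Xi>) - fst \<Xi>) < \<delta> / 2"
      "besov_norm P (-2 * \<kappa>) (Xi2_eps P m \<epsilon> (fst \<Xi>) - snd \<Xi>) < \<delta> / 2" "0 < \<epsilon>"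
    using eventually_happens'[OF trivial_limit_at_right_real] by blast
  let ?N = "(xi_eps m \<epsilon> (fst \<Xi>), Xi2_eps P m \<epsilon> (fst \<Xi>))"
  have tn: "trig_noise (c_eps m \<epsilon>) ?N" by (rule trig_noise_mollified[where f = "fst \<Xi>", OF m h \<epsilon>(3)])
  note n' = noiseD[OF trig_noiseD(4)[OF tn], unfolded fst_conv snd_conv]
  have "noise_norm (noise_diff \<Xi> ?N) \<le> \<delta>"
    using \<epsilon>(1,2) unfolding noise_norm_def noise_diff_def fst_conv snd_conv
      besov_norm_diff_commute[OF n(1) n'(1)] besov_norm_diff_commute[OF n(2) n'(2)] by linarith
  with tn show "\<exists>\<Xi>' c. trig_noise c \<Xi>' \<and> noise_norm (noise_diff \<Xi> \<Xi>') \<le> \<delta>" by blast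
qed

end

theorem lemma2p29:
  fixes M :: "'w measure" and \<xi> :: "'w \<Rightarrow> pdist"
    and P :: lp_pair and C :: "pdist \<Rightarrow> pdist \<Rightarrow> pdist \<Rightarrow> pdist"
    and m :: "plane \<Rightarrow> real" and \<alpha> \<gamma> :: real
  assumes "dyadic_partition P"
    and "is_commutator_operator P C"
    and "mollifier_symbol m"
    and "white_noise M \<xi>"
    and "- 4 / 3 < \<alpha>" and "\<alpha> < - 1"
    and "2 / 3 < \<gamma>" and "\<gamma> \<le> \<alpha> + 2"
  shows "\<exists>K0 :: pdist \<times> pdist \<Rightarrow> real.
    \<forall>w\<in>space M. \<forall>\<Xi>2. enhanced_noise_limit P m (\<xi> w, \<Xi>2) \<longrightarrow>
      (let \<Xi> = (\<xi> w, \<Xi>2) in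
        0 < K0 \<Xi> \<and>
        (\<forall>K \<ge> K0 \<Xi>.
          self_adjoint_on_L2 (A_dom P \<Xi> \<gamma>) (H_op P C \<Xi> K) \<and>
          (\<forall>\<epsilon>\<in>{0<..<1}. self_adjoint_on_L2 (sobolev 2) (H_eps_op m \<epsilon> \<Xi> K))))"
proof -
  \<comment> \<open>\<open>\<gamma> \<le> \<alpha> + 2\<close> and \<open>\<alpha> < - 1\<close>
    give \<open>\<gamma> < 1\<close>, so that \<kappa> is positive.\<close>
  interpret anderson P C \<gamma> "(1 - \<gamma>) / 8"
    by unfold_locales (use assms in auto)
  note m = assms(3)
  have "self_adjoint_on_L2 (A_dom P (\<xi> w, \<Xi>2) \<gamma>) (H_op P C (\<xi> w, \<Xi>2) K) \<and>
      (\<forall>\<epsilon>\<in>{0<..<1}. self_adjoint_on_L2 (sobolev 2) (H_eps_op m \<epsilon> (\<xi> w, \<Xi>2) K))"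
    if w: "w \<in> space M" and lim: "enhanced_noise_limit P m (\<xi> w, \<Xi>2)" for w \<Xi>2 K
  proof (intro conjI ballI)
    have h: "\<xi> w (- k) = cnj (\<xi> w k)" for k using assms(4) w by (simp add: white_noise_def)
    then have h': "fst (\<xi> w, \<Xi>2) (- k) = cnj (fst (\<xi> w, \<Xi>2) k)" for k by simp
    note approx = enhanced_noise_approx[where \<Xi> = "(\<xi> w, \<Xi>2)", OF m h' lim]
    have n: "noise (\<xi> w, \<Xi>2)" by (rule approx(1)[of 1]) simp
    show "self_adjoint_on_L2 (A_dom P (\<xi> w, \<Xi>2) \<gamma>) (H_op P C (\<xi> w, \<Xi>2) K)"
      using A_self_adjoint[OF n A_op_symmetric[OF n approx(2)], of K] by (simp add: H_op_def[abs_def])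
    fix \<epsilon> :: real assume "\<epsilon> \<in> {0<..<1}"
    then have "trig_noise (c_eps m \<epsilon>) (xi_eps m \<epsilon> (\<xi> w), Xi2_eps P m \<epsilon> (\<xi> w))"
      by (intro trig_noise_mollified[where f = "\<xi> w", OF m h]) auto
    from smooth_op_self_adjoint[OF this, of K] show "self_adjoint_on_L2 (sobolev 2) (H_eps_op m \<epsilon> (\<xi> w, \<Xi>2) K)"
      by (simp add: H_eps_op_def[abs_def] A_eps_op_def smooth_op_def)
  qed
  then show ?thesis by (intro exI[of _ "\<lambda>_. 1"]) (simp add: Let_def)
qed

end
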